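(* Let $d\in\mathbb{N}$, $0<s<\infty$ and $1\le r,p,q\le\infty$ with $\frac1q-\frac1p<\frac sd$. Then there exist constants $C>0$ and $W_0,L_0\in\mathbb{N}$, depending only on $s,r,p,q,d$, such that for all integers $W\ge W_0$, $L\ge L_0$ and every $f\in\mathcal{B}^s_{q,r}([0,1]^d)$, \[ \inf_{g\in \mathcal{NN}_{d,1}(W,L)} \|f-g\|_{L^p([0,1]^d)} \le C\, \|f\|_{\mathcal{B}^s_{q,r}([0,1]^d)}\, (WL)^{-2s/d}. \]
   Context: ReLU networks: $\sigma(t)=\max\{t,0\}$ applied componentwise. For $d,k,W,L\in\mathbb{N}$, $\mathcal{NN}_{d,k}(W,L)$ is the set of maps $g:\mathbb{R}^d\to\mathbb{R}^k$ of the form $g_0(x)=x$, $g_{\ell+1}(x)=\sigma(A_\ell g_\ell(x)+b_\ell)$ for $\ell=0,\dots,L-1$, $g(x)=A_Lg_L(x)+b_L$, where $A_\ell\in\mathbb{R}^{N_{\ell+1}\times N_\ell}$, $b_\ell\in\mathbb{R}^{N_{\ell+1}}$, $N_0=d$, $N_{L+1}=k$, and $N_1,\dots,N_L\in\mathbb{N}$ satisfy $\max\{N_1,\dots,N_L\}\le W$. Besov spaces on $\Omega=[0,1]^d$: for $k\in\mathbb{N}$, $h\in\mathbb{R}^d$, $\Delta_h^kf(x)=\sum_{j=0}^k(-1)^j\binom kj f(x+jh)$, $\Omega_{kh}=\{x\in\Omega:x+kh\in\Omega\}$, $\omega_k(f,t)_q=\sup_{|h|<t}\|\Delta_h^kf\|_{L^q(\Omega_{kh})}$.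 With $k=\lfloor s\rfloor+1$, $\|f\|_{\mathcal{B}^s_{q,r}(\Omega)}=\|f\|_{L^q(\Omega)}+|f|_{\mathcal{B}^s_{q,r}(\Omega)}$ where $|f|_{\mathcal{B}^s_{q,r}}=\big(\int_0^\infty(t^{-s}\omega_k(f,t)_q)^rt^{-1}dt\big)^{1/r}$ for $r<\infty$ and $\sup_{t>0}t^{-s}\omega_k(f,t)_q$ for $r=\infty$; $\mathcal{B}^s_{q,r}(\Omega)$ is the set of $f\in L^q(\Omega)$ with finite norm. *)

theory Defs
  imports "HOL-Analysis.Analysis"
begin

definition relu :: "real \<Rightarrow> real" where
  "relu t = max t 0"

text \<open>Hidden layer outputs g_l(x), l = 1..L, stored as nat-indexed vectors of
  length N l. A0, b0: first affine map (from R^d); A l, b l: the map from layer l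
  to layer l+1.\<close>
fun hid :: "(nat \<Rightarrow> nat) \<Rightarrow> (nat \<Rightarrow> 'n::finite \<Rightarrow> real) \<Rightarrow> (nat \<Rightarrow> real)
            \<Rightarrow> (nat \<Rightarrow> nat \<Rightarrow> nat \<Rightarrow> real) \<Rightarrow> (nat \<Rightarrow> nat \<Rightarrow> real)
            \<Rightarrow> nat \<Rightarrow> real^'n \<Rightarrow> nat \<Rightarrow> real" where
  "hid N A0 b0 A b 0 x = (\<lambda>_. 0)"
| "hid N A0 b0 A b (Suc 0) x =
     (\<lambda>i. if i < N 1 then relu ((\<Sum>j\<in>UNIV. A0 i j * x $ j) + b0 i) else 0)"
| "hid N A0 b0 A b (Suc (Suc l)) x =
     (\<lambda>i. if i < N (Suc (Suc l))
           then relu ((\<Sum>j<N (Suc l). A (Suc l) i j * hid N A0 b0 A b (Suc l) x j) + b (Suc l) i)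
           else 0)"

definition NN :: "nat \<Rightarrow> nat \<Rightarrow> (real^'n::finite \<Rightarrow> real) set" where
  "NN W L = {g. \<exists>N A0 b0 A b (cin :: 'n \<Rightarrow> real) c c0.
      (\<forall>l\<in>{1..L}. 1 \<le> N l \<and> N l \<le> W) \<and>
      (if L = 0 then g = (\<lambda>x. (\<Sum>j\<in>UNIV. cin j * x $ j) + c0)
       else g = (\<lambda>x. (\<Sum>j<N L. c j * hid N A0 b0 A b L x j) + c0))}"

definition epow :: "ennreal \<Rightarrow> real \<Rightarrow> ennreal" where
  "epow x a = (if x = \<infinity> then \<infinity> else ennreal (enn2real x powr a))"

definition Lpnorm :: "ennreal \<Rightarrow> (real^'n::finite) set \<Rightarrow> (real^'n \<Rightarrow> real) \<Rightarrow> ennreal" where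
  "Lpnorm p S f =
     (if p = \<infinity> then Inf {C. AE x in lebesgue. x \<in> S \<longrightarrow> ennreal \<bar>f x\<bar> \<le> C}
      else epow (\<integral>\<^sup>+ x\<in>S. ennreal (\<bar>f x\<bar> powr enn2real p) \<partial>lebesgue) (1 / enn2real p))"

abbreviation cube :: "(real^'n::finite) set" where
  "cube \<equiv> cbox 0 1"

definition fdiff :: "nat \<Rightarrow> real^'n::finite \<Rightarrow> (real^'n \<Rightarrow> real) \<Rightarrow> real^'n \<Rightarrow> real" where
  "fdiff k h f x = (\<Sum>j=0..k. (-1)^j * real (k choose j) * f (x + real j *\<^sub>R h))"

definition cube_shift :: "nat \<Rightarrow> real^'n::finite \<Rightarrow> (real^'n) set" where
  "cube_shift k h = {x \<in> cube. x + real k *\<^sub>R h \<in> cube}"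

definition modulus :: "nat \<Rightarrow> (real^'n::finite \<Rightarrow> real) \<Rightarrow> real \<Rightarrow> ennreal \<Rightarrow> ennreal" where
  "modulus k f t q = (SUP h\<in>{h. norm h < t}. Lpnorm q (cube_shift k h) (fdiff k h f))"

definition besov_semi :: "real \<Rightarrow> ennreal \<Rightarrow> ennreal \<Rightarrow> (real^'n::finite \<Rightarrow> real) \<Rightarrow> ennreal" where
  "besov_semi s q r f =
     (let k = nat \<lfloor>s\<rfloor> + 1 in
      if r = \<infinity> then (SUP t\<in>{0<..}. ennreal (t powr (-s)) * modulus k f t q)
      else epow (\<integral>\<^sup>+ t\<in>{0<..}. epow (ennreal (t powr (-s)) * modulus k f t q) (enn2real r)
                   * ennreal (1 / t) \<partial>lborel) (1 / enn2real r))"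

definition besov_norm :: "real \<Rightarrow> ennreal \<Rightarrow> ennreal \<Rightarrow> (real^'n::finite \<Rightarrow> real) \<Rightarrow> ennreal" where
  "besov_norm s q r f = Lpnorm q cube f + besov_semi s q r f"

definition besov_space :: "real \<Rightarrow> ennreal \<Rightarrow> ennreal \<Rightarrow> (real^'n::finite \<Rightarrow> real) set" where
  "besov_space s q r = {f. (\<lambda>x. indicator cube x * f x) \<in> borel_measurable lebesgue
                          \<and> besov_norm s q r f < \<infinity>}"

end

theory Submission
  imports Defs
begin

text \<open>Cell averages of \<open>f\<close> on dyadic cells are turned by dual polynomials into a local reconstruction
  \<open>P\<^sub>l f\<close> of degree below \<open>k\<close>, glued together by tensor hat functions. The details \<open>P\<^sub>l\<^sub>+\<^sub>1 f - P\<^sub>l f\<close> are linear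
  combinations of hat-localized monomials whose coefficients are controlled in \<open>\<ell>\<^sup>q\<close> by the modulus of smoothness. Put
  \<open>R = W L\<close> and let \<open>2\<^sup>l\<close> be about \<open>R\<close> to the power \<open>2 / d\<close> on the critical level. Thresholding the coefficients with a level-dependent
  threshold and writing the quotients in binary leaves sums of localized monomials with coefficient one over sets
  of at most \<open>R\<^sup>2\<close> nodes, geometrically smaller away from the critical level. The gaps of such a sparse set fit into
  about \<open>w\<^sup>2 D\<^sup>2\<close> bits, which a network of width \<open>w\<close> and depth \<open>D\<close> can store and look up by bit extraction; this squares the
  usual count and gives the rate. The pieces are summed serially when \<open>L\<close> exceeds the cube of \<open>log W\<close> and in parallel
  otherwise.\<close>

section \<open>A calculus of ReLU networks\<close>

text \<open>The rate carries no logarithm, and this shapes the proof. A piece has about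
  \<open>R^2 u^4\<close> elements and gaps of \<open>O(1 + log (1/u))\<close> bits, so its storage
  is at most of order \<open>R^2 u^2\<close> and a network whose width times depth is of order
  \<open>R u\<close> can hold it; the costs \<open>u\<close> are summable, so storage never costs a
  factor \<open>log R\<close>. Only accuracy does: errors must be a power of \<open>R\<close> below
  the rate. In series that is \<open>log R\<close> layers for each of \<open>(log R)^2\<close>
  pieces, hence the cube; in parallel a squaring stage whose base is a power of \<open>W\<close>
  needs only boundedly many layers. A network is continuous, so digits and bits are wrong on ramps.
  Instead of excluding a small set, which would fail for \<open>p = \<infinity>\<close>, the
  products are built so that they vanish exactly wherever the digits may be wrong. The condition
  \<open>1/q - 1/p < s/d\<close> makes two demands on the thresholds of fine levels compatible: few
  large coefficients, and small remainders in \<open>L^p\<close>.\<close>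

definition affs :: "('x => real) set => ('x => real) set" where
  "affs H = {f. \<exists>c c0. f = (\<lambda>x. (\<Sum>h\<in>H. c h * h x) + c0)}"

text \<open>A layer is a set of functions of the network input rather than a vector of neurons, so
  sharing, composition and juxtaposition become unions and images. The width bound concerns hidden
  layers; layer 0 is the family \<open>B\<close> of inputs, whatever its size.\<close>

inductive layers :: "('x => real) set => nat => nat => ('x => real) set => bool"
  for B :: "('x => real) set" and w :: nat where
  base: "layers B w 0 B"
| step: "layers B w D H ==> finite H' ==> card H' <= w ==>
    (\<And>h. h \<in> H' ==> \<exists>a\<in>affs H. h = (\<lambda>x. relu (a x))) ==> layers B w (Suc D) H'"

text \<open>All members of \<open>F\<close> are affine in one common last hidden layer, so affine
  maps after a network cost nothing. \<open>D\<close> is an exact number of hidden layers. The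
  conjunct \<open>finite B\<close> guards \<open>affs\<close>, because a sum over an infinite set is
  0.\<close>

definition cmp :: "('x => real) set => nat => nat => ('x => real) set => bool" where
  "cmp B w D F \<longleftrightarrow> finite B \<and> (\<exists>H. layers B w D H \<and> F \<subseteq> affs H)"

lemma relu_simps [simp]: "relu 0 = 0" "x \<ge> 0 ==> relu x = x" "x <= 0 ==> relu x = 0" "relu x \<ge> 0"
  by (auto simp: relu_def)

lemma relu_diff: "relu x - relu (- x) = x"
  by (auto simp: relu_def)

lemma affs_const: "(\<lambda>x. c) \<in> affs H"
  unfolding affs_def by (auto intro!: exI[of _ "\<lambda>_. 0"])

lemma affs_gen: assumes "finite H" "h \<in> H" shows "h \<in> affs H"
proof -
  have "h = (\<lambda>x. (\<Sum>g\<in>H. (if g = h then 1 else 0) * g x) + 0)"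
    using assms by (simp add: if_distrib[of "\<lambda>z. z * _"] sum.delta' cong: if_cong)
  then show ?thesis unfolding affs_def by (intro CollectI exI)
qed

lemma affs_add: assumes "f \<in> affs H" "g \<in> affs H" shows "(\<lambda>x. f x + g x) \<in> affs H"
proof -
  obtain c c0 where f: "f = (\<lambda>x. (\<Sum>h\<in>H. c h * h x) + c0)" using assms(1) by (auto simp: affs_def)
  obtain e e0 where g: "g = (\<lambda>x. (\<Sum>h\<in>H. e h * h x) + e0)" using assms(2) by (auto simp: affs_def)
  have "(\<lambda>x. f x + g x) = (\<lambda>x. (\<Sum>h\<in>H. (c h + e h) * h x) + (c0 + e0))"
    by (simp add: f g sum.distrib algebra_simps)
  then show ?thesis unfolding affs_def by (intro CollectI exI)
qed

lemma affs_cmul: assumes "f \<in> affs H" shows "(\<lambda>x. a * f x) \<in> affs H"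
proof -
  obtain c c0 where f: "f = (\<lambda>x. (\<Sum>h\<in>H. c h * h x) + c0)" using assms(1) by (auto simp: affs_def)
  have "(\<lambda>x. a * f x) = (\<lambda>x. (\<Sum>h\<in>H. (a * c h) * h x) + a * c0)"
    by (simp add: f sum_distrib_left algebra_simps)
  then show ?thesis unfolding affs_def by (intro CollectI exI)
qed

lemma affs_neg: "f \<in> affs H ==> (\<lambda>x. - f x) \<in> affs H"
  using affs_cmul[of f H "-1"] by simp

lemma affs_diff: "f \<in> affs H ==> g \<in> affs H ==> (\<lambda>x. f x - g x) \<in> affs H"
  using affs_add[OF _ affs_neg, of f H g] by simp

lemma affs_cmul': "f \<in> affs H ==> (\<lambda>x. f x * a) \<in> affs H"
  using affs_cmul[of f H a] by (simp add: mult.commute)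

lemma affs_divide: "f \<in> affs H ==> (\<lambda>x. f x / a) \<in> affs H"
  using affs_cmul[of f H "1/a"] by simp

lemma affs_sum: assumes "\<And>i. i \<in> I ==> f i \<in> affs H" shows "(\<lambda>x. \<Sum>i\<in>I. f i x) \<in> affs H"
  using assms by (induction I rule: infinite_finite_induct) (auto intro: affs_const affs_add)

lemmas affs_intros = affs_const affs_add affs_cmul affs_cmul' affs_neg affs_diff affs_divide affs_sum

lemma affs_trans: assumes "f \<in> affs F" "F \<subseteq> affs H" shows "f \<in> affs H"
proof -
  obtain c c0 where f: "f = (\<lambda>x. (\<Sum>h\<in>F. c h * h x) + c0)" using assms(1) by (auto simp: affs_def)
  show ?thesis unfolding f by (intro affs_intros) (use assms in auto)
qed

lemma affs_mono: assumes "H \<subseteq> H'" "finite H'" shows "affs H \<subseteq> affs H'"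
  using affs_trans[of _ H H'] affs_gen[of H'] assms by blast

lemma affs_comp:
  assumes "f \<in> affs H" "\<And>h. h \<in> H ==> (\<lambda>x. h (G x)) \<in> affs H'"
  shows "(\<lambda>x. f (G x)) \<in> affs H'"
proof -
  obtain c c0 where f: "f = (\<lambda>x. (\<Sum>h\<in>H. c h * h x) + c0)" using assms(1) by (auto simp: affs_def)
  show ?thesis unfolding f by (intro affs_intros assms(2))
qed

lemma layers_finite: "layers B w D H ==> finite B ==> finite H"
  by (induction rule: layers.induct) auto

lemma layers_width_mono: "layers B w D H ==> w <= w' ==> layers B w' D H"
  by (induction rule: layers.induct) (auto intro: layers.intros order_trans)

text \<open>Composition of a network with a substitution \<open>G\<close> computed by another one, while the
  functions in \<open>F0\<close> are handed on unchanged as \<open>f = relu f - relu (- f)\<close>.\<close>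

lemma layers_compose:
  assumes 1: "layers B w1 D1 H1" and finB: "finite B" and F0: "finite F0" "F0 \<subseteq> affs H1"
    and 2: "layers B' w2 D2 H2" and finB': "finite B'"
    and G: "\<And>b. b \<in> B' ==> (\<lambda>x. b (G x)) \<in> affs H1"
  shows "\<exists>H. layers B (max w1 (w2 + 2 * card F0)) (D1 + D2) H \<and> F0 \<subseteq> affs H \<and>
    (\<forall>h\<in>H2. (\<lambda>x. h (G x)) \<in> affs H)"
  using 2
proof (induction rule: layers.induct)
  case base
  then show ?case using layers_width_mono[OF 1] F0 G by (auto intro!: exI[of _ H1])
next
  case (step D H H')
  let ?w = "max w1 (w2 + 2 * card F0)"
  obtain K where K: "layers B ?w (D1 + D) K" "F0 \<subseteq> affs K" "\<And>h. h \<in> H ==> (\<lambda>x. h (G x)) \<in> affs K"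
    using step.IH by blast
  define K' where "K' = (\<lambda>h x. h (G x)) ` H' \<union> ((\<lambda>f x. relu (f x)) ` F0 \<union> (\<lambda>f x. relu (- f x)) ` F0)"
  have fin: "finite K'" using step.hyps F0 by (auto simp: K'_def)
  have "card K' <= card ((\<lambda>h x. h (G x)) ` H') + (card ((\<lambda>f x. relu (f x)) ` F0) + card ((\<lambda>f x. relu (- f x)) ` F0))"
    unfolding K'_def by (meson add_left_mono card_Un_le le_trans)
  also have "... <= w2 + (card F0 + card F0)"
    using step.hyps F0(1) by (intro add_mono order_trans[OF card_image_le]) auto
  finally have card: "card K' <= ?w" by simp
  have L: "layers B ?w (Suc (D1 + D)) K'"
  proof (rule layers.step[OF K(1) fin card])
    fix h assume "h \<in> K'"
    then consider (a) g where "g \<in> H'" "h = (\<lambda>x. g (G x))" | (b) f where "f \<in> F0" "h = (\<lambda>x. relu (f x))"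
      | (c) f where "f \<in> F0" "h = (\<lambda>x. relu (- f x))" by (auto simp: K'_def)
    then show "\<exists>a\<in>affs K. h = (\<lambda>x. relu (a x))"
    proof cases
      case a
      obtain q where q: "q \<in> affs H" "g = (\<lambda>x. relu (q x))" using step.hyps a(1) by blast
      show ?thesis using affs_comp[OF q(1) K(3)] a(2) q(2) by (intro bexI[of _ "\<lambda>x. q (G x)"]) auto
    next
      case b then show ?thesis using K(2) by auto
    next
      case c then show ?thesis using K(2) affs_neg[of f K] by (intro bexI[of _ "\<lambda>x. - f x"]) auto
    qed
  qed
  have "F0 \<subseteq> affs K'"
  proof
    fix f assume "f \<in> F0"
    then have "(\<lambda>x. relu (f x) - relu (- f x)) \<in> affs K'"
      by (intro affs_diff affs_gen[OF fin]) (auto simp: K'_def)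
    then show "f \<in> affs K'" by (simp add: relu_diff)
  qed
  moreover have "\<forall>h\<in>H'. (\<lambda>x. h (G x)) \<in> affs K'" by (intro ballI affs_gen[OF fin]) (auto simp: K'_def)
  ultimately show ?case using L by auto
qed

section \<open>Closure of \<open>cmp\<close> under composition, juxtaposition, padding and
  summation\<close>

lemma cmp_finite: "cmp B w D F ==> finite B" by (simp add: cmp_def)

lemma cmp_mono: "cmp B w D F ==> w <= w' ==> F' \<subseteq> F ==> cmp B w' D F'"
  unfolding cmp_def using layers_width_mono by blast

lemma cmp_affs: "cmp B w D F ==> G \<subseteq> affs F ==> cmp B w D G"
  unfolding cmp_def using affs_trans by blast

lemma cmp_0: "finite B ==> F \<subseteq> affs B ==> cmp B w 0 F"
  unfolding cmp_def by (auto intro: layers.base)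

lemma cmp_compose:
  assumes 1: "cmp B w1 D1 F1" and F0: "finite F0" "F0 \<subseteq> affs F1" and 2: "cmp B' w2 D2 F2"
    and G: "\<And>b. b \<in> B' ==> (\<lambda>x. b (G x)) \<in> affs F1"
  shows "cmp B (max w1 (w2 + 2 * card F0)) (D1 + D2) (F0 \<union> (\<lambda>f x. f (G x)) ` F2)"
proof -
  obtain H1 where H1: "layers B w1 D1 H1" "F1 \<subseteq> affs H1" using 1 by (auto simp: cmp_def)
  obtain H2 where H2: "layers B' w2 D2 H2" "F2 \<subseteq> affs H2" using 2 by (auto simp: cmp_def)
  obtain H where H: "layers B (max w1 (w2 + 2 * card F0)) (D1 + D2) H" "F0 \<subseteq> affs H"
    "\<forall>h\<in>H2. (\<lambda>x. h (G x)) \<in> affs H"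
    using layers_compose[OF H1(1) cmp_finite[OF 1] F0(1) _ H2(1) cmp_finite[OF 2], of G]
      affs_trans[OF _ H1(2)] F0(2) G by blast
  have "(\<lambda>x. f (G x)) \<in> affs H" if "f \<in> F2" for f
    using affs_comp[of f H2 G H] H(3) H2(2) that by blast
  then show ?thesis unfolding cmp_def using H cmp_finite[OF 1] by auto
qed

lemma cmp_layer:
  assumes 1: "cmp B w D F" and "finite H" "card H <= w"
    and "\<And>h. h \<in> H ==> \<exists>a\<in>affs F. h = (\<lambda>x. relu (a x))"
  shows "cmp B w (Suc D) H"
proof -
  obtain K where K: "layers B w D K" "F \<subseteq> affs K" using 1 by (auto simp: cmp_def)
  have "layers B w (Suc D) H"
    by (rule layers.step[OF K(1) assms(2,3)]) (use assms(4) affs_trans[OF _ K(2)] in blast)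
  then show ?thesis unfolding cmp_def using cmp_finite[OF 1] affs_gen[OF assms(2)] by auto
qed

lemma cmp_parallel:
  assumes "cmp B w1 D F1" "cmp B w2 D F2"
  shows "cmp B (w1 + w2) D (F1 \<union> F2)"
proof -
  have *: "\<exists>H. layers B (w1 + w2) D H \<and> affs H1 \<subseteq> affs H \<and> affs H2 \<subseteq> affs H"
    if "layers B w1 D H1" "layers B w2 D H2" "finite B" for D H1 H2
    using that
  proof (induction D arbitrary: H1 H2)
    case 0
    then have "H1 = B" "H2 = B" by (auto elim: layers.cases)
    then show ?case by (auto intro: layers.base)
  next
    case (Suc D)
    obtain K1 where K1: "layers B w1 D K1" "finite H1" "card H1 <= w1"
      "\<And>h. h \<in> H1 ==> \<exists>a\<in>affs K1. h = (\<lambda>x. relu (a x))"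
      using Suc.prems(1) by (auto elim: layers.cases)
    obtain K2 where K2: "layers B w2 D K2" "finite H2" "card H2 <= w2"
      "\<And>h. h \<in> H2 ==> \<exists>a\<in>affs K2. h = (\<lambda>x. relu (a x))"
      using Suc.prems(2) by (auto elim: layers.cases)
    obtain K where K: "layers B (w1 + w2) D K" "affs K1 \<subseteq> affs K" "affs K2 \<subseteq> affs K"
      using Suc.IH[OF K1(1) K2(1) Suc.prems(3)] by blast
    have fin: "finite (H1 \<union> H2)" using K1 K2 by auto
    have "layers B (w1 + w2) (Suc D) (H1 \<union> H2)"
      by (rule layers.step[OF K(1) fin])
        (use card_Un_le[of H1 H2] K1(3,4) K2(3,4) K(2,3) in \<open>auto, blast+\<close>)
    then show ?case using affs_mono[OF _ fin] by blast
  qed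
  obtain H1 where H1: "layers B w1 D H1" "F1 \<subseteq> affs H1" using assms(1) by (auto simp: cmp_def)
  obtain H2 where H2: "layers B w2 D H2" "F2 \<subseteq> affs H2" using assms(2) by (auto simp: cmp_def)
  show ?thesis using *[OF H1(1) H2(1) cmp_finite[OF assms(1)]] H1(2) H2(2) cmp_finite[OF assms(1)]
    unfolding cmp_def by (meson Un_least order_trans)
qed

text \<open>Composition with a network over the unit type that has no neurons: in the added layers
  only the carried functions remain, each as a pair of neurons, whence
  \<open>2 * card F\<close>.\<close>

lemma cmp_pad:
  assumes "cmp B w D F" "finite F" "D <= D'"
  shows "cmp B (max w (2 * card F)) D' F"
proof -
  have "layers {} 0 n {}" for n :: nat
    by (induction n) (auto intro: layers.intros)
  then have "cmp ({} :: (unit => real) set) 0 (D' - D) {}" by (auto simp: cmp_def)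
  from cmp_compose[OF assms(1,2) _ this, of "\<lambda>_. ()"] show ?thesis
    using affs_gen[OF assms(2)] assms(3) by auto
qed

lemma cmp_parallel_pad:
  assumes "cmp B w1 D1 F1" "cmp B w2 D2 F2" "finite F1" "finite F2"
  shows "cmp B (max w1 (2 * card F1) + max w2 (2 * card F2)) (max D1 D2) (F1 \<union> F2)"
  using cmp_parallel[OF cmp_pad[OF assms(1,3), of "max D1 D2"] cmp_pad[OF assms(2,4), of "max D1 D2"]] by simp

lemma cmp_parallel_family:
  assumes "finite I" "finite B" "\<And>i. i \<in> I ==> cmp B (w i) D (F i)"
  shows "cmp B (\<Sum>i\<in>I. w i) D (\<Union>i\<in>I. F i)"
  using assms(1,3)
proof (induction I)
  case empty
  have "\<exists>H. layers B 0 n H" for n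
  proof (induction n)
    case (Suc n)
    then obtain H where "layers B 0 n H" by blast
    then have "layers B 0 (Suc n) {}" by (rule layers.step) auto
    then show ?case by blast
  qed (auto intro: layers.base)
  then show ?case using assms(2) by (auto simp: cmp_def)
next
  case (insert i I)
  then show ?case using cmp_parallel[of B "w i" D "F i" "\<Sum>i\<in>I. w i" "\<Union>i\<in>I. F i"] by auto
qed

text \<open>Depths add up while the width stays that of one summand: besides the network at work
  only the inputs \<open>B\<close> and the partial sum are carried, at two neurons each.\<close>

lemma cmp_serial_sum:
  fixes m :: nat
  assumes "finite B" "\<And>t. t < m ==> cmp B (w t) (D t) {g t}" "\<And>t. t < m ==> w t <= w0"
  shows "cmp B (w0 + 2 * card B + 2) (\<Sum>t<m. D t) (insert (\<lambda>x. \<Sum>t<m. g t x) B)"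
  using assms(2,3)
proof (induction m)
  case 0
  show ?case using assms(1) affs_const[of 0 B] affs_gen[OF assms(1)] by (auto intro!: cmp_0)
next
  case (Suc m)
  let ?F = "insert (\<lambda>x. \<Sum>t<m. g t x) B"
  have 1: "cmp B (w0 + 2 * card B + 2) (\<Sum>t<m. D t) ?F" using Suc by auto
  have fin: "finite ?F" using assms(1) by auto
  have "cmp B (max (w0 + 2 * card B + 2) (w m + 2 * card ?F)) ((\<Sum>t<m. D t) + D m) (?F \<union> (\<lambda>f x. f (id x)) ` {g m})"
    by (rule cmp_compose[OF 1 fin _ Suc.prems(1)[of m]]) (use affs_gen[OF fin] in auto)
  moreover have "max (w0 + 2 * card B + 2) (w m + 2 * card ?F) <= w0 + 2 * card B + 2"
    using Suc.prems(2)[of m] card_insert_le_m1[of "Suc (card B)" B "\<lambda>x. \<Sum>t<m. g t x"] assms(1)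
    by (auto simp: card_insert_if)
  ultimately have 2: "cmp B (w0 + 2 * card B + 2) (\<Sum>t<Suc m. D t) (?F \<union> {g m})"
    by (auto elim: cmp_mono)
  show ?case
    apply (rule cmp_affs[OF 2])
    using affs_gen[of "?F \<union> {g m}"] fin by (auto intro!: affs_add)
qed

lemma cmp_subst:
  assumes "cmp B' w D F" "finite B" "\<And>b. b \<in> B' ==> (\<lambda>x. b (G x)) \<in> affs B"
  shows "cmp B w D ((\<lambda>f x. f (G x)) ` F)"
  using cmp_compose[OF cmp_0[OF assms(2), of B 0] _ _ assms(1), of "{}" G] affs_gen[OF assms(2)] assms(3) by auto

lemma cmp_compose':
  assumes "cmp B w1 D1 F1" "cmp B' w2 D2 F2" "\<And>b. b \<in> B' ==> (\<lambda>x. b (G x)) \<in> affs F1"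
  shows "cmp B (max w1 w2) (D1 + D2) ((\<lambda>f x. f (G x)) ` F2)"
  using cmp_compose[OF assms(1) _ _ assms(2), of "{}" G] assms(3) by auto

subsection \<open>Conversion to the matrix description\<close>

lemma hid_cong:
  "(\<And>l. l \<in> {1..L} ==> N l = N' l) ==> (\<And>l. l \<in> {1..<L} ==> A l = A' l) ==> (\<And>l. l \<in> {1..<L} ==> b l = b' l)
    ==> hid N A0 b0 A b L x = hid N' A0 b0 A' b' L x"
proof (induction L rule: nat_less_induct)
  case (1 L)
  consider "L = 0" | "L = 1" | l where "L = Suc (Suc l)" by (metis One_nat_def not0_implies_Suc)
  then show ?case
  proof cases
    case 3
    have "hid N A0 b0 A b (Suc l) x = hid N' A0 b0 A' b' (Suc l) x"
      using "1.prems" 3 by (intro "1.IH"[rule_format]) auto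
    then show ?thesis using "1.prems"(1)[of L] "1.prems"(1)[of "Suc l"] "1.prems"(2)[of "Suc l"] "1.prems"(3)[of "Suc l"] 3 by auto
  qed (use "1.prems" in \<open>auto simp: fun_eq_iff\<close>)
qed

text \<open>\<open>NN\<close> asks for at least one neuron in each layer, while a layer of
  \<open>layers\<close> may be empty; hence \<open>max 1\<close> in the proof. An index that belongs
  to no function later gets the coefficient 0.\<close>

lemma finite_indexing:
  assumes "finite H" "card H <= W" "1 <= W"
  obtains n idx where "1 <= n" "n <= W" "inj_on idx H" "idx ` H \<subseteq> {..<n::nat}"
proof -
  obtain idx where "bij_betw idx H {0..<card H}" using ex_bij_betw_finite_nat[OF assms(1)] by auto
  then have "inj_on idx H" "idx ` H \<subseteq> {..<max 1 (card H)}" by (auto simp: bij_betw_def)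
  then show ?thesis using that[of "max 1 (card H)" idx] assms by auto
qed

lemma affs_indexed:
  assumes "f \<in> affs H" "finite H" "inj_on idx H" "idx ` H \<subseteq> {..<n::nat}"
    and "\<And>h x. h \<in> H ==> v x (idx h) = h x"
  shows "\<exists>c c0. f = (\<lambda>x. (\<Sum>j<n. c j * v x j) + c0)"
proof -
  obtain c c0 where f: "f = (\<lambda>x. (\<Sum>h\<in>H. c h * h x) + c0)" using assms(1) by (auto simp: affs_def)
  define e where "e j = (if j \<in> idx ` H then c (inv_into H idx j) else 0)" for j
  have "(\<Sum>j<n. e j * v x j) = (\<Sum>h\<in>H. c h * h x)" for x
  proof -
    have "(\<Sum>j<n. e j * v x j) = (\<Sum>j\<in>idx ` H. e j * v x j)"
      by (rule sum.mono_neutral_right) (use assms(4) in \<open>auto simp: e_def\<close>)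
    also have "... = (\<Sum>h\<in>H. c h * h x)"
      using assms(3,5) by (subst sum.reindex) (auto simp: e_def intro!: sum.cong)
    finally show ?thesis .
  qed
  then show ?thesis unfolding f by (intro exI[of _ e] exI[of _ c0]) auto
qed

lemma layers_hid:
  fixes H :: "(real^'n::finite => real) set"
  assumes "layers (range (\<lambda>j x. x $ j)) W L H" "L \<ge> 1" "W \<ge> 1"
  shows "\<exists>N A0 b0 A b idx. (\<forall>l\<in>{1..L}. 1 <= N l \<and> N l <= W) \<and> inj_on idx H \<and> idx ` H \<subseteq> {..<N L} \<and>
    (\<forall>h\<in>H. \<forall>x. hid N A0 b0 A b L x (idx h) = h x)"
  using assms
proof (induction rule: layers.induct)
  case base then show ?case by simp
next
  case (step D H H')
  obtain n idx where n: "1 <= n" "n <= W" "inj_on idx H'" "idx ` H' \<subseteq> {..<n}"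
    using finite_indexing[OF step.hyps(2,3) step.prems(2)] by blast
  define inv where "inv = inv_into H' idx"
  have inv: "inv (idx h) = h" if "h \<in> H'" for h using that n(3) by (simp add: inv_def)
  show ?case
  proof (cases "D = 0")
    case True
    then have H: "H = range (\<lambda>j x. x $ j)" using step.hyps(1) by (auto elim: layers.cases)
    have "\<exists>c c0. h = (\<lambda>x. relu ((\<Sum>j\<in>UNIV. c j * x $ j) + c0))" if hH: "h \<in> H'" for h
    proof -
      obtain a where a: "a \<in> affs H" "h = (\<lambda>x. relu (a x))" using step.hyps(4)[OF hH] by blast
      obtain c c0 where c: "a = (\<lambda>x. (\<Sum>h\<in>H. c h * h x) + c0)" using a(1) by (auto simp: affs_def)
      \<comment> \<open>Distinct coordinates are distinct functions, so the sum over the set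
        \<open>H\<close> of functions becomes a sum over coordinate indices.\<close>
      have inj: "inj (\<lambda>j (x::real^'n). x $ j)"
      proof (rule injI)
        fix i j assume "(\<lambda>x::real^'n. x $ i) = (\<lambda>x. x $ j)"
        then have "(axis i (1::real)) $ i = (axis i 1 :: real^'n) $ j" by metis
        then show "i = j" by (auto simp: axis_def split: if_splits)
      qed
      have "a = (\<lambda>x. (\<Sum>j\<in>UNIV. c (\<lambda>x. x $ j) * x $ j) + c0)"
        unfolding c H using inj by (subst sum.reindex) (auto simp: o_def)
      then show ?thesis using a(2) by (intro exI[of _ "\<lambda>j. c (\<lambda>x. x $ j)"] exI[of _ c0]) auto
    qed
    then obtain c c0 where c: "\<And>h. h \<in> H' ==> h = (\<lambda>x. relu ((\<Sum>j\<in>UNIV. c h j * x $ j) + c0 h))" by metis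
    have "hid (\<lambda>_. n) (\<lambda>i. c (inv i)) (\<lambda>i. c0 (inv i)) A b (Suc D) x (idx h) = h x" if "h \<in> H'" for A b h x
      using True n(4) that inv[OF that] fun_cong[OF c[OF that], of x] by auto
    then show ?thesis using n by (intro exI[of _ "\<lambda>_. n"] exI conjI) auto
  next
    case False
    then obtain N A0 b0 A b ix where I: "\<forall>l\<in>{1..D}. 1 <= N l \<and> N l <= W" "inj_on ix H" "ix ` H \<subseteq> {..<N D}"
      "\<And>h x. h\<in>H ==> hid N A0 b0 A b D x (ix h) = h x"
      proof -
      have "1 <= D" using False by simp
      from step.IH[OF this step.prems(2)] show thesis by (elim exE conjE) (rule that, auto)
    qed
    have finH: "finite H" using layers_finite[OF step.hyps(1)] by auto
    have "\<exists>c c0. h = (\<lambda>x. relu ((\<Sum>j<N D. c j * hid N A0 b0 A b D x j) + c0))" if hH: "h \<in> H'" for h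
    proof -
      obtain a where a: "a \<in> affs H" "h = (\<lambda>x. relu (a x))" using step.hyps(4)[OF hH] by blast
      show ?thesis using affs_indexed[OF a(1) finH I(2,3), of "hid N A0 b0 A b D"] I(4) a(2) by blast
    qed
    then obtain c c0 where c: "\<And>h. h \<in> H' ==> h = (\<lambda>x. relu ((\<Sum>j<N D. c h j * hid N A0 b0 A b D x j) + c0 h))" by metis
    obtain D' where D': "D = Suc D'" using False not0_implies_Suc by blast
    \<comment> \<open>Only entries with index \<open>D\<close> (weights, biases) and
      \<open>Suc D\<close> (width) change, so the values of layer \<open>D\<close> survive by
      \<open>hid_cong\<close>.\<close>
    define N' A' b' where "N' = N(Suc D := n)" and "A' = A(D := (\<lambda>i. c (inv i)))" and "b' = b(D := (\<lambda>i. c0 (inv i)))"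
    have same: "hid N' A0 b0 A' b' D x = hid N A0 b0 A b D x" for x
      by (rule hid_cong) (auto simp: N'_def A'_def b'_def)
    have "hid N' A0 b0 A' b' (Suc D) x (idx h) = h x" if "h \<in> H'" for h x
    proof -
      have "idx h < n" using n(4) that by auto
      then have "hid N' A0 b0 A' b' (Suc D) x (idx h) = relu ((\<Sum>j<N D. c h j * hid N A0 b0 A b D x j) + c0 h)"
        using same[of x] unfolding D' by (simp add: N'_def A'_def b'_def D' inv[OF that])
      also have "... = h x" using fun_cong[OF c[OF that], of x] by simp
      finally show ?thesis .
    qed
    moreover have "\<forall>l\<in>{1..Suc D}. 1 <= N' l \<and> N' l <= W" "idx ` H' \<subseteq> {..<N' (Suc D)}"
      using n I(1) by (auto simp: N'_def)
    ultimately show ?thesis using n(3) by blast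
  qed
qed

lemma cmp_NN:
  fixes g :: "real^'n::finite => real"
  assumes "cmp (range (\<lambda>j x. x $ j)) W L {g}" "L \<ge> 1" "W \<ge> 1"
  shows "g \<in> NN W L"
proof -
  obtain H where H: "layers (range (\<lambda>j (x::real^'n). x $ j)) W L H" "g \<in> affs H" using assms(1) by (auto simp: cmp_def)
  obtain N A0 b0 A b idx where I: "\<forall>l\<in>{1..L}. 1 <= N l \<and> N l <= W" "inj_on idx H" "idx ` H \<subseteq> {..<N L}"
    "\<And>h x. h\<in>H ==> hid N A0 b0 A b L x (idx h) = h x"
    using layers_hid[OF H(1) assms(2,3)] by (elim exE conjE) (rule that, auto)
  obtain c c0 where "g = (\<lambda>x. (\<Sum>j<N L. c j * hid N A0 b0 A b L x j) + c0)"
    using affs_indexed[OF H(2) layers_finite[OF H(1)] I(2,3), of "hid N A0 b0 A b L"] I(4) by auto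
  then show ?thesis unfolding NN_def using I(1) assms(2)
    by (intro CollectI exI[of _ N] exI[of _ A0] exI[of _ b0] exI[of _ A] exI[of _ b] exI[of _ "\<lambda>_. 0"] exI[of _ c] exI[of _ c0]) auto
qed

section \<open>Looking up sparse sets\<close>

text \<open>\<open>a\<close> is the last threshold passed. The index 0 also serves queries below
  \<open>P 0\<close>, which is why the equivalence starts at 1.\<close>

lemma step_index_exists:
  fixes P :: "nat => nat"
  assumes "mono P" "w \<ge> 1"
  shows "\<exists>a<w. \<forall>c\<in>{1..<w}. P c <= i \<longleftrightarrow> c <= a"
proof -
  let ?M = "{c. c < w \<and> (c = 0 \<or> P c <= i)}"
  have fin: "finite ?M" by auto
  have "0 \<in> ?M" using assms(2) by auto
  then have ne: "?M \<noteq> {}" by blast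
  let ?a = "Max ?M"
  have a: "?a \<in> ?M" using Max_in[OF fin ne] .
  have "P c <= i \<longleftrightarrow> c <= ?a" if "c \<in> {1..<w}" for c
  proof
    assume "c <= ?a" then show "P c <= i" using a that monoD[OF assms(1), of c ?a] by auto
  qed (use that fin in \<open>auto intro!: Max_ge\<close>)
  then show ?thesis using a by auto
qed

text \<open>Abel summation turns unit steps into a table: the jumps \<open>h c - h (c - 1)\<close>
  up to the current index add up to \<open>h a\<close> minus \<open>h 0\<close>. Thus every table
  over the same thresholds is an affine function of the same step neurons.\<close>

lemma step_telescope:
  fixes h :: "nat => real"
  assumes "a < w" "\<And>c. c \<in> {1..<w} ==> s c = (if c <= a then 1 else 0)"
  shows "h 0 + (\<Sum>c\<in>{1..<w}. (h c - h (c - 1)) * s c) = h a"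
proof -
  have "(\<Sum>c\<in>{1..<w}. (h c - h (c - 1)) * s c) = (\<Sum>c\<in>{1..<w}. if c \<in> {1..a} then h c - h (c - 1) else 0)"
    by (rule sum.cong) (auto simp: assms(2))
  also have "... = (\<Sum>c\<in>{1..a}. h c - h (c - 1))"
    using assms(1) by (subst sum.inter_restrict[symmetric]) (auto intro: sum.cong)
  also have "... = h a - h 0" by (induction a) auto
  finally show ?thesis by simp
qed

lemma sum_group_nat: "(\<Sum>c<n. \<Sum>b<k. f (c * k + b :: nat)) = (\<Sum>g<n * k. f g)"
proof -
  have "(\<Sum>b<k. f (c * k + b)) = sum f {c * k..<c * k + k}" for c
    by (rule sum.reindex_bij_witness[of _ "\<lambda>g. g - c * k" "\<lambda>b. c * k + b"]) auto
  then show ?thesis by (simp add: sum.nat_group)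
qed

lemma sum_split_at:
  fixes f :: "nat => 'a::comm_monoid_add"
  assumes "a < w"
  shows "(\<Sum>c<w. f c) = (\<Sum>c<a. f c) + f a + (\<Sum>c\<in>{a<..<w}. f c)"
proof -
  have "{..<w} = {..<Suc a} \<union> {a<..<w}" using assms by auto
  then have "(\<Sum>c<w. f c) = (\<Sum>c\<in>{..<Suc a} \<union> {a<..<w}. f c)" by (rule arg_cong)
  also have "... = (\<Sum>c<Suc a. f c) + (\<Sum>c\<in>{a<..<w}. f c)"
    by (rule sum.union_disjoint) auto
  finally show ?thesis by simp
qed

text \<open>Search in two stages: steps at the \<open>w\<close> block boundaries find the block
  \<open>a\<close> of the query and thereby select one row of the tables; then about
  \<open>w\<close> neurons compare the query with the thresholds of that row. In this way width of
  order \<open>w\<close> handles \<open>w * w\<close> jumps. Nonnegative jumps allow a relu to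
  switch an entry off.\<close>

lemma lookup_mono:
  fixes P :: "nat => nat" and \<Delta> :: "nat => real"
  assumes w: "w \<ge> 1" and P: "mono P" and \<Delta>: "\<And>g. 0 <= \<Delta> g"
  shows "\<exists>\<phi>. cmp {\<lambda>x. x} (2 * w + 3) 3 {\<phi>} \<and>
    (\<forall>i::nat. \<phi> (real i) = (\<Sum>g<w * w. \<Delta> g * (if P g <= i then 1 else 0)))"
proof -
  \<comment> \<open>On integer queries the difference of the two ramps at \<open>P (c * w)\<close>
    is a 0/1 step. The neuron \<open>relu x\<close> hands the query on, since it equals the query
    for natural numbers.\<close>
  define H1 where "H1 = insert (\<lambda>x. relu x) ((\<lambda>c x. relu (x - real (P (c * w)) + 1)) ` {1..<w}
     \<union> (\<lambda>c x. relu (x - real (P (c * w)))) ` {1..<w})"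
  have fin1: "finite H1" by (auto simp: H1_def)
  have "card H1 <= Suc (card ((\<lambda>c x. relu (x - real (P (c * w)) + 1)) ` {1..<w}
     \<union> (\<lambda>c x. relu (x - real (P (c * w)))) ` {1..<w}))"
    unfolding H1_def by (rule card_insert_le_m1) auto
  also have "... <= Suc (card {1..<w} + card {1..<w})"
    by (intro Suc_le_mono[THEN iffD2] order_trans[OF card_Un_le] add_mono card_image_le) auto
  finally have card1: "card H1 <= 2 * w + 3" by simp
  have c1: "cmp {\<lambda>x. x} (2 * w + 3) 1 H1"
    unfolding One_nat_def
  proof (rule cmp_layer[OF cmp_0[of "{\<lambda>x::real. x}" "{\<lambda>x. x}"] fin1 card1])
    have x: "(\<lambda>x. x) \<in> affs {\<lambda>x::real. x}" by (rule affs_gen) auto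
    then show "{\<lambda>x. x} \<subseteq> affs {\<lambda>x::real. x}" by simp
    fix h assume "h \<in> H1"
    then consider "h = (\<lambda>x. relu x)" | c where "h = (\<lambda>x. relu (x - real (P (c * w)) + 1))"
      | c where "h = (\<lambda>x. relu (x - real (P (c * w))))" by (auto simp: H1_def)
    then show "\<exists>a\<in>affs {\<lambda>x. x}. h = (\<lambda>x. relu (a x))"
    proof cases
      case 1 then show ?thesis using x by auto
    next
      case (2 c)
      then show ?thesis using x by (intro bexI[of _ "\<lambda>x. x - real (P (c * w)) + 1"] affs_intros) auto
    next
      case (3 c)
      then show ?thesis using x by (intro bexI[of _ "\<lambda>x. x - real (P (c * w))"] affs_intros) auto
    qed
  qed auto
  define s where "s c x = relu (x - real (P (c * w)) + 1) - relu (x - real (P (c * w)))" for c x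
  define hf where "hf h x = h 0 + (\<Sum>c\<in>{1..<w}. (h c - h (c - 1)) * s c x)" for h x
  have s_aff: "s c \<in> affs H1" if "c \<in> {1..<w}" for c
    unfolding s_def by (intro affs_diff affs_gen[OF fin1]) (use that in \<open>auto simp: H1_def\<close>)
  have hf_aff: "hf h \<in> affs H1" for h
    unfolding hf_def using s_aff by (intro affs_intros) auto
  have x_aff: "(\<lambda>x. relu x) \<in> affs H1" by (intro affs_gen[OF fin1]) (auto simp: H1_def)
  \<comment> \<open>The jumps of all blocks before \<open>a\<close>; these thresholds have been
    passed completely.\<close>
  define A where "A a = (\<Sum>c<a. \<Sum>b<w. \<Delta> (c * w + b))" for a
  define \<theta> where "\<theta> b x = relu (hf (\<lambda>a. real (P (a * w + b))) x - relu x)" for b x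
  define \<delta> where "\<delta> b x = relu (hf (\<lambda>a. \<Delta> (a * w + b)) x)" for b x
  define \<alpha> where "\<alpha> x = relu (hf A x)" for x
  define H2 where "H2 = insert \<alpha> (\<theta> ` {..<w} \<union> \<delta> ` {..<w})"
  have fin2: "finite H2" by (auto simp: H2_def)
  have "card H2 <= Suc (card (\<theta> ` {..<w} \<union> \<delta> ` {..<w}))" unfolding H2_def by (rule card_insert_le_m1) auto
  also have "... <= Suc (card {..<w} + card {..<w})"
    by (intro Suc_le_mono[THEN iffD2] order_trans[OF card_Un_le] add_mono card_image_le) auto
  finally have card2: "card H2 <= 2 * w + 3" by simp
  have c2: "cmp {\<lambda>x. x} (2 * w + 3) (Suc 1) H2"
  proof (rule cmp_layer[OF c1 fin2 card2])
    fix h assume "h \<in> H2"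
    then consider "h = \<alpha>" | b where "h = \<theta> b" | b where "h = \<delta> b" by (auto simp: H2_def)
    then show "\<exists>a\<in>affs H1. h = (\<lambda>x. relu (a x))"
    proof cases
      case 1 then show ?thesis using hf_aff[of A] by (auto simp: \<alpha>_def[abs_def])
    next
      case 2 then show ?thesis using affs_diff[OF hf_aff x_aff] by (auto simp: \<theta>_def[abs_def])
    next
      case 3 then show ?thesis using hf_aff by (auto simp: \<delta>_def[abs_def])
    qed
  qed
  \<comment> \<open>\<open>\<theta> b\<close> is 0 if the threshold has been reached and at least 1
    otherwise, so subtracting \<open>K * \<theta> b\<close>, with \<open>K\<close> a bound for every
    single jump, switches the entry off.\<close>
  define K where "K = (\<Sum>g<w * w. \<Delta> g)"
  define \<gamma> where "\<gamma> b x = relu (\<delta> b x - K * \<theta> b x)" for b x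
  define H3 where "H3 = insert (\<lambda>x. relu (\<alpha> x)) (\<gamma> ` {..<w})"
  have fin3: "finite H3" by (auto simp: H3_def)
  have "card H3 <= Suc (card (\<gamma> ` {..<w}))" unfolding H3_def by (rule card_insert_le_m1) auto
  also have "... <= Suc (card {..<w})" by (intro Suc_le_mono[THEN iffD2] card_image_le) auto
  finally have card3: "card H3 <= 2 * w + 3" by simp
  have c3: "cmp {\<lambda>x. x} (2 * w + 3) (Suc (Suc 1)) H3"
  proof (rule cmp_layer[OF c2 fin3 card3])
    fix h assume "h \<in> H3"
    then consider "h = (\<lambda>x. relu (\<alpha> x))" | b where "b < w" "h = \<gamma> b" by (auto simp: H3_def)
    then show "\<exists>a\<in>affs H2. h = (\<lambda>x. relu (a x))"
    proof cases
      case 1 then show ?thesis using affs_gen[OF fin2, of \<alpha>] by (auto simp: H2_def)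
    next
      case 2
      have "(\<lambda>x. \<delta> b x - K * \<theta> b x) \<in> affs H2"
        using 2 by (intro affs_diff affs_cmul affs_gen[OF fin2]) (auto simp: H2_def)
      then show ?thesis using 2 by (auto simp: \<gamma>_def[abs_def])
    qed
  qed
  define \<phi> where "\<phi> x = relu (\<alpha> x) + (\<Sum>b<w. \<gamma> b x)" for x
  have "\<phi> \<in> affs H3" unfolding \<phi>_def by (intro affs_add affs_sum affs_gen[OF fin3]) (auto simp: H3_def)
  then have c: "cmp {\<lambda>x. x} (2 * w + 3) 3 {\<phi>}" using cmp_affs[OF c3, of "{\<phi>}"] by (simp add: numeral_3_eq_3)
  have A0: "A a \<ge> 0" for a unfolding A_def by (intro sum_nonneg \<Delta>)
  have "\<phi> (real i) = (\<Sum>g<w * w. \<Delta> g * (if P g <= i then 1 else 0))" for i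
  proof -
    have "mono (\<lambda>c. P (c * w))" using P by (auto simp: mono_def)
    from step_index_exists[OF this w, of i] obtain a where a: "a < w"
      "\<And>c. c \<in> {1..<w} ==> P (c * w) <= i \<longleftrightarrow> c <= a" by blast
    have "s c (real i) = (if c <= a then 1 else 0)" if "c \<in> {1..<w}" for c
    proof (cases "c <= a")
      case True
      then show ?thesis using a(2)[OF that] by (simp add: s_def)
    next
      case False
      then have "i + 1 <= P (c * w)" using a(2)[OF that] by simp
      then show ?thesis using False by (simp add: s_def)
    qed
    then have hf: "hf h (real i) = h a" for h
      unfolding hf_def by (intro step_telescope[OF a(1)]) auto
    have \<gamma>: "\<gamma> b (real i) = \<Delta> (a * w + b) * (if P (a * w + b) <= i then 1 else 0)" if b: "b < w" for b
    proof (cases "P (a * w + b) <= i")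
      case True then show ?thesis using \<Delta> by (simp add: \<gamma>_def \<delta>_def \<theta>_def hf)
    next
      case False
      then have t: "\<theta> b (real i) \<ge> 1" by (simp add: \<theta>_def hf)
      have "a * w + b < w * w"
        using a(1) b by (metis add.commute less_le_trans mult_le_mono1 nat_add_left_cancel_less Suc_leI mult_Suc)
      then have "\<Delta> (a * w + b) <= K" unfolding K_def using \<Delta> by (intro member_le_sum) auto
      moreover have "K \<ge> 0" unfolding K_def by (intro sum_nonneg \<Delta>)
      then have "K * \<theta> b (real i) \<ge> K" using t mult_left_mono[OF t, of K] by simp
      ultimately show ?thesis using False \<Delta> by (simp add: \<gamma>_def \<delta>_def hf)
    qed
    have "\<phi> (real i) = A a + (\<Sum>b<w. \<Delta> (a * w + b) * (if P (a * w + b) <= i then 1 else 0))"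
      using A0[of a] \<gamma> by (simp add: \<phi>_def \<alpha>_def hf)
    also have "... = (\<Sum>c<w. \<Sum>b<w. \<Delta> (c * w + b) * (if P (c * w + b) <= i then 1 else 0))"
    proof -
      have "(\<Sum>b<w. \<Delta> (c * w + b) * (if P (c * w + b) <= i then 1 else 0)) = 0" if "c \<in> {a<..<w}" for c
      proof (rule sum.neutral, safe)
        fix b
        have "\<not> P (c * w) <= i" using a(2)[of c] that by auto
        moreover have "P (c * w) <= P (c * w + b)" using P by (auto intro: monoD)
        ultimately show "\<Delta> (c * w + b) * (if P (c * w + b) <= i then 1 else 0) = 0" by auto
      qed
      moreover have "(\<Sum>b<w. \<Delta> (c * w + b) * (if P (c * w + b) <= i then 1 else 0)) = (\<Sum>b<w. \<Delta> (c * w + b))"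
        if "c < a" for c
      proof (rule sum.cong, safe)
        fix b assume "b < w"
        have "P (Suc c * w) <= i" using a(2)[of "Suc c"] a(1) that by (simp del: mult_Suc)
        moreover have "P (c * w + b) <= P (Suc c * w)" using P \<open>b < w\<close> by (auto intro!: monoD[OF P])
        ultimately show "\<Delta> (c * w + b) * (if P (c * w + b) <= i then 1 else 0) = \<Delta> (c * w + b)" by auto
      qed
      ultimately show ?thesis unfolding A_def
        by (subst (2) sum_split_at[OF a(1)]) simp
    qed
    also have "... = (\<Sum>g<w * w. \<Delta> g * (if P g <= i then 1 else 0))"
      by (rule sum_group_nat)
    finally show ?thesis .
  qed
  then show ?thesis using c by blast
qed

lemma lookup_block:
  fixes P :: "nat => nat" and \<Delta> :: "nat => real"
  assumes w: "w \<ge> 1" and P: "mono P"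
  shows "\<exists>\<phi>. cmp {\<lambda>x. x} (4 * w + 6) 3 {\<phi>} \<and>
    (\<forall>i::nat. \<phi> (real i) = (\<Sum>g<w * w. \<Delta> g * (if P g <= i then 1 else 0)))"
proof -
  obtain \<phi> where 1: "cmp {\<lambda>x. x} (2 * w + 3) 3 {\<phi>}"
     "\<And>i::nat. \<phi> (real i) = (\<Sum>g<w * w. max (\<Delta> g) 0 * (if P g <= i then 1 else 0))"
    using lookup_mono[OF w P, of "\<lambda>g. max (\<Delta> g) 0"] by auto
  obtain \<psi> where 2: "cmp {\<lambda>x. x} (2 * w + 3) 3 {\<psi>}"
     "\<And>i::nat. \<psi> (real i) = (\<Sum>g<w * w. max (- \<Delta> g) 0 * (if P g <= i then 1 else 0))"
    using lookup_mono[OF w P, of "\<lambda>g. max (- \<Delta> g) 0"] by auto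
  have "cmp {\<lambda>x. x} (4 * w + 6) 3 ({\<phi>} \<union> {\<psi>})" using cmp_parallel[OF 1(1) 2(1)] by simp
  then have "cmp {\<lambda>x. x} (4 * w + 6) 3 {\<lambda>x. \<phi> x - \<psi> x}"
    by (rule cmp_affs) (use affs_gen[of "{\<phi>} \<union> {\<psi>}"] in \<open>simp, intro affs_diff, simp_all\<close>)
  moreover have "\<phi> (real i) - \<psi> (real i) = (\<Sum>g<w * w. \<Delta> g * (if P g <= i then 1 else 0))" for i
    unfolding 1 2 sum_subtractf[symmetric] by (intro sum.cong) auto
  ultimately show ?thesis by blast
qed

text \<open>Arbitrary table values on \<open>D * (w * w)\<close> intervals: the increments
  \<open>\<Delta>\<close> of the table are distributed over \<open>D\<close> lookups in series, so
  capacity is depth times squared width.\<close>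

lemma lookup_step:
  fixes P :: "nat => nat" and v :: "nat => real"
  assumes w: "w \<ge> 1" and P: "mono P" and D: "D \<ge> 1" and P0: "P 0 = 0"
  shows "\<exists>\<phi>. cmp {\<lambda>x. x} (4 * w + 10) (3 * D) {\<phi>} \<and>
    (\<forall>i g. g < D * (w * w) --> P g <= i --> (\<forall>g'. g < g' --> g' < D * (w * w) --> i < P g') --> \<phi> (real i) = v g)"
proof -
  define \<Delta> where "\<Delta> g = (if g = 0 then v 0 else v g - v (g - 1))" for g
  have "\<exists>\<phi>. cmp {\<lambda>x. x} (4 * w + 6) 3 {\<phi>} \<and>
    (\<forall>i::nat. \<phi> (real i) = (\<Sum>g<w * w. \<Delta> (t * (w * w) + g) * (if P (t * (w * w) + g) <= i then 1 else 0)))" for t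
    using P by (intro lookup_block[OF w]) (auto simp: mono_def)
  then obtain \<phi> where \<phi>: "\<And>t. cmp {\<lambda>x. x} (4 * w + 6) 3 {\<phi> t}"
    "\<And>t i. \<phi> t (real i) = (\<Sum>g<w * w. \<Delta> (t * (w * w) + g) * (if P (t * (w * w) + g) <= i then 1 else 0))"
    by metis
  let ?f = "\<lambda>x. \<Sum>t<D. \<phi> t x"
  have "cmp {\<lambda>x. x} (4 * w + 6 + 2 * card {\<lambda>x::real. x} + 2) (\<Sum>t<D. 3) (insert ?f {\<lambda>x. x})"
    by (rule cmp_serial_sum) (use \<phi>(1) in auto)
  then have c: "cmp {\<lambda>x. x} (4 * w + 10) (3 * D) {?f}" by (auto simp: mult.commute elim: cmp_mono)
  have "?f (real i) = v g" if g: "g < D * (w * w)" "P g <= i" "\<And>g'. g < g' ==> g' < D * (w * w) ==> i < P g'" for i g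
  proof -
    have "?f (real i) = (\<Sum>g<D * (w * w). \<Delta> g * (if P g <= i then 1 else 0))"
      unfolding \<phi>(2) by (rule sum_group_nat)
    also have "... = v 0 + (\<Sum>g\<in>{1..<D * (w * w)}. (v g - v (g - 1)) * (if P g <= i then 1 else 0))"
    proof -
      have "{..<D * (w * w)} = insert 0 {1..<D * (w * w)}" using D w by auto
      then show ?thesis using P0 by (simp add: \<Delta>_def)
    qed
    also have "... = v g"
    proof (rule step_telescope[OF g(1)])
      fix c assume c: "c \<in> {1..<D * (w * w)}"
      show "(if P c <= i then 1 else 0) = (if c <= g then 1 else 0 :: real)"
      proof (cases "c <= g")
        case True then show ?thesis using monoD[OF P True] g(2) by simp
      next
        case False then show ?thesis using g(3)[of c] c by simp
      qed
    qed
    finally show ?thesis .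
  qed
  then show ?thesis using c by blast
qed

subsection \<open>Decoding gaps bit by bit\<close>

text \<open>A state \<open>(i, p, y, h)\<close> holds the query, the current element of the
  enumeration, the binary expansion of the gaps still to come, and the number of hits so
  far.\<close>

type_synonym st = "real \<times> real \<times> real \<times> real"

definition projs :: "(st => real) set" where
  "projs = {\<lambda>x. fst x, \<lambda>x. fst (snd x), \<lambda>x. fst (snd (snd x)), \<lambda>x. snd (snd (snd x))}"

definition mach :: "nat => nat => (st => st) => bool" where
  "mach w D M \<longleftrightarrow> cmp projs w D ((\<lambda>f x. f (M x)) ` projs)"

lemma mach_comp: "mach w D M ==> mach w D' M' ==> mach w (D + D') (\<lambda>x. M' (M x))"
  unfolding mach_def
  using cmp_compose'[of projs w D "(\<lambda>f x. f (M x)) ` projs" projs w D' "(\<lambda>f x. f (M' x)) ` projs" M]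
    affs_gen[of "(\<lambda>f x. f (M x)) ` projs"] by (auto simp: image_image projs_def)

lemma mach_id: "mach w 0 (\<lambda>x. x)"
  unfolding mach_def using affs_gen[of projs] by (intro cmp_0) (auto simp: projs_def)

text \<open>The leading binary digit of a \<open>y\<close> in \<open>[0, 1)\<close>, correct except
  on the ramp between \<open>1/2 - \<delta>\<close> and \<open>1/2\<close>.\<close>

definition bit_ramp :: "real => real => real" where
  "bit_ramp \<delta> y = relu ((y - 1/2) / \<delta> + 1) - relu ((y - 1/2) / \<delta>)"

definition bit_step :: "real => nat => st => st" where
  "bit_step \<delta> b = (\<lambda>(i, p, y, h). (i, p + 2 ^ b * bit_ramp \<delta> y, 2 * y - bit_ramp \<delta> y, h))"

text \<open>The hat function written with three neurons; on differences of integers it is the test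
  for equality.\<close>

definition tri :: "real => real" where
  "tri z = relu (z + 1) - 2 * relu z + relu (z - 1)"

definition check_step :: "st => st" where
  "check_step = (\<lambda>(i, p, y, h). (i, p, y, h + tri (i - p)))"

lemma tri_int: "tri (real i - real j) = (if i = j then 1 else 0)"
proof -
  consider "i = j" | "i + 1 <= j" | "j + 1 <= i" by linarith
  then show ?thesis
  proof cases
    case 2 then have "real i + 1 <= real j" by linarith
    then show ?thesis using 2 by (simp add: tri_def)
  next
    case 3 then have "real j + 1 <= real i" by linarith
    then show ?thesis using 3 by (simp add: tri_def)
  qed (simp add: tri_def)
qed

lemma relu_carry:
  assumes "(\<lambda>x. relu (f x)) \<in> H" "(\<lambda>x. relu (- f x)) \<in> H" "finite H"
  shows "f \<in> affs H"
proof -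
  have "(\<lambda>x. relu (f x) - relu (- f x)) \<in> affs H" by (intro affs_diff affs_gen assms)
  then show ?thesis by (simp add: relu_diff)
qed

text \<open>One layer advances the machine. The bound 11 counts a pair of neurons for each of the
  four state components and three neurons \<open>relu (a j x)\<close> for the nonlinear
  part.\<close>

lemma mach_step_aux:
  fixes a :: "nat => st => real"
  assumes a: "\<And>j. j < 3 ==> a j \<in> affs projs"
    and m: "\<And>H f. finite H ==> projs \<subseteq> affs H ==> (\<And>j. j < 3 ==> (\<lambda>x. relu (a j x)) \<in> affs H) ==> f \<in> projs ==> (\<lambda>x. f (M x)) \<in> affs H"
  shows "mach 11 1 M"
proof -
  let ?H = "(\<lambda>f x. relu (f x)) ` projs \<union> (\<lambda>f x. relu (- f x)) ` projs \<union> (\<lambda>j x. relu (a j x)) ` {..<3}"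
  have fp: "finite projs" and "card projs <= 4" using card_length[of "[\<lambda>x. fst x, \<lambda>x. fst (snd x), \<lambda>x. fst (snd (snd x)), \<lambda>x. snd (snd (snd x)) :: real]"]
    by (simp_all add: projs_def)
  have fin: "finite ?H" using fp by auto
  have "card ?H <= card projs + card projs + card {..<3::nat}"
    using fp by (intro order_trans[OF card_Un_le] add_mono card_image_le) auto
  then have card: "card ?H <= 11" using \<open>card projs <= 4\<close> by simp
  have "\<exists>a\<in>affs projs. h = (\<lambda>x. relu (a x))" if "h \<in> ?H" for h
  proof -
    from that consider f where "f \<in> projs" "h = (\<lambda>x. relu (f x))" | f where "f \<in> projs" "h = (\<lambda>x. relu (- f x))"
      | j where "j < 3" "h = (\<lambda>x. relu (a j x))" by auto
    then show ?thesis
    proof cases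
      case (1 f) then show ?thesis using affs_gen[OF fp] by (intro bexI[of _ f]) auto
    next
      case (2 f) then show ?thesis using affs_neg[OF affs_gen[OF fp]] by (intro bexI[of _ "\<lambda>x. - f x"]) auto
    next
      case (3 j) then show ?thesis using a by (intro bexI[of _ "a j"]) auto
    qed
  qed
  then have c: "cmp projs 11 (Suc 0) ?H"
    by (intro cmp_layer[OF cmp_0[of projs projs] fin card]) (use fp affs_gen[OF fp] in auto)
  have H1: "projs \<subseteq> affs ?H" using relu_carry[OF _ _ fin] by blast
  have H2: "(\<lambda>x. relu (a j x)) \<in> affs ?H" if "j < 3" for j using that by (intro affs_gen[OF fin]) auto
  show ?thesis unfolding mach_def One_nat_def
  proof (intro cmp_affs[OF c] image_subsetI)
    fix f assume "f \<in> projs"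
    show "(\<lambda>x. f (M x)) \<in> affs ?H"
      by (rule m) (fact fin, fact H1, erule H2, fact)
  qed
qed

lemma mach_bit_step: "mach 11 1 (bit_step \<delta> b)"
proof (rule mach_step_aux[of "\<lambda>j x. if j = 0 then (fst (snd (snd x)) - 1/2) / \<delta> + 1 else (fst (snd (snd x)) - 1/2) / \<delta>"])
  fix j :: nat
  have "(\<lambda>x. fst (snd (snd x))) \<in> affs projs" by (intro affs_gen) (auto simp: projs_def)
  then have "(\<lambda>x. (fst (snd (snd x)) - 1/2) / \<delta>) \<in> affs projs" by (intro affs_diff affs_divide affs_const)
  then show "(\<lambda>x. if j = 0 then (fst (snd (snd x)) - 1/2) / \<delta> + 1 else (fst (snd (snd x)) - 1/2) / \<delta>) \<in> affs projs"
    using affs_add[OF _ affs_const, of _ projs 1] by (cases "j = 0") auto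
next
  fix H :: "(st => real) set" and f
  assume H: "finite H" "projs \<subseteq> affs H" and f: "f \<in> projs"
    and r: "\<And>j::nat. j < 3 ==> (\<lambda>x. relu (if j = 0 then (fst (snd (snd x)) - 1/2) / \<delta> + 1 else (fst (snd (snd x)) - 1/2) / \<delta>)) \<in> affs H"
  have br: "(\<lambda>x. bit_ramp \<delta> (fst (snd (snd x)))) \<in> affs H"
    unfolding bit_ramp_def using affs_diff[OF r[of 0] r[of 1]] by simp
  have p: "(\<lambda>x. fst x) \<in> affs H" "(\<lambda>x. fst (snd x)) \<in> affs H" "(\<lambda>x. fst (snd (snd x))) \<in> affs H" "(\<lambda>x. snd (snd (snd x))) \<in> affs H"
    using H(2) by (auto simp: projs_def)
  show "(\<lambda>x. f (bit_step \<delta> b x)) \<in> affs H"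
    using f p(1,4) affs_add[OF p(2) affs_cmul[OF br, of "2 ^ b"]] affs_diff[OF affs_cmul[OF p(3), of 2] br]
    unfolding projs_def bit_step_def case_prod_unfold by auto
qed

lemma mach_check_step: "mach 11 1 check_step"
proof (rule mach_step_aux[of "\<lambda>j x. fst x - fst (snd x) + (real j - 1)"])
  fix j :: nat
  show "(\<lambda>x. fst x - fst (snd x) + (real j - 1)) \<in> affs projs"
    by (intro affs_add affs_diff affs_const affs_gen) (auto simp: projs_def)
next
  fix H :: "(st => real) set" and f
  assume H: "finite H" "projs \<subseteq> affs H" and f: "f \<in> projs"
    and r: "\<And>j::nat. j < 3 ==> (\<lambda>x. relu (fst x - fst (snd x) + (real j - 1))) \<in> affs H"
  have br: "(\<lambda>x. tri (fst x - fst (snd x))) \<in> affs H"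
    unfolding tri_def using affs_add[OF affs_diff[OF r[of 2] affs_cmul[OF r[of 1], of 2]] r[of 0]] by simp
  have p: "(\<lambda>x. fst x) \<in> affs H" "(\<lambda>x. fst (snd x)) \<in> affs H" "(\<lambda>x. fst (snd (snd x))) \<in> affs H" "(\<lambda>x. snd (snd (snd x))) \<in> affs H"
    using H(2) by (auto simp: projs_def)
  show "(\<lambda>x. f (check_step x)) \<in> affs H"
    using f p(1-3) affs_add[OF p(4) br]
    unfolding projs_def check_step_def case_prod_unfold by auto
qed

primrec getbits :: "real => nat => st => st" where
  "getbits \<delta> 0 x = x"
| "getbits \<delta> (Suc b) x = getbits \<delta> b (bit_step \<delta> b x)"

lemma mach_getbits: "mach 11 b (getbits \<delta> b)"
proof (induction b)
  case (Suc b)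
  then show ?case using mach_comp[OF mach_bit_step[of \<delta> b] Suc] by simp
qed (simp add: mach_id)

text \<open>The tail \<open>y'\<close> keeps \<open>y\<close> off the ramp: with
  \<open>Suc b\<close> digits left and leading digit 0, \<open>y\<close> lies below
  \<open>1/2\<close> by at least \<open>(1 - y') / 2 ^ Suc b\<close>, and the margin hypothesis
  makes this at least \<open>\<delta>\<close>. The hypothesis weakens as digits are removed, so it
  survives the induction.\<close>

lemma getbits_eq:
  assumes "v < 2 ^ b" "0 <= y'" "2 ^ b * \<delta> <= 1 - y'" "\<delta> > 0"
  shows "getbits \<delta> b (i, p, (real v + y') / 2 ^ b, h) = (i, p + real v, y', h)"
  using assms
proof (induction b arbitrary: v p)
  case (Suc b)
  define y where "y = (real v + y') / 2 ^ Suc b"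
  define t where "t = v div 2 ^ b"
  define r where "r = v mod 2 ^ b"
  have v: "v = t * 2 ^ b + r" unfolding t_def r_def by (rule div_mult_mod_eq[symmetric])
  have r: "r < 2 ^ b" by (simp add: r_def)
  have t: "t = 0 \<or> t = 1" using Suc.prems(1) by (auto simp: t_def less_mult_imp_div_less Suc_leI dest: less_mult_imp_div_less[of v 2 "2 ^ b"])
  have y1: "y' < 1" using Suc.prems(3,4) by (smt (verit) mult_pos_pos zero_less_power)
  have bit: "bit_ramp \<delta> y = real t"
  proof (cases "t = 0")
    case True
    then have "real v <= 2 ^ b - 1" using v r by (metis Suc_leI add_0 le_diff_conv2 mult_0 of_nat_1 of_nat_le_iff of_nat_numeral of_nat_power one_le_numeral one_le_power plus_1_eq_Suc of_nat_Suc add.commute le_diff_eq)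
    then have "y <= (2 ^ b - 1 + y') / 2 ^ Suc b" unfolding y_def by (intro divide_right_mono) auto
    also have "... = 1/2 - (1 - y') / 2 ^ Suc b" by (simp add: field_simps)
    also have "... <= 1/2 - \<delta>"
    proof -
      have "\<delta> <= (1 - y') / 2 ^ Suc b" using Suc.prems(3) by (simp add: field_simps)
      then show ?thesis by simp
    qed
    finally have "(y - 1/2) / \<delta> <= - 1" using Suc.prems(4) by (simp add: field_simps)
    then show ?thesis using True by (simp add: bit_ramp_def)
  next
    case False
    then have "2 ^ b <= v" using v t by simp
    then have "(2 ^ b :: real) <= real v" by (metis of_nat_le_iff of_nat_numeral of_nat_power)
    then have "2 ^ b <= real v + y'" using Suc.prems(2) by linarith
    then have "2 ^ b / 2 ^ Suc b <= y" unfolding y_def by (intro divide_right_mono) auto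
    then have "y \<ge> 1/2" by simp
    then have "(y - 1/2) / \<delta> \<ge> 0" using Suc.prems(4) by simp
    then show ?thesis using False t by (simp add: bit_ramp_def)
  qed
  have y2: "2 * y - real t = (real r + y') / 2 ^ b" by (simp add: y_def v field_simps)
  have "2 ^ b * \<delta> <= 2 ^ Suc b * \<delta>" using Suc.prems(4) by simp
  then have le: "2 ^ b * \<delta> <= 1 - y'" using Suc.prems(3) by linarith
  show ?case
    using Suc.IH[OF r Suc.prems(2) le Suc.prems(4), of "p + 2 ^ b * real t"] bit y2
    unfolding y_def[symmetric] by (simp add: bit_step_def v algebra_simps)
qed simp

primrec decode :: "real => nat => nat => st => st" where
  "decode \<delta> b 0 x = x"
| "decode \<delta> b (Suc n) x = decode \<delta> b n (check_step (getbits \<delta> b x))"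

lemma mach_decode: "mach 11 (n * (b + 1)) (decode \<delta> b n)"
proof (induction n)
  case (Suc n)
  then show ?case using mach_comp[OF mach_comp[OF mach_getbits[of b \<delta>] mach_check_step] Suc]
    by (simp add: algebra_simps)
qed (simp add: mach_id)

text \<open>The next \<open>n\<close> gaps from position \<open>r\<close> on, read as digits in base
  \<open>2 ^ b\<close> after the point.\<close>

primrec enc :: "(nat => nat) => nat => nat => nat => real" where
  "enc p b 0 r = 0"
| "enc p b (Suc n) r = (real (p (Suc r) - p r) + enc p b n (Suc r)) / 2 ^ b"

text \<open>The distance to 1 is one unit of the last digit. It provides the margin of
  \<open>getbits_eq\<close>, so that one slope, fixed by the longest code, works for all
  extractions.\<close>

lemma enc_bounds:
  assumes "\<And>r. p (Suc r) - p r < 2 ^ b"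
  shows "0 <= enc p b n r \<and> enc p b n r <= 1 - 1 / 2 ^ (b * n)"
proof (induction n arbitrary: r)
  case (Suc n)
  have "real (p (Suc r) - p r) <= 2 ^ b - 1"
    using assms[of r] by (metis Suc_leI Suc_eq_plus1 le_diff_eq of_nat_1 of_nat_add of_nat_le_iff of_nat_numeral of_nat_power)
  then have "enc p b (Suc n) r <= (2 ^ b - 1 + (1 - 1 / 2 ^ (b * n))) / 2 ^ b"
    unfolding enc.simps using Suc.IH[of "Suc r"] by (intro divide_right_mono) auto
  also have "... = 1 - 1 / 2 ^ (b * Suc n)" by (simp add: field_simps power_add)
  finally show ?case using Suc.IH[of "Suc r"] by simp
qed simp

lemma decode_eq:
  assumes "mono p" and gap: "\<And>r. p (Suc r) - p r < 2 ^ b" and "\<delta> = 1 / 2 ^ (b * M)" "n <= M"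
  shows "decode \<delta> b n (real i, real (p r), enc p b n r, h) =
    (real i, real (p (r + n)), 0, h + (\<Sum>j<n. if i = p (r + Suc j) then 1 else 0))"
  using assms(4)
proof (induction n arbitrary: r h)
  case (Suc n)
  have "2 ^ b * \<delta> <= 1 - enc p b n (Suc r)"
  proof -
    have "b + b * n <= b * M" using Suc.prems by (metis mult_Suc_right mult_le_mono2)
    then have "2 ^ (b + b * n) <= (2::real) ^ (b * M)" by (rule power_increasing) simp
    then have "2 ^ b * \<delta> <= 1 / 2 ^ (b * n)" by (simp add: assms(3) field_simps power_add)
    then show ?thesis using enc_bounds[where p = p and b = b and n = n and r = "Suc r", OF gap] by linarith
  qed
  moreover have "p r <= p (Suc r)" using assms(1) by (auto intro: monoD)
  ultimately have "decode \<delta> b (Suc n) (real i, real (p r), enc p b (Suc n) r, h) =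
      decode \<delta> b n (check_step (real i, real (p (Suc r)), enc p b n (Suc r), h))"
    using getbits_eq[OF gap[of r], of "enc p b n (Suc r)" \<delta> "real i" "real (p r)" h] enc_bounds[where p = p and b = b and n = n and r = "Suc r", OF gap] assms(3)
    by (simp add: of_nat_diff)
  also have "... = decode \<delta> b n (real i, real (p (Suc r)), enc p b n (Suc r), h + (if i = p (Suc r) then 1 else 0))"
    by (simp add: check_step_def tri_int)
  also have "... = (real i, real (p (Suc r + n)), 0,
      h + (if i = p (Suc r) then 1 else 0) + (\<Sum>j<n. if i = p (Suc r + Suc j) then 1 else 0))"
    using Suc.IH Suc.prems by simp
  also have "h + (if i = p (Suc r) then 1 else 0) + (\<Sum>j<n. if i = p (Suc r + Suc j) then 1 else 0)
      = h + (\<Sum>j<Suc n. if i = p (r + Suc j) then 1 else 0)"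
    by (subst sum.lessThan_Suc_shift) simp
  finally show ?case by simp
qed simp

text \<open>Only every \<open>m\<close>-th element is stored, together with the code of the
  \<open>m - 1\<close> gaps after it; the query finds its block by lookup and the gaps are unpacked
  one after the other. Depth of order \<open>D + m * b\<close> thus reaches
  \<open>D * (w * w) * m\<close> elements. For \<open>m\<close> near \<open>D / b\<close> this is
  the square of width times depth, divided by the bits per gap.\<close>

lemma member_net:
  fixes p :: "nat => nat"
  assumes p: "mono p" "p 0 = 0" and gap: "\<And>r. p (Suc r) - p r < 2 ^ b"
    and wDm: "w \<ge> 1" "D \<ge> 1" "m \<ge> 1" and range: "range p = p ` {..<D * (w * w) * m}"
  shows "\<exists>\<phi>. cmp {\<lambda>x. x} (8 * w + 22) (3 * D + 2 + (m - 1) * (b + 1)) {\<phi>} \<and>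
    (\<forall>i::nat. \<phi> (real i) = (if i \<in> range p then 1 else 0))"
proof -
  let ?W = "8 * w + 22" and ?G = "D * (w * w)"
  define P where "P g = p (g * m)" for g
  have P: "mono P" "P 0 = 0" using p by (auto simp: P_def mono_def)
  obtain \<phi>1 where 1: "cmp {\<lambda>x. x} (4 * w + 10) (3 * D) {\<phi>1}"
    "\<And>i g. g < ?G ==> P g <= i ==> (\<And>g'. g < g' ==> g' < ?G ==> i < P g') ==> \<phi>1 (real i) = real (P g)"
    using lookup_step[OF wDm(1) P(1) wDm(2) P(2), of "\<lambda>g. real (P g)"] by blast
  obtain \<phi>2 where 2: "cmp {\<lambda>x. x} (4 * w + 10) (3 * D) {\<phi>2}"
    "\<And>i g. g < ?G ==> P g <= i ==> (\<And>g'. g < g' ==> g' < ?G ==> i < P g') ==> \<phi>2 (real i) = enc p b (m - 1) (g * m)"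
    using lookup_step[OF wDm(1) P(1) wDm(2) P(2), of "\<lambda>g. enc p b (m - 1) (g * m)"] by blast
  have 3: "cmp {\<lambda>x::real. x} 2 (3 * D) {\<lambda>x. x}"
    using cmp_pad[OF cmp_0[of "{\<lambda>x::real. x}" "{\<lambda>x. x}" 0], of "3 * D"] by (auto intro: affs_gen)
  define F where "F = {\<lambda>x. x, \<phi>1, \<phi>2}"
  have cF: "cmp {\<lambda>x. x} ?W (3 * D) F"
    using cmp_parallel[OF cmp_parallel[OF 1(1) 2(1)] 3] by (rule cmp_mono) (auto simp: F_def)
  have fF: "finite F" by (simp add: F_def)
  define G1 where "G1 x = (x, \<phi>1 x, \<phi>2 x, 0::real)" for x
  define \<delta> :: real where "\<delta> = 1 / 2 ^ (b * m)"
  have m1: "mach 11 (1 + (m - 1) * (b + 1)) (\<lambda>x. decode \<delta> b (m - 1) (check_step x))"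
    using mach_comp[OF mach_check_step mach_decode] .
  \<comment> \<open>The first \<open>check_step\<close> tests the element that opens the block, to
    which no stored gap leads.\<close>
  define hit where "hit x = snd (snd (snd (decode \<delta> b (m - 1) (check_step (G1 x)))))" for x
  have c1: "cmp {\<lambda>x. x} ?W (3 * D + (1 + (m - 1) * (b + 1))) {hit}"
  proof -
    have "(\<lambda>x. g (G1 x)) \<in> affs F" if "g \<in> projs" for g
      using that affs_gen[OF fF] affs_const[of 0 F] unfolding projs_def
      by (simp only: insert_iff empty_iff, elim disjE) (simp_all add: G1_def F_def)
    from cmp_compose'[OF cF m1[unfolded mach_def] this] show ?thesis
      by (rule cmp_mono) (auto simp: projs_def hit_def image_image)
  qed
  \<comment> \<open>\<open>p\<close> may take a value several times, so the counter is capped at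
    1.\<close>
  define \<phi> where "\<phi> x = 1 - relu (1 - hit x)" for x
  have c2: "cmp {\<lambda>x. x} ?W (Suc (3 * D + (1 + (m - 1) * (b + 1)))) {\<lambda>x. relu (1 - hit x)}"
    by (rule cmp_layer[OF c1]) (use affs_gen[of "{hit}" hit] in \<open>auto intro!: bexI[of _ "\<lambda>x. 1 - hit x"] affs_diff affs_const\<close>)
  have c3: "cmp {\<lambda>x. x} ?W (Suc (3 * D + (1 + (m - 1) * (b + 1)))) {\<phi>}"
    by (rule cmp_affs[OF c2]) (use affs_diff[OF affs_const affs_gen, of "{\<lambda>x. relu (1 - hit x)}" "\<lambda>x. relu (1 - hit x)" 1] in \<open>auto simp: \<phi>_def[abs_def]\<close>)
  have "\<phi> (real i) = (if i \<in> range p then 1 else 0)" for i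
  proof -
    have G: "?G \<ge> 1" using wDm by simp
    obtain g where g: "g < ?G" "\<And>c. c \<in> {1..<?G} ==> P c <= i \<longleftrightarrow> c <= g"
      using step_index_exists[OF P(1) G, of i] by blast
    have gi: "P g <= i" using g(2)[of g] g(1) P(2) by (cases "g = 0") auto
    have gi': "i < P g'" if "g < g'" "g' < ?G" for g' using g(2)[of g'] that by auto
    have st: "G1 (real i) = (real i, real (p (g * m)), enc p b (m - 1) (g * m), 0)"
      unfolding G1_def using 1(2)[OF g(1) gi gi'] 2(2)[OF g(1) gi gi'] by (simp add: P_def)
    have hit: "hit (real i) = (if i = p (g * m) then 1 else 0) + (\<Sum>j<m - 1. if i = p (g * m + Suc j) then 1 else 0)"
      unfolding hit_def st using decode_eq[OF p(1) gap \<delta>_def, of "m - 1" i "g * m"]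
      by (simp add: check_step_def tri_int)
    also have "... = (\<Sum>j<m. if i = p (g * m + j) then 1 else 0)"
    proof -
      have "m = Suc (m - 1)" using wDm by simp
      then show ?thesis using sum.lessThan_Suc_shift[of "\<lambda>j. if i = p (g * m + j) then 1 else 0 :: real" "m - 1"] by simp
    qed
    finally have hit: "hit (real i) = (\<Sum>j<m. if i = p (g * m + j) then 1 else 0)" .
    show ?thesis
    proof (cases "i \<in> range p")
      case False
      then have "hit (real i) = 0" unfolding hit by (intro sum.neutral) auto
      then show ?thesis using False by (simp add: \<phi>_def)
    next
      case True
      then obtain r where r: "r < ?G * m" "i = p r" using range by auto
      have rd: "r = (r div m) * m + r mod m" by simp
      have "r div m < ?G" using r(1) by (simp add: less_mult_imp_div_less)
      moreover have "P (r div m) <= i" unfolding P_def r(2) by (rule monoD[OF p(1)]) simp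
      ultimately have le: "r div m <= g" using g(2)[of "r div m"] by (cases "r div m = 0") auto
      \<comment> \<open>\<open>g\<close> is the last block whose first element is at most
        \<open>i\<close>. If \<open>i\<close> is enumerated in an earlier block, monotonicity gives
        \<open>i = p r <= p (g * m) <= i\<close>, so the first element of block \<open>g\<close> is
        a hit as well.\<close>
      have "\<exists>j<m. i = p (g * m + j)"
      proof (cases "r div m = g")
        case True then show ?thesis using rd r(2) wDm(3) by (intro exI[of _ "r mod m"]) auto
      next
        case False
        then have "Suc (r div m) <= g" using le by simp
        then have "Suc (r div m) * m <= g * m" by (rule mult_le_mono1)
        moreover have "r < Suc (r div m) * m" using rd mod_less_divisor[of m r] wDm(3) by (metis add.commute add_less_cancel_left mult_Suc less_eq_Suc_le zero_less_one One_nat_def Suc_le_lessD)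
        ultimately have "p r <= p (g * m)" by (intro monoD[OF p(1)]) simp
        then have "i = p (g * m + 0)" using gi r(2) by (simp add: P_def)
        then show ?thesis using wDm(3) by (intro exI[of _ 0]) auto
      qed
      then obtain j where j: "j < m" "i = p (g * m + j)" by blast
      have "hit (real i) \<ge> 1" unfolding hit
        using member_le_sum[of j "{..<m}" "\<lambda>j. if i = p (g * m + j) then 1 else 0 :: real"] j by simp
      then show ?thesis using True by (simp add: \<phi>_def)
    qed
  qed
  moreover have "Suc (3 * D + (1 + (m - 1) * (b + 1))) = 3 * D + 2 + (m - 1) * (b + 1)" by simp
  ultimately show ?thesis using c3 by metis
qed


text \<open>Past the end the enumeration repeats the maximum. Gaps are 0 there, so the number of
  stored elements may be rounded up to full blocks.\<close>

lemma sorted_enum_gap: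
  assumes fin: "finite T" and T0: "(0::nat) \<in> T" and b: "0 < B"
    and gap: "\<And>t. t \<in> T ==> t < Max T ==> \<exists>t'\<in>T. t < t' \<and> t' < t + B"
  shows "\<exists>p. mono p \<and> p 0 = 0 \<and> (\<forall>r. p (Suc r) - p r < B) \<and> range p = T \<and> (\<forall>n\<ge>card T. p ` {..<n} = T)"
proof -
  let ?l = "sorted_list_of_set T"
  have l: "sorted ?l" "distinct ?l" "set ?l = T" "length ?l = card T" using fin by auto
  have E: "card T \<ge> 1" using T0 fin card_gt_0_iff[of T] by (metis One_nat_def Suc_leI empty_iff)
  define p where "p r = ?l ! (min r (card T - 1))" for r
  have mono: "mono p" unfolding p_def mono_def
    using l E by (auto intro!: sorted_nth_mono)
  have pT: "p r \<in> T" for r unfolding p_def using l E nth_mem[of "min r (card T - 1)" ?l] by (simp add: min.strict_coboundedI2)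
  have ex: "\<exists>r<card T. p r = t" if "t \<in> T" for t
  proof -
    have "t \<in> set ?l" using that l by simp
    then obtain r where "r < card T" "?l ! r = t" using l(4) by (auto simp: in_set_conv_nth)
    then show ?thesis by (intro exI[of _ r]) (auto simp: p_def min_def)
  qed
  have "p 0 = 0"
  proof -
    obtain r where "p r = 0" using ex[OF T0] by blast
    then show ?thesis using monoD[OF mono, of 0 r] by simp
  qed
  moreover have "p (Suc r) - p r < B" for r
  proof (cases "p r < Max T")
    case False
    then have "p (Suc r) <= p r" using pT[of "Suc r"] fin by (meson Max_ge le_trans not_le)
    then show ?thesis using b by simp
  next
    case True
    obtain t' where t': "t' \<in> T" "p r < t'" "t' < p r + B" using gap[OF pT True] by blast
    obtain r' where r': "p r' = t'" using ex[OF t'(1)] by blast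
    have "r < r'" using r' t'(2) monoD[OF mono, of r' r] by (metis leD leI)
    then have "p (Suc r) <= t'" using r' monoD[OF mono, of "Suc r" r'] by simp
    then show ?thesis using t' by linarith
  qed
  moreover have "range p = T" using pT ex by blast
  moreover have "p ` {..<n} = T" if "n \<ge> card T" for n using pT ex that by (force simp: image_iff)
  ultimately show ?thesis using mono by blast
qed

text \<open>Queries are moved to the even numbers \<open>2 i + 2\<close>; odd numbers at distance \<open>2 ^ (b + 1)\<close> are
  inserted as dummies, so that all gaps fit into \<open>b + 2\<close> bits.\<close>

lemma sparse_net:
  assumes S: "S \<subseteq> {..<N}" and w: "w \<ge> 1" "D \<ge> 1"
    and bound: "(card S + N div 2 ^ b + 3) * (b + 3) <= D * D * (w * w)"
  shows "\<exists>\<phi>. cmp {\<lambda>x. x} (8 * w + 22) (4 * D + 2) {\<phi>} \<and>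
    (\<forall>i<N. \<phi> (real i) = (if i \<in> S then 1 else 0))"
proof -
  define A where "A = (2::nat) ^ b"
  define J where "J = N div A + 1"
  have A0: "A > 0" by (simp add: A_def)
  have NJ: "N < A * J"
    unfolding J_def using A0 dividend_less_div_times[of A N] by (simp add: algebra_simps)
  \<comment> \<open>The number 0 is not a query and gives the enumeration its required start. The
    last dummy \<open>2 * A * J + 1\<close> exceeds every query because \<open>N < A * J\<close>, so
    it is the maximum and every other element has a dummy shortly after it.\<close>
  define T where "T = insert 0 ((\<lambda>s. 2 * s + 2) ` S \<union> (\<lambda>j. 2 * A * j + 1) ` {..J})"
  have finS: "finite S" using S finite_subset by blast
  have finT: "finite T" using finS by (auto simp: T_def)
  have "card T <= Suc (card ((\<lambda>s. 2 * s + 2) ` S \<union> (\<lambda>j. 2 * A * j + 1) ` {..J}))"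
    unfolding T_def using finS by (intro card_insert_le_m1) auto
  also have "... <= Suc (card S + card {..J})"
    using finS by (intro Suc_le_mono[THEN iffD2] order_trans[OF card_Un_le] add_mono card_image_le) auto
  finally have cardT: "card T <= card S + N div 2 ^ b + 3" by (simp add: J_def A_def)
  have T_le: "t <= 2 * A * J + 1" if "t \<in> T" for t
  proof -
    from that consider "t = 0" | s where "s \<in> S" "t = 2 * s + 2" | j where "j <= J" "t = 2 * A * j + 1" by (auto simp: T_def)
    then show ?thesis
    proof cases
      case (2 s)
      then have "s < N" using S by auto
      then show ?thesis using NJ 2 by simp
    qed auto
  qed
  have Max: "Max T = 2 * A * J + 1"
    by (rule Max_eqI[OF finT T_le]) (auto simp: T_def)
  have gap: "\<exists>t'\<in>T. t < t' \<and> t' < t + 2 ^ (b + 2)" if "t \<in> T" "t < Max T" for t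
  proof -
    define j where "j = (if t = 0 then 0 else (t - 1) div (2 * A) + 1)"
    have t': "t < 2 * A * j + 1 \<and> 2 * A * j + 1 < t + 2 ^ (b + 2)"
    proof (cases "t = 0")
      case True
      have "Suc 0 < 4 * 2 ^ b" using one_le_power[of "2::nat" b] by linarith
      then show ?thesis using True by (simp add: j_def)
    next
      case False
      define q r where "q = (t - 1) div (2 * A)" and "r = (t - 1) mod (2 * A)"
      have "t - 1 = 2 * A * q + r" unfolding q_def r_def by simp
      then have tq: "t = 2 * A * q + r + 1" using False by simp
      have r: "r < 2 * A" unfolding r_def using A0 by simp
      have j: "j = q + 1" using False by (simp add: j_def q_def)
      have B: "2 ^ (b + 2) = 4 * A" by (simp add: A_def)
      show ?thesis unfolding j B tq using r A0 by (simp add: algebra_simps)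
    qed
    have "j <= J"
    proof (rule ccontr)
      assume "\<not> j <= J"
      then have "t \<noteq> 0" by (auto simp: j_def split: if_splits)
      have "J <= (t - 1) div (2 * A)" using \<open>\<not> j <= J\<close> by (simp add: j_def split: if_splits)
      then have "J * (2 * A) <= t - 1" using A0 by (simp add: less_eq_div_iff_mult_less_eq)
      then show False using that(2) \<open>t \<noteq> 0\<close> unfolding Max by (simp add: algebra_simps)
    qed
    then have "2 * A * j + 1 \<in> T" by (auto simp: T_def)
    then show ?thesis using t' by blast
  qed
  obtain p where p: "mono p" "p 0 = 0" "\<And>r. p (Suc r) - p r < 2 ^ (b + 2)" "range p = T"
    "\<And>n. n \<ge> card T ==> p ` {..<n} = T"
    using sorted_enum_gap[OF finT _ _ gap] by (auto simp: T_def)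
  \<comment> \<open>Block length for which decoding, at \<open>b + 3\<close> layers per gap, stays
    within \<open>D\<close> layers. Since \<open>(b + 3) * m\<close> exceeds \<open>D\<close>, the
    hypothesis \<open>bound\<close> yields enough room in \<open>D * (w * w)\<close> blocks.\<close>
  define m where "m = 1 + D div (b + 3)"
  have "D < (b + 3) * m" unfolding m_def using dividend_less_div_times[of "b + 3" D] by (simp add: algebra_simps)
  then have "D * (D * (w * w)) <= (b + 3) * m * (D * (w * w))" by (intro mult_le_mono1) simp
  then have "(card S + N div 2 ^ b + 3) * (b + 3) <= (D * (w * w) * m) * (b + 3)"
    using bound by (simp add: algebra_simps)
  then have "card S + N div 2 ^ b + 3 <= D * (w * w) * m" by simp
  then have "range p = p ` {..<D * (w * w) * m}" using p(4) p(5)[of "D * (w * w) * m"] cardT by simp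
  from member_net[OF p(1-3) w _ this] obtain \<phi> where \<phi>:
    "cmp {\<lambda>x. x} (8 * w + 22) (3 * D + 2 + (m - 1) * (b + 2 + 1)) {\<phi>}"
    "\<And>i::nat. \<phi> (real i) = (if i \<in> range p then 1 else 0)" by (auto simp: m_def)
  have d: "3 * D + 2 + (m - 1) * (b + 2 + 1) <= 4 * D + 2"
  proof -
    have "b + 2 + 1 = b + 3" "m - 1 = D div (b + 3)" by (simp_all add: m_def)
    then show ?thesis using div_times_less_eq_dividend[of D "b + 3"] by (simp only:)
  qed
  have "cmp {\<lambda>x. x} (8 * w + 22) (3 * D + 2 + (m - 1) * (b + 2 + 1)) {\<lambda>x. \<phi> (2 * x + 2)}"
  proof -
    have "(\<lambda>x. x) \<in> affs {\<lambda>x::real. x}" by (rule affs_gen) auto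
    then have "(\<lambda>x. 2 * x + 2) \<in> affs {\<lambda>x::real. x}" by (intro affs_add affs_cmul affs_const)
    then show ?thesis using cmp_subst[OF \<phi>(1), of "{\<lambda>x. x}" "\<lambda>x. 2 * x + 2"] by (simp del: mult_Suc_right)
  qed
  from cmp_pad[OF this _ d] have "cmp {\<lambda>x. x} (8 * w + 22) (4 * D + 2) {\<lambda>x. \<phi> (2 * x + 2)}" by (simp add: max_def)
  moreover have "\<phi> (2 * real i + 2) = (if i \<in> S then 1 else 0)" for i
  proof -
    have "Suc (2 * i) \<noteq> 2 * A * x" for x
    proof
      assume "Suc (2 * i) = 2 * A * x"
      then have "even (Suc (2 * i))" by (metis dvd_triv_left mult.assoc)
      then show False by simp
    qed
    then have "2 * i + 2 \<in> T \<longleftrightarrow> i \<in> S" unfolding T_def by (auto simp: image_iff)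
    moreover have "\<phi> (2 * real i + 2) = \<phi> (real (2 * i + 2))" by (simp add: add.commute)
    ultimately show ?thesis using \<phi>(2)[of "2 * i + 2"] p(4) by simp
  qed
  ultimately show ?thesis by blast
qed

section \<open>Networks for localized monomials\<close>

subsection \<open>Triangle waves and squares\<close>

text \<open>The triangle wave of period 2: the distance of \<open>x\<close> to the nearest even
  integer.\<close>

definition tw :: "real => real" where
  "tw x = \<bar>x - 2 * of_int \<lfloor>(x + 1) / 2\<rfloor>\<bar>"

lemma tw_eqI:
  assumes "\<bar>x - 2 * of_int k\<bar> <= 1" shows "tw x = \<bar>x - 2 * of_int k\<bar>"
proof (cases "x = 2 * of_int k + 1")
  case True
  then have "(x + 1) / 2 = of_int (k + 1)" by simp
  then have "\<lfloor>(x + 1) / 2\<rfloor> = k + 1" by (metis floor_of_int)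
  then show ?thesis using True by (simp add: tw_def)
next
  case False
  then have "\<lfloor>(x + 1) / 2\<rfloor> = k" using assms by (intro floor_unique) (auto simp: abs_le_iff field_simps)
  then show ?thesis by (simp add: tw_def)
qed

lemma tw_ex: "\<exists>k. \<bar>x - 2 * of_int k\<bar> <= 1 \<and> tw x = \<bar>x - 2 * of_int k\<bar>"
proof -
  have "\<bar>x - 2 * of_int \<lfloor>(x + 1) / 2\<rfloor>\<bar> <= 1"
  proof -
    define k where "k = \<lfloor>(x + 1) / 2\<rfloor>"
    have "of_int k <= (x + 1) / 2" "(x + 1) / 2 < of_int k + 1" unfolding k_def by linarith+
    then show ?thesis unfolding k_def[symmetric] by (simp add: abs_le_iff field_simps)
  qed
  then show ?thesis using tw_eqI by blast
qed

lemma tw_bounds: "0 <= tw x" "tw x <= 1"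
  using tw_ex[of x] by auto

lemma tw_unit: "0 <= x ==> x <= 1 ==> tw x = x"
  using tw_eqI[of x 0] by simp

lemma tw_minus: "tw (- x) = tw x"
proof -
  obtain k where k: "\<bar>x - 2 * of_int k\<bar> <= 1" "tw x = \<bar>x - 2 * of_int k\<bar>" using tw_ex by blast
  have "tw (- x) = \<bar>- x - 2 * of_int (- k)\<bar>" by (rule tw_eqI) (use k(1) in auto)
  then show ?thesis using k(2) by simp
qed

lemma tw_shift: "tw (x + 2 * of_int m) = tw x"
proof -
  obtain k where k: "\<bar>x - 2 * of_int k\<bar> <= 1" "tw x = \<bar>x - 2 * of_int k\<bar>" using tw_ex by blast
  have "tw (x + 2 * of_int m) = \<bar>x + 2 * of_int m - 2 * of_int (k + m)\<bar>"
    by (rule tw_eqI) (use k(1) in \<open>auto simp: algebra_simps\<close>)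
  then show ?thesis using k(2) by (simp add: algebra_simps)
qed

text \<open>The wave is even and 2-periodic and \<open>b\<close> is an integer, so folding the
  argument beforehand makes no difference. Composed waves therefore multiply their
  frequencies.\<close>

lemma tw_tw: "tw (real b * tw x) = tw (real b * x)"
proof -
  obtain k where k: "tw x = \<bar>x - 2 * of_int k\<bar>" using tw_ex by blast
  have *: "real b * x = real b * (x - 2 * of_int k) + 2 * of_int (int b * k)" by (simp add: algebra_simps)
  have "tw (real b * x) = tw (real b * (x - 2 * of_int k))" by (subst *) (rule tw_shift)
  then show ?thesis unfolding k using tw_minus[of "real b * (x - 2 * of_int k)"]
    by (cases "x - 2 * of_int k \<ge> 0") (auto simp: abs_if algebra_simps)
qed

lemma tw_piece:
  assumes "real i <= x" "x <= real i + 1"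
  shows "tw x = (if even i then x - real i else real i + 1 - x)"
proof (cases "even i")
  case True
  then obtain j where "i = 2 * j" by blast
  then show ?thesis using tw_eqI[of x "int j"] assms by simp
next
  case False
  then obtain j where "i = 2 * j + 1" by (auto elim: oddE)
  then show ?thesis using tw_eqI[of x "int j + 1"] assms by simp
qed

text \<open>The coefficient at a breakpoint is the jump of the slope there; the slope before 0
  counts as 0.\<close>

lemma piecewise_linear_relu:
  fixes g :: "real => real"
  assumes b: "b \<ge> (1::nat)"
    and pl: "\<And>i x. i < b ==> real i / real b <= x ==> x <= (real i + 1) / real b ==>
      g x = g (real i / real b) + s i * (x - real i / real b)"
    and x: "0 <= x" "x <= 1"
  shows "g x = g 0 + (\<Sum>i<b. (s i - (if i = 0 then 0 else s (i - 1))) * relu (x - real i / real b))"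
proof -
  let ?c = "\<lambda>i. s i - (if i = 0 then 0 else s (i - 1))"
  have c: "(\<Sum>i<Suc j. ?c i) = s j" for j
    by (induction j) auto
  have "g x = g 0 + (\<Sum>i<j. ?c i * relu (x - real i / real b))" if "j <= b" "0 <= x" "x <= real j / real b" for j x
    using that
  proof (induction j arbitrary: x)
    case (Suc j)
    show ?case
    proof (cases "x <= real j / real b")
      case True then show ?thesis using Suc.IH[of x] Suc.prems by simp
    next
      case False
      let ?t = "real j / real b"
      have t: "?t \<ge> 0" by simp
      have "g x = g ?t + s j * (x - ?t)" using False Suc.prems by (intro pl) (auto simp: add.commute)
      also have "g ?t = g 0 + (\<Sum>i<j. ?c i * relu (?t - real i / real b))" using Suc.prems by (intro Suc.IH) auto
      also have "(\<Sum>i<j. ?c i * relu (?t - real i / real b)) = (\<Sum>i<j. ?c i * (?t - real i / real b))"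
        by (intro sum.cong) (auto simp: divide_right_mono)
      also have "(\<Sum>i<j. ?c i * (?t - real i / real b)) = (\<Sum>i<Suc j. ?c i * (?t - real i / real b))" by simp
      also have "s j * (x - ?t) = (\<Sum>i<Suc j. ?c i * (x - ?t))" by (simp only: sum_distrib_right[symmetric] c)
      also have "g 0 + (\<Sum>i<Suc j. ?c i * (?t - real i / real b)) + (\<Sum>i<Suc j. ?c i * (x - ?t)) =
         g 0 + (\<Sum>i<Suc j. ?c i * (x - real i / real b))"
        by (simp only: add.assoc sum.distrib[symmetric] distrib_left[symmetric]) simp
      also have "(\<Sum>i<Suc j. ?c i * (x - real i / real b)) = (\<Sum>i<Suc j. ?c i * relu (x - real i / real b))"
      proof (intro sum.cong refl)
        fix i assume "i \<in> {..<Suc j}"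
        then have "real i / real b <= ?t" by (intro divide_right_mono) auto
        then have "relu (x - real i / real b) = x - real i / real b" using False by (intro relu_simps) linarith
        then show "?c i * (x - real i / real b) = ?c i * relu (x - real i / real b)" by simp
      qed
      finally show ?thesis .
    qed
  qed (use b in auto)
  from this[of b x] show ?thesis using x b by simp
qed

lemma tw_mult_relu:
  assumes "b \<ge> (1::nat)"
  shows "\<exists>c c0. \<forall>x. 0 <= x --> x <= 1 --> tw (real b * x) = c0 + (\<Sum>i<b. c i * relu (x - real i / real b))"
proof -
  have "tw (real b * x) = tw (real b * (real i / real b)) + (if even i then real b else - real b) * (x - real i / real b)"
    if "i < b" "real i / real b <= x" "x <= (real i + 1) / real b" for i x
  proof -
    have b: "real b > 0" using assms by simp
    have "real i <= real b * x" "real b * x <= real i + 1" using that b by (simp_all add: field_simps)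
    then show ?thesis using tw_piece[of i "real b * x"] tw_piece[of i "real i"] b by (simp add: field_simps)
  qed
  from piecewise_linear_relu[where g = "\<lambda>x. tw (real b * x)", OF assms this] show ?thesis
    by (intro exI allI impI) assumption
qed

text \<open>On each piece \<open>tw (real b * x)\<close> is affine with slope \<open>b\<close> or
  \<open>- b\<close>, so both quadratic terms have leading coefficient -1 and cancel. At the
  breakpoints the wave is 0 or 1 and the second term vanishes.\<close>

lemma square_correction_relu:
  assumes "b \<ge> (1::nat)"
  shows "\<exists>c c0. \<forall>x. 0 <= x --> x <= 1 -->
    x * (1 - x) - tw (real b * x) * (1 - tw (real b * x)) / (real b)\<^sup>2 = c0 + (\<Sum>i<b. c i * relu (x - real i / real b))"
proof -
  let ?g = "\<lambda>x. x * (1 - x) - tw (real b * x) * (1 - tw (real b * x)) / (real b)\<^sup>2"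
  have "?g x = ?g (real i / real b) + (1 - (2 * real i + 1) / real b) * (x - real i / real b)"
    if "i < b" "real i / real b <= x" "x <= (real i + 1) / real b" for i x
  proof -
    have b: "real b > 0" using assms by simp
    have x: "real i <= real b * x" "real b * x <= real i + 1" using that b by (simp_all add: field_simps)
    define y where "y = real b * x - real i"
    have xy: "x = (real i + y) / real b" using b by (simp add: y_def)
    have 1: "tw (real b * x) * (1 - tw (real b * x)) = y * (1 - y)"
      using tw_piece[OF x] by (simp add: y_def algebra_simps)
    have 2: "tw (real b * (real i / real b)) * (1 - tw (real b * (real i / real b))) = 0"
      using tw_piece[of i "real i"] b by simp
    show ?thesis unfolding 1 2 using b by (simp add: xy power2_eq_square field_simps)
  qed
  from piecewise_linear_relu[where g = ?g, OF assms this] show ?thesis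
    by (intro exI allI impI) assumption
qed

lemma relu_image_bound: "card ((\<lambda>i x. relu (f i x)) ` {..<b::nat}) <= b"
  using card_image_le[of "{..<b}" "\<lambda>i x. relu (f i x)"] by simp

text \<open>Start from \<open>x = x^2 + x (1 - x)\<close>. Each layer replaces the residual
  \<open>X (1 - X)\<close> by its copy at \<open>bs t\<close> times the frequency, divided by the
  square of \<open>bs t\<close>; by \<open>square_correction_relu\<close> the difference is
  piecewise linear in \<open>X\<close>. A base costs as many neurons as its size, so width buys
  accuracy per layer. Bases may vary from layer to layer in order to hit a prescribed
  product.\<close>

lemma tw_square_net:
  assumes "\<And>t. 1 <= bs t \<and> bs t <= (b::nat)"
  shows "\<exists>X F. cmp {\<lambda>x. x} (b + 2) T {X, F} \<and> (\<forall>x. 0 <= x --> x <= 1 -->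
    X x = tw ((\<Prod>t<T. real (bs t)) * x) \<and>
    F x = x\<^sup>2 + X x * (1 - X x) / (\<Prod>t<T. real (bs t))\<^sup>2)"
proof (induction T)
  case 0
  have "cmp {\<lambda>x. x} (b + 2) 0 {\<lambda>x. x, \<lambda>x. x}" by (intro cmp_0) (auto intro: affs_gen)
  then show ?case by (intro exI[of _ "\<lambda>x. x"]) (auto simp: tw_unit power2_eq_square algebra_simps)
next
  case (Suc T)
  let ?B = "\<Prod>t<T. real (bs t)"
  obtain X F where XF: "cmp {\<lambda>x. x} (b + 2) T {X, F}"
    "\<And>x. 0 <= x ==> x <= 1 ==> X x = tw (?B * x)"
    "\<And>x. 0 <= x ==> x <= 1 ==> F x = x\<^sup>2 + X x * (1 - X x) / ?B\<^sup>2"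
    using Suc by blast
  let ?b = "bs T"
  have b: "?b \<ge> 1" "?b <= b" using assms by auto
  obtain c c0 where c: "\<And>x. 0 <= x ==> x <= 1 ==> tw (real ?b * x) = c0 + (\<Sum>i<?b. c i * relu (x - real i / real ?b))"
    using tw_mult_relu[OF b(1)] by blast
  obtain e e0 where e: "\<And>x. 0 <= x ==> x <= 1 ==>
    x * (1 - x) - tw (real ?b * x) * (1 - tw (real ?b * x)) / (real ?b)\<^sup>2 = e0 + (\<Sum>i<?b. e i * relu (x - real i / real ?b))"
    using square_correction_relu[OF b(1)] by blast
  define H where "H = (\<lambda>i x. relu (X x - real i / real ?b)) ` {..<?b} \<union> {\<lambda>x. relu (F x), \<lambda>x. relu (- F x)}"
  have fin: "finite H" by (simp add: H_def)
  have "card H <= card ((\<lambda>i x. relu (X x - real i / real ?b)) ` {..<?b}) + card {\<lambda>x. relu (F x), \<lambda>x. relu (- F x)}"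
    unfolding H_def by (rule card_Un_le)
  also have "... <= b + 2" by (intro add_mono order_trans[OF relu_image_bound b(2)]) (simp add: card_insert_if)
  finally have card: "card H <= b + 2" .
  have XFa: "X \<in> affs {X, F}" "F \<in> affs {X, F}" by (auto intro!: affs_gen)
  have "\<exists>a\<in>affs {X, F}. h = (\<lambda>x. relu (a x))" if "h \<in> H" for h
  proof -
    from that consider i where "h = (\<lambda>x. relu (X x - real i / real ?b))" | "h = (\<lambda>x. relu (F x))" | "h = (\<lambda>x. relu (- F x))"
      by (auto simp: H_def)
    then show ?thesis
    proof cases
      case (1 i) then show ?thesis using XFa by (intro bexI[of _ "\<lambda>x. X x - real i / real ?b"] affs_diff affs_const) auto
    next
      case 2 then show ?thesis using XFa by blast
    next
      case 3 then show ?thesis using XFa by (intro bexI[of _ "\<lambda>x. - F x"] affs_neg) auto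
    qed
  qed
  then have cH: "cmp {\<lambda>x. x} (b + 2) (Suc T) H" by (intro cmp_layer[OF XF(1) fin card])
  define X' where "X' x = c0 + (\<Sum>i<?b. c i * relu (X x - real i / real ?b))" for x
  define F' where "F' x = F x - (e0 + (\<Sum>i<?b. e i * relu (X x - real i / real ?b))) / ?B\<^sup>2" for x
  have r: "(\<lambda>x. relu (X x - real i / real ?b)) \<in> affs H" if "i < ?b" for i
    using that by (intro affs_gen[OF fin]) (auto simp: H_def)
  have "F \<in> affs H" by (rule relu_carry) (auto simp: H_def)
  then have "{X', F'} \<subseteq> affs H" unfolding X'_def F'_def using r
    by (auto intro!: affs_add affs_const affs_sum affs_cmul affs_diff affs_divide)
  then have c1: "cmp {\<lambda>x. x} (b + 2) (Suc T) {X', F'}" by (rule cmp_affs[OF cH])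
  have B: "?B > 0" using assms by (intro prod_pos) (metis of_nat_0_less_iff less_le_trans zero_less_one)
  have "X' x = tw ((\<Prod>t<Suc T. real (bs t)) * x) \<and> F' x = x\<^sup>2 + X' x * (1 - X' x) / (\<Prod>t<Suc T. real (bs t))\<^sup>2"
    if x: "0 <= x" "x <= 1" for x
  proof -
    have X1: "0 <= X x" "X x <= 1" using XF(2)[OF x] tw_bounds by auto
    have X': "X' x = tw (real ?b * X x)" using c[OF X1] by (simp add: X'_def)
    have "X' x = tw (real ?b * (?B * x))" unfolding X' XF(2)[OF x] by (rule tw_tw)
    then have 1: "X' x = tw ((\<Prod>t<Suc T. real (bs t)) * x)" by (simp add: mult_ac)
    have "F' x = F x - (X x * (1 - X x) - X' x * (1 - X' x) / (real ?b)\<^sup>2) / ?B\<^sup>2"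
      using e[OF X1] X' by (simp add: F'_def)
    also have "... = x\<^sup>2 + X' x * (1 - X' x) / (real ?b)\<^sup>2 / ?B\<^sup>2"
      unfolding XF(3)[OF x] by (simp add: diff_divide_distrib)
    finally show ?thesis using 1 by (simp add: power_mult_distrib mult.commute)
  qed
  then show ?case using c1 by blast
qed

subsection \<open>Products\<close>

definition clip :: "real => real" where "clip z = relu (z + 1) - relu (z - 1) - 1"

lemma clip_eq: "clip z = max (-1) (min 1 z)" by (auto simp: clip_def relu_def)

lemma abs_relu: "\<bar>x\<bar> = relu x + relu (- x)" by (auto simp: relu_def)

text \<open>Polarization \<open>u v = ((u + v) / 2)^2 - ((u - v) / 2)^2\<close>, with both squares
  computed by the same \<open>F\<close> at absolute values. If a factor is 0, the two arguments
  coincide and the result is exactly 0, whatever the accuracy. Both squares are overestimated by at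
  most the same amount, so the errors do not add. Clipping makes the bound 1 hold for all
  arguments.\<close>

lemma mult_net:
  assumes b: "b \<ge> (1::nat)"
  shows "\<exists>M. cmp {\<lambda>x. fst x, \<lambda>x. snd x} (2 * b + 8) (T + 2) {M} \<and>
    (\<forall>u v. \<bar>M (u, v)\<bar> <= 1 \<and> M (u, 0) = 0 \<and> M (0, v) = 0 \<and>
      (\<bar>u\<bar> <= 1 --> \<bar>v\<bar> <= 1 --> \<bar>M (u, v) - u * v\<bar> <= 1 / (real b ^ T)\<^sup>2))"
proof -
  obtain X F where F: "cmp {\<lambda>x. x} (b + 2) T {X, F}"
    "\<And>x. 0 <= x ==> x <= 1 ==> X x = tw ((\<Prod>t<T. real b) * x)"
    "\<And>x. 0 <= x ==> x <= 1 ==> F x = x\<^sup>2 + X x * (1 - X x) / (\<Prod>t<T. real b)\<^sup>2"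
    using tw_square_net[of "\<lambda>_. b" b T] b by auto
  let ?B = "{\<lambda>x. fst x, \<lambda>x. snd x} :: (real \<times> real => real) set"
  let ?\<eta> = "1 / (real b ^ T)\<^sup>2"
  have F2: "cmp {\<lambda>x. x} (b + 2) T {F}" using F(1) by (rule cmp_mono) auto
  have bs: "(\<lambda>x. fst x) \<in> affs ?B" "(\<lambda>x. snd x) \<in> affs ?B" by (auto intro: affs_gen)
  have A: "cmp ?B (b + 4) (1 + T) {\<lambda>x. F \<bar>a x\<bar>}" if a: "a \<in> affs ?B" for a
  proof -
    let ?H = "{\<lambda>x. relu (a x), \<lambda>x. relu (- a x)}"
    have "cmp ?B (b + 4) (Suc 0) ?H"
      by (rule cmp_layer[OF cmp_0[of ?B ?B]]) (use a affs_neg[OF a] in \<open>auto intro: affs_gen simp: card_insert_if\<close>)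
    moreover have "(\<lambda>x. \<bar>a x\<bar>) \<in> affs ?H" unfolding abs_relu by (intro affs_add affs_gen) auto
    ultimately have "cmp ?B (max (b + 4) (b + 2)) (Suc 0 + T) ((\<lambda>f x. f \<bar>a x\<bar>) ` {F})"
      by (intro cmp_compose'[OF _ F2]) auto
    then show ?thesis by simp
  qed
  have FF: "cmp ?B (2 * b + 8) (1 + T) ({\<lambda>x. F \<bar>(fst x + snd x) / 2\<bar>} \<union> {\<lambda>x. F \<bar>(fst x - snd x) / 2\<bar>})"
    (is "cmp _ _ _ ?F")
    by (rule cmp_mono[OF cmp_parallel[OF A[OF affs_divide[OF affs_add[OF bs], of 2]] A[OF affs_divide[OF affs_diff[OF bs], of 2]]]])
      (simp, rule order_refl)
  define z where "z x = F \<bar>(fst x + snd x) / 2\<bar> - F \<bar>(fst x - snd x) / 2\<bar>" for x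
  have z: "cmp ?B (2 * b + 8) (1 + T) {z}"
  proof (rule cmp_affs[OF FF])
    have "z \<in> affs ?F" unfolding z_def by (intro affs_diff affs_gen) auto
    then show "{z} \<subseteq> affs ?F" by simp
  qed
  let ?H = "{\<lambda>x. relu (z x + 1), \<lambda>x. relu (z x - 1)}"
  have "cmp ?B (2 * b + 8) (Suc (1 + T)) ?H"
  proof (rule cmp_layer[OF z])
    have "z \<in> affs {z}" by (auto intro: affs_gen)
    then have "(\<lambda>x. z x + 1) \<in> affs {z}" "(\<lambda>x. z x - 1) \<in> affs {z}" by (intro affs_intros; simp)+
    then show "\<exists>a\<in>affs {z}. h = (\<lambda>x. relu (a x))" if "h \<in> ?H" for h using that by auto
  qed (auto simp: card_insert_if)
  then have c: "cmp ?B (2 * b + 8) (Suc (1 + T)) {\<lambda>x. clip (z x)}"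
  proof (rule cmp_affs)
    have "(\<lambda>x. clip (z x)) \<in> affs ?H" unfolding clip_def by (intro affs_diff affs_const affs_gen) auto
    then show "{\<lambda>x. clip (z x)} \<subseteq> affs ?H" by simp
  qed
  have "\<bar>clip (z (u, v)) - u * v\<bar> <= ?\<eta>" if "\<bar>u\<bar> <= 1" "\<bar>v\<bar> <= 1" for u v
  proof -
    have *: "x\<^sup>2 <= F x \<and> F x <= x\<^sup>2 + ?\<eta>" if "0 <= x" "x <= 1" for x
    proof -
      have "0 <= X x" "X x <= 1" using F(2)[OF that] tw_bounds by auto
      then have "0 <= X x * (1 - X x)" "X x * (1 - X x) <= 1" by (auto intro: mult_le_one)
      then show ?thesis unfolding F(3)[OF that] using b by (simp add: divide_right_mono)
    qed
    have "u * v = \<bar>(u + v) / 2\<bar>\<^sup>2 - \<bar>(u - v) / 2\<bar>\<^sup>2" by (simp add: power2_eq_square field_simps)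
    moreover have "\<bar>(u + v) / 2\<bar> <= 1" "\<bar>(u - v) / 2\<bar> <= 1" using that by auto
    ultimately have "\<bar>z (u, v) - u * v\<bar> <= ?\<eta>"
      using *[of "\<bar>(u + v) / 2\<bar>"] *[of "\<bar>(u - v) / 2\<bar>"] unfolding z_def fst_conv snd_conv by (intro abs_leI) auto
    moreover have "\<bar>u * v\<bar> <= 1" using that by (simp add: abs_mult mult_le_one)
    ultimately show ?thesis unfolding clip_eq by linarith
  qed
  moreover have "clip (z (u, 0)) = 0" "clip (z (0, v)) = 0" for u v
    by (simp_all add: z_def clip_eq)
  moreover have "\<bar>clip y\<bar> <= 1" for y by (simp add: clip_eq)
  ultimately show ?thesis using c by (intro exI[of _ "\<lambda>x. clip (z x)"]) auto
qed

text \<open>Factors bounded by 1 do not amplify errors, so these just add up along the list, and an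
  exact zero of any factor is passed on to the result.\<close>

lemma product_net:
  assumes b: "b \<ge> (1::nat)" and c: "cmp B w D F" and fin: "finite F" and fs: "set fs \<subseteq> F"
    and bd: "\<And>f x. f \<in> F ==> \<bar>f x\<bar> <= 1"
  shows "\<exists>g. cmp B (max w (2 * b + 8 + 2 * card F)) (D + length fs * (T + 2)) (insert g F) \<and>
    (\<forall>x. \<bar>g x\<bar> <= 1 \<and> ((\<exists>f\<in>set fs. f x = 0) --> g x = 0) \<and>
      \<bar>g x - (\<Prod>f\<leftarrow>fs. f x)\<bar> <= real (length fs) / (real b ^ T)\<^sup>2)"
  using fs
proof (induction fs)
  case Nil
  have "cmp B (max w (2 * b + 8 + 2 * card F)) D (insert (\<lambda>_. 1) F)"
    by (rule cmp_mono[OF cmp_affs[OF c, of "insert (\<lambda>_. 1) F"]]) (use affs_gen[OF fin] affs_const[of 1 F] in auto)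
  then show ?case by (intro exI[of _ "\<lambda>_. 1"]) auto
next
  case (Cons f fs)
  let ?W = "max w (2 * b + 8 + 2 * card F)" and ?\<eta> = "1 / (real b ^ T)\<^sup>2"
  obtain g where g: "cmp B ?W (D + length fs * (T + 2)) (insert g F)" "\<And>x. \<bar>g x\<bar> <= 1"
    "\<And>x. (\<exists>f\<in>set fs. f x = 0) ==> g x = 0"
    "\<And>x. \<bar>g x - (\<Prod>f\<leftarrow>fs. f x)\<bar> <= real (length fs) / (real b ^ T)\<^sup>2"
    using Cons by auto
  obtain M where M: "cmp {\<lambda>x. fst x, \<lambda>x. snd x} (2 * b + 8) (T + 2) {M}"
    "\<And>u v. \<bar>M (u, v)\<bar> <= 1" "\<And>u. M (u, 0) = 0" "\<And>v. M (0, v) = 0"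
    "\<And>u v. \<bar>u\<bar> <= 1 ==> \<bar>v\<bar> <= 1 ==> \<bar>M (u, v) - u * v\<bar> <= ?\<eta>"
    using mult_net[OF b, of T] by blast
  have f: "f \<in> F" using Cons.prems by simp
  have aff: "h \<in> affs (insert g F)" if "h \<in> insert g F" for h using fin that by (intro affs_gen) auto
  let ?g = "\<lambda>x. M (f x, g x)"
  have "cmp B (max ?W (2 * b + 8 + 2 * card F)) (D + length fs * (T + 2) + (T + 2)) (F \<union> (\<lambda>h x. h (f x, g x)) ` {M})"
    by (rule cmp_compose[OF g(1) fin _ M(1)]) (use aff f in auto)
  then have 1: "cmp B ?W (D + length (f # fs) * (T + 2)) (insert ?g F)" by (simp add: algebra_simps)
  have "\<bar>?g x - (\<Prod>f\<leftarrow>f # fs. f x)\<bar> <= real (length (f # fs)) / (real b ^ T)\<^sup>2" for x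
  proof -
    have "\<bar>f x * (g x - (\<Prod>f\<leftarrow>fs. f x))\<bar> <= 1 * (real (length fs) / (real b ^ T)\<^sup>2)"
      unfolding abs_mult using bd[OF f] g(4) by (intro mult_mono) auto
    moreover have "\<bar>?g x - f x * g x\<bar> <= ?\<eta>" by (rule M(5)[OF bd[OF f] g(2)])
    ultimately show ?thesis by (simp add: algebra_simps add_divide_distrib)
  qed
  moreover have "?g x = 0" if "\<exists>h\<in>set (f # fs). h x = 0" for x using that g(3)[of x] M(3,4) by (cases "f x = 0") auto
  ultimately show ?case using 1 M(2) by (intro exI[of _ ?g]) auto
qed

subsection \<open>Digits\<close>

text \<open>Counting the integers passed gives the floor. The ramps lie to the left of the integers,
  so \<open>z\<close> may equal an integer but must not be slightly below one.\<close>

lemma digit_sum_ramp: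
  assumes z: "0 <= z" "z < real n" and \<omega>: "\<omega> > 0" and sep: "\<And>i::nat. z \<ge> real i \<or> z <= real i - \<omega>"
  shows "(\<Sum>i\<in>{1..<n}. relu ((z - real i) / \<omega> + 1) - relu ((z - real i) / \<omega>)) = of_int \<lfloor>z\<rfloor>"
proof -
  define q where "q = nat \<lfloor>z\<rfloor>"
  have q: "real q <= z" "z < real q + 1" using z by (auto simp: q_def)
  have qn: "q < n" using q z by linarith
  have "(\<Sum>i\<in>{1..<n}. relu ((z - real i) / \<omega> + 1) - relu ((z - real i) / \<omega>)) = (\<Sum>i\<in>{1..<n}. if i \<in> {1..q} then 1 else 0)"
  proof (intro sum.cong refl)
    fix i assume i: "i \<in> {1..<n}"
    show "relu ((z - real i) / \<omega> + 1) - relu ((z - real i) / \<omega>) = (if i \<in> {1..q} then 1 else 0)"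
    proof (cases "i <= q")
      case True
      then have "(z - real i) / \<omega> \<ge> 0" using q \<omega> by (intro divide_nonneg_pos) auto
      then show ?thesis using True i by simp
    next
      case False
      then have "z <= real i - \<omega>" using sep[of i] q by linarith
      then have "(z - real i) / \<omega> <= - 1" using \<omega> by (simp add: field_simps)
      then show ?thesis using False by simp
    qed
  qed
  also have "... = (\<Sum>i\<in>{1..<n} \<inter> {1..q}. 1)" by (rule sum.inter_restrict[symmetric]) simp
  also have "{1..<n} \<inter> {1..q} = {1..q}" using qn by auto
  finally show ?thesis using z by (simp add: q_def)
qed

text \<open>Mixed radix expansion: in each layer the remainder \<open>R\<close> is multiplied by the
  next base and its integer part is moved into \<open>I\<close>. A digit can be wrong only just
  below a breakpoint; the one separation hypothesis at the final scale excludes this in all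
  layers.\<close>

lemma digit_net:
  assumes bs: "\<And>t. 1 <= bs t \<and> bs t <= (b::nat)"
  shows "\<exists>I. cmp {\<lambda>x. x} (2 * b + 4) T {I} \<and> (\<forall>x. 0 <= x --> x < 1 -->
    (\<forall>m::int. \<bar>(\<Prod>t<T. real (bs t)) * x - of_int m\<bar> \<ge> 1/4) --> I x = of_int \<lfloor>(\<Prod>t<T. real (bs t)) * x\<rfloor>)"
proof -
  define B where "B n = (\<Prod>t<n. real (bs t))" for n
  have B0: "B n > 0" for n unfolding B_def using bs by (intro prod_pos) (metis of_nat_0_less_iff less_le_trans zero_less_one)
  \<comment> \<open>A breakpoint of an intermediate layer becomes an integer at the final scale,
    after multiplication with the remaining bases. Distance 1/4 at the final scale therefore means
    distance at least \<open>1 / (4 * B T)\<close> at every earlier one.\<close>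
  define \<omega> where "\<omega> = 1 / (4 * B T)"
  have \<omega>: "\<omega> > 0" using B0 by (simp add: \<omega>_def)
  define good where "good x \<longleftrightarrow> 0 <= x \<and> x < 1 \<and> (\<forall>m::int. \<bar>B T * x - of_int m\<bar> \<ge> 1/4)" for x
  have "\<exists>R I. cmp {\<lambda>x. x} (2 * b + 4) n {R, I} \<and> (\<forall>x. good x --> R x = frac (B n * x) \<and> I x = of_int \<lfloor>B n * x\<rfloor>)"
    if "n <= T" for n using that
  proof (induction n)
    case 0
    have "cmp {\<lambda>x. x} (2 * b + 4) 0 {\<lambda>x. x, \<lambda>_. 0}" by (intro cmp_0) (auto intro: affs_gen affs_const)
    moreover have "\<lfloor>x\<rfloor> = 0" if "good x" for x using that by (intro floor_unique) (auto simp: good_def)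
    ultimately show ?case by (intro exI[of _ "\<lambda>x. x"] exI[of _ "\<lambda>_. 0"]) (auto simp: B_def frac_def)
  next
    case (Suc n)
    obtain R I where RI: "cmp {\<lambda>x. x} (2 * b + 4) n {R, I}" "\<And>x. good x ==> R x = frac (B n * x)"
      "\<And>x. good x ==> I x = of_int \<lfloor>B n * x\<rfloor>" using Suc by auto
    let ?b = "bs n"
    have b: "?b \<ge> 1" "?b <= b" using bs by auto
    define p where "p i x = relu ((real ?b * R x - real i) / \<omega> + 1)" for i x
    define q where "q i x = relu ((real ?b * R x - real i) / \<omega>)" for i x
    define H where "H = p ` {1..<?b} \<union> q ` {1..<?b} \<union> {\<lambda>x. relu (R x), \<lambda>x. relu (- R x), \<lambda>x. relu (I x), \<lambda>x. relu (- I x)}"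
    have fin: "finite H" by (simp add: H_def)
    have "card {\<lambda>x. relu (R x), \<lambda>x. relu (- R x), \<lambda>x. relu (I x), \<lambda>x. relu (- I x)} <= 4" by (simp add: card_insert_if)
    moreover have "card (p ` {1..<?b}) <= b" "card (q ` {1..<?b}) <= b"
      using card_image_le[of "{1..<?b}" p] card_image_le[of "{1..<?b}" q] b by auto
    ultimately have card: "card H <= 2 * b + 4" unfolding H_def
      using card_Un_le[of "p ` {1..<?b} \<union> q ` {1..<?b}" "{\<lambda>x. relu (R x), \<lambda>x. relu (- R x), \<lambda>x. relu (I x), \<lambda>x. relu (- I x)}"]
        card_Un_le[of "p ` {1..<?b}" "q ` {1..<?b}"] by linarith
    have a: "R \<in> affs {R, I}" "I \<in> affs {R, I}" by (auto intro: affs_gen)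
    have "\<exists>a\<in>affs {R, I}. h = (\<lambda>x. relu (a x))" if "h \<in> H" for h
    proof -
      from that consider i where "h = p i" | i where "h = q i" | "h = (\<lambda>x. relu (R x))" | "h = (\<lambda>x. relu (- R x))"
        | "h = (\<lambda>x. relu (I x))" | "h = (\<lambda>x. relu (- I x))" by (auto simp: H_def)
      then show ?thesis
      proof cases
        case (1 i) then show ?thesis using a
          by (intro bexI[of _ "\<lambda>x. (real ?b * R x - real i) / \<omega> + 1"] affs_add affs_diff affs_divide affs_cmul affs_const) (auto simp: p_def)
      next
        case (2 i) then show ?thesis using a
          by (intro bexI[of _ "\<lambda>x. (real ?b * R x - real i) / \<omega>"] affs_diff affs_divide affs_cmul affs_const) (auto simp: q_def)
      qed (use a affs_neg[OF a(1)] affs_neg[OF a(2)] in auto)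
    qed
    then have cH: "cmp {\<lambda>x. x} (2 * b + 4) (Suc n) H" by (intro cmp_layer[OF RI(1) fin card])
    define d where "d x = (\<Sum>i\<in>{1..<?b}. p i x - q i x)" for x
    have dH: "d \<in> affs H" unfolding d_def by (intro affs_sum affs_diff affs_gen[OF fin]) (auto simp: H_def)
    have "R \<in> affs H" "I \<in> affs H" by (rule relu_carry; auto simp: H_def)+
    then have "{\<lambda>x. real ?b * R x - d x, \<lambda>x. real ?b * I x + d x} \<subseteq> affs H"
      using dH by (auto intro!: affs_diff affs_add affs_cmul)
    then have c1: "cmp {\<lambda>x. x} (2 * b + 4) (Suc n) {\<lambda>x. real ?b * R x - d x, \<lambda>x. real ?b * I x + d x}" by (rule cmp_affs[OF cH])
    have "real ?b * R x - d x = frac (B (Suc n) * x) \<and> real ?b * I x + d x = of_int \<lfloor>B (Suc n) * x\<rfloor>" if g: "good x" for x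
    proof -
      define z where "z = real ?b * R x"
      have Bz: "B (Suc n) * x = z + of_int (int ?b * \<lfloor>B n * x\<rfloor>)"
        unfolding z_def RI(2)[OF g] by (simp add: B_def frac_def algebra_simps)
      have z: "0 <= z" "z < real ?b" unfolding z_def RI(2)[OF g] using b frac_lt_1[of "B n * x"] by auto
      have "z \<ge> real i \<or> z <= real i - \<omega>" for i
      proof (rule ccontr)
        assume "\<not> (z \<ge> real i \<or> z <= real i - \<omega>)"
        then have *: "\<bar>z - real i\<bar> < \<omega>" by auto
        define Q where "Q = (\<Prod>t\<in>{Suc n..<T}. bs t)"
        have "{..<T} = {..<Suc n} \<union> {Suc n..<T}" using Suc.prems by auto
        then have "B T = (\<Prod>t\<in>{..<Suc n} \<union> {Suc n..<T}. real (bs t))" unfolding B_def by (rule arg_cong)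
        also have "... = (\<Prod>t\<in>{..<Suc n}. real (bs t)) * (\<Prod>t\<in>{Suc n..<T}. real (bs t))"
          by (rule prod.union_disjoint) auto
        finally have BT: "B T = B (Suc n) * real Q" by (simp only: B_def Q_def of_nat_prod)
        have "B (Suc n) \<ge> 1" unfolding B_def using bs by (intro prod_ge_1) (metis of_nat_1 of_nat_le_iff)
        have Q0: "real Q > 0" using BT B0 by (metis zero_less_mult_pos)
        have "\<bar>B T * x - of_int (int Q * (int i + int ?b * \<lfloor>B n * x\<rfloor>))\<bar> = real Q * \<bar>z - real i\<bar>"
        proof -
          have "B T * x - of_int (int Q * (int i + int ?b * \<lfloor>B n * x\<rfloor>)) = real Q * (B (Suc n) * x) - real Q * (real i + of_int (int ?b * \<lfloor>B n * x\<rfloor>))"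
            by (simp add: BT algebra_simps)
          also have "... = real Q * (z - real i)" unfolding Bz by (simp add: algebra_simps)
          finally show ?thesis by (simp add: abs_mult)
        qed
        also have "... < real Q * \<omega>" using * Q0 by simp
        also have "... <= 1/4" using \<open>B (Suc n) \<ge> 1\<close> Q0 B0[of T] by (simp add: \<omega>_def BT field_simps)
        finally have "\<bar>B T * x - of_int (int Q * (int i + int ?b * \<lfloor>B n * x\<rfloor>))\<bar> < 1/4" .
        then show False using g unfolding good_def by (meson not_le)
      qed
      then have d: "d x = of_int \<lfloor>z\<rfloor>" unfolding d_def p_def q_def z_def[symmetric] using digit_sum_ramp[OF z \<omega>] by blast
      have fl: "\<lfloor>B (Suc n) * x\<rfloor> = \<lfloor>z\<rfloor> + int ?b * \<lfloor>B n * x\<rfloor>" unfolding Bz by (rule floor_add_int[symmetric])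
      show ?thesis unfolding frac_def fl d using Bz RI(3)[OF g] by (simp add: z_def[symmetric])
    qed
    then show ?case using c1 by blast
  qed
  from this[of T] obtain R I where "cmp {\<lambda>x. x} (2 * b + 4) T {R, I}" "\<And>x. good x ==> I x = of_int \<lfloor>B T * x\<rfloor>" by blast
  then show ?thesis using cmp_mono[of "{\<lambda>x. x}" "2 * b + 4" T "{R, I}" "2 * b + 4" "{I}"]
    unfolding good_def B_def by blast
qed

subsection \<open>Sums of sparsely many localized monomials\<close>

definition hat :: "real => real" where "hat z = relu (1 - \<bar>z\<bar>)"

type_synonym 'n idx = "'n => nat"

text \<open>A tensor product of one-dimensional factors \<open>hat y * y ^ \<alpha>\<close>; on the
  support of the hat the power is bounded by 1, which later makes every coefficient bound a bound
  for the function.\<close>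

definition psi :: "('n::finite) idx => ('n => real) => real" where
  "psi \<alpha> y = (\<Prod>m\<in>UNIV. hat (y m) * y m ^ \<alpha> m)"

abbreviation loc :: "nat => ('n::finite) idx => real^'n => 'n => real" where
  "loc l i x \<equiv> (\<lambda>m. 2 ^ l * x $ m - real (i m))"

definition bump :: "nat => ('n::finite) idx => 'n idx set => real^'n => real" where
  "bump l \<alpha> S x = (\<Sum>i\<in>S. psi \<alpha> (loc l i x))"

abbreviation nodes :: "nat => ('n::finite) idx set" where
  "nodes l \<equiv> {i. \<forall>m. i m <= 2 ^ l}"

lemma hat_eq_0_iff: "hat z = 0 \<longleftrightarrow> \<bar>z\<bar> \<ge> 1" by (auto simp: hat_def relu_def max_def)

lemma hat_tri: "hat z = tri z" by (auto simp: hat_def tri_def relu_def max_def)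

lemma hat_bounds: "0 <= hat z" "hat z <= 1" by (auto simp: hat_def relu_def)

lemma psi_eq_0: "\<bar>y m\<bar> \<ge> 1 ==> psi \<alpha> y = 0"
  unfolding psi_def using hat_eq_0_iff[of "y m"] by (intro prod_zero) auto

lemma finite_nodes: "finite (nodes l :: ('n::finite) idx set)"
proof -
  have "nodes l = Pi\<^sub>E (UNIV :: 'n set) (\<lambda>_. {..(2::nat) ^ l})" by (auto simp: PiE_def extensional_def)
  then show ?thesis by (simp add: finite_PiE)
qed

text \<open>Period 8 in \<open>X\<close> is period 2 in \<open>\<zeta>\<close>. The shift 10 is one
  full period plus 2: the period keeps the argument nonnegative for residues up to 7, and 2 puts the
  node into the middle of a rising cell of the wave, where the wave is 1/2 and recovers the signed
  offset. The middle half of that cell is exactly \<open>\<bar>X - real i\<bar> < 1\<close>.\<close>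

lemma node_location:
  fixes X :: real and i \<rho> :: nat
  assumes "i mod 8 = \<rho>" "\<bar>X - real i\<bar> < 1"
  defines "\<zeta> \<equiv> (X + 10 - real \<rho>) / 4"
  shows "4 * tw \<zeta> - 2 = X - real i" "\<lfloor>\<zeta>\<rfloor> = int ((i - \<rho>) div 4 + 2)"
    "(i - \<rho>) div 4 = 2 * (i div 8)"
proof -
  define u where "u = i div 8"
  have i: "i = 8 * u + \<rho>" using assms(1) by (simp add: u_def mult.commute flip: assms(1))
  have z: "\<zeta> = real (2 * u + 2) + (X - real i + 2) / 4" by (simp add: \<zeta>_def i field_simps)
  have e: "(i - \<rho>) div 4 = 2 * u" by (simp add: i)
  have X: "-1 < X - real i" "X - real i < 1" using assms(2) by auto
  have "tw \<zeta> = (X - real i + 2) / 4"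
    using tw_piece[of "2 * u + 2" \<zeta>] X unfolding z by simp
  then show "4 * tw \<zeta> - 2 = X - real i" by simp
  show "\<lfloor>\<zeta>\<rfloor> = int ((i - \<rho>) div 4 + 2)" unfolding e z using X by (intro floor_unique) auto
  show "(i - \<rho>) div 4 = 2 * (i div 8)" using e by (simp add: u_def)
qed

text \<open>The formula for the offset holds on the whole cell and not only near the node, so a
  matching cell index alone identifies the node to which the wave refers.\<close>

lemma node_location_converse:
  fixes X :: real and i \<rho> :: nat
  assumes "i mod 8 = \<rho>" "\<lfloor>(X + 10 - real \<rho>) / 4\<rfloor> = int ((i - \<rho>) div 4 + 2)"
  shows "4 * tw ((X + 10 - real \<rho>) / 4) - 2 = X - real i"
proof -
  define u where "u = i div 8"
  have i: "i = 8 * u + \<rho>" using assms(1) by (simp add: u_def mult.commute flip: assms(1))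
  define \<zeta> where "\<zeta> = (X + 10 - real \<rho>) / 4"
  have e: "(i - \<rho>) div 4 = 2 * u" by (simp add: i)
  have "real (2 * u + 2) <= \<zeta>" "\<zeta> <= real (2 * u + 2) + 1"
    using assms(2) unfolding e \<zeta>_def[symmetric] by linarith+
  from tw_piece[OF this] have "4 * tw \<zeta> - 2 = 4 * (\<zeta> - real (2 * u + 2)) - 2" by simp
  also have "... = X - real i" by (simp add: \<zeta>_def i field_simps)
  finally show ?thesis by (simp add: \<zeta>_def)
qed

section \<open>Numbering multi-indices by digits in base \<open>B\<close>\<close>

lemma digits_inj:
  fixes a a' :: "nat => nat"
  assumes "\<And>j. j < n ==> a j < B" "\<And>j. j < n ==> a' j < B" "(\<Sum>j<n. a j * B ^ j) = (\<Sum>j<n. a' j * B ^ j)"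
  shows "\<forall>j<n. a j = a' j"
  using assms
proof (induction n arbitrary: a a')
  case (Suc n)
  have *: "(\<Sum>j<Suc n. a j * B ^ j) = a 0 + B * (\<Sum>j<n. a (Suc j) * B ^ j)" for a
    by (subst sum.lessThan_Suc_shift) (simp add: sum_distrib_left mult_ac)
  have eq: "a 0 + B * (\<Sum>j<n. a (Suc j) * B ^ j) = a' 0 + B * (\<Sum>j<n. a' (Suc j) * B ^ j)"
    using Suc.prems(3) unfolding * .
  have B: "a 0 < B" "a' 0 < B" using Suc.prems by auto
  have 0: "a 0 = a' 0" using arg_cong[OF eq, of "\<lambda>x. x mod B"] B by simp
  then have "(\<Sum>j<n. a (Suc j) * B ^ j) = (\<Sum>j<n. a' (Suc j) * B ^ j)" using eq B by simp
  then have "\<forall>j<n. a (Suc j) = a' (Suc j)" using Suc.prems(1,2) by (intro Suc.IH) auto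
  then show ?case using 0 by (auto simp: less_Suc_eq_0_disj)
qed simp

lemma digits_less:
  fixes a :: "nat => nat"
  assumes "\<And>j. j < n ==> a j < B"
  shows "(\<Sum>j<n. a j * B ^ j) < B ^ n"
  using assms
proof (induction n)
  case (Suc n)
  have "(\<Sum>j<n. a j * B ^ j) < B ^ n" using Suc by auto
  moreover have "a n + 1 <= B" using Suc.prems[of n] by simp
  then have "(a n + 1) * B ^ n <= B * B ^ n" by (rule mult_le_mono1)
  ultimately show ?case by simp
qed simp

definition linidx :: "('n::finite) idx => nat => 'n idx => nat" where
  "linidx e B c = (\<Sum>m\<in>UNIV. c m * B ^ e m)"

lemma linidx_sum:
  assumes "bij_betw e (UNIV :: 'n::finite set) {..<CARD('n)}"
  shows "linidx e B c = (\<Sum>j<CARD('n). c (inv_into UNIV e j) * B ^ j)"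
proof -
  have "inv_into UNIV e (e m) = m" for m using assms by (auto simp: bij_betw_def)
  then show ?thesis unfolding linidx_def
    using sum.reindex_bij_betw[OF assms, of "\<lambda>j. c (inv_into UNIV e j) * B ^ j"] by simp
qed

lemma linidx_less:
  assumes "bij_betw e (UNIV :: 'n::finite set) {..<CARD('n)}" "\<And>m. c m < B"
  shows "linidx e B c < B ^ CARD('n)"
  unfolding linidx_sum[OF assms(1)] using assms(2) by (intro digits_less)

lemma linidx_inj:
  assumes e: "bij_betw e (UNIV :: 'n::finite set) {..<CARD('n)}" and "\<And>m. c m < B" "\<And>m. c' m < B"
    and "linidx e B c = linidx e B c'"
  shows "c = c'"
proof
  fix m
  have "\<forall>j<CARD('n). c (inv_into UNIV e j) = c' (inv_into UNIV e j)"
    using assms(2-4) unfolding linidx_sum[OF e] by (intro digits_inj[of _ _ B])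
  moreover have "e m < CARD('n)" "inv_into UNIV e (e m) = m" using e by (auto simp: bij_betw_def)
  ultimately show "c m = c' m" by metis
qed

text \<open>Full factors \<open>2 ^ e\<close> until the exponent is exhausted, then a partial one,
  then factors 1. The product has to be exactly \<open>2 ^ \<Lambda>\<close>, because both the wave
  and the cell index are read at that scale.\<close>

lemma power_two_split:
  assumes "e \<ge> 1" "\<Lambda> <= e * T"
  shows "\<exists>bs. (\<forall>t. 1 <= bs t \<and> bs t <= (2::nat) ^ e) \<and> (\<Prod>t<T. real (bs t)) = 2 ^ \<Lambda>"
proof -
  define bs where "bs t = (2::nat) ^ min e (\<Lambda> - t * e)" for t
  have "(\<Prod>t<n. real (bs t)) = 2 ^ min (n * e) \<Lambda>" for n
  proof (induction n)
    case (Suc n)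
    have "min (n * e) \<Lambda> + min e (\<Lambda> - n * e) = min (Suc n * e) \<Lambda>" by auto
    then show ?case using Suc by (simp add: bs_def flip: power_add)
  qed simp
  from this[of T] have "(\<Prod>t<T. real (bs t)) = 2 ^ \<Lambda>" using assms(2) by (simp add: min_absorb2 mult.commute)
  moreover have "1 <= bs t \<and> bs t <= 2 ^ e" for t by (simp add: bs_def power_increasing)
  ultimately show ?thesis by blast
qed

abbreviation coords :: "(real^'n::finite => real) set" where
  "coords \<equiv> range (\<lambda>j x. x $ j)"

text \<open>Exact product of a \<open>z\<close> in \<open>[-1, 1]\<close> with a bit
  \<open>h\<close>. At \<open>z = 0\<close> it is 0 for every real \<open>h\<close>, hence also
  where the lookup is fed with a wrong index.\<close>

definition gate :: "real => real => real" where
  "gate h z = relu (z + h - 1) - relu (- z + h - 1)"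

lemma gate_simps: "\<bar>z\<bar> <= 1 ==> gate 1 z = z" "\<bar>z\<bar> <= 1 ==> gate 0 z = 0" "gate h 0 = 0"
  by (auto simp: gate_def relu_def)

text \<open>On nodes of a fixed residue class modulo 8 the triangle wave of period 8 restores the signed
  local coordinate, and the cell index is only needed in the middle half of a cell. Wherever it is
  not a correct integer, the factor \<open>psi\<close> vanishes exactly.\<close>

lemma class_bump_net:
  fixes S :: "('n::finite) idx set" and \<alpha> \<rho> :: "'n => nat"
  assumes \<alpha>: "\<And>m. \<alpha> m < k" and S: "S \<subseteq> nodes l" "\<And>i m. i \<in> S ==> i m mod 8 = \<rho> m"
    and e: "e \<ge> 1" "l + 2 <= e * T" and wD: "w \<ge> 1" "D \<ge> 1"
    and bound: "(card S + (2 ^ (l + 2)) ^ CARD('n) div 2 ^ \<beta> + 3) * (\<beta> + 3) <= D * D * (w * w)"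
  shows "\<exists>g. cmp coords (40 * CARD('n) * (2 ^ e + w)) (4 * (k + 2) * CARD('n) * (T + D + 1)) {g} \<and>
    (\<forall>x\<in>cube. \<bar>g x - bump l \<alpha> S x\<bar> <= real (CARD('n) * (k + 1)) / ((2 ^ e) ^ T)\<^sup>2)"
proof -
  let ?d = "CARD('n)" and ?b = "(2::nat) ^ e" and ?N = "(2::nat) ^ (l + 2)"
  have d: "?d \<ge> 1" by (simp add: Suc_leI)
  have rho: "\<rho> m < 8" if "i \<in> S" for i m using S(2)[OF that, of m] mod_less_divisor[of 8 "i m"] by simp
  obtain ix where ix: "bij_betw ix (UNIV :: 'n set) {..<?d}"
    using ex_bij_betw_finite_nat[of "UNIV :: 'n set"] by (auto simp: atLeast0LessThan)
  \<comment> \<open>For empty \<open>S\<close> nothing bounds \<open>\<rho>\<close>; the cap makes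
    the estimates for \<open>zeta\<close> hold in that case too, and it changes nothing
    otherwise.\<close>
  define \<rho>' where "\<rho>' m = min 7 (\<rho> m)" for m
  define zeta where "zeta m x = (2 ^ l * x $ m + 10 - real (\<rho>' m)) / 4" for m and x :: "real^'n"
  \<comment> \<open>\<open>zeta\<close> stays below \<open>4 * 2 ^ l\<close> on the cube, so
    division by \<open>2 ^ (l + 2)\<close> leads into the unit interval on which the wave and digit
    networks are correct.\<close>
  define z where "z m x = zeta m x / 2 ^ (l + 2)" for m x
  have z01: "0 <= z m x" "z m x < 1" if "x \<in> cube" for m x
  proof -
    have x: "0 <= x $ m" "x $ m <= 1" using that by (auto simp: mem_box_cart)
    have "0 <= 2 ^ l * x $ m" "2 ^ l * x $ m <= 2 ^ l * 1" using x by (auto intro!: mult_left_mono)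
    moreover have "0 <= (A + 10 - r) / 4 \<and> (A + 10 - r) / 4 < 4 * P" if "0 <= A" "A <= P * 1" "r <= 7" "1 <= P" "0 <= r" for A P r :: real
      using that by auto
    moreover have "real (\<rho>' m) <= 7" by (simp add: \<rho>'_def)
    moreover have "(1::real) <= 2 ^ l" "0 <= real (\<rho>' m)" by simp_all
    ultimately have "0 <= (2 ^ l * x $ m + 10 - real (\<rho>' m)) / 4 \<and> (2 ^ l * x $ m + 10 - real (\<rho>' m)) / 4 < 4 * 2 ^ l"
      by blast
    then have "0 <= zeta m x" "zeta m x < 2 ^ (l + 2)" by (simp_all add: zeta_def)
    then show "0 <= z m x" "z m x < 1" by (simp_all add: z_def)
  qed
  obtain bs where bs: "\<And>t. 1 <= bs t \<and> bs t <= ?b" "(\<Prod>t<T. real (bs t)) = 2 ^ (l + 2)"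
    using power_two_split[OF e] by blast
  obtain X F where XF: "cmp {\<lambda>x. x} (?b + 2) T {X, F}"
    "\<And>x. 0 <= x ==> x <= 1 ==> X x = tw (2 ^ (l + 2) * x)"
    using tw_square_net[of bs ?b T] bs by auto
  obtain I where I: "cmp {\<lambda>x. x} (2 * ?b + 4) T {I}"
    "\<And>x. 0 <= x ==> x < 1 ==> (\<And>m::int. \<bar>2 ^ (l + 2) * x - of_int m\<bar> \<ge> 1/4) ==> I x = of_int \<lfloor>2 ^ (l + 2) * x\<rfloor>"
    using digit_net[of bs ?b T] bs by auto
  have finc: "finite (coords :: (real^'n => real) set)" by simp
  have zaff: "z m \<in> affs coords" for m
    unfolding z_def zeta_def by (intro affs_divide affs_diff affs_add affs_cmul affs_const affs_gen) auto
  have c: "cmp coords w' D' {\<lambda>x. f (z m x)}" if "cmp {\<lambda>x. x} w' D' {f}" for w' D' f m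
    using cmp_subst[OF that finc, of "z m"] zaff[of m] by auto
  define y where "y m x = 4 * X (z m x) - 2" for m x
  have cy: "cmp coords (?d * (?b + 2)) T (\<Union>m\<in>UNIV. {\<lambda>x. X (z m x)})"
    using cmp_parallel_family[OF _ finc c[OF cmp_mono[OF XF(1) order_refl, of "{X}"]], of UNIV "\<lambda>m. m"] by simp
  have cI: "cmp coords (?d * (2 * ?b + 4)) T (\<Union>m\<in>UNIV. {\<lambda>x. I (z m x)})"
    using cmp_parallel_family[OF _ finc c[OF I(1)], of UNIV "\<lambda>m. m"] by simp

  \<comment> \<open>The localized monomial as a product of hats and clipped coordinates\<close>
  define h c' where "h m x = tri (y m x)" and "c' m x = clip (y m x)" for m x
  define H where "H = (\<Union>m\<in>UNIV. {\<lambda>x. relu (y m x + 1), \<lambda>x. relu (y m x), \<lambda>x. relu (y m x - 1)})"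
  have finH: "finite H" by (simp add: H_def)
  have "card H <= (\<Sum>m\<in>(UNIV::'n set). card {\<lambda>x. relu (y m x + 1), \<lambda>x. relu (y m x), \<lambda>x. relu (y m x - 1)})"
    unfolding H_def by (rule card_UN_le) simp
  also have "... <= (\<Sum>m\<in>(UNIV::'n set). 3)" by (intro sum_mono) (simp add: card_insert_if)
  also have "... = 3 * ?d" by simp
  also have "... <= ?d * (?b + 2)" using one_le_power[of "2::nat" e] by (simp add: algebra_simps)
  finally have cardH: "card H <= ?d * (?b + 2)" .
  have yaff: "y m \<in> affs (\<Union>m\<in>UNIV. {\<lambda>x. X (z m x)})" for m
    unfolding y_def by (intro affs_diff affs_cmul affs_const affs_gen) auto
  have cH: "cmp coords (?d * (?b + 2)) (Suc T) H"
  proof (rule cmp_layer[OF cy finH cardH])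
    fix h assume "h \<in> H"
    then consider m where "h = (\<lambda>x. relu (y m x + 1))" | m where "h = (\<lambda>x. relu (y m x))" | m where "h = (\<lambda>x. relu (y m x - 1))"
      by (auto simp: H_def)
    then show "\<exists>a\<in>affs (\<Union>m\<in>UNIV. {\<lambda>x. X (z m x)}). h = (\<lambda>x. relu (a x))"
    proof cases
      case (1 m) then show ?thesis using yaff by (intro bexI[of _ "\<lambda>x. y m x + 1"] affs_add affs_const) auto
    next
      case (2 m) then show ?thesis using yaff by (intro bexI[of _ "y m"]) auto
    next
      case (3 m) then show ?thesis using yaff by (intro bexI[of _ "\<lambda>x. y m x - 1"] affs_diff affs_const) auto
    qed
  qed
  define Fs where "Fs = range h \<union> range c'"
  have finFs: "finite Fs" by (simp add: Fs_def)
  have cardFs: "card Fs <= 2 * ?d" unfolding Fs_def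
    using card_Un_le[of "range h" "range c'"] card_image_le[of UNIV h] card_image_le[of UNIV c'] by simp
  have "h m \<in> affs H" "c' m \<in> affs H" for m
    unfolding h_def c'_def tri_def clip_def
    by (intro affs_add affs_diff affs_cmul affs_const affs_gen[OF finH]; auto simp: H_def)+
  then have cFs: "cmp coords (?d * (?b + 2)) (Suc T) Fs" by (intro cmp_affs[OF cH]) (auto simp: Fs_def)
  have Fs1: "\<bar>f x\<bar> <= 1" if "f \<in> Fs" for f x
    using that hat_bounds by (auto simp: Fs_def h_def c'_def clip_eq simp flip: hat_tri)
  obtain ms where ms: "distinct ms" "set ms = (UNIV :: 'n set)" using finite_distinct_list[of "UNIV :: 'n set"] by auto
  define fs where "fs = concat (map (\<lambda>m. h m # replicate (\<alpha> m) (c' m)) ms)"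
  have fsFs: "set fs \<subseteq> Fs" by (auto simp: fs_def Fs_def)
  have prod_fs: "(\<Prod>f\<leftarrow>fs. f x) = psi \<alpha> (\<lambda>m. y m x)" for x
  proof -
    \<comment> \<open>Clipping, which provides factors bounded by 1, alters \<open>y\<close> only
      where the hat vanishes.\<close>
    have hc: "h m x * c' m x ^ \<alpha> m = hat (y m x) * y m x ^ \<alpha> m" for m
    proof (cases "\<bar>y m x\<bar> \<ge> 1")
      case True then show ?thesis using hat_eq_0_iff[of "y m x"] by (simp add: h_def hat_tri)
    next
      case False then show ?thesis by (simp add: h_def c'_def clip_eq hat_tri)
    qed
    have "(\<Prod>f\<leftarrow>fs. f x) = (\<Prod>m\<leftarrow>ms. h m x * c' m x ^ \<alpha> m)"
      unfolding fs_def by (induction ms) (auto simp: prod_list_replicate)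
    also have "... = (\<Prod>m\<in>UNIV. h m x * c' m x ^ \<alpha> m)" using prod.distinct_set_conv_list[OF ms(1), of "\<lambda>m. h m x * c' m x ^ \<alpha> m"] ms(2) by simp
    finally show ?thesis by (simp add: psi_def hc)
  qed
  have len: "length fs <= ?d * (k + 1)"
  proof -
    have "length fs = (\<Sum>m\<leftarrow>ms. Suc (\<alpha> m))" by (simp add: fs_def length_concat o_def)
    also have "... <= (\<Sum>m\<leftarrow>ms. k + 1)" using \<alpha> by (intro sum_list_mono) (auto intro: less_imp_le)
    also have "... = ?d * (k + 1)" using ms distinct_card[of ms] by (simp add: sum_list_triv)
    finally show ?thesis .
  qed
  obtain \<Psi> where \<Psi>: "cmp coords (max (?d * (?b + 2)) (2 * ?b + 8 + 2 * card Fs)) (Suc T + length fs * (T + 2)) (insert \<Psi> Fs)"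
    "\<And>x. \<bar>\<Psi> x\<bar> <= 1" "\<And>x. (\<exists>f\<in>set fs. f x = 0) ==> \<Psi> x = 0"
    "\<And>x. \<bar>\<Psi> x - psi \<alpha> (\<lambda>m. y m x)\<bar> <= real (length fs) / (real ?b ^ T)\<^sup>2"
    using product_net[where b = ?b and T = T and fs = fs and F = Fs, OF _ cFs finFs fsFs] Fs1 unfolding prod_fs by auto
  have \<Psi>0: "\<Psi> x = 0" if "\<bar>y m x\<bar> \<ge> 1" for m x
  proof -
    have "h m \<in> set fs" unfolding fs_def using ms(2) by auto
    moreover have "h m x = 0" using that hat_eq_0_iff[of "y m x"] by (simp add: h_def hat_tri)
    ultimately show ?thesis using \<Psi>(3) by blast
  qed

  \<comment> \<open>Cell numbers and their lookup\<close>
  define idx where "idx i = (\<lambda>m. (i m - \<rho> m) div 4 + 2)" for i :: "'n => nat"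
  define S' where "S' = (\<lambda>i. linidx ix ?N (idx i)) ` S"
  have idxN: "idx i m < ?N" if "i \<in> S" for i m
  proof -
    have "i m <= 2 ^ l" using that S(1) by auto
    then have "(i m - \<rho> m) div 4 <= 2 ^ l" by (meson diff_le_self div_le_dividend le_trans)
    moreover have "?N = 4 * 2 ^ l" by simp
    ultimately show ?thesis unfolding idx_def using one_le_power[of "2::nat" l] by linarith
  qed
  have finS: "finite S" using finite_subset[OF S(1) finite_nodes] .
  have S'N: "S' \<subseteq> {..<?N ^ ?d}" unfolding S'_def using linidx_less[OF ix idxN] by auto
  have "card S' <= card S" unfolding S'_def by (rule card_image_le[OF finS])
  then have "(card S' + ?N ^ ?d div 2 ^ \<beta> + 3) * (\<beta> + 3) <= (card S + ?N ^ ?d div 2 ^ \<beta> + 3) * (\<beta> + 3)"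
    by (intro mult_le_mono1) simp
  then have "(card S' + ?N ^ ?d div 2 ^ \<beta> + 3) * (\<beta> + 3) <= D * D * (w * w)" using bound by linarith
  from sparse_net[OF S'N wD this] obtain \<phi> where \<phi>: "cmp {\<lambda>x. x} (8 * w + 22) (4 * D + 2) {\<phi>}"
    "\<And>i. i < ?N ^ ?d ==> \<phi> (real i) = (if i \<in> S' then 1 else 0)" by blast
  define L where "L x = (\<Sum>m\<in>UNIV. I (z m x) * real (?N ^ ix m))" for x
  define hh where "hh x = \<phi> (L x)" for x
  have "L \<in> affs (\<Union>m\<in>UNIV. {\<lambda>x. I (z m x)})" unfolding L_def by (intro affs_sum affs_cmul' affs_gen) auto
  then have chh: "cmp coords (max (?d * (2 * ?b + 4)) (8 * w + 22)) (T + (4 * D + 2)) {hh}"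
    using cmp_compose'[OF cI \<phi>(1), of L] by (auto simp: hh_def[abs_def])

  \<comment> \<open>Gating the product by the looked-up bit, and the size of the network\<close>
  define g where "g x = gate (hh x) (\<Psi> x)" for x
  let ?W1 = "max (?d * (?b + 2)) (2 * ?b + 8 + 2 * card Fs)" and ?W2 = "max (?d * (2 * ?b + 4)) (8 * w + 22)"
  let ?D1 = "Suc T + length fs * (T + 2)" and ?D2 = "T + (4 * D + 2)"
  have c\<Psi>: "cmp coords ?W1 ?D1 {\<Psi>}" by (rule cmp_mono[OF \<Psi>(1)]) auto
  let ?W = "max ?W1 (2 * card {\<Psi>}) + max ?W2 (2 * card {hh})"
  have c2: "cmp coords ?W (max ?D1 ?D2) ({\<Psi>} \<union> {hh})"
    by (rule cmp_parallel_pad[OF c\<Psi> chh]) auto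
  let ?G = "{\<lambda>x. relu (\<Psi> x + hh x - 1), \<lambda>x. relu (- \<Psi> x + hh x - 1)}"
  have c3: "cmp coords ?W (Suc (max ?D1 ?D2)) ?G"
  proof (rule cmp_layer[OF c2])
    have a: "\<Psi> \<in> affs ({\<Psi>} \<union> {hh})" "hh \<in> affs ({\<Psi>} \<union> {hh})" by (auto intro!: affs_gen)
    have "(\<lambda>x. \<Psi> x + hh x - 1) \<in> affs ({\<Psi>} \<union> {hh})" "(\<lambda>x. - \<Psi> x + hh x - 1) \<in> affs ({\<Psi>} \<union> {hh})"
      by (intro affs_diff affs_add affs_neg affs_const a)+
    then show "\<exists>a\<in>affs ({\<Psi>} \<union> {hh}). f = (\<lambda>x. relu (a x))" if "f \<in> ?G" for f using that by auto
  qed (auto simp: card_insert_if)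
  have c4: "cmp coords ?W (Suc (max ?D1 ?D2)) {g}"
  proof (rule cmp_affs[OF c3])
    have "g \<in> affs ?G" unfolding g_def gate_def by (intro affs_diff affs_gen) auto
    then show "{g} \<subseteq> affs ?G" by simp
  qed
  have b2: "?b \<ge> 2" using power_increasing[OF e(1), of "2::nat"] by simp
  have W: "?W <= 40 * ?d * (?b + w)"
  proof -
    have "?b + w <= ?d * (?b + w)" using d by simp
    moreover have "?d * 3 <= ?d * (?b + w)" using b2 wD by (intro mult_le_mono2) simp
    moreover have "?d * ?b <= ?d * (?b + w)" by simp
    ultimately show ?thesis using cardFs b2 wD d by (simp add: algebra_simps max_def)
  qed
  have D: "Suc (max ?D1 ?D2) <= 4 * (k + 2) * ?d * (T + D + 1)"
  proof -
    define M where "M = T + D + 1"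
    have 1: "length fs * (T + 2) <= ?d * (k + 1) * M" using len wD unfolding M_def by (intro mult_le_mono) auto
    have 2: "1 * M <= ?d * M" by (rule mult_le_mono1[OF d])
    have 3: "4 * (k + 2) * ?d * M = 4 * (?d * (k + 1) * M) + 4 * (?d * M)" by (simp add: algebra_simps)
    have "T + 2 <= M" "T + 4 * D + 3 <= 4 * M" using wD by (simp_all add: M_def)
    then have "Suc ?D1 <= 4 * (k + 2) * ?d * M" "Suc ?D2 <= 4 * (k + 2) * ?d * M"
      using 1 2 unfolding 3 by linarith+
    then show ?thesis unfolding M_def by simp
  qed
  have fing: "finite {g}" by simp
  have c5: "cmp coords (max ?W (2 * card {g})) (4 * (k + 2) * ?d * (T + D + 1)) {g}"
    by (rule cmp_pad[OF c4 fing D])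
  have c6: "cmp coords (40 * ?d * (?b + w)) (4 * (k + 2) * ?d * (T + D + 1)) {g}"
  proof (rule cmp_mono[OF c5])
    have "2 * card {g} <= 40 * ?d * (?b + w)" using b2 d by (simp add: mult_le_mono)
    then show "max ?W (2 * card {g}) <= 40 * ?d * (?b + w)" using W by simp
  qed simp

  \<comment> \<open>Error on the cube\<close>
  have "\<bar>g x - bump l \<alpha> S x\<bar> <= real (?d * (k + 1)) / ((2 ^ e) ^ T)\<^sup>2" if x: "x \<in> cube" for x
  proof -
    have ytw: "y m x = 4 * tw (zeta m x) - 2" for m
      unfolding y_def using XF(2)[of "z m x"] z01[OF x, of m] by (simp add: z_def)
    have zr: "zeta m x = (2 ^ l * x $ m + 10 - real (\<rho> m)) / 4" if "i \<in> S" for i m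
      using rho[OF that, of m] by (simp add: zeta_def \<rho>'_def)
    have near: "y m x = 2 ^ l * x $ m - real (i m)" "\<lfloor>zeta m x\<rfloor> = int (idx i m)"
      if "i \<in> S" "\<bar>2 ^ l * x $ m - real (i m)\<bar> < 1" for i m
      using node_location[OF S(2)[OF that(1)] that(2)] unfolding ytw zr[OF that(1)] idx_def by auto
    have zero: "psi \<alpha> (loc l i x) = 0" if "\<bar>2 ^ l * x $ m - real (i m)\<bar> \<ge> 1" for i m
      using that by (rule psi_eq_0)
    have fin: "real (length fs) / (real ?b ^ T)\<^sup>2 <= real (?d * (k + 1)) / ((2 ^ e) ^ T)\<^sup>2"
    proof -
      have "real (length fs) <= real (?d * (k + 1))" using len by (simp only: of_nat_le_iff)
      then show ?thesis unfolding of_nat_power of_nat_numeral by (rule divide_right_mono) simp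
    qed
    show ?thesis
    proof (cases "\<forall>m. \<bar>y m x\<bar> < 1")
      \<comment> \<open>In some coordinate the point is at distance at least 1 from every node of
        the class: both functions are exactly 0, and the looked-up bit is irrelevant.\<close>
      case False
      then obtain m where m: "\<bar>y m x\<bar> \<ge> 1" by (auto simp: not_less)
      have "bump l \<alpha> S x = 0" unfolding bump_def
      proof (intro sum.neutral ballI)
        fix i assume "i \<in> S"
        then have "\<bar>2 ^ l * x $ m - real (i m)\<bar> \<ge> 1" using near(1)[of i m] m by (cases "\<bar>2 ^ l * x $ m - real (i m)\<bar> < 1") auto
        then show "psi \<alpha> (loc l i x) = 0" by (rule zero)
      qed
      moreover have "g x = 0" using \<Psi>0[OF m] by (simp add: g_def gate_simps)
      ultimately show ?thesis by simp
    next
      case True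
      \<comment> \<open>Integers are the extrema of the wave: within 1/4 of one, the wave is below
        1/4 or above 3/4 and \<open>\<bar>y m x\<bar>\<close> would exceed 1. Hence the digits are
        correct here.\<close>
      have Iz: "I (z m x) = of_int \<lfloor>zeta m x\<rfloor>" for m
      proof -
        have y: "\<bar>4 * tw (zeta m x) - 2\<bar> < 1" using True ytw by metis
        have "\<bar>zeta m x - of_int j\<bar> \<ge> 1/4" for j
        proof (rule ccontr)
          assume j: "\<not> \<bar>zeta m x - of_int j\<bar> \<ge> 1/4"
          show False
          proof (cases "even j")
            case True
            then obtain i where "j = 2 * i" by blast
            then show False using tw_eqI[of "zeta m x" i] j y by auto
          next
            case False
            then obtain i where i: "j = 2 * i + 1" by (auto elim: oddE)
            show False
            proof (cases "zeta m x <= of_int j")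
              case True
              then show False using tw_eqI[of "zeta m x" i] j y i by auto
            next
              case False
              then show False using tw_eqI[of "zeta m x" "i + 1"] j y i by auto
            qed
          qed
        qed
        then show ?thesis using I(2)[of "z m x"] z01[OF x, of m] by (simp add: z_def)
      qed
      define cc where "cc m = nat \<lfloor>zeta m x\<rfloor>" for m
      have ccN: "cc m < ?N" and cc0: "zeta m x \<ge> 0" for m
      proof -
        have "zeta m x = z m x * 2 ^ (l + 2)" by (simp add: z_def)
        then have "0 <= zeta m x" "zeta m x < 2 ^ (l + 2)"
          using z01[OF x, of m] mult_strict_right_mono[of "z m x" 1 "2 ^ (l + 2)"] by simp_all
        moreover from this have "real (cc m) <= zeta m x" unfolding cc_def by (intro of_nat_floor)
        moreover have "real ?N = 2 ^ (l + 2)" by simp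
        ultimately have "real (cc m) < real ?N" by linarith
        then show "cc m < ?N" by (simp only: of_nat_less_iff)
        show "zeta m x \<ge> 0" by fact
      qed
      have "L x = real (linidx ix ?N cc)"
        unfolding L_def Iz linidx_def using cc0 by (simp add: cc_def)
      then have hh: "hh x = (if linidx ix ?N cc \<in> S' then 1 else 0)"
        unfolding hh_def using \<phi>(2)[OF linidx_less[OF ix ccN]] by simp
      show ?thesis
      \<comment> \<open>A match singles out the only node whose summand can be nonzero. Without a
        match every summand vanishes; this covers the cells with an odd index in some coordinate,
        where the wave runs backwards, since all \<open>idx i m\<close> are even.\<close>
      proof (cases "\<exists>i\<in>S. idx i = cc")
        case True
        then obtain i where i: "i \<in> S" "idx i = cc" by blast
        have yi: "y m x = 2 ^ l * x $ m - real (i m)" for m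
        proof -
          have "\<lfloor>zeta m x\<rfloor> = int (idx i m)" using i(2) cc0[of m] by (simp add: cc_def)
          then show ?thesis using node_location_converse[OF S(2)[OF i(1)], of "2 ^ l * x $ m" m]
            unfolding ytw zr[OF i(1)] idx_def by auto
        qed
        have "psi \<alpha> (\<lambda>m. 2 ^ l * x $ m - real (j m)) = 0" if j: "j \<in> S" "j \<noteq> i" for j
        proof -
          obtain m where m: "j m \<noteq> i m" using j(2) by auto
          have "\<not> \<bar>2 ^ l * x $ m - real (j m)\<bar> < 1"
          proof
            assume "\<bar>2 ^ l * x $ m - real (j m)\<bar> < 1"
            then have "y m x = 2 ^ l * x $ m - real (j m)" by (rule near(1)[OF j(1)])
            then show False using yi[of m] m by simp
          qed
          then show ?thesis by (intro zero[of m]) auto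
        qed
        then have "bump l \<alpha> S x = psi \<alpha> (\<lambda>m. y m x)"
          unfolding bump_def yi using i(1) finS by (subst sum.remove[OF finS i(1)]) auto
        moreover have "hh x = 1" unfolding hh S'_def using i by auto
        ultimately show ?thesis using \<Psi>(2,4)[of x] fin by (simp add: g_def gate_simps)
      next
        case False
        then have "linidx ix ?N cc \<notin> S'" unfolding S'_def using linidx_inj[OF ix idxN ccN] by auto
        then have "g x = 0" using \<Psi>(2) by (simp add: g_def hh gate_simps)
        moreover have "bump l \<alpha> S x = 0" unfolding bump_def
        proof (intro sum.neutral ballI)
          fix i assume i: "i \<in> S"
          have "\<exists>m. \<not> \<bar>2 ^ l * x $ m - real (i m)\<bar> < 1"
          proof (rule ccontr)
            assume "\<not> ?thesis"
            then have "idx i m = cc m" for m using near(2)[OF i, of m] by (simp add: cc_def)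
            then show False using False i by blast
          qed
          then obtain m where "\<bar>2 ^ l * x $ m - real (i m)\<bar> \<ge> 1" by (auto simp: not_less)
          then show "psi \<alpha> (loc l i x) = 0" by (rule zero)
        qed
        ultimately show ?thesis by simp
      qed
    qed
  qed
  then show ?thesis using c6 by blast
qed

text \<open>The \<open>8 ^ d\<close> residue classes of \<open>S\<close> are treated in parallel;
  each has at most the cardinality of \<open>S\<close>, so one budget serves all.\<close>

lemma bump_net:
  fixes S :: "('n::finite) idx set" and \<alpha> :: "'n => nat"
  assumes \<alpha>: "\<And>m. \<alpha> m < k" and S: "S \<subseteq> nodes l"
    and e: "e \<ge> 1" "l + 2 <= e * T" and wD: "w \<ge> 1" "D \<ge> 1"
    and bound: "(card S + (2 ^ (l + 2)) ^ CARD('n) div 2 ^ \<beta> + 3) * (\<beta> + 3) <= D * D * (w * w)"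
  shows "\<exists>g. cmp coords (8 ^ CARD('n) * (40 * CARD('n)) * (2 ^ e + w)) (4 * (k + 2) * CARD('n) * (T + D + 1)) {g} \<and>
    (\<forall>x\<in>cube. \<bar>g x - bump l \<alpha> S x\<bar> <= real (8 ^ CARD('n) * CARD('n) * (k + 1)) / ((2 ^ e) ^ T)\<^sup>2)"
proof -
  define R where "R = Pi\<^sub>E (UNIV :: 'n set) (\<lambda>_. {..<8::nat})"
  have finR: "finite R" and cardR: "card R = 8 ^ CARD('n)" by (auto simp: R_def finite_PiE card_PiE)
  define cl where "cl \<rho> = {i\<in>S. \<forall>m. i m mod 8 = \<rho> m}" for \<rho>
  have finS: "finite S" using finite_subset[OF S finite_nodes] .
  have "\<exists>g. cmp coords (40 * CARD('n) * (2 ^ e + w)) (4 * (k + 2) * CARD('n) * (T + D + 1)) {g} \<and>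
    (\<forall>x\<in>cube. \<bar>g x - bump l \<alpha> (cl \<rho>) x\<bar> <= real (CARD('n) * (k + 1)) / ((2 ^ e) ^ T)\<^sup>2)" for \<rho>
  proof (rule class_bump_net[OF \<alpha> _ _ e wD])
    have "card (cl \<rho>) <= card S" using finS by (intro card_mono) (auto simp: cl_def)
    then have "(card (cl \<rho>) + (2 ^ (l + 2)) ^ CARD('n) div 2 ^ \<beta> + 3) * (\<beta> + 3) <= (card S + (2 ^ (l + 2)) ^ CARD('n) div 2 ^ \<beta> + 3) * (\<beta> + 3)"
      by (intro mult_le_mono1) simp
    then show "(card (cl \<rho>) + (2 ^ (l + 2)) ^ CARD('n) div 2 ^ \<beta> + 3) * (\<beta> + 3) <= D * D * (w * w)" using bound by linarith
  qed (use S in \<open>auto simp: cl_def\<close>)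
  then obtain g where g: "\<And>\<rho>. cmp coords (40 * CARD('n) * (2 ^ e + w)) (4 * (k + 2) * CARD('n) * (T + D + 1)) {g \<rho>}"
    "\<And>\<rho> x. x \<in> cube ==> \<bar>g \<rho> x - bump l \<alpha> (cl \<rho>) x\<bar> <= real (CARD('n) * (k + 1)) / ((2 ^ e) ^ T)\<^sup>2" by metis
  have "cmp coords (\<Sum>\<rho>\<in>R. 40 * CARD('n) * (2 ^ e + w)) (4 * (k + 2) * CARD('n) * (T + D + 1)) (\<Union>\<rho>\<in>R. {g \<rho>})"
    by (rule cmp_parallel_family[OF finR _ g(1)]) simp
  then have "cmp coords (\<Sum>\<rho>\<in>R. 40 * CARD('n) * (2 ^ e + w)) (4 * (k + 2) * CARD('n) * (T + D + 1)) {\<lambda>x. \<Sum>\<rho>\<in>R. g \<rho> x}"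
    by (rule cmp_affs) (use finR affs_gen[of "\<Union>\<rho>\<in>R. {g \<rho>}"] in \<open>auto intro!: affs_sum\<close>)
  then have 1: "cmp coords (8 ^ CARD('n) * (40 * CARD('n)) * (2 ^ e + w)) (4 * (k + 2) * CARD('n) * (T + D + 1)) {\<lambda>x. \<Sum>\<rho>\<in>R. g \<rho> x}"
    by (simp add: cardR mult.assoc)
  have "\<bar>(\<Sum>\<rho>\<in>R. g \<rho> x) - bump l \<alpha> S x\<bar> <= real (8 ^ CARD('n) * CARD('n) * (k + 1)) / ((2 ^ e) ^ T)\<^sup>2" if x: "x \<in> cube" for x
  proof -
    have "S = (\<Union>\<rho>\<in>R. cl \<rho>)"
    proof
      show "S \<subseteq> (\<Union>\<rho>\<in>R. cl \<rho>)"
      proof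
        fix i assume "i \<in> S"
        then have "i \<in> cl (\<lambda>m. i m mod 8)" "(\<lambda>m. i m mod 8) \<in> R" by (auto simp: cl_def R_def)
        then show "i \<in> (\<Union>\<rho>\<in>R. cl \<rho>)" by blast
      qed
    qed (auto simp: cl_def)
    then have "bump l \<alpha> S x = bump l \<alpha> (\<Union>\<rho>\<in>R. cl \<rho>) x" by simp
    also have "... = (\<Sum>\<rho>\<in>R. bump l \<alpha> (cl \<rho>) x)"
      unfolding bump_def by (rule sum.UNION_disjoint) (use finR finS in \<open>auto simp: cl_def fun_eq_iff\<close>)
    finally have "\<bar>(\<Sum>\<rho>\<in>R. g \<rho> x) - bump l \<alpha> S x\<bar> = \<bar>\<Sum>\<rho>\<in>R. g \<rho> x - bump l \<alpha> (cl \<rho>) x\<bar>" by (simp add: sum_subtractf)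
    also have "... <= (\<Sum>\<rho>\<in>R. real (CARD('n) * (k + 1)) / ((2 ^ e) ^ T)\<^sup>2)"
      by (rule sum_abs[THEN order_trans]) (intro sum_mono g(2)[OF x])
    also have "... = real (8 ^ CARD('n) * CARD('n) * (k + 1)) / ((2 ^ e) ^ T)\<^sup>2"
      by (simp add: cardR algebra_simps)
    finally show ?thesis .
  qed
  then show ?thesis using 1 by blast
qed

section \<open>Local polynomial reconstruction from cell averages\<close>

subsection \<open>Polynomials dual to averages\<close>

definition lagr :: "nat => nat => real poly" where
  "lagr k r = smult (1 / (\<Prod>i\<in>{..k} - {r}. real r - real i)) (\<Prod>i\<in>{..k} - {r}. [:- real i, 1:])"

lemma degree_lagr: "r <= k ==> degree (lagr k r) <= k"
proof -
  assume "r <= k"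
  have "degree (lagr k r) <= degree (\<Prod>i\<in>{..k} - {r}. [:- real i, 1:])" unfolding lagr_def by (rule degree_smult_le)
  also have "... <= sum (degree \<circ> (\<lambda>i. [:- real i, 1:])) ({..k} - {r})" by (rule degree_prod_sum_le) simp
  also have "... = k" using \<open>r <= k\<close> by simp
  finally show ?thesis .
qed

lemma poly_lagr: "r <= k ==> i <= k ==> poly (lagr k r) (real i) = (if i = r then 1 else 0)"
  by (auto simp: lagr_def poly_prod)

text \<open>The sum of the Lagrange polynomials with \<open>r > j\<close> interpolates the step from
  0 to 1 between \<open>j\<close> and \<open>j + 1\<close> on the nodes 0 to \<open>k\<close>; its
  derivative is the polynomial dual to the average over the cell \<open>[j, j + 1]\<close>.\<close>

definition mu :: "nat => nat => real poly" where
  "mu k j = pderiv (\<Sum>r\<in>{j<..k}. lagr k r)"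

lemma degree_mu: "k \<ge> 1 ==> degree (mu k j) < k"
proof -
  assume "k \<ge> 1"
  have "degree (\<Sum>r\<in>{j<..k}. lagr k r) <= k" by (rule degree_sum_le) (auto intro: degree_lagr)
  then show ?thesis using \<open>k \<ge> 1\<close> by (simp add: mu_def degree_pderiv)
qed

lemma pderiv_sum: "pderiv (sum p A) = (\<Sum>j\<in>A. pderiv (p j))"
  by (induction A rule: infinite_finite_induct) (auto simp: pderiv_add)

text \<open>Interpolation of \<open>Q\<close> at 0 to \<open>k\<close> is exact, and differentiating
  the interpolant gives the claim. Cell averages of a polynomial always appear as increments of an
  antiderivative \<open>Q\<close>, so the algebra stays free of integrals.\<close>

lemma mu_reproduces:
  assumes "degree Q <= k"
  shows "pderiv Q = (\<Sum>j<k. smult (poly Q (real j + 1) - poly Q (real j)) (mu k j))"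
proof -
  let ?M = "\<lambda>j. \<Sum>r\<in>{j<..k}. lagr k r"
  let ?R = "[:poly Q 0:] + (\<Sum>j<k. smult (poly Q (real j + 1) - poly Q (real j)) (?M j))"
  have "Q = ?R"
  proof (rule poly_eqI_degree[of "real ` {..k}"])
    fix x assume "x \<in> real ` {..k}"
    then obtain i where i: "i <= k" "x = real i" by auto
    have M: "poly (?M j) x = (if j < i then 1 else 0)" for j
    proof -
      have "poly (?M j) x = (\<Sum>r\<in>{j<..k}. if r = i then 1 else 0)"
        unfolding poly_sum i(2) by (intro sum.cong) (use i(1) in \<open>auto simp: poly_lagr\<close>)
      then show ?thesis using i(1) by simp
    qed
    have "poly ?R x = poly Q 0 + (\<Sum>j<k. (poly Q (real j + 1) - poly Q (real j)) * poly (?M j) x)"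
      by (simp add: poly_sum)
    also have "... = poly Q 0 + (\<Sum>j<k. if j < i then poly Q (real j + 1) - poly Q (real j) else 0)"
      unfolding M by (simp add: if_distrib cong: if_cong)
    also have "(\<Sum>j<k. if j < i then poly Q (real j + 1) - poly Q (real j) else 0) = (\<Sum>j<i. poly Q (real (Suc j)) - poly Q (real j))"
      using i(1) by (subst sum.inter_filter[symmetric]) (auto intro!: sum.cong simp: add.commute)
    also have "... = poly Q x - poly Q 0" unfolding sum_lessThan_telescope[of "\<lambda>j. poly Q (real j)"] i(2) by simp
    finally show "poly Q x = poly ?R x" by simp
  next
    have c: "card (real ` {..k}) = Suc k" by (simp add: card_image)
    show "card (real ` {..k}) > degree Q" unfolding c using assms by simp
    have "degree ?R <= k"
      by (intro degree_add_le degree_sum_le order_trans[OF degree_smult_le]) (auto intro: degree_lagr)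
    then show "card (real ` {..k}) > degree ?R" unfolding c by simp
  qed
  then have "pderiv Q = pderiv ?R" by simp
  also have "... = (\<Sum>j<k. smult (poly Q (real j + 1) - poly Q (real j)) (mu k j))"
    unfolding pderiv_add mu_def by (simp add: pderiv_sum pderiv_smult)
  finally show ?thesis .
qed

lemma poly_as_sum: "degree p < k ==> poly p (y::real) = (\<Sum>a<k. coeff p a * y ^ a)"
  unfolding poly_altdef by (intro sum.mono_neutral_left) (auto simp: coeff_eq_0)

text \<open>Coefficient of \<open>y ^ \<alpha>\<close> in the dual polynomial of cell
  \<open>t\<close>, for the stencil of \<open>k\<close> cells that starts at
  \<open>\<sigma>\<close>, after the substitution of \<open>o1 + c * y\<close> for the
  variable.\<close>

definition vv :: "nat => real => real => nat => nat => nat => real" where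
  "vv k o1 c \<sigma> \<alpha> t = (if \<sigma> <= t \<and> t < \<sigma> + k then coeff (pcompose (mu k (t - \<sigma>)) [:o1, c:]) \<alpha> else 0)"

text \<open>First cell of the stencil used at node \<open>i\<close>: the cell to the right of the
  node, shifted back near the end so that all \<open>k\<close> cells stay in the grid.\<close>

definition st :: "nat => nat => nat => nat" where
  "st k l i = min i (2 ^ l - k)"

definition Vc :: "nat => nat => nat => nat => nat => real" where
  "Vc k l i \<alpha> t = vv k (real i - real (st k l i)) 1 (st k l i) \<alpha> t"

text \<open>In \<open>Uc\<close> and \<open>Rc\<close> the node \<open>i\<close> and the cell \<open>t\<close> belong to level \<open>l + 1\<close>, the node \<open>i'\<close> to level \<open>l\<close>.\<close>

definition Uc :: "nat => nat => nat => nat => nat => nat => real" where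
  "Uc k l i i' \<alpha> t = vv k (real i / 2 - real (st k l i')) (1/2) (st k l i') \<alpha> (t div 2) / 2"

definition Rc :: "nat => nat => nat => nat => nat => real" where
  "Rc k l i \<alpha> t = (Uc k l i (i div 2) \<alpha> t + Uc k l i ((i + 1) div 2) \<alpha> t) / 2"

text \<open>Weight with which the average over cell \<open>t\<close> enters the one-dimensional
  reconstruction: local polynomials at the nodes, blended by hats.\<close>

definition Phi :: "nat => nat => nat => real => real" where
  "Phi k l t x = (\<Sum>i\<le>2 ^ l. hat (2 ^ l * x - real i) * (\<Sum>\<alpha><k. Vc k l i \<alpha> t * (2 ^ l * x - real i) ^ \<alpha>))"

lemma vv_poly:
  assumes "k \<ge> 1"
  shows "(\<Sum>\<alpha><k. vv k o1 c \<sigma> \<alpha> t * y ^ \<alpha>) = (if \<sigma> <= t \<and> t < \<sigma> + k then poly (mu k (t - \<sigma>)) (o1 + y * c) else 0)"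
proof -
  have "degree (pcompose (mu k j) [:o1, c:]) < k" for j
  proof -
    have "degree (mu k j) * degree [:o1, c:] <= degree (mu k j) * 1" by (rule mult_le_mono2) simp
    then show ?thesis using degree_pcompose_le[of "mu k j" "[:o1, c:]"] degree_mu[OF assms, of j] by linarith
  qed
  note * = poly_as_sum[OF this, of _ y]
  show ?thesis
  proof (cases "\<sigma> <= t \<and> t < \<sigma> + k")
    case True then show ?thesis using *[of "t - \<sigma>"] by (simp add: vv_def poly_pcompose)
  next
    case False then show ?thesis unfolding vv_def if_not_P[OF False] by simp
  qed
qed

lemma hat_sum:
  fixes h :: "nat => real"
  assumes "c + 1 <= n" "real c <= X" "X <= real c + 1"
  shows "(\<Sum>i\<le>n. hat (X - real i) * h i) = (1 - (X - real c)) * h c + (X - real c) * h (c + 1)"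
proof -
  have "(\<Sum>i\<le>n. hat (X - real i) * h i) = (\<Sum>i\<in>{c, c + 1}. hat (X - real i) * h i)"
  proof (rule sum.mono_neutral_right)
    show "\<forall>i\<in>{..n} - {c, c + 1}. hat (X - real i) * h i = 0"
    proof
      fix i assume "i \<in> {..n} - {c, c + 1}"
      then have "i < c \<or> i > c + 1" by auto
      then have "\<bar>X - real i\<bar> \<ge> 1" using assms by auto
      then show "hat (X - real i) * h i = 0" using hat_eq_0_iff by simp
    qed
  qed (use assms in auto)
  also have "... = hat (X - real c) * h c + hat (X - real (c + 1)) * h (c + 1)" by simp
  also have "... = (1 - (X - real c)) * h c + (X - real c) * h (c + 1)"
    using assms by (auto simp: hat_def relu_def)
  finally show ?thesis .
qed

lemma cell_exists:
  assumes "0 <= X" "X <= real n" "n \<ge> 1"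
  shows "\<exists>c. c + 1 <= n \<and> real c <= X \<and> X <= real c + 1"
proof (cases "X = real n")
  case True then show ?thesis using assms by (intro exI[of _ "n - 1"]) auto
next
  case False
  define c where "c = nat \<lfloor>X\<rfloor>"
  have "real c = of_int \<lfloor>X\<rfloor>" using assms by (simp add: c_def)
  then have c: "real c <= X" "X < real c + 1" by linarith+
  then have "real c < real n" using assms False by linarith
  then show ?thesis using c by (intro exI[of _ c]) auto
qed

text \<open>A piecewise linear function on the coarse grid is its own interpolant on the fine grid,
  and at a fine node its value is the mean of those at the two parents, which coincide for even
  \<open>i\<close>. The identity is pointwise in \<open>x\<close>, so the numbers \<open>h i\<close>
  may themselves depend on \<open>x\<close>.\<close>

lemma hat_refine:
  fixes h :: "nat => real"
  assumes "0 <= x" "x <= 1"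
  shows "(\<Sum>i\<le>2 ^ l. hat (2 ^ l * x - real i) * h i) =
    (\<Sum>i\<le>2 ^ Suc l. hat (2 ^ Suc l * x - real i) * ((h (i div 2) + h ((i + 1) div 2)) / 2))"
proof -
  let ?X = "2 ^ Suc l * x"
  have "0 <= ?X" "?X <= real (2 ^ Suc l)" using assms mult_left_mono[of x 1 "2 ^ Suc l"] by auto
  then obtain c where c: "c + 1 <= 2 ^ Suc l" "real c <= ?X" "?X <= real c + 1" using cell_exists[of ?X "2 ^ Suc l"] by auto
  have R: "(\<Sum>i\<le>2 ^ Suc l. hat (?X - real i) * ((h (i div 2) + h ((i + 1) div 2)) / 2)) =
     (1 - (?X - real c)) * ((h (c div 2) + h ((c + 1) div 2)) / 2) + (?X - real c) * ((h ((c + 1) div 2) + h ((c + 1 + 1) div 2)) / 2)"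
    by (rule hat_sum[OF c])
  define b where "b = c div 2"
  have b: "b + 1 <= 2 ^ l" "real b <= 2 ^ l * x" "2 ^ l * x <= real b + 1"
  proof -
    have bc: "2 * b <= c" "c <= 2 * b + 1" by (auto simp: b_def)
    then have "real (2 * b) <= real c" "real c <= real (2 * b + 1)" by (simp_all only: of_nat_le_iff)
    moreover have "?X = 2 * (2 ^ l * x)" by simp
    ultimately show "real b <= 2 ^ l * x" "2 ^ l * x <= real b + 1"
      using c(2,3) unfolding of_nat_mult of_nat_add by simp_all
    show "b + 1 <= 2 ^ l" using c(1) bc by simp
  qed
  have L: "(\<Sum>i\<le>2 ^ l. hat (2 ^ l * x - real i) * h i) = (1 - (2 ^ l * x - real b)) * h b + (2 ^ l * x - real b) * h (b + 1)"
    by (rule hat_sum[OF b])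
  show ?thesis
  proof (cases "even c")
    case True
    then have "c = 2 * b" by (simp add: b_def)
    then show ?thesis unfolding L R by (simp add: field_simps)
  next
    case False
    then have "c = 2 * b + 1" by (simp add: b_def)
    then show ?thesis unfolding L R by (simp add: field_simps)
  qed
qed

text \<open>The parents' polynomials are expanded anew at the fine node. This gives the coarse
  reconstruction the shape of the fine one, so their difference can be formed coefficient by
  coefficient. The factor 1/2 comes from a coarse average being the mean of fine averages.\<close>

lemma Phi_refine:
  assumes k: "k \<ge> 1" and x: "0 <= x" "x <= 1"
  shows "Phi k l (t div 2) x / 2 =
    (\<Sum>i\<le>2 ^ Suc l. hat (2 ^ Suc l * x - real i) * (\<Sum>\<alpha><k. Rc k l i \<alpha> t * (2 ^ Suc l * x - real i) ^ \<alpha>))"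
proof -
  define h where "h i = (if st k l i <= t div 2 \<and> t div 2 < st k l i + k then poly (mu k (t div 2 - st k l i)) (2 ^ l * x - real (st k l i)) else 0)" for i
  have 1: "(\<Sum>\<alpha><k. Vc k l i \<alpha> (t div 2) * (2 ^ l * x - real i) ^ \<alpha>) = h i" for i
    unfolding Vc_def vv_poly[OF k] h_def by simp
  have 2: "(\<Sum>\<alpha><k. Uc k l i i' \<alpha> t * (2 ^ Suc l * x - real i) ^ \<alpha>) = h i' / 2" for i i'
  proof -
    have 0: "(\<Sum>\<alpha><k. Uc k l i i' \<alpha> t * (2 ^ Suc l * x - real i) ^ \<alpha>) =
       (\<Sum>\<alpha><k. vv k (real i / 2 - real (st k l i')) (1/2) (st k l i') \<alpha> (t div 2) * (2 ^ Suc l * x - real i) ^ \<alpha>) / 2"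
      unfolding Uc_def sum_divide_distrib by simp
    have "real i / 2 - real (st k l i') + (2 ^ Suc l * x - real i) * (1 / 2) = 2 ^ l * x - real (st k l i')"
      by (simp add: field_simps)
    then have "(\<Sum>\<alpha><k. vv k (real i / 2 - real (st k l i')) (1/2) (st k l i') \<alpha> (t div 2) * (2 ^ Suc l * x - real i) ^ \<alpha>) / 2 = h i' / 2"
      unfolding vv_poly[OF k] h_def by (simp only:)
    with 0 show ?thesis by simp
  qed
  have 3: "(\<Sum>\<alpha><k. Rc k l i \<alpha> t * (2 ^ Suc l * x - real i) ^ \<alpha>) = (h (i div 2) / 2 + h ((i + 1) div 2) / 2) / 2" for i
    unfolding 2[of i "i div 2", symmetric] 2[of i "(i + 1) div 2", symmetric] Rc_def
    by (subst sum.distrib[symmetric], subst sum_divide_distrib, intro sum.cong refl) (simp add: field_simps)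
  have "Phi k l (t div 2) x / 2 = (\<Sum>i\<le>2 ^ l. hat (2 ^ l * x - real i) * (h i / 2))"
    unfolding Phi_def 1 by (simp add: sum_divide_distrib)
  also have "... = (\<Sum>i\<le>2 ^ Suc l. hat (2 ^ Suc l * x - real i) * ((h (i div 2) / 2 + h ((i + 1) div 2) / 2) / 2))"
    by (rule hat_refine[OF x])
  finally show ?thesis unfolding 3 .
qed

lemma stencil_bounds: "k <= 2 ^ l ==> i <= 2 ^ l ==> st k l i <= i \<and> i <= st k l i + k \<and> st k l i + k <= 2 ^ l"
  by (auto simp: st_def min_def)

abbreviation coeff_bounded :: "nat => real => bool" where
  "coeff_bounded k C \<equiv> \<forall>j<k. \<forall>z\<in>{-1..2 * int k + 1}. \<forall>c\<in>{1, 1/2}. \<forall>\<alpha><k. \<bar>coeff (pcompose (mu k j) [:of_int z / 2, c:]) \<alpha>\<bar> <= C"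

text \<open>Relative to the stencil a node has only finitely many positions, the half integers from
  -1/2 to \<open>k + 1/2\<close>, and there are only two scales. Hence one constant serves all
  levels, nodes and cells.\<close>

lemma coeff_bound_ex: "\<exists>C\<ge>1. coeff_bounded k C"
proof -
  let ?S = "(\<lambda>(j, z, c, \<alpha>). \<bar>coeff (pcompose (mu k j) [:of_int z / 2, c:]) \<alpha>\<bar>) ` ({..<k} \<times> {-1..2 * int k + 1} \<times> {1, 1/2} \<times> {..<k})"
  have fin: "finite (insert 1 ?S)" by simp
  show ?thesis
  proof (intro exI[of _ "Max (insert 1 ?S)"] conjI allI impI ballI)
    show "1 <= Max (insert 1 ?S)" by (rule Max_ge[OF fin]) simp
    fix j z c \<alpha> assume "j < k" "z \<in> {-1..2 * int k + 1}" "c \<in> {1, 1/2 :: real}" "\<alpha> < k"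
    then have "\<bar>coeff (pcompose (mu k j) [:of_int z / 2, c:]) \<alpha>\<bar> \<in> ?S"
      by (intro image_eqI[of _ _ "(j, z, c, \<alpha>)"]) auto
    then show "\<bar>coeff (pcompose (mu k j) [:of_int z / 2, c:]) \<alpha>\<bar> <= Max (insert 1 ?S)" by (intro Max_ge[OF fin]) simp
  qed
qed

lemma vv_bound:
  assumes C: "coeff_bounded k C" "C \<ge> 1"
    and "z \<in> {-1..2 * int k + 1}" "c \<in> {1, 1/2}" "\<alpha> < k"
  shows "\<bar>vv k (of_int z / 2) c \<sigma> \<alpha> t\<bar> <= C"
proof (cases "\<sigma> <= t \<and> t < \<sigma> + k")
  case True
  then have "t - \<sigma> < k" by auto
  then show ?thesis using True C(1)[rule_format, OF _ assms(3-5), of "t - \<sigma>"] by (simp add: vv_def)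
qed (use C in \<open>auto simp: vv_def\<close>)

lemma Vc_bound:
  assumes C: "coeff_bounded k C" "C \<ge> 1"
    and k: "k <= 2 ^ l" "i <= 2 ^ l" "\<alpha> < k"
  shows "\<bar>Vc k l i \<alpha> t\<bar> <= C" "Vc k l i \<alpha> t \<noteq> 0 ==> t < 2 ^ l \<and> t <= i + (2 * k + 1) \<and> i <= t + (2 * k + 1)"
proof -
  note s = stencil_bounds[OF k(1,2)]
  have eq: "real i - real (st k l i) = of_int (2 * (int i - int (st k l i))) / 2" by simp
  show "\<bar>Vc k l i \<alpha> t\<bar> <= C" unfolding Vc_def eq
    by (rule vv_bound[OF C]) (use s k(3) in auto)
  assume "Vc k l i \<alpha> t \<noteq> 0"
  then have "st k l i <= t \<and> t < st k l i + k" by (auto simp: Vc_def vv_def split: if_splits)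
  then show "t < 2 ^ l \<and> t <= i + (2 * k + 1) \<and> i <= t + (2 * k + 1)" using s by auto
qed

lemma Rc_bound:
  assumes C: "coeff_bounded k C" "C \<ge> 1"
    and k: "k <= 2 ^ l" "i <= 2 ^ Suc l" "\<alpha> < k"
  shows "\<bar>Rc k l i \<alpha> t\<bar> <= C" "Rc k l i \<alpha> t \<noteq> 0 ==> t < 2 ^ Suc l \<and> t <= i + (2 * k + 1) \<and> i <= t + (2 * k + 1)"
proof -
  have U: "\<bar>Uc k l i i' \<alpha> t\<bar> <= C / 2 \<and> (Uc k l i i' \<alpha> t \<noteq> 0 --> t < 2 ^ Suc l \<and> t <= i + (2 * k + 1) \<and> i <= t + (2 * k + 1))"
    if i': "i' = i div 2 \<or> i' = (i + 1) div 2" for i'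
  proof -
    have i2: "2 * i' <= i + 1" "i <= 2 * i' + 1" "i' <= 2 ^ l" using i' k(2) by auto
    note s = stencil_bounds[OF k(1) i2(3)]
    have eq: "real i / 2 - real (st k l i') = of_int (int i - 2 * int (st k l i')) / 2" by simp
    have "\<bar>vv k (real i / 2 - real (st k l i')) (1/2) (st k l i') \<alpha> (t div 2)\<bar> <= C" unfolding eq
      by (rule vv_bound[OF C]) (use s i2 k(3) in auto)
    then have 1: "\<bar>Uc k l i i' \<alpha> t\<bar> <= C / 2" unfolding Uc_def by (simp add: abs_divide)
    have 2: "t < 2 ^ Suc l \<and> t <= i + (2 * k + 1) \<and> i <= t + (2 * k + 1)" if "Uc k l i i' \<alpha> t \<noteq> 0"
    proof -
      have "st k l i' <= t div 2 \<and> t div 2 < st k l i' + k" using that by (auto simp: Uc_def vv_def split: if_splits)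
      then have t: "2 * st k l i' <= t" "t + 1 <= 2 * (st k l i' + k)" by auto
      have s': "st k l i' <= i'" "i' <= st k l i' + k" "st k l i' + k <= 2 ^ l" using s by auto
      have "t < 2 ^ Suc l" using t(2) s'(3) by simp
      moreover have "t <= i + (2 * k + 1)" "i <= t + (2 * k + 1)" using t s'(1,2) i2(1,2) by auto
      ultimately show ?thesis by blast
    qed
    show ?thesis using 1 2 by blast
  qed
  show "\<bar>Rc k l i \<alpha> t\<bar> <= C" unfolding Rc_def using U[of "i div 2"] U[of "(i + 1) div 2"] C(2) by auto
  assume "Rc k l i \<alpha> t \<noteq> 0"
  then have "Uc k l i (i div 2) \<alpha> t \<noteq> 0 \<or> Uc k l i ((i + 1) div 2) \<alpha> t \<noteq> 0" by (auto simp: Rc_def)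
  then show "t < 2 ^ Suc l \<and> t <= i + (2 * k + 1) \<and> i <= t + (2 * k + 1)" using U[of "i div 2"] U[of "(i + 1) div 2"] by blast
qed

section \<open>Polynomial reproduction within a level and across levels\<close>

lemma coeff_sum_smult: "coeff (\<Sum>j\<in>A. smult (a j) (p j)) n = (\<Sum>j\<in>A. a j * coeff (p j) n)"
  by (induction A rule: infinite_finite_induct) auto

lemma pcompose_sum_smult: "pcompose (\<Sum>j\<in>A. smult (a j) (p j)) q = (\<Sum>j\<in>A. smult (a j) (pcompose (p j) q))"
  by (induction A rule: infinite_finite_induct) (auto simp: pcompose_add pcompose_smult)

lemma sum_stencil:
  fixes f :: "nat => real"
  assumes "\<sigma> + k <= n"
  shows "(\<Sum>t<n. (if \<sigma> <= t \<and> t < \<sigma> + k then f t else 0)) = (\<Sum>j<k. f (\<sigma> + j))"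
proof -
  have "(\<Sum>t<n. (if \<sigma> <= t \<and> t < \<sigma> + k then f t else 0)) = (\<Sum>t\<in>{t\<in>{..<n}. \<sigma> <= t \<and> t < \<sigma> + k}. f t)"
    by (rule sum.inter_filter[symmetric]) simp
  also have "... = (\<Sum>j<k. f (\<sigma> + j))"
    by (rule sum.reindex_bij_witness[of _ "\<lambda>j. \<sigma> + j" "\<lambda>t. t - \<sigma>"]) (use assms in auto)
  finally show ?thesis .
qed

lemma Vc_reproduces:
  assumes k: "k <= 2 ^ l" "i <= 2 ^ l" and Q: "degree Q <= k"
  shows "(\<Sum>t<2 ^ l. Vc k l i \<alpha> t * (poly Q (real t + 1) - poly Q (real t))) = coeff (pcompose (pderiv Q) [:real i, 1:]) \<alpha>"
proof -
  let ?s = "st k l i"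
  let ?Q = "pcompose Q [:real ?s, 1:]"
  have dQ: "degree ?Q <= k" using Q by (simp add: degree_pcompose)
  have "pcompose (pderiv ?Q) [:real i - real ?s, 1:] = pcompose (pderiv Q) [:real i, 1:]"
    by (intro poly_eq_poly_eq_iff[THEN iffD1] ext) (simp add: pderiv_pcompose poly_pcompose pderiv_pCons algebra_simps)
  also have "pderiv ?Q = (\<Sum>j<k. smult (poly ?Q (real j + 1) - poly ?Q (real j)) (mu k j))" by (rule mu_reproduces[OF dQ])
  finally have E: "pcompose (\<Sum>j<k. smult (poly ?Q (real j + 1) - poly ?Q (real j)) (mu k j)) [:real i - real ?s, 1:] = pcompose (pderiv Q) [:real i, 1:]" .
  have "coeff (pcompose (pderiv Q) [:real i, 1:]) \<alpha> =
     (\<Sum>j<k. (poly ?Q (real j + 1) - poly ?Q (real j)) * coeff (pcompose (mu k j) [:real i - real ?s, 1:]) \<alpha>)"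
    unfolding E[symmetric] pcompose_sum_smult coeff_sum_smult ..
  also have "... = (\<Sum>t<2 ^ l. (if ?s <= t \<and> t < ?s + k then (poly Q (real t + 1) - poly Q (real t)) * coeff (pcompose (mu k (t - ?s)) [:real i - real ?s, 1:]) \<alpha> else 0))"
    using stencil_bounds[OF k] by (subst sum_stencil) (auto simp: poly_pcompose add_ac)
  also have "... = (\<Sum>t<2 ^ l. Vc k l i \<alpha> t * (poly Q (real t + 1) - poly Q (real t)))"
    by (intro sum.cong) (auto simp: Vc_def vv_def)
  finally show ?thesis by simp
qed

lemma sum_pairs: "(\<Sum>t<2 * n. f t) = (\<Sum>t<n. f (2 * t) + f (2 * t + 1 :: nat))" for f :: "nat => real"
  by (induction n) (auto simp: algebra_simps)

lemma Uc_reproduces: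
  assumes k: "k <= 2 ^ l" "i' <= 2 ^ l" and Q: "degree Q <= k"
  shows "(\<Sum>t<2 ^ Suc l. Uc k l i i' \<alpha> t * (poly Q (real t + 1) - poly Q (real t))) = coeff (pcompose (pderiv Q) [:real i, 1:]) \<alpha>"
proof -
  let ?s = "st k l i'"
  let ?Q = "pcompose Q [:2 * real ?s, 2:]"
  have dQ: "degree ?Q <= k" using Q by (simp add: degree_pcompose)
  have "pcompose (pderiv ?Q) [:real i / 2 - real ?s, 1/2:] = smult 2 (pcompose (pderiv Q) [:real i, 1:])"
    by (intro poly_eq_poly_eq_iff[THEN iffD1] ext) (simp add: pderiv_pcompose poly_pcompose pderiv_pCons algebra_simps)
  also have "pderiv ?Q = (\<Sum>j<k. smult (poly ?Q (real j + 1) - poly ?Q (real j)) (mu k j))" by (rule mu_reproduces[OF dQ])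
  finally have E: "pcompose (\<Sum>j<k. smult (poly ?Q (real j + 1) - poly ?Q (real j)) (mu k j)) [:real i / 2 - real ?s, 1/2:] = smult 2 (pcompose (pderiv Q) [:real i, 1:])" .
  have "2 * coeff (pcompose (pderiv Q) [:real i, 1:]) \<alpha> = coeff (smult 2 (pcompose (pderiv Q) [:real i, 1:])) \<alpha>" by simp
  also have "... = (\<Sum>j<k. (poly ?Q (real j + 1) - poly ?Q (real j)) * coeff (pcompose (mu k j) [:real i / 2 - real ?s, 1/2:]) \<alpha>)"
    unfolding E[symmetric] pcompose_sum_smult coeff_sum_smult ..
  finally have *: "2 * coeff (pcompose (pderiv Q) [:real i, 1:]) \<alpha> =
     (\<Sum>j<k. (poly ?Q (real j + 1) - poly ?Q (real j)) * coeff (pcompose (mu k j) [:real i / 2 - real ?s, 1/2:]) \<alpha>)" .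
  have "(\<Sum>t<2 ^ Suc l. Uc k l i i' \<alpha> t * (poly Q (real t + 1) - poly Q (real t)))
     = (\<Sum>t<2 ^ l. vv k (real i / 2 - real ?s) (1/2) ?s \<alpha> t / 2 * (poly Q (2 * real t + 2) - poly Q (2 * real t)))"
    unfolding power_Suc sum_pairs by (intro sum.cong refl) (simp add: Uc_def field_simps)
  also have "... = (\<Sum>t<2 ^ l. (if ?s <= t \<and> t < ?s + k then (poly Q (2 * real t + 2) - poly Q (2 * real t)) * coeff (pcompose (mu k (t - ?s)) [:real i / 2 - real ?s, 1/2:]) \<alpha> / 2 else 0))"
    by (intro sum.cong) (auto simp: vv_def)
  also have "... = (\<Sum>j<k. (poly ?Q (real j + 1) - poly ?Q (real j)) * coeff (pcompose (mu k j) [:real i / 2 - real ?s, 1/2:]) \<alpha>) / 2"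
    using stencil_bounds[OF k] by (subst sum_stencil) (auto simp: poly_pcompose algebra_simps sum_divide_distrib)
  finally show ?thesis unfolding *[symmetric] by simp
qed

text \<open>Both functionals recover the same coefficient of a polynomial of degree below
  \<open>k\<close> from its averages, so their difference kills such polynomials. This is where
  every gain from smoothness originates.\<close>

lemma Vc_Rc_annihilate:
  assumes k: "k <= 2 ^ l" "i <= 2 ^ Suc l" and Q: "degree Q <= k"
  shows "(\<Sum>t<2 ^ Suc l. (Vc k (Suc l) i \<alpha> t - Rc k l i \<alpha> t) * (poly Q (real t + 1) - poly Q (real t))) = 0"
proof -
  let ?c = "coeff (pcompose (pderiv Q) [:real i, 1:]) \<alpha>" and ?q = "\<lambda>t. poly Q (real t + 1) - poly Q (real t)"
  have U: "(\<Sum>t<2 ^ Suc l. Uc k l i (i div 2) \<alpha> t * ?q t) = ?c" "(\<Sum>t<2 ^ Suc l. Uc k l i ((i + 1) div 2) \<alpha> t * ?q t) = ?c"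
    using k by (intro Uc_reproduces Q; auto)+
  have V: "(\<Sum>t<2 ^ Suc l. Vc k (Suc l) i \<alpha> t * ?q t) = ?c"
    using k by (intro Vc_reproduces Q) auto
  have "(\<Sum>t<2 ^ Suc l. (Vc k (Suc l) i \<alpha> t - Rc k l i \<alpha> t) * ?q t) = (\<Sum>t<2 ^ Suc l. Vc k (Suc l) i \<alpha> t * ?q t)
     - ((\<Sum>t<2 ^ Suc l. Uc k l i (i div 2) \<alpha> t * ?q t) + (\<Sum>t<2 ^ Suc l. Uc k l i ((i + 1) div 2) \<alpha> t * ?q t)) / 2"
    unfolding Rc_def by (simp add: sum_subtractf sum.distrib sum_divide_distrib algebra_simps add_divide_distrib diff_divide_distrib)
  then show ?thesis unfolding U V by simp
qed

subsection \<open>Summation by parts\<close>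

text \<open>The partial sums of a sequence of total 0 vanish beyond its support, so no boundary term
  remains and the support becomes shorter by one.\<close>

lemma sum_by_parts_step:
  fixes v a :: "nat => real"
  assumes supp: "\<And>t. v t \<noteq> 0 ==> e <= t \<and> t < e + K" and 0: "(\<Sum>t<n. v t) = 0" and n: "e + K <= n"
  defines "w \<equiv> \<lambda>t. \<Sum>s\<le>t. v s"
  shows "\<And>t. w t \<noteq> 0 ==> e <= t \<and> t < e + (K - 1)" "(\<Sum>t<n. v t * a t) = (\<Sum>t<n. w t * (a t - a (Suc t)))"
proof -
  have w0: "w t = 0" if "t + 1 \<ge> e + K" for t
  proof -
    have "w t = (\<Sum>s<n. v s)"
    proof (cases "t + 1 <= n")
      case True
      have "w t = (\<Sum>s\<in>{..t}. v s)" by (simp add: w_def)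
      also have "... = (\<Sum>s<n. v s)" by (rule sum.mono_neutral_left) (use True that supp in \<open>auto simp: not_le, fastforce\<close>)
      finally show ?thesis .
    next
      case False
      have "(\<Sum>s<n. v s) = (\<Sum>s\<in>{..t}. v s)" by (rule sum.mono_neutral_left) (use False n supp in \<open>auto simp: not_le, fastforce\<close>)
      then show ?thesis by (simp add: w_def)
    qed
    then show ?thesis using 0 by simp
  qed
  have w1: "w t = 0" if "t < e" for t unfolding w_def by (rule sum.neutral) (use supp that in force)
  show "\<And>t. w t \<noteq> 0 ==> e <= t \<and> t < e + (K - 1)" using w0 w1 by (metis add_diff_assoc le_add_diff_inverse2 less_diff_conv not_le not_less_eq_eq Suc_eq_plus1 add.commute diff_is_0_eq' add_0_right leI less_imp_le_nat)
  have "(\<Sum>t<m. v t * a t) = (\<Sum>t<m. w t * (a t - a (Suc t))) + (\<Sum>t<m. v t) * a m" for m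
    by (induction m) (auto simp: w_def lessThan_Suc_atMost[symmetric] algebra_simps)
  then show "(\<Sum>t<n. v t * a t) = (\<Sum>t<n. w t * (a t - a (Suc t)))" using 0 by simp
qed

text \<open>Sign convention of \<open>fdiff\<close>: for \<open>k = 1\<close> this is
  \<open>a t - a (t + 1)\<close>.\<close>

definition fd :: "nat => (nat => real) => nat => real" where
  "fd k a t = (\<Sum>j\<le>k. (-1) ^ j * real (k choose j) * a (t + j))"

lemma fd_Suc: "fd (Suc k) a t = fd k (\<lambda>t. a t - a (Suc t)) t"
proof -
  have "fd (Suc k) a t = a t + (\<Sum>j\<le>k. (-1) ^ Suc j * real (Suc k choose Suc j) * a (t + Suc j))"
    unfolding fd_def by (subst sum.atMost_Suc_shift) simp
  also have "(\<Sum>j\<le>k. (-1) ^ Suc j * real (Suc k choose Suc j) * a (t + Suc j)) =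
      (\<Sum>j\<le>k. (-1) ^ Suc j * real (k choose j) * a (t + Suc j)) + (\<Sum>j\<le>k. (-1) ^ Suc j * real (k choose Suc j) * a (t + Suc j))"
    unfolding sum.distrib[symmetric] by (intro sum.cong) (auto simp: algebra_simps)
  also have "(\<Sum>j\<le>k. (-1) ^ Suc j * real (k choose Suc j) * a (t + Suc j)) = (\<Sum>j\<le>Suc k. (-1) ^ j * real (k choose j) * a (t + j)) - a t"
    by (subst sum.atMost_Suc_shift) simp
  also have "(\<Sum>j\<le>Suc k. (-1) ^ j * real (k choose j) * a (t + j)) = fd k a t" by (simp add: fd_def)
  also have "(\<Sum>j\<le>k. (-1) ^ Suc j * real (k choose j) * a (t + Suc j)) = - fd k (\<lambda>t. a (Suc t)) t"
    by (simp add: fd_def sum_negf)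
  finally have "fd (Suc k) a t = fd k a t - fd k (\<lambda>t. a (Suc t)) t" by simp
  then show ?thesis by (simp add: fd_def sum_subtractf right_diff_distrib)
qed

text \<open>A discrete Peano kernel: \<open>m\<close> vanishing moments permit \<open>m\<close>
  summations by parts. Moments are taken against binomials because Pascal's rule makes a summation
  by parts lower \<open>j\<close> by one. Each step costs at most a factor \<open>K\<close> in size
  and one unit of support.\<close>

lemma functional_as_difference:
  fixes v :: "nat => real"
  assumes supp: "\<And>t. v t \<noteq> 0 ==> e <= t \<and> t < e + K" and n: "e + K <= n"
    and 0: "\<And>j. j < m ==> (\<Sum>t<n. v t * real ((t - e) choose j)) = 0"
    and B: "\<And>t. \<bar>v t\<bar> <= B" "B \<ge> 0"
  shows "\<exists>G. (\<forall>t. G t \<noteq> 0 --> e <= t \<and> t < e + (K - m)) \<and> (\<forall>t. \<bar>G t\<bar> <= real K ^ m * B) \<and>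
    (\<forall>a. (\<Sum>t<n. v t * a t) = (\<Sum>t<n. G t * fd m a t))"
  using assms
proof (induction m arbitrary: v K B)
  case 0
  then show ?case by (intro exI[of _ v]) (auto simp: fd_def)
next
  case (Suc m)
  define w where "w t = (\<Sum>s\<le>t. v s)" for t
  have s0: "(\<Sum>t<n. v t) = 0" using Suc.prems(3)[of 0] by simp
  note S = sum_by_parts_step[of v e K n, OF Suc.prems(1) s0 Suc.prems(2), folded w_def]
  have "(\<Sum>t<n. w t * real ((t - e) choose j)) = 0" if "j < m" for j
  proof -
    have "(\<Sum>t<n. w t * real ((t - e) choose j)) = - (\<Sum>t<n. w t * (real ((t - e) choose Suc j) - real ((Suc t - e) choose Suc j)))"
      unfolding sum_negf[symmetric]
    proof (intro sum.cong refl)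
      fix t
      show "w t * real ((t - e) choose j) = - (w t * (real ((t - e) choose Suc j) - real ((Suc t - e) choose Suc j)))"
      \<comment> \<open>Where \<open>w t\<close> is nonzero, \<open>t\<close> is at least
        \<open>e\<close> and the truncated subtraction is a true one.\<close>
      proof (cases "w t = 0")
        case False
        then have "Suc t - e = Suc (t - e)" using S(1)[of t] by auto
        then show ?thesis by (simp add: algebra_simps)
      qed simp
    qed
    also have "(\<Sum>t<n. w t * (real ((t - e) choose Suc j) - real ((Suc t - e) choose Suc j))) = (\<Sum>t<n. v t * real ((t - e) choose Suc j))"
      by (rule S(2)[symmetric])
    also have "... = 0" using Suc.prems(3)[of "Suc j"] that by simp
    finally show ?thesis by simp
  qed
  moreover have "\<bar>w t\<bar> <= real K * B" for t
  proof -
    have "\<bar>w t\<bar> <= (\<Sum>s\<le>t. \<bar>v s\<bar>)" unfolding w_def by (rule sum_abs)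
    also have "... = (\<Sum>s\<in>{..t} \<inter> {e..<e + K}. \<bar>v s\<bar>)"
    proof (rule sum.mono_neutral_right)
      have "v s = 0" if "\<not> (e <= s \<and> s < e + K)" for s using Suc.prems(1)[of s] that by blast
      then show "\<forall>s\<in>{..t} - {..t} \<inter> {e..<e + K}. \<bar>v s\<bar> = 0" by auto
    qed auto
    also have "... <= (\<Sum>s\<in>{e..<e + K}. \<bar>v s\<bar>)" by (rule sum_mono2) auto
    also have "... <= (\<Sum>s\<in>{e..<e + K}. B)" by (intro sum_mono Suc.prems)
    finally show ?thesis by simp
  qed
  ultimately have "\<exists>G. (\<forall>t. G t \<noteq> 0 --> e <= t \<and> t < e + (K - 1 - m)) \<and> (\<forall>t. \<bar>G t\<bar> <= real (K - 1) ^ m * (real K * B)) \<and>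
    (\<forall>a. (\<Sum>t<n. w t * a t) = (\<Sum>t<n. G t * fd m a t))"
    using Suc.prems(2,5) by (intro Suc.IH S(1)) auto
  then obtain G where G: "\<And>t. G t \<noteq> 0 ==> e <= t \<and> t < e + (K - 1 - m)" "\<And>t. \<bar>G t\<bar> <= real (K - 1) ^ m * (real K * B)"
    "\<And>a. (\<Sum>t<n. w t * a t) = (\<Sum>t<n. G t * fd m a t)" by blast
  have "\<bar>G t\<bar> <= real K ^ Suc m * B" for t
  proof -
    have "real (K - 1) ^ m * (real K * B) <= real K ^ m * (real K * B)" using Suc.prems(5) by (intro mult_right_mono power_mono) auto
    then show ?thesis using G(2)[of t] by (simp add: mult_ac)
  qed
  moreover have "(\<Sum>t<n. v t * a t) = (\<Sum>t<n. G t * fd (Suc m) a t)" for a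
  proof -
    have "(\<Sum>t<n. v t * a t) = (\<Sum>t<n. w t * (a t - a (Suc t)))" by (rule S(2))
    also have "... = (\<Sum>t<n. G t * fd m (\<lambda>t. a t - a (Suc t)) t)" by (rule G(3))
    finally show ?thesis by (simp add: fd_Suc)
  qed
  ultimately show ?case using G(1) by (intro exI[of _ G]) (auto simp: diff_diff_left)
qed

text \<open>A binomial is the increment of a polynomial of one degree more, namely the next
  binomial; this is the form in which \<open>Vc_Rc_annihilate\<close> delivers vanishing
  moments.\<close>

lemma binomial_poly: "\<exists>Q::real poly. degree Q <= Suc j \<and> (\<forall>t\<ge>e. poly Q (real t + 1) - poly Q (real t) = real ((t - e) choose j))"
proof -
  let ?Q = "smult (1 / fact (Suc j)) (\<Prod>i\<in>{0..<Suc j}. [:- real e - real i, 1:])"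
  have "degree ?Q <= sum (degree \<circ> (\<lambda>i. [:- real e - real i, 1:])) {0..<Suc j}"
    by (rule order_trans[OF degree_smult_le degree_prod_sum_le]) simp
  then have d: "degree ?Q <= Suc j" by simp
  have P: "poly ?Q (real t) = real ((t - e) choose Suc j)" if "t \<ge> e" for t
  proof -
    have "poly ?Q (real t) = 1 / fact (Suc j) * (\<Prod>i\<in>{0..<Suc j}. poly [:- real e - real i, 1:] (real t))"
      by (simp only: poly_smult poly_prod)
    also have "(\<Prod>i\<in>{0..<Suc j}. poly [:- real e - real i, 1:] (real t)) = (\<Prod>i\<in>{0..<Suc j}. real (t - e) - real i)"
      using that by (intro prod.cong) (auto simp: of_nat_diff)
    also have "1 / fact (Suc j) * \<dots> = real ((t - e) choose Suc j)"
      unfolding binomial_gbinomial gbinomial_prod_rev by (simp only: times_divide_eq_left mult_1_left)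
    finally show ?thesis .
  qed
  have "poly ?Q (real t + 1) - poly ?Q (real t) = real ((t - e) choose j)" if "t \<ge> e" for t
  proof -
    have "poly ?Q (real t + 1) = real ((Suc t - e) choose Suc j)" using P[of "Suc t"] that by (simp add: add.commute)
    then show ?thesis using P[OF that] that by (simp add: Suc_diff_le)
  qed
  then show ?thesis using d by blast
qed

lemma Vc_Rc_difference:
  assumes k: "k \<ge> 1"
  shows "\<exists>C\<ge>1. \<forall>l (i::nat) \<alpha>. k <= 2 ^ l --> i <= 2 ^ Suc l --> \<alpha> < k -->
    (\<exists>G. (\<forall>t. \<bar>G t\<bar> <= C) \<and> (\<forall>t. G t \<noteq> 0 --> t + k < 2 ^ Suc l \<and> t <= i + (4 * k + 3) \<and> i <= t + (4 * k + 3)) \<and>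
      (\<forall>a. (\<Sum>t<2 ^ Suc l. (Vc k (Suc l) i \<alpha> t - Rc k l i \<alpha> t) * a t) = (\<Sum>t<2 ^ Suc l. G t * fd k a t)))"
proof -
  obtain C where C: "coeff_bounded k C" "C \<ge> 1"
    using coeff_bound_ex by blast
  let ?C = "real (4 * k + 3) ^ k * (2 * C)"
  show ?thesis
  proof (intro exI[of _ ?C] conjI allI impI)
    have "1 <= real (4 * k + 3) ^ k" by (rule one_le_power) simp
    then show "1 <= ?C" using C(2) mult_mono[of 1 "real (4 * k + 3) ^ k" 1 "2 * C"] by simp
    fix l i \<alpha> :: nat assume h: "k <= 2 ^ l" "i <= 2 ^ Suc l" "\<alpha> < k"
    let ?n = "2 ^ Suc l :: nat" and ?v = "\<lambda>t. Vc k (Suc l) i \<alpha> t - Rc k l i \<alpha> t"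
    have k': "k <= 2 ^ Suc l" using h(1) by simp
    \<comment> \<open>Supports lie within \<open>2 * k + 1\<close> of \<open>i\<close>, hence in a
      window of length \<open>4 * k + 3\<close>. The window is cut at \<open>?n\<close>; as the
      kernel is shorter by \<open>k\<close>, its differences of order \<open>k\<close> then use
      cells of the grid only.\<close>
    define e where "e = i - (2 * k + 1)"
    define K where "K = min (4 * k + 3) (?n - e)"
    have e: "e <= ?n" using h(2) by (simp add: e_def)
    have supp: "e <= t \<and> t < e + K" if "?v t \<noteq> 0" for t
    proof -
      have "Vc k (Suc l) i \<alpha> t \<noteq> 0 \<or> Rc k l i \<alpha> t \<noteq> 0" using that by auto
      then have "t < ?n \<and> t <= i + (2 * k + 1) \<and> i <= t + (2 * k + 1)"
        using Vc_bound(2)[OF C k' h(2,3)] Rc_bound(2)[OF C h] by blast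
      then show ?thesis by (auto simp: e_def K_def min_def)
    qed
    have n: "e + K <= ?n" using e by (simp add: K_def)
    have z: "(\<Sum>t<?n. ?v t * real ((t - e) choose j)) = 0" if "j < k" for j
    proof -
      obtain Q :: "real poly" where Q: "degree Q <= Suc j" "\<And>t. t \<ge> e ==> poly Q (real t + 1) - poly Q (real t) = real ((t - e) choose j)"
        using binomial_poly[of j e] by blast
      have "(\<Sum>t<?n. ?v t * real ((t - e) choose j)) = (\<Sum>t<?n. ?v t * (poly Q (real t + 1) - poly Q (real t)))"
      proof (intro sum.cong refl)
        fix t show "?v t * real ((t - e) choose j) = ?v t * (poly Q (real t + 1) - poly Q (real t))"
          using supp[of t] Q(2)[of t] by (cases "?v t = 0") auto
      qed
      also have "... = 0" by (rule Vc_Rc_annihilate[OF h(1,2)]) (use Q(1) that in auto)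
      finally show ?thesis .
    qed
    have B: "\<bar>?v t\<bar> <= 2 * C" for t using Vc_bound(1)[OF C k' h(2,3), of t] Rc_bound(1)[OF C h, of t] by linarith
    obtain G where G: "\<And>t. G t \<noteq> 0 ==> e <= t \<and> t < e + (K - k)" "\<And>t. \<bar>G t\<bar> <= real K ^ k * (2 * C)"
      "\<And>a. (\<Sum>t<?n. ?v t * a t) = (\<Sum>t<?n. G t * fd k a t)"
      using functional_as_difference[where m = k, OF supp n z B] C(2) by auto
    have "\<bar>G t\<bar> <= ?C" for t
    proof -
      have "real K ^ k * (2 * C) <= ?C" using C(2) by (intro mult_right_mono power_mono) (auto simp: K_def)
      then show ?thesis using G(2)[of t] by linarith
    qed
    moreover have "t + k < ?n \<and> t <= i + (4 * k + 3) \<and> i <= t + (4 * k + 3)" if "G t \<noteq> 0" for t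
    proof -
      have g: "e <= t" "t < e + (K - k)" using G(1)[OF that] by auto
      have K: "K <= ?n - e" "K <= 4 * k + 3" by (simp_all add: K_def)
      have "e <= i" "i <= e + (2 * k + 1)" by (auto simp: e_def)
      then show ?thesis using g K e by linarith
    qed
    ultimately show "\<exists>G. (\<forall>t. \<bar>G t\<bar> <= ?C) \<and> (\<forall>t. G t \<noteq> 0 --> t + k < ?n \<and> t <= i + (4 * k + 3) \<and> i <= t + (4 * k + 3)) \<and>
      (\<forall>a. (\<Sum>t<?n. ?v t * a t) = (\<Sum>t<?n. G t * fd k a t))" using G(3) by blast
  qed
qed

subsection \<open>Tensor products\<close>

abbreviation boxes :: "nat => ('n::finite) idx set" where
  "boxes n \<equiv> {t. \<forall>m. t m < n}"

lemma boxes_PiE: "boxes n = Pi\<^sub>E UNIV (\<lambda>_. {..<n})"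
  by (auto simp: PiE_def extensional_def)

lemma nodes_PiE: "nodes l = Pi\<^sub>E UNIV (\<lambda>_. {..2 ^ l})"
  by (auto simp: PiE_def extensional_def)

lemma finite_boxes [simp]: "finite (boxes n :: ('n::finite) idx set)"
  unfolding boxes_PiE by (rule finite_PiE) auto

lemma card_boxes: "card (boxes n :: ('n::finite) idx set) = n ^ CARD('n)"
  unfolding boxes_PiE by (simp add: card_PiE)

lemma tensor_expand:
  fixes X :: "'n::finite => real" and B :: "'n => nat => nat => real"
  shows "(\<Prod>m\<in>UNIV. \<Sum>i\<le>2 ^ l. hat (X m - real i) * (\<Sum>\<alpha><k. B m i \<alpha> * (X m - real i) ^ \<alpha>)) =
    (\<Sum>i\<in>nodes l. \<Sum>\<alpha>\<in>boxes k. (\<Prod>m\<in>UNIV. B m (i m) (\<alpha> m)) * psi \<alpha> (\<lambda>m. X m - real (i m)))"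
proof -
  have "(\<Prod>m\<in>UNIV. \<Sum>i\<le>2 ^ l. hat (X m - real i) * (\<Sum>\<alpha><k. B m i \<alpha> * (X m - real i) ^ \<alpha>)) =
    (\<Prod>m\<in>UNIV. \<Sum>i\<le>2 ^ l. \<Sum>\<alpha><k. B m i \<alpha> * (hat (X m - real i) * (X m - real i) ^ \<alpha>))"
    by (simp add: sum_distrib_left mult_ac)
  also have "... = (\<Sum>i\<in>nodes l. \<Prod>m\<in>UNIV. \<Sum>\<alpha><k. B m (i m) \<alpha> * (hat (X m - real (i m)) * (X m - real (i m)) ^ \<alpha>))"
    unfolding nodes_PiE by (rule prod_sum_PiE) auto
  also have "... = (\<Sum>i\<in>nodes l. \<Sum>\<alpha>\<in>boxes k. \<Prod>m\<in>UNIV. B m (i m) (\<alpha> m) * (hat (X m - real (i m)) * (X m - real (i m)) ^ \<alpha> m))"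
    unfolding boxes_PiE by (intro sum.cong refl prod_sum_PiE) auto
  finally show ?thesis by (simp add: psi_def prod.distrib)
qed

lemma sum_boxes_split:
  fixes f :: "('n::finite) idx => real"
  shows "(\<Sum>t\<in>boxes n. f t) = (\<Sum>t\<in>{t\<in>boxes n. t m = 0}. \<Sum>\<tau><n. f (t(m := \<tau>)))"
proof (cases "n = 0")
  case True
  then have "boxes n = ({} :: 'n idx set)" "{t\<in>boxes n. t m = 0} = ({} :: 'n idx set)" by auto
  then show ?thesis by (simp only: sum.empty)
next
  case False
  have "(\<Sum>t\<in>{t\<in>boxes n. t m = 0}. \<Sum>\<tau><n. f (t(m := \<tau>))) = (\<Sum>(t, \<tau>)\<in>{t\<in>boxes n. t m = 0} \<times> {..<n}. f (t(m := \<tau>)))"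
    by (rule sum.cartesian_product)
  also have "... = (\<Sum>t\<in>boxes n. f t)"
    by (rule sum.reindex_bij_witness[of _ "\<lambda>t. (t(m := 0), t m)" "\<lambda>(t, \<tau>). t(m := \<tau>)"]) (use False in auto)
  finally show ?thesis ..
qed

definition cdiff :: "nat => 'n => ('n idx => real) => 'n idx => real" where
  "cdiff k m a t = fd k (\<lambda>\<tau>. a (t(m := \<tau>))) (t m)"

text \<open>The two tensor functionals are connected through hybrids that use \<open>v\<close> on the
  coordinates in \<open>H\<close> and \<open>r\<close> on the others.\<close>

lemma tensor_difference_bound:
  fixes v r G :: "'n::finite => nat => real" and a :: "'n idx => real"
  assumes C: "C \<ge> 1" and v: "\<And>m t. \<bar>v m t\<bar> <= C" "\<And>m t. v m t \<noteq> 0 ==> near m t"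
    and r: "\<And>m t. \<bar>r m t\<bar> <= C" "\<And>m t. r m t \<noteq> 0 ==> near m t"
    and G: "\<And>m t. \<bar>G m t\<bar> <= C" "\<And>m t. G m t \<noteq> 0 ==> near m t \<and> t + k < n"
    and vr: "\<And>m a. (\<Sum>t<n. (v m t - r m t) * a t) = (\<Sum>t<n. G m t * fd k a t)"
  shows "\<bar>\<Sum>t\<in>boxes n. a t * ((\<Prod>m\<in>UNIV. v m (t m)) - (\<Prod>m\<in>UNIV. r m (t m)))\<bar> \<le>
    C ^ CARD('n) * (\<Sum>m\<in>UNIV. \<Sum>t\<in>{t\<in>boxes n. t m + k < n \<and> (\<forall>m'. near m' (t m'))}. \<bar>cdiff k m a t\<bar>)"
proof -
  define z where "z H m = (if m \<in> H then v m else r m)" for H m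
  define S where "S H = (\<Sum>t\<in>boxes n. a t * (\<Prod>m\<in>UNIV. z H m (t m)))" for H
  let ?N = "\<lambda>m. {t\<in>boxes n. t m + k < n \<and> (\<forall>m'. near m' (t m'))}"
  have step: "\<bar>S (insert m H) - S H\<bar> <= C ^ CARD('n) * (\<Sum>t\<in>?N m. \<bar>cdiff k m a t\<bar>)" if m: "m \<notin> H" for m H
  proof -
    \<comment> \<open>\<open>Z\<close> does not depend on coordinate \<open>m\<close>. With the
      other coordinates frozen, the one-dimensional sum over \<open>t m\<close> can be replaced by
      the difference kernel.\<close>
    define Z where "Z t = (\<Prod>m'\<in>UNIV - {m}. z H m' (t m'))" for t
    have Zu: "Z (t(m := \<tau>)) = Z t" for t \<tau> unfolding Z_def by (intro prod.cong) auto
    have p: "(\<Prod>m'\<in>UNIV. z (insert m H) m' (t m')) - (\<Prod>m'\<in>UNIV. z H m' (t m')) = (v m (t m) - r m (t m)) * Z t" for t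
    proof -
      have "(\<Prod>m'\<in>UNIV. z (insert m H) m' (t m')) = v m (t m) * (\<Prod>m'\<in>UNIV - {m}. z (insert m H) m' (t m'))"
        by (subst prod.remove[of _ m]) (auto simp: z_def)
      moreover have "(\<Prod>m'\<in>UNIV - {m}. z (insert m H) m' (t m')) = Z t" unfolding Z_def by (intro prod.cong) (auto simp: z_def)
      moreover have "(\<Prod>m'\<in>UNIV. z H m' (t m')) = r m (t m) * Z t" unfolding Z_def
        by (subst prod.remove[of _ m]) (use m in \<open>auto simp: z_def\<close>)
      ultimately show ?thesis by (simp add: algebra_simps)
    qed
    have "S (insert m H) - S H = (\<Sum>t\<in>boxes n. a t * ((v m (t m) - r m (t m)) * Z t))"
      unfolding S_def sum_subtractf[symmetric] p[symmetric] by (simp add: algebra_simps)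
    also have "... = (\<Sum>t\<in>{t\<in>boxes n. t m = 0}. Z t * (\<Sum>\<tau><n. (v m \<tau> - r m \<tau>) * a (t(m := \<tau>))))"
      by (subst sum_boxes_split[of _ _ m]) (simp add: Zu sum_distrib_left mult_ac)
    also have "... = (\<Sum>t\<in>{t\<in>boxes n. t m = 0}. Z t * (\<Sum>\<tau><n. G m \<tau> * fd k (\<lambda>\<tau>. a (t(m := \<tau>))) \<tau>))"
      by (simp only: vr)
    also have "... = (\<Sum>t\<in>boxes n. Z t * (G m (t m) * cdiff k m a t))"
      unfolding sum_boxes_split[of "\<lambda>t. Z t * (G m (t m) * cdiff k m a t)" n m]
      by (simp add: Zu sum_distrib_left cdiff_def)
    also have "... = (\<Sum>t\<in>?N m. Z t * (G m (t m) * cdiff k m a t))"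
    proof (rule sum.mono_neutral_right)
      show "\<forall>t\<in>boxes n - ?N m. Z t * (G m (t m) * cdiff k m a t) = 0"
      proof
        fix t assume t: "t \<in> boxes n - ?N m"
        show "Z t * (G m (t m) * cdiff k m a t) = 0"
        proof (rule ccontr)
          assume nz: "Z t * (G m (t m) * cdiff k m a t) \<noteq> 0"
          then have g: "near m (t m)" "t m + k < n" using G(2)[of m "t m"] by auto
          have "near m' (t m')" for m'
          proof (cases "m' = m")
            case False
            then have "z H m' (t m') \<noteq> 0" using nz unfolding Z_def by (auto simp: prod_zero_iff)
            then show ?thesis using v(2) r(2) by (auto simp: z_def split: if_splits)
          qed (use g in auto)
          then show False using t g by auto
        qed
      qed
    qed auto
    finally have E: "S (insert m H) - S H = (\<Sum>t\<in>?N m. Z t * (G m (t m) * cdiff k m a t))" .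
    have "\<bar>\<Sum>t\<in>?N m. Z t * (G m (t m) * cdiff k m a t)\<bar> <= (\<Sum>t\<in>?N m. C ^ CARD('n) * \<bar>cdiff k m a t\<bar>)"
    proof (rule sum_abs[THEN order_trans], rule sum_mono)
      fix t
      have "\<bar>Z t\<bar> <= (\<Prod>m'\<in>UNIV - {m}. C)" unfolding Z_def abs_prod
        by (intro prod_mono) (use v(1) r(1) in \<open>auto simp: z_def\<close>)
      then have "\<bar>Z t\<bar> <= C ^ (CARD('n) - 1)" by simp
      then have "\<bar>Z t\<bar> * \<bar>G m (t m)\<bar> <= C ^ (CARD('n) - 1) * C" using G(1)[of m "t m"] C by (intro mult_mono) auto
      also have "... = C ^ CARD('n)" using zero_less_card_finite[where 'a = 'n] by (metis Suc_diff_1 power_Suc2)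
      finally have "\<bar>Z t\<bar> * \<bar>G m (t m)\<bar> * \<bar>cdiff k m a t\<bar> <= C ^ CARD('n) * \<bar>cdiff k m a t\<bar>" by (rule mult_right_mono) simp
      then show "\<bar>Z t * (G m (t m) * cdiff k m a t)\<bar> <= C ^ CARD('n) * \<bar>cdiff k m a t\<bar>" by (simp add: abs_mult mult.assoc)
    qed
    then show ?thesis unfolding E by (simp only: sum_distrib_left)
  qed
  have "\<bar>S H - S {}\<bar> <= C ^ CARD('n) * (\<Sum>m\<in>H. \<Sum>t\<in>?N m. \<bar>cdiff k m a t\<bar>)" if "finite H" for H
    using that
  proof (induction H)
    case (insert m H)
    then show ?case using step[of m H] by (simp add: distrib_left)
  qed simp
  from this[of UNIV] have "\<bar>S UNIV - S {}\<bar> <= C ^ CARD('n) * (\<Sum>m\<in>UNIV. \<Sum>t\<in>?N m. \<bar>cdiff k m a t\<bar>)" by simp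
  moreover have "S UNIV - S {} = (\<Sum>t\<in>boxes n. a t * ((\<Prod>m\<in>UNIV. v m (t m)) - (\<Prod>m\<in>UNIV. r m (t m))))"
    by (simp add: S_def z_def sum_subtractf right_diff_distrib)
  ultimately show ?thesis by simp
qed

section \<open>From windows around a node to bounds of the coefficient sums in
  \<open>\<ell>\<^sup>q\<close>\<close>

lemma sum_powr_le:
  fixes x :: "'a => real"
  assumes "finite S" "\<And>i. i \<in> S ==> x i \<ge> 0" "q > 0" "real (card S) <= N"
  shows "(\<Sum>i\<in>S. x i) powr q <= N powr q * (\<Sum>i\<in>S. x i powr q)"
proof (cases "S = {}")
  case False
  let ?M = "Max (x ` S)"
  have M: "x i <= ?M" if "i \<in> S" for i using assms(1) that by simp
  have "?M \<in> x ` S" using assms(1) False by (intro Max_in) auto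
  then obtain j where j: "j \<in> S" "?M = x j" by auto
  have M0: "?M \<ge> 0" using j assms(2) by simp
  have "(\<Sum>i\<in>S. x i) <= (\<Sum>i\<in>S. ?M)" by (intro sum_mono M)
  also have "... <= N * ?M" using assms(4) M0 by (simp add: mult_right_mono)
  finally have "(\<Sum>i\<in>S. x i) powr q <= (N * ?M) powr q" using assms by (intro powr_mono2) (auto intro: sum_nonneg)
  also have "... = N powr q * x j powr q" using M0 assms(4) j by (subst powr_mult) auto
  also have "... <= N powr q * (\<Sum>i\<in>S. x i powr q)"
    using assms(1) j by (intro mult_left_mono member_le_sum) auto
  finally show ?thesis .
qed simp

lemma near_PiE:
  "{t. \<forall>m::'n::finite. t m <= i m + n \<and> i m <= t m + (n::nat)} = Pi\<^sub>E UNIV (\<lambda>m. {i m - n..i m + n})"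
  by (rule set_eqI) (simp add: PiE_UNIV_domain Pi_iff le_diff_conv conj_commute)

lemma card_near_le:
  fixes n :: nat
  shows "card {t. \<forall>m::'n::finite. t m <= i m + n \<and> i m <= t m + n} <= (2 * n + 1) ^ CARD('n)"
proof -
  have "card {t. \<forall>m::'n. t m <= i m + n \<and> i m <= t m + n} = (\<Prod>m\<in>UNIV. card {i m - n..i m + n})"
    unfolding near_PiE by (simp add: card_PiE)
  also have "... <= (\<Prod>m\<in>(UNIV :: 'n set). 2 * n + 1)" by (intro prod_mono) auto
  finally show ?thesis by simp
qed

lemma finite_near: "finite {t. \<forall>m::'n::finite. t m <= i m + n \<and> i m <= t m + (n::nat)}"
  unfolding near_PiE by (simp add: finite_PiE)

text \<open>Coefficient at node \<open>i\<close> and exponent \<open>\<alpha>\<close> on level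
  \<open>l + 1\<close> of the difference of consecutive reconstructions, when \<open>a\<close> lists
  the averages of level \<open>l + 1\<close>.\<close>

definition detail :: "nat => nat => (('n::finite) idx => real) => 'n idx => 'n idx => real" where
  "detail k l a i \<alpha> = (\<Sum>t\<in>boxes (2 ^ Suc l). a t *
    ((\<Prod>m\<in>UNIV. Vc k (Suc l) (i m) (\<alpha> m) (t m)) - (\<Prod>m\<in>UNIV. Rc k l (i m) (\<alpha> m) (t m))))"

definition coarse :: "nat => nat => (('n::finite) idx => real) => 'n idx => 'n idx => real" where
  "coarse k l a i \<alpha> = (\<Sum>t\<in>boxes (2 ^ l). a t * (\<Prod>m\<in>UNIV. Vc k l (i m) (\<alpha> m) (t m)))"

text \<open>Bounded overlap turns the pointwise window estimates into \<open>\<ell>\<^sup>q\<close> estimates.\<close>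

lemma overlap_sum:
  fixes y :: "('n::finite) idx => real" and c :: "'n idx => real"
  assumes q: "q > 0" and fin: "finite I" "finite T" and y: "\<And>t. y t \<ge> 0" and C: "C \<ge> 0"
    and c: "\<And>i. i \<in> I ==> \<bar>c i\<bar> <= C * (\<Sum>t\<in>{t\<in>T. \<forall>m. t m <= i m + n \<and> i m <= t m + n}. y t)"
  shows "(\<Sum>i\<in>I. \<bar>c i\<bar> powr q) <= (C * real (2 * n + 1) ^ CARD('n)) powr q * real (2 * n + 1) ^ CARD('n) * (\<Sum>t\<in>T. y t powr q)"
proof -
  let ?nr = "\<lambda>(i :: 'n => nat) t. \<forall>m. t m <= i m + n \<and> i m <= t m + n"
  define N where "N = real (2 * n + 1) ^ CARD('n)"
  have N0: "N \<ge> 0" by (simp add: N_def)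
  have card: "real (card {t\<in>T. ?nr i t}) <= N" for i
  proof -
    have "card {t\<in>T. ?nr i t} <= card {t. ?nr i t}" by (rule card_mono[OF finite_near]) auto
    also have "... <= (2 * n + 1) ^ CARD('n)" by (rule card_near_le)
    finally show ?thesis unfolding N_def of_nat_power[symmetric] by (simp only: of_nat_le_iff)
  qed
  have card': "real (card {i\<in>I. ?nr i t}) <= N" for t
  proof -
    have "card {i\<in>I. ?nr i t} <= card {i. ?nr t i}" by (rule card_mono[OF finite_near]) auto
    also have "... <= (2 * n + 1) ^ CARD('n)" by (rule card_near_le)
    finally show ?thesis unfolding N_def of_nat_power[symmetric] by (simp only: of_nat_le_iff)
  qed
  have "(\<Sum>i\<in>I. \<bar>c i\<bar> powr q) <= (\<Sum>i\<in>I. (C * N) powr q * (\<Sum>t\<in>{t\<in>T. ?nr i t}. y t powr q))"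
  proof (rule sum_mono)
    fix i assume "i \<in> I"
    then have "\<bar>c i\<bar> powr q <= (C * (\<Sum>t\<in>{t\<in>T. ?nr i t}. y t)) powr q" using q by (intro powr_mono2 c) auto
    also have "... = C powr q * (\<Sum>t\<in>{t\<in>T. ?nr i t}. y t) powr q" by (rule powr_mult)
    also have "... <= C powr q * (N powr q * (\<Sum>t\<in>{t\<in>T. ?nr i t}. y t powr q))"
      using fin y q card[of i] by (intro mult_left_mono sum_powr_le) auto
    also have "... = (C * N) powr q * (\<Sum>t\<in>{t\<in>T. ?nr i t}. y t powr q)" by (simp only: powr_mult mult.assoc)
    finally show "\<bar>c i\<bar> powr q <= (C * N) powr q * (\<Sum>t\<in>{t\<in>T. ?nr i t}. y t powr q)" .
  qed
  also have "... = (C * N) powr q * (\<Sum>i\<in>I. \<Sum>t\<in>T. if ?nr i t then y t powr q else 0)"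
    unfolding sum_distrib_left[symmetric] using fin(2) by (simp add: sum.inter_filter)
  also have "(\<Sum>i\<in>I. \<Sum>t\<in>T. if ?nr i t then y t powr q else 0) = (\<Sum>t\<in>T. \<Sum>i\<in>I. if ?nr i t then y t powr q else 0)"
    by (rule sum.swap)
  also have "... = (\<Sum>t\<in>T. real (card {i\<in>I. ?nr i t}) * y t powr q)"
    using fin(1) by (simp add: sum.inter_filter[symmetric])
  also have "(C * N) powr q * \<dots> <= (C * N) powr q * (\<Sum>t\<in>T. N * y t powr q)"
    using card' by (intro mult_left_mono sum_mono mult_right_mono) auto
  finally show ?thesis unfolding N_def[symmetric] by (simp add: sum_distrib_left mult.assoc)
qed

lemma detail_bound:
  assumes k: "k \<ge> 1"
  shows "\<exists>C\<ge>1. \<forall>l (a :: ('n::finite) idx => real) i \<alpha>. k <= 2 ^ l --> i \<in> nodes (Suc l) --> \<alpha> \<in> boxes k -->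
    \<bar>detail k l a i \<alpha>\<bar> <= C * (\<Sum>m\<in>UNIV. \<Sum>t\<in>{t\<in>{t\<in>boxes (2 ^ Suc l). t m + k < 2 ^ Suc l}. \<forall>m'. t m' <= i m' + (4 * k + 3) \<and> i m' <= t m' + (4 * k + 3)}. \<bar>cdiff k m a t\<bar>)"
proof -
  obtain C1 where C1: "coeff_bounded k C1" "C1 \<ge> 1"
    using coeff_bound_ex by blast
  obtain C2 where C2: "C2 \<ge> 1" "\<And>l (i::nat) \<alpha>. k <= 2 ^ l ==> i <= 2 ^ Suc l ==> \<alpha> < k ==>
    (\<exists>G. (\<forall>t. \<bar>G t\<bar> <= C2) \<and> (\<forall>t. G t \<noteq> 0 --> t + k < 2 ^ Suc l \<and> t <= i + (4 * k + 3) \<and> i <= t + (4 * k + 3)) \<and>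
      (\<forall>a. (\<Sum>t<2 ^ Suc l. (Vc k (Suc l) i \<alpha> t - Rc k l i \<alpha> t) * a t) = (\<Sum>t<2 ^ Suc l. G t * fd k a t)))"
    using Vc_Rc_difference[OF k] by blast
  define C where "C = max C1 C2"
  show ?thesis
  proof (intro exI[of _ "C ^ CARD('n)"] conjI allI impI)
    show "1 <= C ^ CARD('n)" using C2(1) by (intro one_le_power) (simp add: C_def)
    fix l a and i \<alpha> :: "'n => nat"
    assume h: "k <= 2 ^ l" "i \<in> nodes (Suc l)" "\<alpha> \<in> boxes k"
    have k': "k <= 2 ^ Suc l" using h(1) by simp
    have i: "i m <= 2 ^ Suc l" and \<alpha>: "\<alpha> m < k" for m using h by auto
    define near where "near m t \<longleftrightarrow> t <= i m + (4 * k + 3) \<and> i m <= t + (4 * k + 3)" for m t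
    have "\<exists>G. (\<forall>t. \<bar>G t\<bar> <= C2) \<and> (\<forall>t. G t \<noteq> 0 --> t + k < 2 ^ Suc l \<and> near m t) \<and>
      (\<forall>a. (\<Sum>t<2 ^ Suc l. (Vc k (Suc l) (i m) (\<alpha> m) t - Rc k l (i m) (\<alpha> m) t) * a t) = (\<Sum>t<2 ^ Suc l. G t * fd k a t))" for m
      unfolding near_def by (rule C2(2)[OF h(1) i \<alpha>])
    then obtain G where G: "\<And>m t. \<bar>G m t\<bar> <= C2" "\<And>m t. G m t \<noteq> 0 ==> t + k < 2 ^ Suc l \<and> near m t"
      "\<And>m a. (\<Sum>t<2 ^ Suc l. (Vc k (Suc l) (i m) (\<alpha> m) t - Rc k l (i m) (\<alpha> m) t) * a t) = (\<Sum>t<2 ^ Suc l. G m t * fd k a t)"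
      by metis
    have "\<bar>detail k l a i \<alpha>\<bar> <= C ^ CARD('n) * (\<Sum>m\<in>UNIV. \<Sum>t\<in>{t\<in>boxes (2 ^ Suc l). t m + k < 2 ^ Suc l \<and> (\<forall>m'. near m' (t m'))}. \<bar>cdiff k m a t\<bar>)"
      unfolding detail_def
    proof (rule tensor_difference_bound[where near = near and G = G])
      show "1 <= C" using C2(1) by (simp add: C_def)
      show "\<bar>Vc k (Suc l) (i m) (\<alpha> m) t\<bar> <= C" for m t using Vc_bound(1)[OF C1 k' i \<alpha>] by (auto simp: C_def intro: le_max_iff_disj[THEN iffD2])
      show "near m t" if "Vc k (Suc l) (i m) (\<alpha> m) t \<noteq> 0" for m t using Vc_bound(2)[OF C1 k' i \<alpha> that] by (auto simp: near_def)
      show "\<bar>Rc k l (i m) (\<alpha> m) t\<bar> <= C" for m t using Rc_bound(1)[OF C1 h(1) i \<alpha>] by (auto simp: C_def intro: le_max_iff_disj[THEN iffD2])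
      show "near m t" if "Rc k l (i m) (\<alpha> m) t \<noteq> 0" for m t using Rc_bound(2)[OF C1 h(1) i \<alpha> that] by (auto simp: near_def)
      show "\<bar>G m t\<bar> <= C" for m t using G(1)[of m t] by (simp add: C_def)
    qed (use G in auto)
    then show "\<bar>detail k l a i \<alpha>\<bar> <= C ^ CARD('n) * (\<Sum>m\<in>UNIV. \<Sum>t\<in>{t\<in>{t\<in>boxes (2 ^ Suc l). t m + k < 2 ^ Suc l}. \<forall>m'. t m' <= i m' + (4 * k + 3) \<and> i m' <= t m' + (4 * k + 3)}. \<bar>cdiff k m a t\<bar>)"
      unfolding near_def by (simp add: conj_assoc)
  qed
qed

lemma detail_lq_bound:
  assumes k: "k \<ge> 1" and q: "q \<ge> 1"
  shows "\<exists>C\<ge>1. \<forall>l (a :: ('n::finite) idx => real) \<alpha>. k <= 2 ^ l --> \<alpha> \<in> boxes k -->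
    (\<Sum>i\<in>nodes (Suc l). \<bar>detail k l a i \<alpha>\<bar> powr q) \<le>
      C * (\<Sum>m\<in>UNIV. \<Sum>t\<in>{t\<in>boxes (2 ^ Suc l). t m + k < 2 ^ Suc l}. \<bar>cdiff k m a t\<bar> powr q)"
proof -
  obtain C where C: "C \<ge> 1" "\<And>l (a :: 'n idx => real) i \<alpha>. k <= 2 ^ l ==> i \<in> nodes (Suc l) ==> \<alpha> \<in> boxes k ==>
    \<bar>detail k l a i \<alpha>\<bar> <= C * (\<Sum>m\<in>UNIV. \<Sum>t\<in>{t\<in>{t\<in>boxes (2 ^ Suc l). t m + k < 2 ^ Suc l}. \<forall>m'. t m' <= i m' + (4 * k + 3) \<and> i m' <= t m' + (4 * k + 3)}. \<bar>cdiff k m a t\<bar>)"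
    using detail_bound[OF k, where 'n = 'n] by blast
  let ?d = "real CARD('n)" and ?N = "real (2 * (4 * k + 3) + 1) ^ CARD('n)"
  let ?C = "max 1 (?d powr q * ((C * ?N) powr q * ?N))"
  show ?thesis
  proof (intro exI[of _ ?C] conjI allI impI)
    fix l and a :: "'n idx => real" and \<alpha> :: "'n => nat"
    assume h: "k <= 2 ^ l" "\<alpha> \<in> boxes k"
    let ?T = "\<lambda>m. {t\<in>boxes (2 ^ Suc l). t m + k < 2 ^ Suc l}"
    let ?nr = "\<lambda>(i :: 'n => nat) t. \<forall>m'. t m' <= i m' + (4 * k + 3) \<and> i m' <= t m' + (4 * k + 3)"
    define b where "b m i = C * (\<Sum>t\<in>{t\<in>?T m. ?nr i t}. \<bar>cdiff k m a t\<bar>)" for m i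
    have b0: "b m i \<ge> 0" for m i unfolding b_def using C(1) by (intro mult_nonneg_nonneg sum_nonneg) auto
    have "(\<Sum>i\<in>nodes (Suc l). \<bar>detail k l a i \<alpha>\<bar> powr q) <= (\<Sum>i\<in>nodes (Suc l). ?d powr q * (\<Sum>m\<in>UNIV. b m i powr q))"
    proof (rule sum_mono)
      fix i :: "'n => nat" assume i: "i \<in> nodes (Suc l)"
      have "\<bar>detail k l a i \<alpha>\<bar> <= (\<Sum>m\<in>UNIV. b m i)" using C(2)[OF h(1) i h(2), of a] by (simp add: b_def sum_distrib_left)
      then have "\<bar>detail k l a i \<alpha>\<bar> powr q <= (\<Sum>m\<in>UNIV. b m i) powr q" using q by (intro powr_mono2) auto
      also have "... <= ?d powr q * (\<Sum>m\<in>UNIV. b m i powr q)" using b0 q by (intro sum_powr_le) auto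
      finally show "\<bar>detail k l a i \<alpha>\<bar> powr q <= ?d powr q * (\<Sum>m\<in>UNIV. b m i powr q)" .
    qed
    also have "... = ?d powr q * (\<Sum>m\<in>UNIV. \<Sum>i\<in>nodes (Suc l). \<bar>b m i\<bar> powr q)"
      using b0 by (subst sum.swap) (simp add: sum_distrib_left)
    also have "... <= ?d powr q * (\<Sum>m\<in>UNIV. (C * ?N) powr q * ?N * (\<Sum>t\<in>?T m. \<bar>cdiff k m a t\<bar> powr q))"
    proof (intro mult_left_mono sum_mono overlap_sum)
      fix m i show "\<bar>b m i\<bar> <= C * (\<Sum>t\<in>{t\<in>?T m. ?nr i t}. \<bar>cdiff k m a t\<bar>)" using b0[of m i] by (simp add: b_def)
    qed (use q C(1) finite_nodes[of "Suc l"] in auto)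
    also have "... = ?d powr q * ((C * ?N) powr q * ?N) * (\<Sum>m\<in>UNIV. \<Sum>t\<in>?T m. \<bar>cdiff k m a t\<bar> powr q)"
      by (simp add: sum_distrib_left mult_ac)
    also have "... <= ?C * (\<Sum>m\<in>UNIV. \<Sum>t\<in>?T m. \<bar>cdiff k m a t\<bar> powr q)"
      by (intro mult_right_mono sum_nonneg) auto
    finally show "(\<Sum>i\<in>nodes (Suc l). \<bar>detail k l a i \<alpha>\<bar> powr q) <= ?C * (\<Sum>m\<in>UNIV. \<Sum>t\<in>?T m. \<bar>cdiff k m a t\<bar> powr q)" .
  qed simp
qed

lemma coarse_lq_bound:
  assumes k: "k \<ge> 1" and q: "q \<ge> 1"
  shows "\<exists>C\<ge>1. \<forall>l (a :: ('n::finite) idx => real) \<alpha>. k <= 2 ^ l --> \<alpha> \<in> boxes k -->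
    (\<Sum>i\<in>nodes l. \<bar>coarse k l a i \<alpha>\<bar> powr q) <= C * (\<Sum>t\<in>boxes (2 ^ l). \<bar>a t\<bar> powr q)"
proof -
  obtain C where C: "coeff_bounded k C" "C \<ge> 1"
    using coeff_bound_ex by blast
  let ?N = "real (2 * (2 * k + 1) + 1) ^ CARD('n)"
  let ?C = "max 1 ((C ^ CARD('n) * ?N) powr q * ?N)"
  show ?thesis
  proof (intro exI[of _ ?C] conjI allI impI)
    fix l and a :: "'n idx => real" and \<alpha> :: "'n => nat"
    assume h: "k <= 2 ^ l" "\<alpha> \<in> boxes k"
    let ?nr = "\<lambda>(i :: 'n => nat) t. \<forall>m'. t m' <= i m' + (2 * k + 1) \<and> i m' <= t m' + (2 * k + 1)"
    have "(\<Sum>i\<in>nodes l. \<bar>coarse k l a i \<alpha>\<bar> powr q) <= (C ^ CARD('n) * ?N) powr q * ?N * (\<Sum>t\<in>boxes (2 ^ l). \<bar>a t\<bar> powr q)"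
    proof (rule overlap_sum)
      fix i :: "'n => nat" assume "i \<in> nodes l"
      then have i: "i m <= 2 ^ l" and \<alpha>: "\<alpha> m < k" for m using h by auto
      have "\<bar>coarse k l a i \<alpha>\<bar> = \<bar>\<Sum>t\<in>{t\<in>boxes (2 ^ l). ?nr i t}. a t * (\<Prod>m\<in>UNIV. Vc k l (i m) (\<alpha> m) (t m))\<bar>"
        unfolding coarse_def
      proof (intro arg_cong[of _ _ abs] sum.mono_neutral_right ballI)
        fix t assume "t \<in> boxes (2 ^ l) - {t\<in>boxes (2 ^ l). ?nr i t}"
        then obtain m where "\<not> (t m <= i m + (2 * k + 1) \<and> i m <= t m + (2 * k + 1))" by auto
        then have "Vc k l (i m) (\<alpha> m) (t m) = 0" using Vc_bound(2)[OF C h(1) i \<alpha>] by blast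
        then have "(\<Prod>m\<in>UNIV. Vc k l (i m) (\<alpha> m) (t m)) = 0" by (intro prod_zero) auto
        then show "a t * (\<Prod>m\<in>UNIV. Vc k l (i m) (\<alpha> m) (t m)) = 0" by simp
      qed auto
      also have "... <= (\<Sum>t\<in>{t\<in>boxes (2 ^ l). ?nr i t}. C ^ CARD('n) * \<bar>a t\<bar>)"
      proof (rule sum_abs[THEN order_trans], rule sum_mono)
        fix t
        have "\<bar>\<Prod>m\<in>UNIV. Vc k l (i m) (\<alpha> m) (t m)\<bar> <= (\<Prod>m\<in>(UNIV :: 'n set). C)" unfolding abs_prod
          using Vc_bound(1)[OF C h(1) i \<alpha>] by (intro prod_mono) auto
        then have "\<bar>\<Prod>m\<in>UNIV. Vc k l (i m) (\<alpha> m) (t m)\<bar> * \<bar>a t\<bar> <= C ^ CARD('n) * \<bar>a t\<bar>" by (intro mult_right_mono) auto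
        then show "\<bar>a t * (\<Prod>m\<in>UNIV. Vc k l (i m) (\<alpha> m) (t m))\<bar> <= C ^ CARD('n) * \<bar>a t\<bar>" by (simp add: abs_mult mult.commute)
      qed
      finally show "\<bar>coarse k l a i \<alpha>\<bar> <= C ^ CARD('n) * (\<Sum>t\<in>{t\<in>boxes (2 ^ l). ?nr i t}. \<bar>a t\<bar>)" by (simp add: sum_distrib_left)
    qed (use q C(2) finite_nodes in auto)
    also have "... <= ?C * (\<Sum>t\<in>boxes (2 ^ l). \<bar>a t\<bar> powr q)" by (intro mult_right_mono sum_nonneg) auto
    finally show "(\<Sum>i\<in>nodes l. \<bar>coarse k l a i \<alpha>\<bar> powr q) <= ?C * (\<Sum>t\<in>boxes (2 ^ l). \<bar>a t\<bar> powr q)" .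
  qed simp
qed

subsection \<open>Cell averages\<close>

text \<open>Young's inequality at the mean \<open>c = I / v\<close> is the tangent inequality of the
  power function; integrating it over \<open>Q\<close> gives the claim. A lower bound
  \<open>I\<close> of the integral and an upper bound \<open>v\<close> of the measure are used, so
  that infinite integrals and sets of smaller measure are covered too.\<close>

lemma jensen_powr:
  fixes u :: "'a => real"
  assumes q: "q \<ge> 1" and v: "v > 0" and u [measurable]: "u \<in> borel_measurable M" and u0: "\<And>x. u x \<ge> 0"
    and Q [measurable]: "Q \<in> sets M" and vQ: "emeasure M Q <= ennreal v"
    and I: "I \<ge> 0" "ennreal I <= (\<integral>\<^sup>+x\<in>Q. ennreal (u x) \<partial>M)"
  shows "ennreal (I powr q) <= ennreal (v powr (q - 1)) * (\<integral>\<^sup>+x\<in>Q. ennreal (u x powr q) \<partial>M)"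
proof (cases "(\<integral>\<^sup>+x\<in>Q. ennreal (u x powr q) \<partial>M) = \<infinity>")
  case True
  then show ?thesis using v by (simp add: ennreal_mult_top)
next
  case False
  then obtain B where B: "B \<ge> 0" "(\<integral>\<^sup>+x\<in>Q. ennreal (u x powr q) \<partial>M) = ennreal B"
    by (cases "(\<integral>\<^sup>+x\<in>Q. ennreal (u x powr q) \<partial>M)") auto
  show ?thesis
  proof (cases "I = 0")
    case True then show ?thesis using q by simp
  next
    case False
    then have I0: "I > 0" using I by simp
    define c where "c = I / v"
    have c: "c > 0" using I0 v by (simp add: c_def)
    have young: "c powr (q - 1) * y <= 1 / q * y powr q + (1 - 1 / q) * c powr q" if "y \<ge> 0" for y
    proof (cases "y = 0")
      case False
      have "(y powr q) powr (1 / q) * (c powr q) powr (1 - 1 / q) <= 1 / q * y powr q + (1 - 1 / q) * c powr q"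
        using q False c that by (intro Youngs_inequality_0) auto
      moreover have "(y powr q) powr (1 / q) = y" using q that by (simp add: powr_powr)
      moreover have "(c powr q) powr (1 - 1 / q) = c powr (q - 1)" using q by (simp add: powr_powr right_diff_distrib)
      ultimately show ?thesis by (simp add: mult.commute)
    qed (use q in simp)
    have q1: "1 - 1 / q \<ge> 0" using q by simp
    have "ennreal (c powr (q - 1)) * ennreal I <= ennreal (c powr (q - 1)) * (\<integral>\<^sup>+x\<in>Q. ennreal (u x) \<partial>M)"
      using I by (intro mult_left_mono) auto
    also have "... = (\<integral>\<^sup>+x\<in>Q. ennreal (c powr (q - 1) * u x) \<partial>M)"
      by (subst nn_integral_cmult[symmetric]) (auto simp: ennreal_mult u0 mult.assoc)
    also have "... <= (\<integral>\<^sup>+x. ennreal (1 / q) * (ennreal (u x powr q) * indicator Q x) + ennreal ((1 - 1 / q) * c powr q) * indicator Q x \<partial>M)"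
    proof (rule nn_integral_mono)
      fix x
      show "ennreal (c powr (q - 1) * u x) * indicator Q x <= ennreal (1 / q) * (ennreal (u x powr q) * indicator Q x) + ennreal ((1 - 1 / q) * c powr q) * indicator Q x"
      proof (cases "x \<in> Q")
        case True
        have "ennreal (c powr (q - 1) * u x) <= ennreal (1 / q * u x powr q + (1 - 1 / q) * c powr q)"
          by (rule ennreal_leI[OF young[OF u0]])
        also have "... = ennreal (1 / q) * ennreal (u x powr q) + ennreal ((1 - 1 / q) * c powr q)"
        proof -
          have "ennreal (1 / q * u x powr q + (1 - 1 / q) * c powr q) = ennreal (1 / q * u x powr q) + ennreal ((1 - 1 / q) * c powr q)"
            by (rule ennreal_plus) (use q q1 in auto)
          also have "ennreal (1 / q * u x powr q) = ennreal (1 / q) * ennreal (u x powr q)"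
            by (rule ennreal_mult) (use q in auto)
          finally show ?thesis .
        qed
        finally show ?thesis using True by simp
      qed simp
    qed
    also have "... = ennreal (1 / q) * ennreal B + ennreal ((1 - 1 / q) * c powr q) * emeasure M Q"
      by (subst nn_integral_add) (auto simp: nn_integral_cmult B)
    also have "... <= ennreal (1 / q) * ennreal B + ennreal ((1 - 1 / q) * c powr q) * ennreal v"
      by (intro add_left_mono mult_left_mono vQ) auto
    also have "... = ennreal (1 / q * B) + ennreal ((1 - 1 / q) * c powr q * v)"
      using q q1 B v by (intro arg_cong2[of _ _ _ _ "(+)"] ennreal_mult[symmetric]) auto
    also have "... = ennreal (1 / q * B + (1 - 1 / q) * c powr q * v)"
      by (rule ennreal_plus[symmetric]) (use q q1 B v in auto)
    also have "ennreal (c powr (q - 1)) * ennreal I = ennreal (c powr (q - 1) * I)"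
      by (rule ennreal_mult[symmetric]) (use I in auto)
    finally have "c powr (q - 1) * I <= 1 / q * B + (1 - 1 / q) * c powr q * v"
      by (rule ennreal_le_iff[THEN iffD1, rotated]) (use q q1 B v in auto)
    moreover have cI: "c powr (q - 1) * I = c powr q * v"
      using c v by (simp add: c_def powr_diff field_simps)
    ultimately have "1 / q * (c powr q * v) <= 1 / q * B" by (simp add: algebra_simps)
    then have "c powr q * v <= B" using q by (simp add: divide_le_cancel)
    moreover have "c powr q * v = I powr q * v powr (1 - q)"
      using I0 v by (simp add: c_def powr_divide powr_diff)
    ultimately have "v powr (q - 1) * (I powr q * v powr (1 - q)) <= v powr (q - 1) * B" by (intro mult_left_mono) auto
    moreover have "v powr (q - 1) * (I powr q * v powr (1 - q)) = I powr q" using v by (simp add: powr_diff)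
    ultimately have "I powr q <= v powr (q - 1) * B" by simp
    then have "ennreal (I powr q) <= ennreal (v powr (q - 1) * B)" by (rule ennreal_leI)
    then show ?thesis using B by (simp add: ennreal_mult)
  qed
qed

text \<open>Half-open cells: those of one level are disjoint, and splitting a cell into its children
  is exact at every point.\<close>

definition cell :: "nat => ('n::finite) idx => (real^'n) set" where
  "cell l t = {x. \<forall>m. real (t m) <= 2 ^ l * x $ m \<and> 2 ^ l * x $ m < real (t m) + 1}"

lemma vec_nth_measurable [measurable]: "(\<lambda>x::real^'n::finite. x $ m) \<in> borel_measurable borel"
  by (intro borel_measurable_continuous_onI continuous_intros)

lemma cell_sets [measurable]: "cell l t \<in> sets borel"
proof -
  have "cell l t = (\<Inter>m\<in>UNIV. {x. real (t m) <= 2 ^ l * x $ m} \<inter> {x. 2 ^ l * x $ m < real (t m) + 1})"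
    by (auto simp: cell_def)
  also have "... \<in> sets borel"
    by (intro sets.finite_INT sets.Int) auto
  finally show ?thesis .
qed

lemma cell_floor: "x \<in> cell l t \<longleftrightarrow> (\<forall>m. 0 <= x $ m \<and> nat \<lfloor>2 ^ l * x $ m\<rfloor> = t m)"
proof -
  have "(real n <= 2 ^ l * y \<and> 2 ^ l * y < real n + 1) \<longleftrightarrow> (0 <= y \<and> nat \<lfloor>2 ^ l * y\<rfloor> = n)" for n and y :: real
  proof
    assume h: "real n <= 2 ^ l * y \<and> 2 ^ l * y < real n + 1"
    then have "\<lfloor>2 ^ l * y\<rfloor> = int n" by (intro floor_unique) auto
    moreover have "0 <= y"
    proof (rule ccontr)
      assume "\<not> 0 <= y"
      then have "2 ^ l * y < 0" by (intro mult_pos_neg) auto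
      then show False using h by linarith
    qed
    ultimately show "0 <= y \<and> nat \<lfloor>2 ^ l * y\<rfloor> = n" by simp
  next
    assume h: "0 <= y \<and> nat \<lfloor>2 ^ l * y\<rfloor> = n"
    then have "real n = of_int \<lfloor>2 ^ l * y\<rfloor>" by auto
    then show "real n <= 2 ^ l * y \<and> 2 ^ l * y < real n + 1" by linarith
  qed
  then show ?thesis by (simp add: cell_def)
qed

lemma cell_unique: "x \<in> cell l t ==> x \<in> cell l t' ==> t = t'"
  by (auto simp: cell_floor)

lemma cell_subset_cube: "t \<in> boxes (2 ^ l) ==> cell l t \<subseteq> cube"
proof
  fix x assume t: "t \<in> boxes (2 ^ l)" and x: "x \<in> cell l t"
  have "0 <= x $ m \<and> x $ m <= 1" for m
  proof -
    have "Suc (t m) <= 2 ^ l" using t by (auto simp: Suc_le_eq)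
    then have "real (Suc (t m)) <= real (2 ^ l)" by (simp only: of_nat_le_iff)
    moreover have "2 ^ l * x $ m < real (t m) + 1" "0 <= x $ m" using x by (auto simp: cell_def) (use x in \<open>simp add: cell_floor\<close>)
    ultimately have "2 ^ l * x $ m <= 2 ^ l * 1" "0 <= x $ m"
      by (simp_all only: mult_1_right of_nat_Suc of_nat_power of_nat_numeral)
    then show ?thesis by simp
  qed
  then show "x \<in> cube" by (auto simp: mem_box_cart)
qed

lemma emeasure_cell: "emeasure lborel (cell l (t :: 'n::finite => nat)) = ennreal ((1 / 2 ^ l) ^ CARD('n))"
proof -
  let ?a = "(\<chi> m. real (t m) / 2 ^ l) :: real^'n" and ?b = "(\<chi> m. (real (t m) + 1) / 2 ^ l) :: real^'n"
  have "box ?a ?b \<subseteq> cell l t" by (auto simp: mem_box_cart cell_def field_simps less_imp_le)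
  then have 1: "emeasure lborel (box ?a ?b) <= emeasure lborel (cell l t)" by (intro emeasure_mono) auto
  have "cell l t \<subseteq> cbox ?a ?b" by (auto simp: mem_box_cart cell_def field_simps less_imp_le)
  then have 2: "emeasure lborel (cell l t) <= emeasure lborel (cbox ?a ?b)" by (intro emeasure_mono) auto
  have "measure lborel (cbox ?a ?b) = (\<Prod>m\<in>UNIV. ?b $ m - ?a $ m)"
    by (rule content_cbox_cart) (auto simp: interval_eq_empty_cart field_simps not_less)
  also have "... = (1 / 2 ^ l) ^ CARD('n)" by (simp add: diff_divide_distrib[symmetric])
  finally have "emeasure lborel (cbox ?a ?b) = ennreal ((1 / 2 ^ l) ^ CARD('n))"
    using emeasure_lborel_cbox_finite[of ?a ?b] by (subst emeasure_eq_ennreal_measure) auto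
  moreover have "emeasure lborel (box ?a ?b) = emeasure lborel (cbox ?a ?b)"
    by (simp add: emeasure_lborel_box_eq emeasure_lborel_cbox_eq)
  ultimately show ?thesis using 1 2 by simp
qed

definition cav :: "nat => (real^'n::finite => real) => 'n idx => real" where
  "cav l f t = (2 ^ l) ^ CARD('n) * (\<integral>x. indicator (cell l t) x * f x \<partial>lborel)"

abbreviation pint :: "real => (real^'n) set => (real^'n::finite => real) => ennreal" where
  "pint q Q f \<equiv> (\<integral>\<^sup>+x\<in>Q. ennreal (\<bar>f x\<bar> powr q) \<partial>lborel)"

lemma integrable_cell:
  assumes "integrable lborel f"
  shows "integrable lborel (\<lambda>x. indicator (cell l t) x * f x :: real)"
  using assms by (intro integrable_real_mult_indicator[of _ lborel f, unfolded mult.commute[of _ "indicator _ _"]]) auto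

lemma translate_integral:
  fixes f :: "real^'n::finite => real"
  assumes [measurable]: "f \<in> borel_measurable borel"
  shows "(\<integral>x. f (x + c) \<partial>lborel) = (\<integral>x. f x \<partial>lborel)"
proof -
  have "(\<integral>x. f x \<partial>lborel) = (\<integral>x. f x \<partial>distr lborel borel ((+) c))" by (simp add: lborel_distr_plus)
  also have "... = (\<integral>x. f (c + x) \<partial>lborel)" by (subst integral_distr) auto
  finally show ?thesis by (simp add: add.commute)
qed

lemma translate_integrable:
  fixes f :: "real^'n::finite => real"
  assumes "integrable lborel f"
  shows "integrable lborel (\<lambda>x. f (x + c))"
proof -
  have [measurable]: "f \<in> borel_measurable borel" using assms by auto
  have "integrable (distr lborel borel ((+) c)) f" using assms by (simp add: lborel_distr_plus)
  then have "integrable lborel (\<lambda>x. f (c + x))" by (subst (asm) integrable_distr_eq) auto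
  then show ?thesis by (simp add: add.commute)
qed

lemma cell_translate:
  "x + real j *\<^sub>R axis m (1 / 2 ^ l) \<in> cell l (t(m := t m + j)) \<longleftrightarrow> x \<in> cell l (t :: 'n::finite => nat)"
proof -
  have "2 ^ l * (x + real j *\<^sub>R axis m (1 / 2 ^ l)) $ m' = 2 ^ l * x $ m' + (if m' = m then real j else 0)" for m'
    by (simp add: axis_def algebra_simps)
  then show ?thesis by (auto simp: cell_def)
qed

text \<open>Translation invariance moves the shift from the cell to the function, so a difference of
  averages is the average of a difference with step \<open>1 / 2 ^ l\<close> along axis
  \<open>m\<close>.\<close>

lemma cdiff_cav:
  fixes f :: "real^'n::finite => real"
  assumes f: "integrable lborel f"
  shows "cdiff k m (cav l f) t = (2 ^ l) ^ CARD('n) * (\<integral>x. indicator (cell l t) x * fdiff k (axis m (1 / 2 ^ l)) f x \<partial>lborel)"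
    "integrable lborel (\<lambda>x. indicator (cell l t) x * fdiff k (axis m (1 / 2 ^ l)) f x)"
proof -
  let ?h = "axis m (1 / 2 ^ l) :: real^'n"
  have [measurable]: "f \<in> borel_measurable borel" using f by auto
  have 1: "cav l f (t(m := t m + j)) = (2 ^ l) ^ CARD('n) * (\<integral>x. indicator (cell l t) x * f (x + real j *\<^sub>R ?h) \<partial>lborel)" for j
  proof -
    have "(\<integral>x. indicator (cell l (t(m := t m + j))) x * f x \<partial>lborel) =
      (\<integral>x. indicator (cell l (t(m := t m + j))) (x + real j *\<^sub>R ?h) * f (x + real j *\<^sub>R ?h) \<partial>lborel)"
      by (rule translate_integral[symmetric]) simp
    then show ?thesis unfolding cav_def by (simp add: indicator_def cell_translate)
  qed
  have 2: "integrable lborel (\<lambda>x. (-1) ^ j * real (k choose j) * (indicator (cell l t) x * f (x + real j *\<^sub>R ?h)))" for j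
    by (intro integrable_mult_right integrable_cell translate_integrable f)
  have 3: "indicator (cell l t) x * fdiff k ?h f x = (\<Sum>j\<le>k. (-1) ^ j * real (k choose j) * (indicator (cell l t) x * f (x + real j *\<^sub>R ?h)))" for x
    by (simp add: fdiff_def sum_distrib_left atLeast0AtMost mult_ac)
  show "integrable lborel (\<lambda>x. indicator (cell l t) x * fdiff k ?h f x)"
    unfolding 3 by (intro Bochner_Integration.integrable_sum 2)
  have "(\<integral>x. indicator (cell l t) x * fdiff k ?h f x \<partial>lborel) =
    (\<Sum>j\<le>k. (-1) ^ j * real (k choose j) * (\<integral>x. indicator (cell l t) x * f (x + real j *\<^sub>R ?h) \<partial>lborel))"
    unfolding 3 by (subst Bochner_Integration.integral_sum, rule 2) (simp only: integral_mult_right_zero)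
  then show "cdiff k m (cav l f) t = (2 ^ l) ^ CARD('n) * (\<integral>x. indicator (cell l t) x * fdiff k ?h f x \<partial>lborel)"
    unfolding cdiff_def fd_def by (simp add: 1 sum_distrib_left mult_ac)
qed

lemma cell_average_powr:
  fixes g :: "real^'n::finite => real"
  assumes q: "q \<ge> 1" and g: "integrable lborel (\<lambda>x. indicator (cell l t) x * g x)" and [measurable]: "g \<in> borel_measurable borel"
  shows "ennreal (\<bar>(2 ^ l) ^ CARD('n) * (\<integral>x. indicator (cell l t) x * g x \<partial>lborel)\<bar> powr q) \<le>
    ennreal ((2 ^ l) ^ CARD('n)) * (pint q (cell l t) g)"
proof -
  let ?P = "(2 ^ l) ^ CARD('n) :: real" and ?I = "\<integral>x. \<bar>indicator (cell l t) x * g x\<bar> \<partial>lborel"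
  have P: "?P > 0" by simp
  have gi: "integrable lborel (\<lambda>x. \<bar>indicator (cell l t) x * g x\<bar>)" using g by (rule integrable_abs)
  have "ennreal ?I = (\<integral>\<^sup>+x. ennreal \<bar>indicator (cell l t) x * g x\<bar> \<partial>lborel)"
    by (rule nn_integral_eq_integral[OF gi, symmetric]) simp
  also have "... = (\<integral>\<^sup>+x\<in>cell l t. ennreal \<bar>g x\<bar> \<partial>lborel)"
    by (intro nn_integral_cong) (simp add: indicator_def)
  finally have I: "ennreal ?I <= (\<integral>\<^sup>+x\<in>cell l t. ennreal \<bar>g x\<bar> \<partial>lborel)" by simp
  have J: "ennreal (?I powr q) <= ennreal ((1 / ?P) powr (q - 1)) * (pint q (cell l t) g)"
    by (rule jensen_powr[OF q _ _ _ _ _ _ I]) (auto simp: emeasure_cell power_one_over)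
  have "\<bar>?P * (\<integral>x. indicator (cell l t) x * g x \<partial>lborel)\<bar> <= ?P * ?I"
    unfolding abs_mult[of ?P] using integral_abs_bound[of lborel "\<lambda>x. indicator (cell l t) x * g x"]
    by (simp only: abs_of_pos[OF P]) (rule mult_left_mono, auto)
  then have "\<bar>?P * (\<integral>x. indicator (cell l t) x * g x \<partial>lborel)\<bar> powr q <= (?P * ?I) powr q" using q by (intro powr_mono2) auto
  then have "ennreal (\<bar>?P * (\<integral>x. indicator (cell l t) x * g x \<partial>lborel)\<bar> powr q) <= ennreal (?P powr q) * ennreal (?I powr q)"
    by (simp add: powr_mult ennreal_mult[symmetric] ennreal_leI)
  also have "... <= ennreal (?P powr q) * (ennreal ((1 / ?P) powr (q - 1)) * (pint q (cell l t) g))"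
    by (intro mult_left_mono J) simp
  also have "... = ennreal (?P powr q * (1 / ?P) powr (q - 1)) * (pint q (cell l t) g)"
    by (simp only: mult.assoc[symmetric] ennreal_mult[symmetric] powr_ge_zero)
  also have "?P powr q * (1 / ?P) powr (q - 1) = ?P"
    using P by (simp add: powr_divide powr_diff del: P)
  finally show ?thesis .
qed

lemma disjoint_cells_sum:
  fixes w :: "real^'n::finite => ennreal"
  assumes [measurable]: "w \<in> borel_measurable borel" and T: "finite T" "\<And>t. t \<in> T ==> cell l t \<subseteq> S"
  shows "(\<Sum>t\<in>T. \<integral>\<^sup>+x\<in>cell l t. w x \<partial>lborel) <= (\<integral>\<^sup>+x\<in>S. w x \<partial>lborel)"
proof -
  have "(\<Sum>t\<in>T. \<integral>\<^sup>+x\<in>cell l t. w x \<partial>lborel) = (\<integral>\<^sup>+x. (\<Sum>t\<in>T. w x * indicator (cell l t) x) \<partial>lborel)"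
    by (rule nn_integral_sum[symmetric]) simp
  also have "... <= (\<integral>\<^sup>+x\<in>S. w x \<partial>lborel)"
  proof (rule nn_integral_mono)
    fix x
    show "(\<Sum>t\<in>T. w x * indicator (cell l t) x) <= w x * indicator S x"
    proof (cases "\<exists>t\<in>T. x \<in> cell l t")
      case True
      then obtain t where t: "t \<in> T" "x \<in> cell l t" by blast
      have "(\<Sum>t\<in>T. w x * indicator (cell l t) x) = (\<Sum>t'\<in>T. if t' = t then w x else 0)"
      proof (intro sum.cong refl)
        fix t'
        have "x \<in> cell l t' \<longleftrightarrow> t' = t" using t(2) cell_unique by blast
        then show "w x * indicator (cell l t') x = (if t' = t then w x else 0)" by (simp add: indicator_def)
      qed
      also have "... = w x" using T(1) t(1) by simp
      finally show ?thesis using T(2)[OF t(1)] t(2) by auto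
    next
      case False
      then have "(\<Sum>t\<in>T. w x * indicator (cell l t) x) = 0" by (intro sum.neutral) auto
      then show ?thesis by simp
    qed
  qed
  finally show ?thesis .
qed

text \<open>The condition \<open>t m + k < 2 ^ l\<close> keeps both the cell and its shift by
  \<open>k\<close> cells in the cube, hence the cell in the domain of the difference. The cells are
  disjoint, so their integrals add up to at most one integral over that domain.\<close>

lemma cdiff_sum_bound:
  fixes f :: "real^'n::finite => real"
  assumes q: "q \<ge> 1" and f: "integrable lborel f"
    and w: "(\<integral>\<^sup>+x\<in>cube_shift k (axis m (1 / 2 ^ l)). ennreal (\<bar>fdiff k (axis m (1 / 2 ^ l)) f x\<bar> powr q) \<partial>lborel) <= ennreal w" "w \<ge> 0"
  shows "(\<Sum>t\<in>{t\<in>boxes (2 ^ l). t m + k < 2 ^ l}. \<bar>cdiff k m (cav l f) t\<bar> powr q) <= (2 ^ l) ^ CARD('n) * w"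
proof -
  let ?h = "axis m (1 / 2 ^ l) :: real^'n" and ?T = "{t\<in>boxes (2 ^ l). t m + k < 2 ^ l}" and ?P = "(2 ^ l) ^ CARD('n) :: real"
  have fm [measurable]: "f \<in> borel_measurable borel" using f by auto
  have fd [measurable]: "fdiff k ?h f \<in> borel_measurable borel" unfolding fdiff_def[abs_def] by measurable
  have fin: "finite ?T" by (rule finite_subset[of _ "boxes (2 ^ l)"]) auto
  have sub: "cell l t \<subseteq> cube_shift k ?h" if t: "t \<in> ?T" for t
  proof
    fix x assume x: "x \<in> cell l t"
    have "x \<in> cube" using x cell_subset_cube[of t l] t by auto
    moreover have "x + real k *\<^sub>R ?h \<in> cell l (t(m := t m + k))" using x by (simp add: cell_translate)
    moreover have "t(m := t m + k) \<in> boxes (2 ^ l)" using t by auto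
    ultimately show "x \<in> cube_shift k ?h" using cell_subset_cube[of "t(m := t m + k)" l] by (auto simp: cube_shift_def)
  qed
  have "ennreal (\<Sum>t\<in>?T. \<bar>cdiff k m (cav l f) t\<bar> powr q) = (\<Sum>t\<in>?T. ennreal (\<bar>cdiff k m (cav l f) t\<bar> powr q))"
    by (rule sum_ennreal[symmetric]) simp
  also have "... <= (\<Sum>t\<in>?T. ennreal ?P * (\<integral>\<^sup>+x\<in>cell l t. ennreal (\<bar>fdiff k ?h f x\<bar> powr q) \<partial>lborel))"
    unfolding cdiff_cav(1)[OF f] by (intro sum_mono cell_average_powr q cdiff_cav(2)[OF f] fd)
  also have "... = ennreal ?P * (\<Sum>t\<in>?T. \<integral>\<^sup>+x\<in>cell l t. ennreal (\<bar>fdiff k ?h f x\<bar> powr q) \<partial>lborel)"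
    by (rule sum_distrib_left[symmetric])
  also have "... <= ennreal ?P * (\<integral>\<^sup>+x\<in>cube_shift k ?h. ennreal (\<bar>fdiff k ?h f x\<bar> powr q) \<partial>lborel)"
    by (intro mult_left_mono disjoint_cells_sum fin sub) auto
  also have "... <= ennreal ?P * ennreal w" by (intro mult_left_mono w) auto
  also have "... = ennreal (?P * w)" using w by (simp add: ennreal_mult)
  finally show ?thesis using w by (simp add: ennreal_le_iff)
qed

lemma cav_sum_bound:
  fixes f :: "real^'n::finite => real"
  assumes q: "q \<ge> 1" and f: "integrable lborel f" and w: "(pint q cube f) <= ennreal w" "w \<ge> 0"
  shows "(\<Sum>t\<in>boxes (2 ^ l). \<bar>cav l f t\<bar> powr q) <= (2 ^ l) ^ CARD('n) * w"
proof -
  let ?P = "(2 ^ l) ^ CARD('n) :: real"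
  have fm [measurable]: "f \<in> borel_measurable borel" using f by auto
  have "ennreal (\<Sum>t\<in>boxes (2 ^ l). \<bar>cav l f t\<bar> powr q) = (\<Sum>t\<in>boxes (2 ^ l). ennreal (\<bar>cav l f t\<bar> powr q))"
    by (rule sum_ennreal[symmetric]) simp
  also have "... <= (\<Sum>t\<in>boxes (2 ^ l). ennreal ?P * (pint q (cell l t) f))"
    unfolding cav_def by (intro sum_mono cell_average_powr q integrable_cell f fm)
  also have "... = ennreal ?P * (\<Sum>t\<in>boxes (2 ^ l). \<integral>\<^sup>+x\<in>cell l t. ennreal (\<bar>f x\<bar> powr q) \<partial>lborel)"
    by (rule sum_distrib_left[symmetric])
  also have "... <= ennreal ?P * (pint q cube f)"
    by (intro mult_left_mono disjoint_cells_sum cell_subset_cube) auto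
  also have "... <= ennreal ?P * ennreal w" by (intro mult_left_mono w) auto
  also have "... = ennreal (?P * w)" using w by (simp add: ennreal_mult)
  finally show ?thesis using w by (simp add: ennreal_le_iff)
qed

subsection \<open>The multiscale expansion\<close>

definition Pl :: "nat => nat => (real^'n::finite => real) => real^'n => real" where
  "Pl k l f x = (\<Sum>t\<in>boxes (2 ^ l). cav l f t * (\<Prod>m\<in>UNIV. Phi k l (t m) (x $ m)))"

lemma Pl_coarse:
  "Pl k l f x = (\<Sum>i\<in>nodes l. \<Sum>\<alpha>\<in>boxes k. coarse k l (cav l f) i \<alpha> * psi \<alpha> (loc l i x))"
proof -
  have "Pl k l f x = (\<Sum>t\<in>boxes (2 ^ l). \<Sum>i\<in>nodes l. \<Sum>\<alpha>\<in>boxes k.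
      cav l f t * (\<Prod>m\<in>UNIV. Vc k l (i m) (\<alpha> m) (t m)) * psi \<alpha> (loc l i x))"
    unfolding Pl_def Phi_def by (subst tensor_expand) (simp add: sum_distrib_left mult.assoc)
  also have "... = (\<Sum>i\<in>nodes l. \<Sum>\<alpha>\<in>boxes k. \<Sum>t\<in>boxes (2 ^ l).
      cav l f t * (\<Prod>m\<in>UNIV. Vc k l (i m) (\<alpha> m) (t m)) * psi \<alpha> (loc l i x))"
    by (subst sum.swap) (intro sum.cong refl sum.swap)
  finally show ?thesis unfolding coarse_def by (simp add: sum_distrib_right)
qed

lemma cav_refine:
  fixes f :: "real^'n::finite => real"
  assumes f: "integrable lborel f" and t': "t' \<in> boxes (2 ^ l)"
  shows "cav l f t' = (1/2) ^ CARD('n) * (\<Sum>t\<in>{t\<in>boxes (2 ^ Suc l). (\<lambda>m. t m div 2) = t'}. cav (Suc l) f t)"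
proof -
  let ?T = "{t\<in>boxes (2 ^ Suc l). (\<lambda>m. t m div 2) = t'}"
  have fin: "finite ?T" by (rule finite_subset[of _ "boxes (2 ^ Suc l)"]) auto
  have fl: "nat \<lfloor>2 ^ Suc l * y\<rfloor> div 2 = nat \<lfloor>2 ^ l * y\<rfloor>" if "y \<ge> 0" for y :: real
  proof -
    have "\<lfloor>2 ^ Suc l * y\<rfloor> div 2 = \<lfloor>2 ^ l * y\<rfloor>"
      using floor_divide_real_eq_div[of 2 "2 ^ Suc l * y"] by simp
    then show ?thesis by (simp add: nat_div_distrib[symmetric] that flip: nat_numeral)
  qed
  have ind: "indicator (cell l t') x = (\<Sum>t\<in>?T. indicator (cell (Suc l) t) x :: real)" for x
  proof (cases "\<forall>m. 0 <= x $ m")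
    case False
    then have "x \<notin> cell l t" for l t by (auto simp: cell_floor)
    then show ?thesis by simp
  next
    case True
    define \<tau> where "\<tau> m = nat \<lfloor>2 ^ Suc l * x $ m\<rfloor>" for m
    have x\<tau>: "x \<in> cell (Suc l) t \<longleftrightarrow> t = \<tau>" for t using True by (auto simp: cell_floor \<tau>_def)
    have xl: "x \<in> cell l t' \<longleftrightarrow> (\<lambda>m. \<tau> m div 2) = t'" using True fl by (auto simp: cell_floor \<tau>_def)
    have "(\<Sum>t\<in>?T. indicator (cell (Suc l) t) x :: real) = (\<Sum>t\<in>?T. if t = \<tau> then 1 else 0)"
      by (intro sum.cong) (auto simp: indicator_def x\<tau>)
    also have "... = (if \<tau> \<in> ?T then 1 else 0)" using fin by simp
    also have "\<tau> \<in> ?T \<longleftrightarrow> (\<lambda>m. \<tau> m div 2) = t'"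
    proof -
      have "\<tau> m < 2 ^ Suc l" if "(\<lambda>m. \<tau> m div 2) = t'" for m
      proof -
        have "\<tau> m div 2 < 2 ^ l" using t' that by auto
        then show ?thesis by (simp add: div_less_iff_less_mult)
      qed
      then show ?thesis by auto
    qed
    finally show ?thesis by (simp add: indicator_def xl)
  qed
  have "(\<integral>x. indicator (cell l t') x * f x \<partial>lborel) = (\<Sum>t\<in>?T. \<integral>x. indicator (cell (Suc l) t) x * f x \<partial>lborel)"
    unfolding ind sum_distrib_right by (rule Bochner_Integration.integral_sum) (rule integrable_cell[OF f])
  then show ?thesis unfolding cav_def by (simp add: sum_distrib_left power_mult_distrib mult_ac power_one_over)
qed

text \<open>The coarse reconstruction is rewritten over the finer level, its averages by
  \<open>cav_refine\<close> and its kernels by \<open>Phi_refine\<close>; then both reconstructions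
  are sums over the same cells, nodes and exponents.\<close>

lemma Pl_refine:
  fixes f :: "real^'n::finite => real"
  assumes k: "k \<ge> 1" and f: "integrable lborel f" and x: "x \<in> cube"
  shows "Pl k (Suc l) f x - Pl k l f x =
    (\<Sum>i\<in>nodes (Suc l). \<Sum>\<alpha>\<in>boxes k. detail k l (cav (Suc l) f) i \<alpha> * psi \<alpha> (loc (Suc l) i x))"
proof -
  let ?X = "\<lambda>m. 2 ^ Suc l * x $ m" and ?B = "boxes (2 ^ Suc l) :: 'n idx set"
  have x': "0 <= x $ m" "x $ m <= 1" for m using x by (auto simp: mem_box_cart)
  let ?g = "\<lambda>t. \<Prod>m\<in>UNIV. Phi k l (t m) (x $ m)"
  have "Pl k l f x = (\<Sum>t'\<in>boxes (2 ^ l). \<Sum>t\<in>{t\<in>?B. (\<lambda>m. t m div 2) = t'}. (1/2) ^ CARD('n) * cav (Suc l) f t * ?g (\<lambda>m. t m div 2))"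
    unfolding Pl_def
  proof (intro sum.cong refl)
    fix t' :: "'n => nat" assume t': "t' \<in> boxes (2 ^ l)"
    let ?T = "{t\<in>?B. (\<lambda>m. t m div 2) = t'}"
    have "cav l f t' * ?g t' = (\<Sum>t\<in>?T. (1/2) ^ CARD('n) * cav (Suc l) f t * ?g t')"
      by (simp only: cav_refine[OF f t'] sum_distrib_left sum_distrib_right mult.assoc)
    also have "... = (\<Sum>t\<in>?T. (1/2) ^ CARD('n) * cav (Suc l) f t * ?g (\<lambda>m. t m div 2))"
    proof (intro sum.cong refl)
      fix t assume "t \<in> ?T"
      then have "t' = (\<lambda>m. t m div 2)" by simp
      then show "(1/2) ^ CARD('n) * cav (Suc l) f t * ?g t' = (1/2) ^ CARD('n) * cav (Suc l) f t * ?g (\<lambda>m. t m div 2)"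
        by (simp only:)
    qed
    finally show "cav l f t' * ?g t' = (\<Sum>t\<in>?T. (1/2) ^ CARD('n) * cav (Suc l) f t * ?g (\<lambda>m. t m div 2))" .
  qed
  also have "... = (\<Sum>t\<in>?B. (1/2) ^ CARD('n) * cav (Suc l) f t * ?g (\<lambda>m. t m div 2))"
    by (rule sum.group) (auto simp: div_less_iff_less_mult mult.commute)
  also have "... = (\<Sum>t\<in>?B. cav (Suc l) f t * (\<Prod>m\<in>UNIV. Phi k l (t m div 2) (x $ m) / 2))"
    by (simp add: prod_dividef power_one_over mult_ac)
  also have "... = (\<Sum>t\<in>?B. cav (Suc l) f t * (\<Sum>i\<in>nodes (Suc l). \<Sum>\<alpha>\<in>boxes k. (\<Prod>m\<in>UNIV. Rc k l (i m) (\<alpha> m) (t m)) * psi \<alpha> (\<lambda>m. ?X m - real (i m))))"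
    unfolding Phi_refine[OF k x'] by (subst tensor_expand) simp
  finally have 1: "Pl k l f x = \<dots>" .
  have 2: "Pl k (Suc l) f x = (\<Sum>t\<in>?B. cav (Suc l) f t * (\<Sum>i\<in>nodes (Suc l). \<Sum>\<alpha>\<in>boxes k. (\<Prod>m\<in>UNIV. Vc k (Suc l) (i m) (\<alpha> m) (t m)) * psi \<alpha> (\<lambda>m. ?X m - real (i m))))"
    unfolding Pl_def Phi_def by (subst tensor_expand) simp
  have "Pl k (Suc l) f x - Pl k l f x = (\<Sum>t\<in>?B. \<Sum>i\<in>nodes (Suc l). \<Sum>\<alpha>\<in>boxes k.
      cav (Suc l) f t * ((\<Prod>m\<in>UNIV. Vc k (Suc l) (i m) (\<alpha> m) (t m)) - (\<Prod>m\<in>UNIV. Rc k l (i m) (\<alpha> m) (t m))) * psi \<alpha> (\<lambda>m. ?X m - real (i m)))"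
    unfolding 1 2 by (simp only: sum_subtractf[symmetric] sum_distrib_left right_diff_distrib left_diff_distrib mult.assoc)
  also have "... = (\<Sum>i\<in>nodes (Suc l). \<Sum>\<alpha>\<in>boxes k. \<Sum>t\<in>?B.
      cav (Suc l) f t * ((\<Prod>m\<in>UNIV. Vc k (Suc l) (i m) (\<alpha> m) (t m)) - (\<Prod>m\<in>UNIV. Rc k l (i m) (\<alpha> m) (t m))) * psi \<alpha> (\<lambda>m. ?X m - real (i m)))"
    by (subst sum.swap) (intro sum.cong refl sum.swap)
  finally show ?thesis unfolding detail_def by (simp only: sum_distrib_right)
qed

subsection \<open>Convergence of the reconstructions\<close>

lemma abs_hat_poly_le:
  assumes "\<And>\<alpha>. \<alpha> < k ==> \<bar>v \<alpha>\<bar> <= C" "C \<ge> 0"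
  shows "\<bar>hat y * (\<Sum>\<alpha><k. v \<alpha> * y ^ \<alpha>)\<bar> <= hat y * (real k * C)"
proof (cases "\<bar>y\<bar> < 1")
  case True
  have "\<bar>\<Sum>\<alpha><k. v \<alpha> * y ^ \<alpha>\<bar> <= (\<Sum>\<alpha><k. C)"
  proof (rule sum_abs[THEN order_trans], rule sum_mono)
    fix \<alpha> assume "\<alpha> \<in> {..<k}"
    then have "\<bar>v \<alpha>\<bar> * \<bar>y ^ \<alpha>\<bar> <= C * 1" using assms True by (intro mult_mono) (auto simp: power_abs power_le_one)
    then show "\<bar>v \<alpha> * y ^ \<alpha>\<bar> <= C" by (simp add: abs_mult)
  qed
  then show ?thesis using hat_bounds[of y] by (auto simp: abs_mult intro: mult_left_mono)
next
  case False
  then have "hat y = 0" using hat_eq_0_iff by auto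
  then show ?thesis by simp
qed

lemma emeasure_cube: "emeasure lborel (cube :: (real^'n::finite) set) = 1"
proof -
  have "measure lborel (cube :: (real^'n) set) = (\<Prod>m\<in>UNIV. (1 :: real^'n) $ m - (0 :: real^'n) $ m)"
    by (rule content_cbox_cart) (auto simp: interval_eq_empty_cart)
  then have "measure lborel (cube :: (real^'n) set) = 1" by simp
  moreover have "emeasure lborel (cube :: (real^'n) set) = ennreal (measure lborel (cube :: (real^'n) set))"
    using emeasure_lborel_cbox_finite[of "0::real^'n" 1] by (intro emeasure_eq_ennreal_measure) auto
  ultimately show ?thesis by simp
qed

lemma hat_partition:
  assumes "0 <= x" "x <= 1" shows "(\<Sum>i\<le>2 ^ l. hat (2 ^ l * x - real i)) = 1"
proof -
  have "0 <= 2 ^ l * x" "2 ^ l * x <= real (2 ^ l)" using assms mult_left_mono[of x 1 "2 ^ l"] by auto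
  then obtain c where "c + 1 <= 2 ^ l" "real c <= 2 ^ l * x" "2 ^ l * x <= real c + 1"
    using cell_exists[of "2 ^ l * x" "2 ^ l"] by auto
  from hat_sum[OF this, of "\<lambda>_. 1"] show ?thesis by simp
qed

lemma Phi_bounds:
  assumes k: "k \<ge> 1"
  shows "\<exists>C\<ge>1. \<forall>l t x. k <= 2 ^ l --> 0 <= x --> x <= 1 -->
    \<bar>Phi k l t x\<bar> <= C \<and> (Phi k l t x \<noteq> 0 --> \<bar>2 ^ l * x - real t\<bar> <= real (2 * k + 2))"
proof -
  obtain C where C: "coeff_bounded k C" "C \<ge> 1"
    using coeff_bound_ex by blast
  show ?thesis
  proof (intro exI[of _ "real k * C"] conjI allI impI)
    show "1 <= real k * C" using k C(2) mult_mono[of 1 "real k" 1 C] by simp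
    fix l t and x :: real assume h: "k <= 2 ^ l" "0 <= x" "x <= 1"
    let ?X = "2 ^ l * x"
    have "\<bar>Phi k l t x\<bar> <= (\<Sum>i\<le>2 ^ l. hat (?X - real i) * (real k * C))"
      unfolding Phi_def
      by (rule sum_abs[THEN order_trans], intro sum_mono abs_hat_poly_le) (use Vc_bound(1)[OF C h(1)] C(2) in auto)
    also have "... = real k * C" unfolding sum_distrib_right[symmetric] hat_partition[OF h(2,3)] by simp
    finally show "\<bar>Phi k l t x\<bar> <= real k * C" .
    assume "Phi k l t x \<noteq> 0"
    then obtain i where i: "i <= 2 ^ l" "hat (?X - real i) * (\<Sum>\<alpha><k. Vc k l i \<alpha> t * (?X - real i) ^ \<alpha>) \<noteq> 0"
      unfolding Phi_def by (meson atMost_iff sum.neutral)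
    then have 1: "\<bar>?X - real i\<bar> < 1" using hat_eq_0_iff[of "?X - real i"] by auto
    have "(\<Sum>\<alpha><k. Vc k l i \<alpha> t * (?X - real i) ^ \<alpha>) \<noteq> 0" using i(2) by auto
    then obtain \<alpha> where \<alpha>: "\<alpha> < k" "Vc k l i \<alpha> t \<noteq> 0" by (metis (no_types, lifting) lessThan_iff mult_zero_left sum.neutral)
    have "t <= i + (2 * k + 1) \<and> i <= t + (2 * k + 1)" using Vc_bound(2)[OF C h(1) i(1) \<alpha>] by blast
    then have "real t <= real (i + (2 * k + 1))" "real i <= real (t + (2 * k + 1))" by (simp_all only: of_nat_le_iff)
    then show "\<bar>?X - real t\<bar> <= real (2 * k + 2)" using 1 by simp
  qed
qed

lemma Phi_sum_one:
  assumes k: "1 <= k" "k <= 2 ^ l" and x: "0 <= x" "x <= 1"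
  shows "(\<Sum>t<2 ^ l. Phi k l t x) = 1"
proof -
  have V: "(\<Sum>t<2 ^ l. Vc k l i \<alpha> t) = (if \<alpha> = 0 then 1 else 0)" if "i <= 2 ^ l" for i \<alpha>
    using Vc_reproduces[OF k(2) that, of "[:0, 1:]" \<alpha>] k(1) by (simp add: pderiv_pCons pcompose_1 one_pCons[symmetric])
  have "(\<Sum>t<2 ^ l. Phi k l t x) = (\<Sum>i\<le>2 ^ l. hat (2 ^ l * x - real i) * (\<Sum>\<alpha><k. (\<Sum>t<2 ^ l. Vc k l i \<alpha> t) * (2 ^ l * x - real i) ^ \<alpha>))"
  proof -
    have "(\<Sum>t<2 ^ l. Phi k l t x) = (\<Sum>i\<le>2 ^ l. \<Sum>t<2 ^ l. hat (2 ^ l * x - real i) * (\<Sum>\<alpha><k. Vc k l i \<alpha> t * (2 ^ l * x - real i) ^ \<alpha>))"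
      unfolding Phi_def by (rule sum.swap)
    also have "... = (\<Sum>i\<le>2 ^ l. hat (2 ^ l * x - real i) * (\<Sum>\<alpha><k. \<Sum>t<2 ^ l. Vc k l i \<alpha> t * (2 ^ l * x - real i) ^ \<alpha>))"
      unfolding sum_distrib_left[symmetric] by (intro sum.cong refl arg_cong2[of _ _ _ _ "(*)"] sum.swap)
    finally show ?thesis by (simp only: sum_distrib_right)
  qed
  also have "... = (\<Sum>i\<le>2 ^ l. hat (2 ^ l * x - real i) * 1)"
  proof (intro sum.cong refl arg_cong2[of _ _ _ _ "(*)"])
    fix i :: nat assume "i \<in> {..2 ^ l}"
    then have "(\<Sum>\<alpha><k. (\<Sum>t<2 ^ l. Vc k l i \<alpha> t) * (2 ^ l * x - real i) ^ \<alpha>) = (\<Sum>\<alpha><k. if \<alpha> = 0 then 1 else 0)"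
      by (intro sum.cong refl) (simp add: V)
    also have "... = 1" using k(1) by simp
    finally show "(\<Sum>\<alpha><k. (\<Sum>t<2 ^ l. Vc k l i \<alpha> t) * (2 ^ l * x - real i) ^ \<alpha>) = 1" .
  qed
  finally show ?thesis using hat_partition[OF x] by simp
qed

lemma Phi_sum_abs:
  assumes C: "\<And>t. \<bar>Phi k l t x\<bar> <= C" "\<And>t. Phi k l t x \<noteq> 0 ==> \<bar>2 ^ l * x - real t\<bar> <= real (2 * k + 2)" and "C \<ge> 0" "x \<ge> 0"
  shows "(\<Sum>t<2 ^ l. \<bar>Phi k l t x\<bar>) <= real (4 * k + 6) * C"
proof -
  define c where "c = nat \<lfloor>2 ^ l * x\<rfloor>"
  have "real c = of_int \<lfloor>2 ^ l * x\<rfloor>" using assms(4) by (simp add: c_def)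
  then have c: "real c <= 2 ^ l * x" "2 ^ l * x < real c + 1" by linarith+
  let ?T = "{t\<in>{..<2 ^ l}. Phi k l t x \<noteq> 0}"
  have "(\<Sum>t<2 ^ l. \<bar>Phi k l t x\<bar>) = (\<Sum>t\<in>?T. \<bar>Phi k l t x\<bar>)" by (rule sum.mono_neutral_right) auto
  also have "... <= (\<Sum>t\<in>?T. C)" by (intro sum_mono C)
  also have "... = real (card ?T) * C" by simp
  also have "card ?T <= card {c - (2 * k + 2)..c + 1 + (2 * k + 2)}"
  proof (rule card_mono)
    show "?T \<subseteq> {c - (2 * k + 2)..c + 1 + (2 * k + 2)}"
    proof
      fix t assume "t \<in> ?T"
      then have "\<bar>2 ^ l * x - real t\<bar> <= real (2 * k + 2)" using C(2) by auto
      then have "real t <= real (c + 1 + (2 * k + 2))" "real c <= real (t + (2 * k + 2))" using c by auto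
      then have "t <= c + 1 + (2 * k + 2)" "c <= t + (2 * k + 2)" by (simp_all only: of_nat_le_iff)
      then show "t \<in> {c - (2 * k + 2)..c + 1 + (2 * k + 2)}" by auto
    qed
  qed simp
  then have "real (card ?T) * C <= real (4 * k + 6) * C" using assms(3) by (intro mult_right_mono) auto
  finally show ?thesis .
qed

lemma nn_integral_cbox_indicator:
  fixes c :: "'n::finite => real"
  assumes "r \<ge> 0"
  shows "emeasure lborel {x::real^'n. \<forall>m. \<bar>2 ^ l * x $ m - c m\<bar> <= r} = ennreal ((2 * r / 2 ^ l) ^ CARD('n))"
proof -
  let ?a = "(\<chi> m. (c m - r) / 2 ^ l) :: real^'n" and ?b = "(\<chi> m. (c m + r) / 2 ^ l) :: real^'n"
  have e: "{x::real^'n. \<forall>m. \<bar>2 ^ l * x $ m - c m\<bar> <= r} = cbox ?a ?b"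
    by (auto simp: mem_box_cart abs_le_iff field_simps)
  have "measure lborel (cbox ?a ?b) = (\<Prod>m\<in>UNIV. ?b $ m - ?a $ m)"
    by (rule content_cbox_cart) (use assms in \<open>auto simp: interval_eq_empty_cart field_simps not_less\<close>)
  also have "... = (2 * r / 2 ^ l) ^ CARD('n)" by (simp add: diff_divide_distrib[symmetric])
  finally show ?thesis unfolding e
    using emeasure_lborel_cbox_finite[of ?a ?b] by (subst emeasure_eq_ennreal_measure) auto
qed

lemma measurable_Pl [measurable]: "Pl k l f \<in> borel_measurable borel"
  unfolding Pl_def[abs_def] Phi_def hat_def relu_def by measurable

text \<open>Averaging does not increase the L1 norm, and each average is spread by a kernel of
  bounded height over a cube whose side is a fixed multiple of the cell side.\<close>

lemma Pl_L1_bound: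
  assumes k: "k \<ge> 1"
  shows "\<exists>C\<ge>0. \<forall>l (f :: real^'n::finite => real) w. k <= 2 ^ l --> integrable lborel f --> w \<ge> 0 -->
    (\<integral>\<^sup>+x\<in>cube. ennreal \<bar>f x\<bar> \<partial>lborel) <= ennreal w --> (\<integral>\<^sup>+x\<in>cube. ennreal \<bar>Pl k l f x\<bar> \<partial>lborel) <= ennreal (C * w)"
proof -
  obtain C where C: "C \<ge> 1" "\<And>l t x. k <= 2 ^ l ==> 0 <= x ==> x <= 1 ==>
    \<bar>Phi k l t x\<bar> <= C \<and> (Phi k l t x \<noteq> 0 --> \<bar>2 ^ l * x - real t\<bar> <= real (2 * k + 2))" using Phi_bounds[OF k] by blast
  let ?d = "CARD('n)"
  show ?thesis
  proof (intro exI[of _ "C ^ ?d * (2 * real (2 * k + 2)) ^ ?d"] conjI allI impI)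
    show "0 <= C ^ ?d * (2 * real (2 * k + 2)) ^ ?d" using C(1) by simp
    fix l w and f :: "real^'n => real"
    assume h: "k <= 2 ^ l" "integrable lborel f" "w \<ge> 0" "(\<integral>\<^sup>+x\<in>cube. ennreal \<bar>f x\<bar> \<partial>lborel) <= ennreal w"
    let ?Z = "\<lambda>t. {x::real^'n. \<forall>m. \<bar>2 ^ l * x $ m - real (t m)\<bar> <= real (2 * k + 2)}"
    have Zs [measurable]: "?Z t \<in> sets borel" for t
    proof -
      have "?Z t = (\<Inter>m\<in>UNIV. {x. \<bar>2 ^ l * x $ m - real (t m)\<bar> <= real (2 * k + 2)})" by auto
      also have "... \<in> sets borel" by (intro sets.finite_INT) auto
      finally show ?thesis .
    qed
    have S: "(\<Sum>t\<in>boxes (2 ^ l). \<bar>cav l f t\<bar>) <= (2 ^ l) ^ ?d * w"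
      using cav_sum_bound[of 1 f w l] h by simp
    have "(\<integral>\<^sup>+x\<in>cube. ennreal \<bar>Pl k l f x\<bar> \<partial>lborel) <= (\<integral>\<^sup>+x. (\<Sum>t\<in>boxes (2 ^ l). ennreal (\<bar>cav l f t\<bar> * C ^ ?d) * indicator (?Z t) x) \<partial>lborel)"
    proof (rule nn_integral_mono)
      fix x :: "real^'n"
      show "ennreal \<bar>Pl k l f x\<bar> * indicator cube x <= (\<Sum>t\<in>boxes (2 ^ l). ennreal (\<bar>cav l f t\<bar> * C ^ ?d) * indicator (?Z t) x)"
      proof (cases "x \<in> cube")
        case True
        then have x: "0 <= x $ m" "x $ m <= 1" for m by (auto simp: mem_box_cart)
        have "\<bar>Pl k l f x\<bar> <= (\<Sum>t\<in>boxes (2 ^ l). \<bar>cav l f t\<bar> * C ^ ?d * indicator (?Z t) x)"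
          unfolding Pl_def
        proof (rule sum_abs[THEN order_trans], rule sum_mono)
          fix t :: "'n => nat"
          show "\<bar>cav l f t * (\<Prod>m\<in>UNIV. Phi k l (t m) (x $ m))\<bar> <= \<bar>cav l f t\<bar> * C ^ ?d * indicator (?Z t) x"
          proof (cases "x \<in> ?Z t")
            case True
            have "\<bar>\<Prod>m\<in>UNIV. Phi k l (t m) (x $ m)\<bar> <= (\<Prod>m\<in>(UNIV::'n set). C)"
              unfolding abs_prod using C(2)[OF h(1) x] by (intro prod_mono) auto
            then have "\<bar>cav l f t\<bar> * \<bar>\<Prod>m\<in>UNIV. Phi k l (t m) (x $ m)\<bar> <= \<bar>cav l f t\<bar> * C ^ ?d" by (intro mult_left_mono) auto
            then show ?thesis using True by (simp add: abs_mult)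
          next
            case False
            then obtain m where "\<not> \<bar>2 ^ l * x $ m - real (t m)\<bar> <= real (2 * k + 2)" by auto
            then have "Phi k l (t m) (x $ m) = 0" using C(2)[OF h(1) x] by blast
            then have P0: "(\<Prod>m\<in>UNIV. Phi k l (t m) (x $ m)) = 0" by (intro prod_zero) auto
            show ?thesis unfolding P0 using C(1) by simp
          qed
        qed
        then have "ennreal \<bar>Pl k l f x\<bar> <= ennreal (\<Sum>t\<in>boxes (2 ^ l). \<bar>cav l f t\<bar> * C ^ ?d * indicator (?Z t) x)" by (rule ennreal_leI)
        also have "... = (\<Sum>t\<in>boxes (2 ^ l). ennreal (\<bar>cav l f t\<bar> * C ^ ?d * indicator (?Z t) x))"
          using C(1) by (intro sum_ennreal[symmetric]) auto
        also have "... = (\<Sum>t\<in>boxes (2 ^ l). ennreal (\<bar>cav l f t\<bar> * C ^ ?d) * indicator (?Z t) x)"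
          by (intro sum.cong refl) (simp add: indicator_def)
        finally show ?thesis using True by simp
      qed simp
    qed
    also have "... = (\<Sum>t\<in>boxes (2 ^ l). \<integral>\<^sup>+x. ennreal (\<bar>cav l f t\<bar> * C ^ ?d) * indicator (?Z t) x \<partial>lborel)"
      by (rule nn_integral_sum) simp
    also have "... = (\<Sum>t\<in>boxes (2 ^ l). ennreal (\<bar>cav l f t\<bar> * C ^ ?d) * ennreal ((2 * real (2 * k + 2) / 2 ^ l) ^ ?d))"
      by (intro sum.cong refl, subst nn_integral_cmult_indicator) (auto simp: nn_integral_cbox_indicator)
    also have "... = (\<Sum>t\<in>boxes (2 ^ l). ennreal (\<bar>cav l f t\<bar> * C ^ ?d * (2 * real (2 * k + 2) / 2 ^ l) ^ ?d))"
      using C(1) by (intro sum.cong refl ennreal_mult[symmetric]) auto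
    also have "... = ennreal (\<Sum>t\<in>boxes (2 ^ l). \<bar>cav l f t\<bar> * C ^ ?d * (2 * real (2 * k + 2) / 2 ^ l) ^ ?d)"
      using C(1) by (intro sum_ennreal) auto
    also have "... <= ennreal (C ^ ?d * (2 * real (2 * k + 2)) ^ ?d * w)"
    proof (rule ennreal_leI)
      have "(\<Sum>t\<in>boxes (2 ^ l). \<bar>cav l f t\<bar> * C ^ ?d * (2 * real (2 * k + 2) / 2 ^ l) ^ ?d) =
        (\<Sum>t\<in>boxes (2 ^ l). \<bar>cav l f t\<bar>) * (C ^ ?d * (2 * real (2 * k + 2) / 2 ^ l) ^ ?d)"
        by (simp only: sum_distrib_right mult.assoc)
      also have "... <= (2 ^ l) ^ ?d * w * (C ^ ?d * (2 * real (2 * k + 2) / 2 ^ l) ^ ?d)"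
        using C(1) by (intro mult_right_mono S) auto
      also have "... = C ^ ?d * (2 * real (2 * k + 2)) ^ ?d * w" by (simp add: power_divide)
      finally show "(\<Sum>t\<in>boxes (2 ^ l). \<bar>cav l f t\<bar> * C ^ ?d * (2 * real (2 * k + 2) / 2 ^ l) ^ ?d) <= C ^ ?d * (2 * real (2 * k + 2)) ^ ?d * w" .
    qed
    finally show "(\<integral>\<^sup>+x\<in>cube. ennreal \<bar>Pl k l f x\<bar> \<partial>lborel) <= ennreal (C ^ ?d * (2 * real (2 * k + 2)) ^ ?d * w)" .
  qed
qed

lemma cav_const:
  "(2 ^ l) ^ CARD('n) * (\<integral>x. indicator (cell l (t::'n::finite => nat)) x * c \<partial>lborel) = (c::real)"
  "integrable lborel (\<lambda>x. indicator (cell l (t::'n::finite => nat)) x * (c::real))"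
proof -
  have i: "integrable lborel (indicator (cell l t) :: real^'n => real)"
    by (rule integrable_real_indicator) (auto simp: emeasure_cell)
  then show "integrable lborel (\<lambda>x. indicator (cell l t) x * c)" by simp
  have "(\<integral>x. indicator (cell l t) x \<partial>lborel) = ((1 / 2 ^ l) ^ CARD('n) :: real)"
    by (simp add: measure_def emeasure_cell)
  then show "(2 ^ l) ^ CARD('n) * (\<integral>x. indicator (cell l t) x * c \<partial>lborel) = c" by (simp add: power_one_over)
qed

text \<open>The kernels sum to 1, their absolute values have a bounded sum, and only cells within a
  fixed multiple of the cell side of \<open>x\<close> take part. Uniform continuity on the cube does
  the rest.\<close>

lemma Pl_uniform:
  fixes g :: "real^'n::finite => real"
  assumes k: "k \<ge> 1" and g: "continuous_on UNIV g" and \<epsilon>: "\<epsilon> > 0"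
  shows "\<exists>l0. \<forall>l\<ge>l0. \<forall>x\<in>cube. \<bar>Pl k l (\<lambda>x. indicator cube x * g x) x - g x\<bar> <= \<epsilon>"
proof -
  let ?d = "CARD('n)" and ?g = "\<lambda>x. indicator cube x * g x :: real"
  obtain C where C: "C \<ge> 1" "\<And>l t x. k <= 2 ^ l ==> 0 <= x ==> x <= 1 ==>
    \<bar>Phi k l t x\<bar> <= C \<and> (Phi k l t x \<noteq> 0 --> \<bar>2 ^ l * x - real t\<bar> <= real (2 * k + 2))" using Phi_bounds[OF k] by blast
  define K where "K = (real (4 * k + 6) * C) ^ ?d"
  have K: "K > 0" using C(1) by (simp add: K_def)
  have "uniformly_continuous_on cube g"
    by (rule compact_uniformly_continuous[OF continuous_on_subset[OF g]]) auto
  then obtain \<delta> where \<delta>: "\<delta> > 0" "\<And>x y. x \<in> cube ==> y \<in> cube ==> dist y x < \<delta> ==> \<bar>g y - g x\<bar> < \<epsilon> / K"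
    using \<epsilon> K unfolding uniformly_continuous_on_def dist_real_def by (metis divide_pos_pos)
  obtain N where N: "real ?d * real (2 * k + 3) / \<delta> < 2 ^ N" using real_arch_pow[of 2 "real ?d * real (2 * k + 3) / \<delta>"] by auto
  have gi: "integrable lborel ?g"
    using borel_integrable_compact[OF compact_cbox continuous_on_subset[OF g subset_UNIV], of 0 1] by simp
  show ?thesis
  proof (intro exI[of _ "max N k"] allI impI ballI)
    fix l x assume l: "l \<ge> max N k" and x: "x \<in> (cube :: (real^'n) set)"
    have kl: "k <= 2 ^ l"
    proof -
      have "k < 2 ^ k" by (rule less_exp)
      also have "(2::nat) ^ k <= 2 ^ l" using l by (intro power_increasing) auto
      finally show ?thesis by simp
    qed
    have x': "0 <= x $ m" "x $ m <= 1" for m using x by (auto simp: mem_box_cart)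
    have N2: "(2::real) ^ N <= 2 ^ l" using l by (intro power_increasing) auto
    have small: "real ?d * (real (2 * k + 3) / 2 ^ l) < \<delta>"
    proof -
      have "real ?d * real (2 * k + 3) / \<delta> < 2 ^ l" using N N2 by linarith
      then have "real ?d * real (2 * k + 3) < 2 ^ l * \<delta>" using \<delta>(1) by (simp only: pos_divide_less_eq)
      then have "real ?d * real (2 * k + 3) / 2 ^ l < \<delta>" by (simp only: pos_divide_less_eq zero_less_power zero_less_numeral mult.commute[of \<delta>])
      then show ?thesis by (simp only: times_divide_eq_right)
    qed
    let ?P = "\<lambda>t. \<Prod>m\<in>UNIV. Phi k l (t m) (x $ m)"
    have one: "(\<Sum>t\<in>boxes (2 ^ l). ?P t) = 1"
      unfolding boxes_PiE by (subst prod_sum_PiE[symmetric]) (auto simp: Phi_sum_one[OF k kl x'])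
    have abs: "(\<Sum>t\<in>boxes (2 ^ l). \<bar>?P t\<bar>) <= K"
    proof -
      have "(\<Sum>t\<in>boxes (2 ^ l). \<bar>?P t\<bar>) = (\<Prod>m\<in>UNIV. \<Sum>t<2 ^ l. \<bar>Phi k l t (x $ m)\<bar>)"
        unfolding boxes_PiE abs_prod by (subst prod_sum_PiE) auto
      also have "... <= (\<Prod>m\<in>(UNIV::'n set). real (4 * k + 6) * C)"
        using C kl x' by (intro prod_mono conjI sum_nonneg Phi_sum_abs) auto
      finally show ?thesis by (simp add: K_def)
    qed
    have "\<bar>cav l ?g t - g x\<bar> * \<bar>?P t\<bar> <= \<epsilon> / K * \<bar>?P t\<bar>" if t: "t \<in> boxes (2 ^ l)" for t
    proof (cases "?P t = 0")
      case False
      then have near: "\<bar>2 ^ l * x $ m - real (t m)\<bar> <= real (2 * k + 2)" for m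
        using C(2)[OF kl x'] by (metis UNIV_I finite_code prod_zero)
      have close: "\<bar>g y - g x\<bar> <= \<epsilon> / K" if y: "y \<in> cell l t" for y
      proof -
        have "\<bar>(y - x) $ m\<bar> <= real (2 * k + 3) / 2 ^ l" for m
        proof -
          have "\<bar>2 ^ l * y $ m - real (t m)\<bar> <= 1" using y by (auto simp: cell_def abs_le_iff dest!: spec[of _ m])
          then have "\<bar>2 ^ l * y $ m - 2 ^ l * x $ m\<bar> <= real (2 * k + 3)" using near[of m] by simp
          then have "2 ^ l * \<bar>y $ m - x $ m\<bar> <= real (2 * k + 3)" by (simp add: abs_mult flip: right_diff_distrib)
          then show ?thesis by (simp add: field_simps)
        qed
        then have "norm (y - x) <= (\<Sum>m\<in>(UNIV::'n set). real (2 * k + 3) / 2 ^ l)"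
          by (intro order_trans[OF norm_le_l1_cart] sum_mono)
        then have "dist y x < \<delta>" using small by (simp add: dist_norm)
        then show ?thesis using \<delta>(2)[OF x] cell_subset_cube[OF t] y by (meson less_imp_le subsetD)
      qed
      have "cav l ?g t - g x = (2 ^ l) ^ ?d * (\<integral>y. indicator (cell l t) y * ?g y \<partial>lborel) - (2 ^ l) ^ ?d * (\<integral>y. indicator (cell l t) y * g x \<partial>lborel)"
        unfolding cav_const(1) by (simp add: cav_def)
      also have "... = (2 ^ l) ^ ?d * (\<integral>y. indicator (cell l t) y * ?g y - indicator (cell l t) y * g x \<partial>lborel)"
        by (subst Bochner_Integration.integral_diff[OF integrable_cell[OF gi] cav_const(2)]) (rule right_diff_distrib[symmetric])
      finally have "\<bar>cav l ?g t - g x\<bar> = (2 ^ l) ^ ?d * \<bar>\<integral>y. indicator (cell l t) y * ?g y - indicator (cell l t) y * g x \<partial>lborel\<bar>"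
        by (simp add: abs_mult)
      also have "... <= (2 ^ l) ^ ?d * (\<integral>y. \<bar>indicator (cell l t) y * ?g y - indicator (cell l t) y * g x\<bar> \<partial>lborel)"
        by (intro mult_left_mono integral_abs_bound) simp
      also have "... <= (2 ^ l) ^ ?d * (\<integral>y. indicator (cell l t) y * (\<epsilon> / K) \<partial>lborel)"
      proof (intro mult_left_mono integral_mono)
        show "integrable lborel (\<lambda>y. \<bar>indicator (cell l t) y * ?g y - indicator (cell l t) y * g x\<bar>)"
          by (intro integrable_abs Bochner_Integration.integrable_diff integrable_cell[OF gi] cav_const(2))
        show "\<bar>indicator (cell l t) y * ?g y - indicator (cell l t) y * g x\<bar> <= indicator (cell l t) y * (\<epsilon> / K)" for y
          using close[of y] cell_subset_cube[OF t] by (cases "y \<in> cell l t") auto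
      qed (auto intro: cav_const(2))
      also have "... = \<epsilon> / K" by (rule cav_const(1))
      finally show ?thesis by (rule mult_right_mono) simp
    qed (simp only: abs_zero mult_zero_right order_refl)
    then have "(\<Sum>t\<in>boxes (2 ^ l). \<bar>cav l ?g t - g x\<bar> * \<bar>?P t\<bar>) <= (\<Sum>t\<in>boxes (2 ^ l). \<epsilon> / K * \<bar>?P t\<bar>)" by (rule sum_mono)
    also have "... <= \<epsilon> / K * K" unfolding sum_distrib_left[symmetric] using \<epsilon> K by (intro mult_left_mono abs) auto
    also have "... = \<epsilon>" using K by simp
    finally have 1: "(\<Sum>t\<in>boxes (2 ^ l). \<bar>cav l ?g t - g x\<bar> * \<bar>?P t\<bar>) <= \<epsilon>" .
    have "Pl k l ?g x - g x = (\<Sum>t\<in>boxes (2 ^ l). (cav l ?g t - g x) * ?P t)"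
      unfolding Pl_def left_diff_distrib sum_subtractf sum_distrib_left[symmetric] one by simp
    then have "\<bar>Pl k l ?g x - g x\<bar> <= (\<Sum>t\<in>boxes (2 ^ l). \<bar>cav l ?g t - g x\<bar> * \<bar>?P t\<bar>)"
      using sum_abs[of "\<lambda>t. (cav l ?g t - g x) * ?P t" "boxes (2 ^ l)"] by (simp add: abs_mult)
    then show "\<bar>Pl k l ?g x - g x\<bar> <= \<epsilon>" using 1 by linarith
  qed
qed

text \<open>Measurability yields continuous functions that converge to \<open>f\<close> merely
  almost everywhere. Truncating \<open>f\<close> at a level \<open>M\<close> first, and then the
  approximants as well, supplies the dominating function on the cube.\<close>

lemma continuous_L1_dense:
  fixes f :: "real^'n::finite => real"
  assumes f: "integrable lborel f" and \<epsilon>: "\<epsilon> > 0"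
  shows "\<exists>g. continuous_on UNIV g \<and> (\<integral>x. indicator cube x * \<bar>f x - g x\<bar> \<partial>lborel) <= \<epsilon> \<and> integrable lborel (\<lambda>x. indicator cube x * \<bar>f x - g x\<bar>)"
proof -
  have fm [measurable]: "f \<in> borel_measurable borel" using f by auto
  define cl where "cl M y = max (- M) (min M y)" for M y :: real
  have cl_b: "\<bar>cl M y\<bar> <= M" if "M \<ge> 0" for M y using that by (auto simp: cl_def)
  have cl_le: "\<bar>y - cl M y\<bar> <= \<bar>y\<bar>" if "M \<ge> 0" for M y using that by (auto simp: cl_def)
  have "(\<lambda>M. \<integral>x. \<bar>f x - cl (real M) (f x)\<bar> \<partial>lborel) \<longlonglongrightarrow> (\<integral>x. 0 \<partial>(lborel :: (real^'n) measure))"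
  proof (rule integral_dominated_convergence[where w = "\<lambda>x. \<bar>f x\<bar>"])
    show "AE x in lborel. (\<lambda>M. \<bar>f x - cl (real M) (f x)\<bar>) \<longlonglongrightarrow> 0"
    proof (rule AE_I2)
      fix x
      have "eventually (\<lambda>M. \<bar>f x - cl (real M) (f x)\<bar> = 0) sequentially"
        using eventually_ge_at_top[of "nat \<lceil>\<bar>f x\<bar>\<rceil>"]
      proof eventually_elim
        case (elim M)
        then have "\<bar>f x\<bar> <= real M" by linarith
        then show ?case by (auto simp: cl_def)
      qed
      then show "(\<lambda>M. \<bar>f x - cl (real M) (f x)\<bar>) \<longlonglongrightarrow> 0" by (rule tendsto_eventually)
    qed
    show "AE x in lborel. norm \<bar>f x - cl (real M) (f x)\<bar> <= \<bar>f x\<bar>" for M using cl_le by auto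
  qed (use f in \<open>auto simp: cl_def\<close>)
  then have "eventually (\<lambda>M. (\<integral>x. \<bar>f x - cl (real M) (f x)\<bar> \<partial>lborel) < \<epsilon> / 2) sequentially"
    using \<epsilon> by (intro order_tendstoD(2)[of _ 0]) auto
  then obtain M where M: "(\<integral>x. \<bar>f x - cl (real M) (f x)\<bar> \<partial>lborel) < \<epsilon> / 2" by (meson eventually_sequentially order_refl)
  have "f measurable_on UNIV" by (simp add: measurable_on_iff_borel_measurable lebesgue_on_UNIV_eq measurable_completion)
  then obtain N g where g: "negligible N" "\<And>n. continuous_on UNIV (g n)" "\<And>x. x \<notin> N ==> (\<lambda>n. g n x) \<longlonglongrightarrow> f x"
    by (auto simp: measurable_on_def)
  have gm [measurable]: "g n \<in> borel_measurable borel" for n using g(2) by (rule borel_measurable_continuous_onI)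
  have AEN: "AE x in lborel. x \<notin> N"
  proof -
    have "N \<in> null_sets lebesgue" using g(1) by (simp add: negligible_iff_null_sets)
    then have "AE x in lebesgue. x \<notin> N" by (rule AE_not_in)
    then show ?thesis by (simp only: AE_completion_iff)
  qed
  have clM: "integrable lborel (\<lambda>x :: real^'n. indicator cube x * real M :: real)"
    using emeasure_lborel_cbox_finite[of "0::real^'n" 1] by (intro integrable_mult_left integrable_real_indicator) auto
  have "(\<lambda>n. \<integral>x. indicator cube x * \<bar>cl (real M) (f x) - cl (real M) (g n x)\<bar> \<partial>lborel) \<longlonglongrightarrow> (\<integral>x. 0 \<partial>(lborel :: (real^'n) measure))"
  proof (rule integral_dominated_convergence[where w = "\<lambda>x. 2 * (indicator cube x * real M)"])
    show "AE x in lborel. (\<lambda>n. indicator cube x * \<bar>cl (real M) (f x) - cl (real M) (g n x)\<bar>) \<longlonglongrightarrow> 0"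
      using AEN
    proof eventually_elim
      case (elim x)
      have "(\<lambda>n. indicator cube x * \<bar>cl (real M) (f x) - cl (real M) (g n x)\<bar>) \<longlonglongrightarrow> indicator cube x * \<bar>cl (real M) (f x) - cl (real M) (f x)\<bar>"
        unfolding cl_def by (intro tendsto_intros g(3) elim)
      then show ?case by simp
    qed
    show "AE x in lborel. norm (indicator cube x * \<bar>cl (real M) (f x) - cl (real M) (g n x)\<bar>) <= 2 * (indicator cube x * real M)" for n
    proof (rule AE_I2)
      fix x
      have "\<bar>cl (real M) (f x) - cl (real M) (g n x)\<bar> <= 2 * real M" using cl_b[of "real M" "f x"] cl_b[of "real M" "g n x"] by linarith
      then show "norm (indicator cube x * \<bar>cl (real M) (f x) - cl (real M) (g n x)\<bar>) <= 2 * (indicator cube x * real M)"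
        by (simp add: indicator_def)
    qed
  qed (use clM in \<open>auto simp: cl_def\<close>)
  then have "eventually (\<lambda>n. (\<integral>x. indicator cube x * \<bar>cl (real M) (f x) - cl (real M) (g n x)\<bar> \<partial>lborel) < \<epsilon> / 2) sequentially"
    using \<epsilon> by (intro order_tendstoD(2)[of _ 0]) auto
  then obtain n where n: "(\<integral>x. indicator cube x * \<bar>cl (real M) (f x) - cl (real M) (g n x)\<bar> \<partial>lborel) < \<epsilon> / 2" by (meson eventually_sequentially order_refl)
  let ?g = "\<lambda>x. cl (real M) (g n x)"
  have cont: "continuous_on UNIV ?g" unfolding cl_def by (intro continuous_intros g(2))
  have fi: "integrable lborel (\<lambda>x. \<bar>f x - cl (real M) (f x)\<bar>)"
  proof (rule Bochner_Integration.integrable_bound[OF f])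
    show "AE x in lborel. norm \<bar>f x - cl (real M) (f x)\<bar> <= norm (f x)" using cl_le[of "real M"] by auto
  qed (auto simp: cl_def)
  have gi: "integrable lborel (\<lambda>x. indicator cube x * \<bar>cl (real M) (f x) - ?g x\<bar>)"
  proof (rule Bochner_Integration.integrable_bound[of _ "\<lambda>x. 2 * (indicator cube x * real M)"])
    show "AE x in lborel. norm (indicator cube x * \<bar>cl (real M) (f x) - ?g x\<bar>) <= norm (2 * (indicator cube x * real M))"
    proof (rule AE_I2)
      fix x
      have "\<bar>cl (real M) (f x) - cl (real M) (g n x)\<bar> <= 2 * real M" using cl_b[of "real M" "f x"] cl_b[of "real M" "g n x"] by linarith
      then show "norm (indicator cube x * \<bar>cl (real M) (f x) - ?g x\<bar>) <= norm (2 * (indicator cube x * real M))"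
        by (simp add: indicator_def)
    qed
  qed (use clM in \<open>auto simp: cl_def\<close>)
  have le: "indicator cube x * \<bar>f x - ?g x\<bar> <= \<bar>f x - cl (real M) (f x)\<bar> + indicator cube x * \<bar>cl (real M) (f x) - ?g x\<bar>" for x
    by (auto simp: indicator_def)
  have int: "integrable lborel (\<lambda>x. indicator cube x * \<bar>f x - ?g x\<bar>)"
  proof (rule Bochner_Integration.integrable_bound[OF Bochner_Integration.integrable_add[OF fi gi]])
    show "AE x in lborel. norm (indicator cube x * \<bar>f x - ?g x\<bar>) <= norm (\<bar>f x - cl (real M) (f x)\<bar> + indicator cube x * \<bar>cl (real M) (f x) - ?g x\<bar>)"
      using le by (auto simp: indicator_def)
  qed (auto simp: cl_def)
  have "(\<integral>x. indicator cube x * \<bar>f x - ?g x\<bar> \<partial>lborel) <= (\<integral>x. \<bar>f x - cl (real M) (f x)\<bar> + indicator cube x * \<bar>cl (real M) (f x) - ?g x\<bar> \<partial>lborel)"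
    by (intro integral_mono int Bochner_Integration.integrable_add fi gi le)
  also have "... <= \<epsilon>" using M n by (simp add: Bochner_Integration.integral_add[OF fi gi])
  finally show ?thesis using cont int by blast
qed

lemma Pl_diff:
  assumes "integrable lborel f" "integrable lborel g"
  shows "Pl k l (\<lambda>x. f x - g x) x = Pl k l f x - Pl k l g x"
proof -
  have "cav l (\<lambda>x. f x - g x) t = cav l f t - cav l g t" for t
    unfolding cav_def by (simp add: right_diff_distrib Bochner_Integration.integral_diff[OF integrable_cell[OF assms(1)] integrable_cell[OF assms(2)]])
  then show ?thesis by (simp add: Pl_def left_diff_distrib sum_subtractf)
qed

text \<open>A density argument from the uniform L1 bound and uniform convergence for continuous
  functions. Convergence in L1 is enough: \<open>lp_le_limit\<close> transfers bounds in other
  norms.\<close>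

lemma Pl_L1_convergence:
  fixes f :: "real^'n::finite => real"
  assumes k: "k \<ge> 1" and f: "integrable lborel f" "\<And>x. x \<notin> cube ==> f x = 0" and \<epsilon>: "\<epsilon> > 0"
  shows "\<exists>l0. \<forall>l\<ge>l0. (\<integral>\<^sup>+x\<in>cube. ennreal \<bar>f x - Pl k l f x\<bar> \<partial>lborel) <= ennreal \<epsilon>"
proof -
  have fm [measurable]: "f \<in> borel_measurable borel" using f by auto
  obtain C where C: "C \<ge> 0" "\<And>l (f :: real^'n => real) w. k <= 2 ^ l ==> integrable lborel f ==> w \<ge> 0 ==>
    (\<integral>\<^sup>+x\<in>cube. ennreal \<bar>f x\<bar> \<partial>lborel) <= ennreal w ==> (\<integral>\<^sup>+x\<in>cube. ennreal \<bar>Pl k l f x\<bar> \<partial>lborel) <= ennreal (C * w)"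
    using Pl_L1_bound[OF k, where 'n = 'n] by blast
  define \<eta> where "\<eta> = \<epsilon> / (C + 2)"
  have "\<eta> * (C + 2) = \<epsilon>" using C(1) by (simp add: \<eta>_def)
  then have \<eta>: "\<eta> > 0" "\<eta> + C * \<eta> + \<eta> = \<epsilon>" using C(1) \<epsilon> by (simp add: \<eta>_def, simp add: algebra_simps)
  obtain g where g: "continuous_on UNIV g" "(\<integral>x. indicator cube x * \<bar>f x - g x\<bar> \<partial>lborel) <= \<eta>" "integrable lborel (\<lambda>x. indicator cube x * \<bar>f x - g x\<bar>)"
    using continuous_L1_dense[OF f(1) \<eta>(1)] by blast
  have gm [measurable]: "g \<in> borel_measurable borel" using g(1) by (rule borel_measurable_continuous_onI)
  let ?g = "\<lambda>x. indicator cube x * g x :: real"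
  have gi: "integrable lborel ?g"
    using borel_integrable_compact[OF compact_cbox continuous_on_subset[OF g(1) subset_UNIV], of 0 1] by simp
  have fg: "(\<integral>\<^sup>+x\<in>cube. ennreal \<bar>f x - ?g x\<bar> \<partial>lborel) <= ennreal \<eta>"
  proof -
    have "(\<integral>\<^sup>+x\<in>cube. ennreal \<bar>f x - ?g x\<bar> \<partial>lborel) = (\<integral>\<^sup>+x. ennreal (indicator cube x * \<bar>f x - g x\<bar>) \<partial>lborel)"
      by (intro nn_integral_cong) (auto simp: indicator_def)
    also have "... = ennreal (\<integral>x. indicator cube x * \<bar>f x - g x\<bar> \<partial>lborel)"
      by (rule nn_integral_eq_integral[OF g(3)]) auto
    finally show ?thesis using g(2) by (simp add: ennreal_leI)
  qed
  obtain l0 where l0: "\<And>l x. l \<ge> l0 ==> x \<in> cube ==> \<bar>Pl k l ?g x - g x\<bar> <= \<eta>"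
    using Pl_uniform[OF k g(1) \<eta>(1)] by blast
  show ?thesis
  proof (intro exI[of _ "max l0 k"] allI impI)
    fix l assume l: "l \<ge> max l0 k"
    have kl: "k <= 2 ^ l"
    proof -
      have "k < 2 ^ k" by (rule less_exp)
      also have "(2::nat) ^ k <= 2 ^ l" using l by (intro power_increasing) auto
      finally show ?thesis by simp
    qed
    let ?u = "\<lambda>x. f x - ?g x"
    have "(\<integral>\<^sup>+x\<in>cube. ennreal \<bar>f x - Pl k l f x\<bar> \<partial>lborel) \<le>
      (\<integral>\<^sup>+x. ennreal \<bar>?u x\<bar> * indicator cube x + ennreal \<bar>Pl k l ?u x\<bar> * indicator cube x + ennreal \<eta> * indicator cube x \<partial>lborel)"
    proof (rule nn_integral_mono)
      fix x
      show "ennreal \<bar>f x - Pl k l f x\<bar> * indicator cube x <= ennreal \<bar>?u x\<bar> * indicator cube x + ennreal \<bar>Pl k l ?u x\<bar> * indicator cube x + ennreal \<eta> * indicator cube x"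
      proof (cases "x \<in> cube")
        case True
        have "\<bar>f x - Pl k l f x\<bar> <= \<bar>?u x\<bar> + \<bar>Pl k l ?u x\<bar> + \<eta>"
          using l0[of l x] l True unfolding Pl_diff[OF f(1) gi] by (simp add: abs_le_iff) linarith
        then have "ennreal \<bar>f x - Pl k l f x\<bar> <= ennreal (\<bar>?u x\<bar> + \<bar>Pl k l ?u x\<bar> + \<eta>)" by (rule ennreal_leI)
        also have "... = ennreal \<bar>?u x\<bar> + ennreal \<bar>Pl k l ?u x\<bar> + ennreal \<eta>" using \<eta>(1) by (simp add: ennreal_plus)
        finally show ?thesis using True by simp
      qed simp
    qed
    also have "... = (\<integral>\<^sup>+x\<in>cube. ennreal \<bar>?u x\<bar> \<partial>lborel) + (\<integral>\<^sup>+x\<in>cube. ennreal \<bar>Pl k l ?u x\<bar> \<partial>lborel) + (\<integral>\<^sup>+x. ennreal \<eta> * indicator (cube :: (real^'n) set) x \<partial>lborel)"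
      by (simp add: nn_integral_add)
    also have "(\<integral>\<^sup>+x. ennreal \<eta> * indicator (cube :: (real^'n) set) x \<partial>lborel) = ennreal \<eta>"
    proof -
      show ?thesis by (simp add: nn_integral_cmult_indicator emeasure_cube)
    qed
    also have "(\<integral>\<^sup>+x\<in>cube. ennreal \<bar>?u x\<bar> \<partial>lborel) + (\<integral>\<^sup>+x\<in>cube. ennreal \<bar>Pl k l ?u x\<bar> \<partial>lborel) + ennreal \<eta> <= ennreal \<eta> + ennreal (C * \<eta>) + ennreal \<eta>"
      using \<eta>(1) kl f gi by (intro add_mono fg C(2)) auto
    also have "... = ennreal \<epsilon>" using \<eta> C(1) by (simp add: ennreal_plus[symmetric] del: ennreal_plus)
    finally show "(\<integral>\<^sup>+x\<in>cube. ennreal \<bar>f x - Pl k l f x\<bar> \<partial>lborel) <= ennreal \<epsilon>" .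
  qed
qed

lemma integrable_of_powr:
  fixes f :: "real^'n::finite => real"
  assumes [measurable]: "f \<in> borel_measurable borel" and f0: "\<And>x. x \<notin> cube ==> f x = 0" and q: "q \<ge> 1"
    and b: "(pint q cube f) <= ennreal w"
  shows "integrable lborel f"
proof (rule integrableI_bounded)
  have "(\<integral>\<^sup>+x. ennreal (norm (f x)) \<partial>lborel) <= (\<integral>\<^sup>+x. ennreal (\<bar>f x\<bar> powr q) * indicator cube x + indicator cube x \<partial>lborel)"
  proof (rule nn_integral_mono)
    fix x
    show "ennreal (norm (f x)) <= ennreal (\<bar>f x\<bar> powr q) * indicator cube x + indicator cube x"
    proof (cases "x \<in> cube")
      case True
      have "\<bar>f x\<bar> <= \<bar>f x\<bar> powr q + 1"
      proof (cases "\<bar>f x\<bar> <= 1")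
        case False
        then have "\<bar>f x\<bar> powr 1 <= \<bar>f x\<bar> powr q" using q by (intro powr_mono) auto
        then show ?thesis using False by simp
      qed (simp add: add_increasing)
      then have "ennreal \<bar>f x\<bar> <= ennreal (\<bar>f x\<bar> powr q + 1)" by (rule ennreal_leI)
      also have "... = ennreal (\<bar>f x\<bar> powr q) + 1" by (simp add: ennreal_plus)
      finally show ?thesis using True by simp
    qed (simp add: f0)
  qed
  also have "... = (pint q cube f) + 1"
    by (subst nn_integral_add) (auto simp: emeasure_cube)
  also have "... < \<infinity>" using b by (auto simp: ennreal_add_less_top intro: le_less_trans)
  finally show "(\<integral>\<^sup>+x. ennreal (norm (f x)) \<partial>lborel) < \<infinity>" .
qed simp

abbreviation psum :: "nat => nat => (nat => 'n idx => 'n idx => real) => real^'n::finite => real" where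
  "psum k J c x \<equiv> (\<Sum>l=k..J. \<Sum>\<alpha>\<in>boxes k. \<Sum>i\<in>nodes l. c l i \<alpha> * psi \<alpha> (loc l i x))"

abbreviation smooth_bound :: "nat => real => real => real => (real^'n::finite => real) => bool" where
  "smooth_bound k q s A f \<equiv> \<forall>h. (pint q (cube_shift k h) (fdiff k h f)) <= ennreal ((A * norm h powr s) powr q)"

text \<open>Telescoping starts at level \<open>k\<close>, where the stencil of \<open>k\<close>
  cells fits since \<open>k < 2 ^ k\<close>. On each finer level the details are controlled by
  differences with step \<open>1 / 2 ^ l\<close>, to which \<open>smooth_bound\<close>
  applies.\<close>

lemma multiscale_expansion:
  assumes k: "k \<ge> 1" and q: "q \<ge> 1" and s: "s \<ge> 0"
  shows "\<exists>C\<ge>1. \<forall>(f :: real^'n::finite => real) A. f \<in> borel_measurable borel --> (\<forall>x. x \<notin> cube --> f x = 0) --> A > 0 -->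
    (pint q cube f) <= ennreal (A powr q) -->
    smooth_bound k q s A f -->
    (\<exists>c. (\<forall>l\<ge>k. \<forall>\<alpha>\<in>boxes k. (\<Sum>i\<in>nodes l. \<bar>c l i \<alpha>\<bar> powr q) <= (C * A * 2 powr (- s * l)) powr q * (2 ^ l) ^ CARD('n)) \<and>
      (\<forall>\<epsilon>>0. \<exists>J0. \<forall>J\<ge>J0. (\<integral>\<^sup>+x\<in>cube. ennreal \<bar>f x - psum k J c x\<bar> \<partial>lborel) <= ennreal \<epsilon>))"
proof -
  let ?d = "CARD('n)"
  obtain C1 where C1: "C1 \<ge> 1" "\<And>l (a :: 'n idx => real) \<alpha>. k <= 2 ^ l ==> \<alpha> \<in> boxes k ==>
    (\<Sum>i\<in>nodes l. \<bar>coarse k l a i \<alpha>\<bar> powr q) <= C1 * (\<Sum>t\<in>boxes (2 ^ l). \<bar>a t\<bar> powr q)"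
    using coarse_lq_bound[OF k q, where 'n = 'n] by blast
  obtain C2 where C2: "C2 \<ge> 1" "\<And>l (a :: 'n idx => real) \<alpha>. k <= 2 ^ l ==> \<alpha> \<in> boxes k ==>
    (\<Sum>i\<in>nodes (Suc l). \<bar>detail k l a i \<alpha>\<bar> powr q) \<le>
      C2 * (\<Sum>m\<in>UNIV. \<Sum>t\<in>{t\<in>boxes (2 ^ Suc l). t m + k < 2 ^ Suc l}. \<bar>cdiff k m a t\<bar> powr q)"
    using detail_lq_bound[OF k q, where 'n = 'n] by blast
  \<comment> \<open>The starting level has no gain from smoothness; \<open>2 powr (s * k)\<close>
    compensates the factor \<open>2 powr (- s * k)\<close> in the claimed bound. The factor
    \<open>?d\<close> counts the directions.\<close>
  define C where "C = max (C1 * 2 powr (s * k)) (C2 * real ?d)"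
  have C0: "C \<ge> 1"
  proof -
    have "1 * 1 <= C1 * 2 powr (s * k)" using C1 s by (intro mult_mono ge_one_powr_ge_zero) auto
    then show ?thesis by (simp add: C_def)
  qed
  have Cq: "C <= C powr q" using powr_mono[of 1 q C] C0 q by simp
  have kl: "k <= 2 ^ l" if "l \<ge> k" for l
  proof -
    have "k < 2 ^ k" by (rule less_exp)
    also have "(2::nat) ^ k <= 2 ^ l" using that by (intro power_increasing) auto
    finally show ?thesis by simp
  qed
  show ?thesis
  proof (intro exI[of _ C] conjI allI impI C0)
    fix f :: "real^'n => real" and A
    assume [measurable]: "f \<in> borel_measurable borel" and f0: "\<forall>x. x \<notin> cube --> f x = 0" and A: "A > 0"
      and b1: "(pint q cube f) <= ennreal (A powr q)"
      and b2: "smooth_bound k q s A f"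
    have fi: "integrable lborel f" using integrable_of_powr[OF _ _ q b1] f0 by auto
    define c where "c l i \<alpha> = (if l = k then coarse k k (cav k f) i \<alpha> else detail k (l - 1) (cav l f) i \<alpha>)" for l i \<alpha>
    show "\<exists>c. (\<forall>l\<ge>k. \<forall>\<alpha>\<in>boxes k. (\<Sum>i\<in>nodes l. \<bar>c l i \<alpha>\<bar> powr q) <= (C * A * 2 powr (- s * l)) powr q * (2 ^ l) ^ CARD('n)) \<and>
      (\<forall>\<epsilon>>0. \<exists>J0. \<forall>J\<ge>J0. (\<integral>\<^sup>+x\<in>cube. ennreal \<bar>f x - psum k J c x\<bar> \<partial>lborel) <= ennreal \<epsilon>)"
    proof (intro exI[of _ c] conjI allI impI ballI)
      fix l and \<alpha> :: "'n => nat" assume l: "l \<ge> k" and \<alpha>: "\<alpha> \<in> boxes k"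
      show "(\<Sum>i\<in>nodes l. \<bar>c l i \<alpha>\<bar> powr q) <= (C * A * 2 powr (- s * l)) powr q * (2 ^ l) ^ CARD('n)"
      proof (cases "l = k")
        case True
        have "(\<Sum>i\<in>nodes k. \<bar>coarse k k (cav k f) i \<alpha>\<bar> powr q) <= C1 * (\<Sum>t\<in>boxes (2 ^ k). \<bar>cav k f t\<bar> powr q)"
          using \<alpha> kl by (intro C1) auto
        also have "... <= C1 * ((2 ^ k) ^ ?d * A powr q)"
          using C1 by (intro mult_left_mono cav_sum_bound q fi b1) auto
        also have "... = C1 * (A powr q * (2 ^ k) ^ ?d)" by simp
        also have "... <= (C * 2 powr (- s * k)) powr q * (A powr q * (2 ^ k) ^ ?d)"
        proof (rule mult_right_mono)
          have "C1 <= C * 2 powr (- s * k)"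
            using mult_right_mono[of "C1 * 2 powr (s * k)" C "2 powr (- s * k)"]
            by (simp add: C_def mult.assoc flip: powr_add)
          moreover have "C1 powr 1 <= C1 powr q" using C1 q by (intro powr_mono) auto
          ultimately have "C1 powr q <= (C * 2 powr (- s * k)) powr q" "C1 <= C1 powr q" using C1 q by (auto intro!: powr_mono2)
          then show "C1 <= (C * 2 powr (- s * k)) powr q" by linarith
        qed simp
        also have "... = (C * A * 2 powr (- s * k)) powr q * (2 ^ k) ^ ?d"
          by (simp add: powr_mult mult_ac)
        finally show ?thesis using True by (simp add: c_def)
      next
        case False
        then obtain l' where l': "l = Suc l'" "l' \<ge> k" using l k by (cases l) auto
        have nrm: "norm (axis m (1 / 2 ^ l) :: real^'n) powr s = 2 powr (- s * l)" for m
        proof -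
          have "norm (axis m (1 / 2 ^ l) :: real^'n) = 2 powr (- real l)"
            by (simp add: norm_eq_sqrt_inner inner_axis_axis powr_minus powr_realpow real_sqrt_divide real_sqrt_mult inverse_eq_divide)
          then show ?thesis by (simp add: powr_powr mult.commute)
        qed
        have "(\<Sum>i\<in>nodes l. \<bar>detail k l' (cav l f) i \<alpha>\<bar> powr q) \<le>
           C2 * (\<Sum>m\<in>UNIV. \<Sum>t\<in>{t\<in>boxes (2 ^ l). t m + k < 2 ^ l}. \<bar>cdiff k m (cav l f) t\<bar> powr q)"
          unfolding l' using \<alpha> kl l' by (intro C2) auto
        also have "... <= C2 * (\<Sum>m\<in>(UNIV::'n set). (2 ^ l) ^ ?d * (A * 2 powr (- s * l)) powr q)"
        proof (intro mult_left_mono sum_mono)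
          fix m :: 'n
          show "(\<Sum>t\<in>{t\<in>boxes (2 ^ l). t m + k < 2 ^ l}. \<bar>cdiff k m (cav l f) t\<bar> powr q) <= (2 ^ l) ^ ?d * (A * 2 powr (- s * l)) powr q"
            using b2[rule_format, of "axis m (1 / 2 ^ l)"] unfolding nrm by (intro cdiff_sum_bound q fi) auto
        qed (use C2 in auto)
        also have "... = C2 * real ?d * ((A * 2 powr (- s * l)) powr q * (2 ^ l) ^ ?d)" by simp
        also have "... <= C powr q * ((A * 2 powr (- s * l)) powr q * (2 ^ l) ^ ?d)"
        proof (rule mult_right_mono)
          have "C2 * real ?d <= C" by (simp add: C_def)
          then show "C2 * real ?d <= C powr q" using Cq by linarith
        qed simp
        also have "... = (C * A * 2 powr (- s * l)) powr q * (2 ^ l) ^ ?d" by (simp add: powr_mult mult_ac)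
        finally show ?thesis using l' by (simp add: c_def)
      qed
    next
      fix \<epsilon> :: real assume \<epsilon>: "\<epsilon> > 0"
      obtain l0 where l0: "\<forall>l\<ge>l0. (\<integral>\<^sup>+x\<in>cube. ennreal \<bar>f x - Pl k l f x\<bar> \<partial>lborel) <= ennreal \<epsilon>"
        using Pl_L1_convergence[OF k fi _ \<epsilon>] f0 by blast
      have P: "psum k J c x = Pl k J f x"
        if "J \<ge> k" "x \<in> cube" for J x
        using that(1)
      proof (induction J rule: dec_induct)
        case base
        show ?case by (simp add: c_def Pl_coarse) (rule sum.swap)
      next
        case (step J)
        have "(\<Sum>\<alpha>\<in>boxes k. \<Sum>i\<in>nodes (Suc J). c (Suc J) i \<alpha> * psi \<alpha> (loc (Suc J) i x)) = Pl k (Suc J) f x - Pl k J f x"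
          unfolding Pl_refine[OF k fi that(2)] using step(1) by (subst sum.swap) (simp add: c_def)
        then show ?case using step by (simp add: sum.atLeast_Suc_atMost_Suc_shift del: sum.cl_ivl_Suc) (subst sum.cl_ivl_Suc, simp)
      qed
      show "\<exists>J0. \<forall>J\<ge>J0. (\<integral>\<^sup>+x\<in>cube. ennreal \<bar>f x - psum k J c x\<bar> \<partial>lborel) <= ennreal \<epsilon>"
      proof (intro exI[of _ "max l0 k"] allI impI)
        fix J assume J: "J \<ge> max l0 k"
        have "(\<integral>\<^sup>+x\<in>cube. ennreal \<bar>f x - psum k J c x\<bar> \<partial>lborel)
           = (\<integral>\<^sup>+x\<in>cube. ennreal \<bar>f x - Pl k J f x\<bar> \<partial>lborel)"
        proof (intro nn_integral_cong)
          fix x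
          show "ennreal \<bar>f x - psum k J c x\<bar> * indicator cube x
             = ennreal \<bar>f x - Pl k J f x\<bar> * indicator cube x"
          proof (cases "x \<in> cube")
            case True
            have "J \<ge> k" using J by simp
            then show ?thesis by (simp only: P[OF _ True])
          qed simp
        qed
        also have "... <= ennreal \<epsilon>" using l0 J by simp
        finally show "(\<integral>\<^sup>+x\<in>cube. ennreal \<bar>f x - psum k J c x\<bar> \<partial>lborel) <= ennreal \<epsilon>" .
      qed
    qed
  qed
qed

section \<open>Nonlinear approximation by sparse sums\<close>

subsection \<open>Bounds in \<open>L\<^sup>p\<close> of the cube\<close>

text \<open>A norm bound by a real number in power form, for the Borel completion-free measure: no
  roots and no extended arithmetic, and one predicate for finite and infinite
  \<open>p\<close>.\<close>

definition lp_le :: "ennreal => (real^'n::finite => real) => real => bool" where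
  "lp_le p h a \<longleftrightarrow> (if p = \<infinity> then (AE x in lborel. x \<in> cube --> \<bar>h x\<bar> <= a)
     else (pint (enn2real p) cube h) <= ennreal (a powr enn2real p))"

lemma enn2real_ge_1: "p \<noteq> \<infinity> ==> 1 <= p ==> 1 <= enn2real p"
  by (cases p) (auto simp: ennreal_le_iff simp flip: ennreal_1)

lemma lp_le_Lpnorm:
  assumes h: "lp_le p h a" and a: "a \<ge> 0" and p: "1 <= p"
  shows "Lpnorm p cube h <= ennreal a"
proof (cases "p = \<infinity>")
  case True
  then have "AE x in lebesgue. x \<in> cube --> ennreal \<bar>h x\<bar> <= ennreal a"
    using h by (auto simp: lp_le_def AE_completion_iff ennreal_leI elim!: eventually_mono)
  then show ?thesis using True by (auto simp: Lpnorm_def intro: Inf_lower)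
next
  case False
  let ?p = "enn2real p" and ?I = "\<integral>\<^sup>+x\<in>cube. ennreal (\<bar>h x\<bar> powr enn2real p) \<partial>lborel"
  have p1: "?p \<ge> 1" using enn2real_ge_1[OF False p] .
  have I: "?I <= ennreal (a powr ?p)" using h False by (simp add: lp_le_def)
  then have fin: "?I \<noteq> \<infinity>" by (auto simp: top_unique)
  have "enn2real ?I <= a powr ?p" using I by (intro enn2real_leI) auto
  then have "enn2real ?I powr (1 / ?p) <= (a powr ?p) powr (1 / ?p)" using p1 by (intro powr_mono2) auto
  also have "... = a" using a p1 by (simp add: powr_powr)
  finally show ?thesis using False fin by (simp add: Lpnorm_def epow_def nn_integral_completion ennreal_leI)
qed

text \<open>An instance of \<open>jensen_powr\<close> for a point measure. Weights of total at most
  1 are enough, because the measure enters there through an upper bound.\<close>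

lemma discrete_jensen:
  fixes w u :: "'a => real"
  assumes S: "finite S" and w: "\<And>i. i \<in> S ==> w i \<ge> 0" "(\<Sum>i\<in>S. w i) <= 1" and u: "\<And>i. i \<in> S ==> u i \<ge> 0" and q: "q \<ge> 1"
  shows "(\<Sum>i\<in>S. w i * u i) powr q <= (\<Sum>i\<in>S. w i * u i powr q)"
proof -
  let ?M = "point_measure S (\<lambda>i. ennreal (w i))" and ?u = "\<lambda>i. max 0 (u i)"
  have int: "(\<integral>\<^sup>+i\<in>S. ennreal (g i) \<partial>?M) = ennreal (\<Sum>i\<in>S. w i * g i)" if "\<And>i. i \<in> S ==> g i \<ge> 0" for g
    using S w(1) that by (simp add: nn_integral_point_measure_finite sum_ennreal[symmetric] ennreal_mult)
  have em: "emeasure ?M S <= ennreal 1"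
    using S w by (simp add: emeasure_point_measure_finite sum_ennreal ennreal_le_1)
  have "ennreal ((\<Sum>i\<in>S. w i * u i) powr q) <= ennreal (1 powr (q - 1)) * (\<integral>\<^sup>+i\<in>S. ennreal (?u i powr q) \<partial>?M)"
  proof (rule jensen_powr[OF q _ _ _ _ em])
    show "ennreal (\<Sum>i\<in>S. w i * u i) <= (\<integral>\<^sup>+i\<in>S. ennreal (?u i) \<partial>?M)"
      by (subst int) (auto simp: u max_absorb2 cong: sum.cong)
  qed (auto simp: u w sets_point_measure intro!: sum_nonneg)
  also have "... = ennreal (\<Sum>i\<in>S. w i * u i powr q)"
    by (subst int) (auto simp: u max_absorb2 cong: sum.cong)
  finally show ?thesis by (subst (asm) ennreal_le_iff) (auto intro!: sum_nonneg simp: w)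
qed

text \<open>Minkowski's inequality from convexity: the normalized functions \<open>h / a\<close> and
  \<open>g / b\<close> are averaged with weights \<open>a / (a + b)\<close> and
  \<open>b / (a + b)\<close>. The normalization is the reason for positive bounds.\<close>

lemma lp_le_add:
  assumes [measurable]: "h \<in> borel_measurable borel" "g \<in> borel_measurable borel"
    and h: "lp_le p h a" "lp_le p g b" and ab: "a > 0" "b > 0" and p: "1 <= p"
  shows "lp_le p (\<lambda>x. h x + g x) (a + b)"
proof (cases "p = \<infinity>")
  case True
  have "AE x in lborel. x \<in> cube --> \<bar>h x\<bar> <= a" "AE x in lborel. x \<in> cube --> \<bar>g x\<bar> <= b"
    using h True by (auto simp: lp_le_def)
  then have "AE x in lborel. x \<in> cube --> \<bar>h x + g x\<bar> <= a + b" by eventually_elim auto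
  then show ?thesis using True by (simp add: lp_le_def)
next
  case False
  let ?p = "enn2real p"
  have p1: "?p \<ge> 1" using enn2real_ge_1[OF False p] .
  let ?c = "(a + b) powr (?p - 1)"
  have pt: "\<bar>h x + g x\<bar> powr ?p <= ?c * a powr (1 - ?p) * \<bar>h x\<bar> powr ?p + ?c * b powr (1 - ?p) * \<bar>g x\<bar> powr ?p" for x
  proof -
    let ?w = "\<lambda>i::bool. if i then a / (a + b) else b / (a + b)" and ?u = "\<lambda>i::bool. if i then \<bar>h x\<bar> / a else \<bar>g x\<bar> / b"
    have "(\<Sum>i\<in>UNIV. ?w i * ?u i) powr ?p <= (\<Sum>i\<in>UNIV. ?w i * ?u i powr ?p)"
      using ab p1 by (intro discrete_jensen) (auto simp: UNIV_bool add_divide_distrib[symmetric] field_simps)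
    then have "((\<bar>h x\<bar> + \<bar>g x\<bar>) / (a + b)) powr ?p <= a / (a + b) * (\<bar>h x\<bar> / a) powr ?p + b / (a + b) * (\<bar>g x\<bar> / b) powr ?p"
      using ab by (simp add: UNIV_bool add_divide_distrib add.commute)
    then have "(a + b) powr ?p * ((\<bar>h x\<bar> + \<bar>g x\<bar>) / (a + b)) powr ?p
        <= (a + b) powr ?p * (a / (a + b) * (\<bar>h x\<bar> / a) powr ?p + b / (a + b) * (\<bar>g x\<bar> / b) powr ?p)" by (intro mult_left_mono) auto
    moreover have "(a + b) powr ?p * ((\<bar>h x\<bar> + \<bar>g x\<bar>) / (a + b)) powr ?p = (\<bar>h x\<bar> + \<bar>g x\<bar>) powr ?p"
      using ab by (simp add: powr_divide)
    moreover have "(a + b) powr ?p * (c / (a + b) * (y / c) powr ?p) = ?c * c powr (1 - ?p) * y powr ?p" if "c > 0" "y \<ge> 0" for c y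
      using ab that by (simp add: powr_divide powr_diff field_simps)
    moreover have "\<bar>h x + g x\<bar> powr ?p <= (\<bar>h x\<bar> + \<bar>g x\<bar>) powr ?p" using p1 by (intro powr_mono2) auto
    ultimately show ?thesis using ab by (simp add: distrib_left)
  qed
  have "(\<integral>\<^sup>+x\<in>cube. ennreal (\<bar>h x + g x\<bar> powr ?p) \<partial>lborel) \<le>
     (\<integral>\<^sup>+x. ennreal (?c * a powr (1 - ?p)) * (ennreal (\<bar>h x\<bar> powr ?p) * indicator cube x) + ennreal (?c * b powr (1 - ?p)) * (ennreal (\<bar>g x\<bar> powr ?p) * indicator cube x) \<partial>lborel)"
  proof (rule nn_integral_mono)
    fix x :: "real^'a"
    have "ennreal (\<bar>h x + g x\<bar> powr ?p) <= ennreal (?c * a powr (1 - ?p)) * ennreal (\<bar>h x\<bar> powr ?p) + ennreal (?c * b powr (1 - ?p)) * ennreal (\<bar>g x\<bar> powr ?p)"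
      using ennreal_leI[OF pt[of x]] by (simp add: ennreal_plus ennreal_mult[symmetric])
    then show "ennreal (\<bar>h x + g x\<bar> powr ?p) * indicator cube x <= ennreal (?c * a powr (1 - ?p)) * (ennreal (\<bar>h x\<bar> powr ?p) * indicator cube x) + ennreal (?c * b powr (1 - ?p)) * (ennreal (\<bar>g x\<bar> powr ?p) * indicator cube x)"
      by (cases "x \<in> cube") auto
  qed
  also have "... = ennreal (?c * a powr (1 - ?p)) * (pint ?p cube h) + ennreal (?c * b powr (1 - ?p)) * (pint ?p cube g)"
    by (subst nn_integral_add) (auto simp: nn_integral_cmult)
  also have "... <= ennreal (?c * a powr (1 - ?p)) * ennreal (a powr ?p) + ennreal (?c * b powr (1 - ?p)) * ennreal (b powr ?p)"
    using h False by (intro add_mono mult_left_mono) (auto simp: lp_le_def)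
  also have "... = ennreal (?c * a powr (1 - ?p) * a powr ?p + ?c * b powr (1 - ?p) * b powr ?p)"
    by (simp add: ennreal_plus ennreal_mult)
  also have "?c * a powr (1 - ?p) * a powr ?p + ?c * b powr (1 - ?p) * b powr ?p = ?c * (a + b)"
    using ab by (simp add: mult.assoc distrib_left flip: powr_add)
  also have "... = (a + b) powr ?p" using ab by (simp add: powr_diff)
  finally show ?thesis using False by (simp add: lp_le_def)
qed

lemma lp_le_sum:
  assumes "finite J" "J \<noteq> {}" "1 <= p"
    and "\<And>j. j \<in> J ==> h j \<in> borel_measurable borel" "\<And>j. j \<in> J ==> lp_le p (h j) (a j)" "\<And>j. j \<in> J ==> a j > 0"
  shows "lp_le p (\<lambda>x. \<Sum>j\<in>J. h j x) (\<Sum>j\<in>J. a j)"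
  using assms(1,2,4,5,6)
proof (induction J rule: finite_ne_induct)
  case (insert j J)
  have "lp_le p (\<lambda>x. h j x + (\<Sum>j\<in>J. h j x)) (a j + (\<Sum>j\<in>J. a j))"
    using insert by (intro lp_le_add[OF _ _ _ insert.IH] assms(3) sum_pos borel_measurable_sum) auto
  then show ?case using insert by simp
qed simp

lemma lp_le_mono:
  assumes "lp_le p h a" "a <= b" "0 <= a" shows "lp_le p h b"
proof (cases "p = \<infinity>")
  case True then show ?thesis using assms by (auto simp: lp_le_def elim!: eventually_mono)
next
  case False
  have "a powr enn2real p <= b powr enn2real p" using assms by (intro powr_mono2) auto
  then show ?thesis using assms(1) False by (auto simp: lp_le_def ennreal_leI intro: order_trans)
qed

lemma lp_le_bounded:
  fixes h :: "real^'n::finite => real"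
  assumes "\<And>x. x \<in> cube ==> \<bar>h x\<bar> <= a" shows "lp_le p h a"
proof (cases "p = \<infinity>")
  case True then show ?thesis using assms by (simp add: lp_le_def)
next
  case False
  have "(pint (enn2real p) cube h) <= (\<integral>\<^sup>+x. ennreal (a powr enn2real p) * indicator (cube :: (real^'n) set) x \<partial>lborel)"
    using assms by (intro nn_integral_mono) (auto simp: indicator_def intro!: ennreal_leI powr_mono2)
  also have "... = ennreal (a powr enn2real p)" by (simp add: nn_integral_cmult_indicator emeasure_cube)
  finally show ?thesis using False by (simp add: lp_le_def)
qed

text \<open>Pointwise, the \<open>p\<close>-th power of \<open>\<bar>E\<bar>\<close> is at most
  \<open>\<tau> powr (p - q)\<close> times its \<open>q\<close>-th power. \<open>\<theta>\<close> is
  \<open>q / p\<close>, and it is 0 for \<open>p = \<infinity>\<close>, where the sup bound alone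
  decides.\<close>

lemma lp_le_interpolate:
  fixes E :: "real^'n::finite => real"
  assumes [measurable]: "E \<in> borel_measurable borel" and p: "1 <= p" "ennreal q <= p" and q: "q \<ge> 1" and t: "\<tau> > 0" "M > 0"
    and b: "\<And>x. x \<in> cube ==> \<bar>E x\<bar> <= \<tau>" and I: "(pint q cube E) <= ennreal (M powr q)"
  defines "\<theta> \<equiv> q * enn2real (inverse p)"
  shows "lp_le p E (\<tau> powr (1 - \<theta>) * M powr \<theta>)"
proof (cases "p = \<infinity>")
  case True
  then have "\<theta> = 0" by (simp add: \<theta>_def)
  then show ?thesis using b t by (intro lp_le_bounded) simp
next
  case False
  let ?p = "enn2real p"
  have p1: "?p \<ge> 1" using enn2real_ge_1[OF False p(1)] .
  have th: "\<theta> = q / ?p"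
  proof -
    have "p = ennreal ?p" using False by (simp add: less_top)
    then have "inverse p = ennreal (1 / ?p)" using p1 by (metis inverse_ennreal inverse_eq_divide less_le_trans zero_less_one)
    then show ?thesis using p1 by (simp add: \<theta>_def)
  qed
  have qp: "q <= ?p" using p(2) False q by (metis enn2real_ennreal enn2real_mono less_top order_trans zero_le_one infinity_ennreal_def)
  have "(pint ?p cube E) <= (\<integral>\<^sup>+x. ennreal (\<tau> powr (?p - q)) * (ennreal (\<bar>E x\<bar> powr q) * indicator cube x) \<partial>lborel)"
  proof (rule nn_integral_mono)
    fix x :: "real^'n"
    show "ennreal (\<bar>E x\<bar> powr ?p) * indicator cube x <= ennreal (\<tau> powr (?p - q)) * (ennreal (\<bar>E x\<bar> powr q) * indicator cube x)"
    proof (cases "x \<in> cube")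
      case True
      have "\<bar>E x\<bar> powr ?p = \<bar>E x\<bar> powr (?p - q) * \<bar>E x\<bar> powr q" by (simp flip: powr_add)
      also have "... <= \<tau> powr (?p - q) * \<bar>E x\<bar> powr q" using b[OF True] qp by (intro mult_right_mono powr_mono2) auto
      finally have "\<bar>E x\<bar> powr ?p <= \<tau> powr (?p - q) * \<bar>E x\<bar> powr q" .
      then show ?thesis using True by (simp add: ennreal_mult[symmetric] ennreal_leI)
    qed simp
  qed
  also have "... = ennreal (\<tau> powr (?p - q)) * (pint q cube E)" by (rule nn_integral_cmult) measurable
  also have "... <= ennreal (\<tau> powr (?p - q)) * ennreal (M powr q)" by (intro mult_left_mono I) simp
  also have "... = ennreal ((\<tau> powr (1 - \<theta>) * M powr \<theta>) powr ?p)"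
  proof -
    have "(1 - \<theta>) * ?p = ?p - q" "\<theta> * ?p = q" using p1 by (auto simp: th left_diff_distrib)
    then show ?thesis by (simp add: powr_mult powr_powr ennreal_mult)
  qed
  finally show ?thesis using False by (simp add: lp_le_def)
qed

text \<open>A subsequence converges almost everywhere on the cube; the bound passes to the limit by
  Fatou's lemma for finite \<open>p\<close> and pointwise for
  \<open>p = \<infinity>\<close>.\<close>

lemma lp_le_limit:
  fixes h :: "nat => real^'n::finite => real"
  assumes [measurable]: "\<And>j. h j \<in> borel_measurable borel" "g \<in> borel_measurable borel"
    and b: "\<And>j. j \<ge> J0 ==> lp_le p (h j) a" and p: "1 <= p"
    and lim: "\<And>\<epsilon>. \<epsilon> > 0 ==> \<exists>J. \<forall>j\<ge>J. (\<integral>\<^sup>+x\<in>cube. ennreal \<bar>g x - h j x\<bar> \<partial>lborel) <= ennreal \<epsilon>"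
  shows "lp_le p g a"
proof -
  obtain J1 where J1: "\<And>j. j \<ge> J1 ==> (\<integral>\<^sup>+x\<in>cube. ennreal \<bar>g x - h j x\<bar> \<partial>lborel) <= ennreal 1" using lim[of 1] by auto
  let ?J = "max J0 J1"
  let ?u = "\<lambda>j x. indicator cube x * (g x - h (j + ?J) x)"
  have nu: "(\<integral>\<^sup>+x. ennreal (norm (?u j x)) \<partial>lborel) = (\<integral>\<^sup>+x\<in>cube. ennreal \<bar>g x - h (j + ?J) x\<bar> \<partial>lborel)" for j
    by (intro nn_integral_cong) (simp add: indicator_def)
  have iu: "integrable lborel (?u j)" for j
  proof (rule integrableI_bounded)
    show "(\<integral>\<^sup>+x. ennreal (norm (?u j x)) \<partial>lborel) < \<infinity>"
      unfolding nu by (rule le_less_trans[OF J1]) auto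
  qed measurable
  have "(\<lambda>j. \<integral>x. norm (?u j x) \<partial>lborel) \<longlonglongrightarrow> 0"
  proof (rule LIMSEQ_I)
    fix e :: real assume e: "e > 0"
    obtain J where J: "\<And>j. j \<ge> J ==> (\<integral>\<^sup>+x\<in>cube. ennreal \<bar>g x - h j x\<bar> \<partial>lborel) <= ennreal (e / 2)" using lim[of "e / 2"] e by auto
    show "\<exists>no. \<forall>j\<ge>no. norm ((\<integral>x. norm (?u j x) \<partial>lborel) - 0) < e"
    proof (intro exI[of _ J] allI impI)
      fix j assume j: "j \<ge> J"
      have "ennreal (\<integral>x. norm (?u j x) \<partial>lborel) = (\<integral>\<^sup>+x. ennreal (norm (?u j x)) \<partial>lborel)"
        by (rule nn_integral_eq_integral[symmetric]) (use iu in auto)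
      also have "... <= ennreal (e / 2)" unfolding nu using j by (intro J) simp
      finally have "(\<integral>x. norm (?u j x) \<partial>lborel) <= e / 2" using e by (simp add: ennreal_le_iff)
      moreover have "(\<integral>x. norm (?u j x) \<partial>lborel) \<ge> 0" by (rule integral_nonneg_AE) simp
      ultimately show "norm ((\<integral>x. norm (?u j x) \<partial>lborel) - 0) < e" using e by simp
    qed
  qed
  from tendsto_L1_AE_subseq[OF iu this] obtain r :: "nat => nat" where r: "AE x in lborel. (\<lambda>n. ?u (r n) x) \<longlonglongrightarrow> 0" by blast
  define H where "H n = h (r n + ?J)" for n
  have Hm [measurable]: "H n \<in> borel_measurable borel" for n by (simp add: H_def)
  have Hb: "lp_le p (H n) a" for n unfolding H_def by (rule b) simp
  have Hl: "AE x in lborel. x \<in> cube --> (\<lambda>n. H n x) \<longlonglongrightarrow> g x"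
    using r
  proof eventually_elim
    case (elim x)
    show ?case
    proof
      assume "x \<in> cube"
      then have "(\<lambda>n. g x - H n x) \<longlonglongrightarrow> 0" using elim by (simp add: H_def)
      from tendsto_diff[OF tendsto_const[of "g x"] this] show "(\<lambda>n. H n x) \<longlonglongrightarrow> g x" by simp
    qed
  qed
  show ?thesis
  proof (cases "p = \<infinity>")
    case True
    have "AE x in lborel. \<forall>n. x \<in> cube --> \<bar>H n x\<bar> <= a" unfolding AE_all_countable using Hb True by (simp add: lp_le_def)
    with Hl have "AE x in lborel. x \<in> cube --> \<bar>g x\<bar> <= a"
    proof eventually_elim
      case (elim x)
      then show ?case by (auto intro!: LIMSEQ_le_const2[OF tendsto_rabs])
    qed
    then show ?thesis using True by (simp add: lp_le_def)
  next
    case False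
    let ?p = "enn2real p"
    have p1: "?p \<ge> 1" using enn2real_ge_1[OF False p] .
    have "(pint ?p cube g) = (\<integral>\<^sup>+x. liminf (\<lambda>n. ennreal (\<bar>H n x\<bar> powr ?p) * indicator cube x) \<partial>lborel)"
    proof (rule nn_integral_cong_AE)
      show "AE x in lborel. ennreal (\<bar>g x\<bar> powr ?p) * indicator cube x = liminf (\<lambda>n. ennreal (\<bar>H n x\<bar> powr ?p) * indicator cube x)"
        using Hl
      proof eventually_elim
        case (elim x)
        show ?case
        proof (cases "x \<in> cube")
          case True
          have "(\<lambda>n. ennreal (\<bar>H n x\<bar> powr ?p)) \<longlonglongrightarrow> ennreal (\<bar>g x\<bar> powr ?p)"
            using elim True p1 by (intro tendsto_ennrealI tendsto_powr' tendsto_rabs tendsto_const) auto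
          then have "liminf (\<lambda>n. ennreal (\<bar>H n x\<bar> powr ?p)) = ennreal (\<bar>g x\<bar> powr ?p)"
            by (rule lim_imp_Liminf[rotated]) simp
          then show ?thesis using True by simp
        qed (simp add: Liminf_const)
      qed
    qed
    also have "... <= liminf (\<lambda>n. \<integral>\<^sup>+x\<in>cube. ennreal (\<bar>H n x\<bar> powr ?p) \<partial>lborel)" by (rule nn_integral_liminf) measurable
    also have "... <= liminf (\<lambda>n. ennreal (a powr ?p))"
      using Hb False by (intro Liminf_mono always_eventually) (auto simp: lp_le_def)
    also have "... = ennreal (a powr ?p)" by (simp add: Liminf_const)
    finally show ?thesis using False by (simp add: lp_le_def)
  qed
qed

subsection \<open>Thresholding\<close>

lemma binary_digits: "m < 2 ^ B ==> (\<Sum>b<B. (m div 2 ^ b mod 2) * 2 ^ b) = (m :: nat)"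
proof (induction B arbitrary: m)
  case (Suc B)
  have "(\<Sum>b<Suc B. (m div 2 ^ b mod 2) * 2 ^ b) = m mod 2 + 2 * (\<Sum>b<B. ((m div 2) div 2 ^ b mod 2) * 2 ^ b)"
    by (subst sum.lessThan_Suc_shift) (simp add: sum_distrib_left div_mult2_eq mult_ac)
  also have "(\<Sum>b<B. ((m div 2) div 2 ^ b mod 2) * 2 ^ b) = m div 2" using Suc.prems by (intro Suc.IH) auto
  finally show ?case by simp
qed simp

lemma sum_geometric_le:
  assumes "a > 0" "finite T"
  shows "(\<Sum>l\<in>T. 2 powr (- a * real l)) <= 1 / (1 - 2 powr (- a))"
proof -
  have e: "2 powr (- a * real l) = (2 powr (- a)) ^ l" for l
    by (simp add: powr_powr powr_realpow[symmetric])
  have l1: "norm (2 powr (- a)) < 1" using assms(1) by (simp add: powr_minus field_simps)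
  have "(\<Sum>l\<in>T. (2 powr (- a)) ^ l) <= (\<Sum>l. (2 powr (- a)) ^ l)"
    using assms l1 by (intro sum_le_suminf summable_geometric) auto
  then show ?thesis using l1 by (simp only: e suminf_geometric)
qed

lemma sum_geometric_two_sided_le:
  assumes "a > 0" "finite T"
  shows "(\<Sum>l\<in>T. 2 powr (- a * \<bar>real l - real l0\<bar>)) <= 2 / (1 - 2 powr (- a))"
proof -
  let ?f = "\<lambda>l. 2 powr (- a * \<bar>real l - real l0\<bar>)"
  have "(\<Sum>l\<in>T. ?f l) = (\<Sum>l\<in>T \<inter> {l. l0 <= l}. ?f l) + (\<Sum>l\<in>T \<inter> - {l. l0 <= l}. ?f l)"
    by (rule sum.Int_Diff[of T _ "{l. l0 <= l}", unfolded Diff_eq]) (use assms in auto)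
  also have "(\<Sum>l\<in>T \<inter> {l. l0 <= l}. ?f l) = (\<Sum>n\<in>(\<lambda>l. l - l0) ` (T \<inter> {l. l0 <= l}). 2 powr (- a * real n))"
    by (subst sum.reindex) (auto simp: inj_on_def of_nat_diff intro!: sum.cong)
  also have "(\<Sum>l\<in>T \<inter> - {l. l0 <= l}. ?f l) = (\<Sum>n\<in>(\<lambda>l. l0 - l) ` (T \<inter> - {l. l0 <= l}). 2 powr (- a * real n))"
    by (subst sum.reindex) (auto simp: inj_on_def of_nat_diff intro!: sum.cong)
  also have "(\<Sum>n\<in>(\<lambda>l. l - l0) ` (T \<inter> {l. l0 <= l}). 2 powr (- a * real n)) + (\<Sum>n\<in>(\<lambda>l. l0 - l) ` (T \<inter> - {l. l0 <= l}). 2 powr (- a * real n))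
      <= 1 / (1 - 2 powr (- a)) + 1 / (1 - 2 powr (- a))"
    using assms by (intro add_mono sum_geometric_le) auto
  finally show ?thesis by simp
qed

section \<open>The error made on a single level\<close>

definition hats :: "nat => ('n::finite) idx => real^'n => real" where
  "hats l i x = (\<Prod>m\<in>UNIV. hat (2 ^ l * x $ m - real (i m)))"

lemma hats_nonneg: "0 <= hats l i x"
  unfolding hats_def by (intro prod_nonneg) (auto simp: hat_bounds)

lemma hats_sum: "x \<in> cube ==> (\<Sum>i\<in>nodes l. hats l i x) = 1"
  unfolding hats_def nodes_PiE by (subst prod_sum_PiE[symmetric]) (auto simp: hat_partition mem_box_cart)

lemma psi_le_hats: "\<bar>psi \<alpha> (loc l i x)\<bar> <= hats l i x"
  unfolding psi_def hats_def abs_prod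
proof (intro prod_mono conjI)
  fix m
  show "\<bar>hat (2 ^ l * x $ m - real (i m)) * (2 ^ l * x $ m - real (i m)) ^ \<alpha> m\<bar> <= hat (2 ^ l * x $ m - real (i m))"
  proof (cases "\<bar>2 ^ l * x $ m - real (i m)\<bar> < 1")
    case True
    then have "\<bar>(2 ^ l * x $ m - real (i m)) ^ \<alpha> m\<bar> <= 1" by (simp add: power_abs power_le_one)
    then show ?thesis by (simp add: abs_mult hat_bounds mult_left_le)
  next
    case False
    then have "hat (2 ^ l * x $ m - real (i m)) = 0" by (simp add: hat_eq_0_iff)
    then show ?thesis by simp
  qed
qed auto

lemma measurable_psi [measurable]: "(\<lambda>x::real^'n::finite. psi \<alpha> (loc l i x)) \<in> borel_measurable borel"
  unfolding psi_def hat_def relu_def by measurable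

text \<open>The hats form a partition of unity, so \<open>\<bar>E x\<bar>\<close> is at most a
  convex combination of the \<open>\<bar>\<rho> i\<bar>\<close>. This gives the sup bound at once
  and, by Jensen, the bound in the \<open>q\<close>-norm, where the integral of a hat is at most
  \<open>(2 / 2 ^ l) ^ d\<close>.\<close>

lemma level_error:
  fixes \<rho> :: "('n::finite) idx => real" and l :: nat and \<alpha> :: "'n => nat"
  assumes q: "q \<ge> 1"
  defines "E \<equiv> \<lambda>x::real^'n. \<Sum>i\<in>nodes l. \<rho> i * psi \<alpha> (loc l i x)"
  shows "E \<in> borel_measurable borel"
    and "(\<And>i. i \<in> nodes l ==> \<bar>\<rho> i\<bar> <= \<tau>) ==> x \<in> cube ==> \<bar>E x\<bar> <= \<tau>"
    and "(\<Sum>i\<in>nodes l. \<bar>\<rho> i\<bar> powr q) <= M powr q * (2 ^ l) ^ CARD('n) ==> M > 0 ==>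
      (pint q cube E) <= ennreal ((2 ^ CARD('n) * M) powr q)"
proof -
  let ?d = "CARD('n)"
  show "E \<in> borel_measurable borel" unfolding E_def by measurable
  have Eh: "\<bar>E x\<bar> <= (\<Sum>i\<in>nodes l. hats l i x * \<bar>\<rho> i\<bar>)" for x
  proof -
    have "\<bar>E x\<bar> <= (\<Sum>i\<in>nodes l. \<bar>\<rho> i * psi \<alpha> (loc l i x)\<bar>)" unfolding E_def by (rule sum_abs)
    also have "... <= (\<Sum>i\<in>nodes l. hats l i x * \<bar>\<rho> i\<bar>)"
    proof (rule sum_mono)
      fix i
      show "\<bar>\<rho> i * psi \<alpha> (loc l i x)\<bar> <= hats l i x * \<bar>\<rho> i\<bar>"
        using mult_left_mono[OF psi_le_hats abs_ge_zero] unfolding abs_mult by (simp only: mult.commute[of "hats l i x"])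
    qed
    finally show ?thesis .
  qed
  {
    assume \<rho>: "\<And>i. i \<in> nodes l ==> \<bar>\<rho> i\<bar> <= \<tau>" and x: "x \<in> cube"
    have "(\<Sum>i\<in>nodes l. hats l i x * \<bar>\<rho> i\<bar>) <= (\<Sum>i\<in>nodes l. hats l i x * \<tau>)"
      by (intro sum_mono mult_left_mono \<rho> hats_nonneg)
    also have "... = \<tau>" by (simp add: sum_distrib_right[symmetric] hats_sum[OF x])
    finally show "\<bar>E x\<bar> <= \<tau>" using Eh[of x] by linarith
  }
  assume S: "(\<Sum>i\<in>nodes l. \<bar>\<rho> i\<bar> powr q) <= M powr q * (2 ^ l) ^ CARD('n)" and M: "M > 0"
  have [measurable]: "hats l i \<in> borel_measurable borel" for i :: "'n => nat"
    unfolding hats_def[abs_def] hat_def relu_def by measurable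
  have hI: "(\<integral>\<^sup>+x. ennreal (hats l i x) \<partial>lborel) <= ennreal ((2 / 2 ^ l) ^ ?d)" for i :: "'n => nat"
  proof -
    have "(\<integral>\<^sup>+x. ennreal (hats l i x) \<partial>lborel) <= (\<integral>\<^sup>+x. indicator {x. \<forall>m. \<bar>2 ^ l * x $ m - real (i m)\<bar> <= 1} x \<partial>lborel)"
    proof (rule nn_integral_mono)
      fix x :: "real^'n"
      show "ennreal (hats l i x) <= indicator {x. \<forall>m. \<bar>2 ^ l * x $ m - real (i m)\<bar> <= 1} x"
      proof (cases "\<forall>m. \<bar>2 ^ l * x $ m - real (i m)\<bar> <= 1")
        case True
        have "hats l i x <= 1" unfolding hats_def by (intro prod_le_1) (simp add: hat_bounds)
        then show ?thesis using True by (simp add: ennreal_le_1)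
      next
        case False
        then obtain m where "\<bar>2 ^ l * x $ m - real (i m)\<bar> > 1" by (auto simp: not_le)
        then have "hat (2 ^ l * x $ m - real (i m)) = 0" by (simp add: hat_eq_0_iff)
        then have "hats l i x = 0" unfolding hats_def by (intro prod_zero) auto
        then show ?thesis by simp
      qed
    qed
    also have "... = emeasure lborel {x :: real^'n. \<forall>m. \<bar>2 ^ l * x $ m - real (i m)\<bar> <= 1}"
      by (rule nn_integral_indicator) measurable
    also have "... = ennreal ((2 / 2 ^ l) ^ ?d)" using nn_integral_cbox_indicator[of 1 l "\<lambda>m. real (i m)"] by simp
    finally show ?thesis .
  qed
  have "(pint q cube E) <= (\<integral>\<^sup>+x. (\<Sum>i\<in>nodes l. ennreal (\<bar>\<rho> i\<bar> powr q) * ennreal (hats l i x)) \<partial>lborel)"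
  proof (rule nn_integral_mono)
    fix x :: "real^'n"
    show "ennreal (\<bar>E x\<bar> powr q) * indicator cube x <= (\<Sum>i\<in>nodes l. ennreal (\<bar>\<rho> i\<bar> powr q) * ennreal (hats l i x))"
    proof (cases "x \<in> cube")
      case True
      have "\<bar>E x\<bar> powr q <= (\<Sum>i\<in>nodes l. hats l i x * \<bar>\<rho> i\<bar>) powr q" using q by (intro powr_mono2 Eh) auto
      also have "... <= (\<Sum>i\<in>nodes l. hats l i x * \<bar>\<rho> i\<bar> powr q)"
        using q by (intro discrete_jensen finite_nodes hats_nonneg) (auto simp: hats_sum[OF True])
      finally have "ennreal (\<bar>E x\<bar> powr q) <= ennreal (\<Sum>i\<in>nodes l. hats l i x * \<bar>\<rho> i\<bar> powr q)" by (rule ennreal_leI)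
      also have "... = (\<Sum>i\<in>nodes l. ennreal (\<bar>\<rho> i\<bar> powr q) * ennreal (hats l i x))"
        by (subst sum_ennreal[symmetric]) (auto simp: hats_nonneg ennreal_mult mult.commute)
      finally show ?thesis using True by simp
    qed simp
  qed
  also have "... = (\<Sum>i\<in>nodes l. ennreal (\<bar>\<rho> i\<bar> powr q) * (\<integral>\<^sup>+x. ennreal (hats l i x) \<partial>lborel))"
    by (subst nn_integral_sum) (auto simp: nn_integral_cmult)
  also have "... <= (\<Sum>i\<in>nodes l. ennreal (\<bar>\<rho> i\<bar> powr q) * ennreal ((2 / 2 ^ l) ^ ?d))"
    by (intro sum_mono mult_left_mono hI) auto
  also have "... = ennreal ((\<Sum>i\<in>nodes l. \<bar>\<rho> i\<bar> powr q) * (2 / 2 ^ l) ^ ?d)"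
    by (simp add: ennreal_mult[symmetric] sum_ennreal sum_distrib_right)
  also have "... <= ennreal ((2 ^ ?d * M) powr q)"
  proof (rule ennreal_leI)
    have "(\<Sum>i\<in>nodes l. \<bar>\<rho> i\<bar> powr q) * (2 / 2 ^ l) ^ ?d <= M powr q * (2 ^ l) ^ ?d * (2 / 2 ^ l) ^ ?d"
      by (intro mult_right_mono S) auto
    also have "... = M powr q * 2 ^ ?d" by (simp add: power_divide)
    also have "... <= M powr q * (2 ^ ?d) powr q"
      using powr_mono[of 1 q "2 ^ ?d :: real"] q by (intro mult_left_mono) auto
    finally show "(\<Sum>i\<in>nodes l. \<bar>\<rho> i\<bar> powr q) * (2 / 2 ^ l) ^ ?d <= (2 ^ ?d * M) powr q"
      by (simp add: powr_mult mult.commute)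
  qed
  finally show "(pint q cube E) <= ennreal ((2 ^ CARD('n) * M) powr q)" .
qed

lemma card_nodes_le: "real (card (nodes l :: ('n::finite) idx set)) <= 2 ^ CARD('n) * (2 ^ l) ^ CARD('n)"
proof -
  have "card (nodes l :: 'n idx set) = (2 ^ l + 1) ^ CARD('n)" unfolding nodes_PiE by (simp add: card_PiE)
  then have "real (card (nodes l :: 'n idx set)) = (2 ^ l + 1) ^ CARD('n)" by (simp add: add.commute)
  also have "... <= (2 * 2 ^ l :: real) ^ CARD('n)" by (intro power_mono) auto
  finally show ?thesis by (simp add: power_mult_distrib)
qed

text \<open>Levels finer than \<open>l0\<close> are controlled by the summability of the coefficients alone; on coarser
  levels the trivial count \<open>2^(l d)\<close> is interpolated against it.\<close>

lemma level_count:
  fixes N A C0 R s q \<beta> \<gamma> \<epsilon> :: real and b l l0 d :: nat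
  assumes N: "N \<ge> 0" "N * (A * 2 powr (- s * l0 - \<gamma>) * 2 ^ b) powr q <= (C0 * A * 2 powr (- s * l)) powr q * (2 ^ l) ^ d"
    and N2: "N <= 2 ^ d * (2 ^ l) ^ d" and R: "(2 ^ l0) ^ d <= R\<^sup>2"
    and pos: "A > 0" "C0 \<ge> 1" "q \<ge> 1" "s > 0" "R > 0" "d \<ge> 1"
    and \<gamma>: "\<gamma> = (if l0 <= l then \<beta> * (real l - real l0) else real l0 - real l)"
    and \<epsilon>: "\<epsilon> <= q * (s - \<beta>) - d" "\<epsilon> <= q" "\<epsilon> <= d / 2" "\<epsilon> <= d / (2 * (s + 1))"
  shows "N <= 2 ^ d * C0 powr q * R\<^sup>2 * 2 powr (- \<epsilon> * (\<bar>real l - real l0\<bar> + b))"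
proof -
  define e where "e = q * (- s * l + s * l0 + \<gamma> - b)"
  have p2: "(2 ^ n) ^ d = (2 powr (real n * d) :: real)" for n
    by (simp add: powr_realpow[symmetric] powr_powr)
  have "(A * 2 powr (- s * l0 - \<gamma>) * 2 ^ b) powr q = A powr q * 2 powr (q * (- s * l0 - \<gamma> + b))"
    by (simp add: powr_mult powr_powr powr_realpow[symmetric] powr_add[symmetric] algebra_simps)
  then have a1: "(A * 2 powr (- s * l0 - \<gamma>) * 2 ^ b) powr q * 2 powr (q * (s * l0 + \<gamma> - b)) = A powr q"
    by (simp add: mult.assoc powr_add[symmetric] algebra_simps)
  have "N * A powr q = N * (A * 2 powr (- s * l0 - \<gamma>) * 2 ^ b) powr q * 2 powr (q * (s * l0 + \<gamma> - b))"
    by (subst a1[symmetric]) (rule mult.assoc[symmetric])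
  also have "... <= ((C0 * A * 2 powr (- s * l)) powr q * (2 ^ l) ^ d) * 2 powr (q * (s * l0 + \<gamma> - b))"
    by (rule mult_right_mono[OF N(2)]) simp
  also have "... = A powr q * (C0 powr q * 2 powr e * (2 ^ l) ^ d)"
    by (simp add: powr_mult powr_powr e_def powr_add[symmetric] algebra_simps)
  finally have N1: "N <= C0 powr q * 2 powr e * (2 ^ l) ^ d" using pos by (simp add: mult.commute)
  have R': "2 powr (real l0 * d) <= R\<^sup>2" using R unfolding p2 .
  show ?thesis
  proof (cases "l0 <= l")
    case True
    define w where "w = real l - real l0"
    have w: "w \<ge> 0" using True by (simp add: w_def)
    have "C0 powr q * 2 powr e * (2 ^ l) ^ d = C0 powr q * 2 powr (e + l * d)" by (simp add: p2 powr_add)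
    also have "... <= C0 powr q * (2 powr (real l0 * d) * 2 powr (- \<epsilon> * (w + b)))"
    proof (intro mult_left_mono)
      have "e + l * d = real l0 * d - w * (q * (s - \<beta>) - d) - q * b"
        using True by (simp add: e_def \<gamma> w_def algebra_simps)
      moreover have "w * \<epsilon> <= w * (q * (s - \<beta>) - d)" using w \<epsilon> by (intro mult_left_mono) auto
      moreover have "\<epsilon> * b <= q * b" using \<epsilon> by (intro mult_right_mono) auto
      ultimately have "e + l * d <= real l0 * d + (- \<epsilon> * (w + b))" by (simp add: algebra_simps)
      then show "2 powr (e + l * d) <= 2 powr (real l0 * d) * 2 powr (- \<epsilon> * (w + b))" by (simp flip: powr_add)
    qed simp
    also have "... <= C0 powr q * (R\<^sup>2 * 2 powr (- \<epsilon> * (w + b)))" using R' by (intro mult_left_mono mult_right_mono) auto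
    also have "... <= 2 ^ d * (C0 powr q * (R\<^sup>2 * 2 powr (- \<epsilon> * (w + b))))"
      using mult_right_mono[of 1 "2 ^ d" "C0 powr q * (R\<^sup>2 * 2 powr (- \<epsilon> * (w + b)))"] by simp
    finally show ?thesis using N1 w by (simp add: w_def mult.assoc)
  next
    case False
    define w where "w = real l0 - real l"
    have w: "w > 0" using False by (simp add: w_def)
    have e: "e = q * ((s + 1) * w - b)" using False by (simp add: e_def \<gamma> w_def algebra_simps)
    \<comment> \<open>Weight between the trivial count (\<open>t = 0\<close>) and the coefficient
      bound (\<open>t = 1\<close>). On coarse levels the latter grows with the distance
      \<open>w\<close> at rate \<open>q * (s + 1)\<close>; the choice makes
      \<open>t * q * (s + 1) <= d / 2\<close>, so half of the decay of the trivial count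
      survives.\<close>
    define t where "t = min 1 (d / (2 * q * (s + 1)))"
    have t: "0 < t" "t <= 1" using pos by (auto simp: t_def)
    have C1: "C0 powr q \<ge> 1" using pos by (intro ge_one_powr_ge_zero) auto
    have "N <= 2 ^ d * C0 powr q * 2 powr (t * e) * (2 ^ l) ^ d"
    proof (cases "e \<ge> 0")
      case True
      then have "2 ^ d * 1 * 1 * (2 ^ l) ^ d <= 2 ^ d * C0 powr q * 2 powr (t * e) * (2 ^ l) ^ d"
        using C1 t pos by (intro mult_mono mult_nonneg_nonneg ge_one_powr_ge_zero) auto
      then show ?thesis using N2 by linarith
    next
      case False
      then have "e <= t * e" using t by (simp add: mult_le_cancel_right1)
      then have "1 * C0 powr q * 2 powr e * (2 ^ l) ^ d <= 2 ^ d * C0 powr q * 2 powr (t * e) * (2 ^ l) ^ d"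
        using C1 by (intro mult_mono mult_nonneg_nonneg) auto
      then show ?thesis using N1 by linarith
    qed
    also have "... = 2 ^ d * C0 powr q * 2 powr (t * e + l * d)" by (simp add: p2 powr_add)
    also have "... <= 2 ^ d * C0 powr q * (2 powr (real l0 * d) * 2 powr (- \<epsilon> * (w + b)))"
    proof (intro mult_left_mono)
      have "t * (q * (s + 1)) <= d / (2 * q * (s + 1)) * (q * (s + 1))"
        using pos by (intro mult_right_mono) (auto simp: t_def)
      also have "... = d / 2" using pos by (simp add: nonzero_divide_eq_eq nonzero_eq_divide_eq)
      finally have "t * q * (s + 1) <= d / 2" by (simp only: mult.assoc)
      then have "t * q * (s + 1) * w <= d / 2 * w" using w by (intro mult_right_mono) auto
      moreover have "\<epsilon> <= t * q"
      proof -
        have "d / (2 * q * (s + 1)) * q = d / (2 * (s + 1))" using pos by simp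
        moreover have "t = 1 \<or> t = d / (2 * q * (s + 1))" by (auto simp: t_def min_def)
        ultimately show ?thesis using \<epsilon>(2,4) by auto
      qed
      then have "\<epsilon> * b <= t * q * b" by (intro mult_right_mono) auto
      moreover have "\<epsilon> * w <= d / 2 * w" using \<epsilon> w by (intro mult_right_mono) auto
      moreover have "t * e = t * q * (s + 1) * w - t * q * b" by (simp add: e algebra_simps)
      moreover have "real l * d = real l0 * d - w * d" by (simp add: w_def algebra_simps)
      ultimately have "t * e + real l * d <= real l0 * d + (- \<epsilon> * (w + b))" by (simp add: algebra_simps)
      then show "2 powr (t * e + l * d) <= 2 powr (real l0 * d) * 2 powr (- \<epsilon> * (w + b))" by (simp flip: powr_add)
    qed simp
    also have "... <= 2 ^ d * C0 powr q * (R\<^sup>2 * 2 powr (- \<epsilon> * (w + b)))" using R' by (intro mult_left_mono mult_right_mono) auto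
    finally show ?thesis using w by (simp add: w_def mult.assoc)
  qed
qed

lemma interpolation_exponent:
  assumes "1 <= p" "ennreal q <= p" "q \<ge> 1"
  shows "0 <= q * enn2real (inverse p)" "q * enn2real (inverse p) <= 1"
proof -
  show "0 <= q * enn2real (inverse p)" using assms by simp
  show "q * enn2real (inverse p) <= 1"
  proof (cases p)
    case (real r)
    have r: "r \<ge> q" using assms real by (simp add: ennreal_le_iff)
    then have "inverse p = ennreal (1 / r)" using assms(3) real by (simp add: inverse_ennreal inverse_eq_divide)
    then show ?thesis using r assms(3) by simp
  qed simp
qed

text \<open>\<open>\<beta>\<close> is the slope of the thresholds on fine levels, with
  \<open>D = d / q\<close>. The first condition makes the number of large coefficients decay, the
  second the error of the small ones. They are compatible exactly when
  \<open>(1 - \<theta>) * D < s\<close>, which for \<open>\<theta> = q / p\<close> reads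
  \<open>1/q - 1/p < s/d\<close>.\<close>

lemma slope_exists:
  fixes s \<theta> D :: real
  assumes "0 <= \<theta>" "\<theta> <= 1" "s > 0" "(1 - \<theta>) * D < s"
  shows "\<exists>\<beta>. \<beta> < s - D \<and> \<beta> * (1 - \<theta>) + s * \<theta> > 0"
proof (cases "\<theta> = 1")
  case True
  then show ?thesis using assms by (intro exI[of _ "s - D - 1"]) simp
next
  case False
  then have t: "1 - \<theta> > 0" using assms by simp
  have "- s * \<theta> / (1 - \<theta>) < s - D" using assms(4) by (subst pos_divide_less_eq[OF t]) (simp add: algebra_simps)
  then obtain \<beta> where \<beta>: "- s * \<theta> / (1 - \<theta>) < \<beta>" "\<beta> < s - D" using dense by blast
  have "- s * \<theta> < \<beta> * (1 - \<theta>)" using \<beta>(1) by (subst (asm) pos_divide_less_eq[OF t])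
  then show ?thesis using \<beta>(2) by (intro exI[of _ \<beta>]) simp
qed

text \<open>The fourth power of \<open>u\<close> leaves room: one factor pays for the logarithmic
  number of bits per element, and a square must remain for resources proportional to
  \<open>u\<close>. The bounds on \<open>2 ^ l\<close> and on the coefficients are polynomial only;
  they are met by choosing the accuracy of the networks.\<close>

abbreviation admissible :: "nat => real => real => real => ('i => nat) => ('i => 'n => nat) =>
  ('i => ('n::finite) idx set) => ('i => real) => ('i => real) => 'i => bool" where
  "admissible k C A R l \<alpha> S co u t \<equiv> \<alpha> t \<in> boxes k \<and> S t \<subseteq> nodes (l t) \<and> S t \<noteq> {} \<and> 0 < u t \<and> u t <= 1 \<and>
    real (card (S t)) <= C * R\<^sup>2 * u t ^ 4 \<and> (2 ^ l t) ^ CARD('n) <= C * R\<^sup>2 * u t powr (- C) \<and>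
    \<bar>co t\<bar> <= C * A * (2 ^ l t) ^ CARD('n)"

text \<open>The cost \<open>u\<close> of a piece decays geometrically in its distance from the critical level and in its binary digit;
  it controls both the cardinality of the piece and the resources granted to its network.\<close>

lemma nonlinear_approximation:
  fixes s q :: real and p :: ennreal
  assumes k: "k \<ge> 1" and q: "q \<ge> 1" and s: "s > 0" and p: "1 <= p" "ennreal q <= p"
    and emb: "1 / q - enn2real (inverse p) < s / real CARD('n::finite)"
  shows "\<exists>C\<ge>1. \<forall>(f :: real^'n => real) A R. f \<in> borel_measurable borel --> (\<forall>x. x \<notin> cube --> f x = 0) --> A > 0 -->
    (pint q cube f) <= ennreal (A powr q) -->
    smooth_bound k q s A f -->
    R \<ge> 2 -->
    (\<exists>(I :: (nat \<times> nat \<times> 'n idx \<times> bool) set) L \<alpha> S co u. finite I \<and>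
      lp_le p (\<lambda>x. f x - (\<Sum>t\<in>I. co t * bump (L t) (\<alpha> t) (S t) x)) (C * A * R powr (- 2 * s / real CARD('n))) \<and>
      (\<forall>t\<in>I. admissible k C A R L \<alpha> S co u t) \<and>
      (\<Sum>t\<in>I. u t) <= C \<and> real (card I) <= C * (log 2 R)\<^sup>2)"
proof -
  let ?d = "CARD('n)"
  define \<theta> where "\<theta> = q * enn2real (inverse p)"
  have th: "0 <= \<theta>" "\<theta> <= 1" using interpolation_exponent[OF p q] by (auto simp: \<theta>_def)
  have d1: "real ?d \<ge> 1" by (simp add: Suc_leI)
  have "(1 - \<theta>) * (real ?d / q) < s"
  proof -
    have "(1 / q - enn2real (inverse p)) * real ?d < s" using emb d1 by (simp add: pos_less_divide_eq)
    moreover have "(1 - \<theta>) * (real ?d / q) = (1 / q - enn2real (inverse p)) * real ?d" using q by (simp add: \<theta>_def field_simps)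
    ultimately show ?thesis by simp
  qed
  from slope_exists[OF th s this] obtain \<beta> where \<beta>: "\<beta> < s - real ?d / q" "\<beta> * (1 - \<theta>) + s * \<theta> > 0" by blast
  \<comment> \<open>Decay of the errors away from the critical level: 1 is the slope of the
    thresholds on coarse levels, the other value results from interpolation on fine ones.\<close>
  define \<kappa> where "\<kappa> = min 1 (\<beta> * (1 - \<theta>) + s * \<theta>)"
  have \<kappa>: "\<kappa> > 0" using \<beta> by (simp add: \<kappa>_def)
  \<comment> \<open>Decay of the cardinalities; the four values are the requirements of
    \<open>level_count\<close>.\<close>
  define \<epsilon> where "\<epsilon> = min (min (q * (s - \<beta>) - ?d) q) (min (?d / 2) (?d / (2 * (s + 1))))"
  have \<epsilon>: "\<epsilon> <= q * (s - \<beta>) - ?d" "\<epsilon> <= q" "\<epsilon> <= ?d / 2" "\<epsilon> <= ?d / (2 * (s + 1))"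
    unfolding \<epsilon>_def by (auto simp only: min_le_iff_disj order_refl)
  have \<epsilon>0: "\<epsilon> > 0" using \<beta>(1) q d1 s by (auto simp: \<epsilon>_def field_simps)
  obtain C0 where C0: "C0 \<ge> 1" "\<And>(f :: real^'n => real) A. f \<in> borel_measurable borel ==> (\<forall>x. x \<notin> cube --> f x = 0) ==> A > 0 ==>
    (pint q cube f) <= ennreal (A powr q) ==>
    smooth_bound k q s A f ==>
    (\<exists>c. (\<forall>l\<ge>k. \<forall>\<alpha>\<in>boxes k. (\<Sum>i\<in>nodes l. \<bar>c l i \<alpha>\<bar> powr q) <= (C0 * A * 2 powr (- s * l)) powr q * (2 ^ l) ^ CARD('n)) \<and>
      (\<forall>\<epsilon>>0. \<exists>J0. \<forall>J\<ge>J0. (\<integral>\<^sup>+x\<in>cube. ennreal \<bar>f x - psum k J c x\<bar> \<partial>lborel) <= ennreal \<epsilon>))"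
    using multiscale_expansion[OF k q, of s, where 'n = 'n] s by fastforce
  define C1 where "C1 = 2 ^ ?d * C0 powr q"
  have C0q: "C0 powr q \<ge> 1" using C0 q by (intro ge_one_powr_ge_zero) auto
  have C1: "C1 \<ge> 1" using mult_mono[of 1 "2 ^ ?d" 1 "C0 powr q"] C0q by (simp add: C1_def)
  define K where "K = real (card (boxes k :: 'n idx set))"
  have K: "K \<ge> 1" using k by (simp add: K_def card_boxes)
  define \<eta> where "\<eta> = 2 powr (- (\<epsilon> / 4))"
  have \<eta>: "\<eta> < 1" "\<eta> > 0" using \<epsilon>0 by (auto simp: \<eta>_def powr_minus field_simps)
  define \<mu> where "\<mu> = 2 powr (- \<kappa>)"
  have \<mu>: "\<mu> < 1" using \<kappa> by (auto simp: \<mu>_def powr_minus field_simps)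
  define M where "M = 2 ^ ?d * C0"
  have M: "M \<ge> 1" using C0 mult_mono[of 1 "2 ^ ?d" 1 C0] by (simp add: M_def)
  \<comment> \<open>Once level distance plus digit exceeds \<open>V0 * log 2 R\<close>, the bound on
    the cardinality drops below 1 and the piece is empty. This leaves of order
    \<open>(log R)^2\<close> pieces.\<close>
  define V0 where "V0 = (log 2 C1 + 2) / \<epsilon>"
  have V0: "V0 \<ge> 0" using C1 \<epsilon>0 by (simp add: V0_def)
  define Ce where "Ce = K * M * (2 / (1 - \<mu>)) * 2 powr s"
  define Cs where "Cs = 2 / (1 - \<eta>) * (1 / (1 - \<eta>)) * K * 2"
  define Cn where "Cn = (2 * V0 + 1) * (V0 + 1) * K * 2"
  define C where "C = max 1 (max (max (max C1 (4 * ?d / \<epsilon>)) C0) (max (max Ce Cs) Cn))"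
  have C: "C \<ge> 1" "C \<ge> C1" "C \<ge> 4 * ?d / \<epsilon>" "C \<ge> C0" "C \<ge> Ce" "C \<ge> Cs" "C \<ge> Cn"
    unfolding C_def by (auto simp only: le_max_iff_disj order_refl)
  show ?thesis
  proof (intro exI[of _ C] conjI allI impI C(1))
    fix f :: "real^'n => real" and A R :: real
    assume fm [measurable]: "f \<in> borel_measurable borel" and f0: "\<forall>x. x \<notin> cube --> f x = 0" and A: "A > 0"
      and b1: "(pint q cube f) <= ennreal (A powr q)"
      and b2: "smooth_bound k q s A f"
      and R: "R \<ge> 2"
    obtain c where c: "\<And>l \<alpha>. l \<ge> k ==> \<alpha> \<in> boxes k ==> (\<Sum>i\<in>nodes l. \<bar>c l i \<alpha>\<bar> powr q) <= (C0 * A * 2 powr (- s * l)) powr q * (2 ^ l) ^ ?d"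
      and clim: "\<And>\<epsilon>. \<epsilon> > 0 ==> \<exists>J0. \<forall>J\<ge>J0. (\<integral>\<^sup>+x\<in>cube. ennreal \<bar>f x - psum k J c x\<bar> \<partial>lborel) <= ennreal \<epsilon>"
      using C0(2)[OF fm f0 A b1 b2] by blast
    have lR: "log 2 R \<ge> 1" using R by simp
    \<comment> \<open>The critical level: \<open>2 ^ (l0 * d)\<close> is at most \<open>R^2\<close>,
      and at least that up to a factor \<open>2 ^ d\<close>.\<close>
    define l0 where "l0 = nat \<lfloor>2 / real ?d * log 2 R\<rfloor>"
    have l0: "real l0 <= 2 / real ?d * log 2 R" "2 / real ?d * log 2 R <= real l0 + 1"
      using lR by (auto simp: l0_def intro!: of_nat_floor)
    have R2: "R\<^sup>2 = 2 powr (2 * log 2 R)"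
    proof -
      have "2 powr (2 * log 2 R) = (2 powr (log 2 R)) powr 2" by (simp only: powr_powr mult.commute)
      also have "... = R\<^sup>2" using R by simp
      finally show ?thesis ..
    qed
    have l0R: "(2 ^ l0) ^ ?d <= R\<^sup>2"
    proof -
      have "(2 ^ l0) ^ ?d = (2 powr (real l0 * ?d) :: real)" by (simp add: powr_realpow[symmetric] powr_powr)
      also have "... <= 2 powr (2 * log 2 R)" using l0(1) d1 by (simp add: field_simps)
      finally show ?thesis by (simp add: R2)
    qed
    \<comment> \<open>Coarse levels have few nodes, so their thresholds can shrink with slope 1,
      which makes their errors summable. On fine levels the slope is \<open>\<beta>\<close>, which
      may be negative.\<close>
    define \<gamma> where "\<gamma> l = (if l0 <= l then \<beta> * (real l - real l0) else real l0 - real l)" for l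
    define \<tau> where "\<tau> l = A * 2 powr (- s * l0 - \<gamma> l)" for l
    have \<tau>: "\<tau> l > 0" for l using A by (simp add: \<tau>_def)
    define v where "v l b = \<bar>real l - real l0\<bar> + real b" for l b :: nat
    have big_card: "real (card {i\<in>nodes l. \<tau> l * 2 ^ b <= \<bar>c l i \<alpha>\<bar>}) <= C1 * R\<^sup>2 * 2 powr (- \<epsilon> * v l b)"
      if l: "l \<ge> k" and \<alpha>: "\<alpha> \<in> boxes k" for l b \<alpha>
      unfolding v_def C1_def
    proof (rule level_count[where A = A and \<gamma> = "\<gamma> l" and \<beta> = \<beta>])
      let ?S = "{i\<in>nodes l. \<tau> l * 2 ^ b <= \<bar>c l i \<alpha>\<bar>}"
      have fin: "finite ?S" using finite_nodes by (rule finite_subset[rotated]) auto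
      have "real (card ?S) * (\<tau> l * 2 ^ b) powr q = (\<Sum>i\<in>?S. (\<tau> l * 2 ^ b) powr q)" by simp
      also have "... <= (\<Sum>i\<in>?S. \<bar>c l i \<alpha>\<bar> powr q)" using q \<tau>[of l] by (intro sum_mono powr_mono2) auto
      also have "... <= (\<Sum>i\<in>nodes l. \<bar>c l i \<alpha>\<bar> powr q)" using finite_nodes by (intro sum_mono2) auto
      also note c[OF l \<alpha>]
      finally show "real (card ?S) * (A * 2 powr (- s * l0 - \<gamma> l) * 2 ^ b) powr q <= (C0 * A * 2 powr (- s * l)) powr q * (2 ^ l) ^ ?d"
        by (simp only: \<tau>_def)
      have "card ?S <= card (nodes l :: 'n idx set)" using finite_nodes by (intro card_mono) auto
      then show "real (card ?S) <= 2 ^ ?d * (2 ^ l) ^ ?d" using card_nodes_le[of l, where 'n = 'n] by linarith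
    qed (use A C0 q s R d1 l0R \<epsilon> in \<open>auto simp: \<gamma>_def Suc_leI\<close>)
    have nonempty: "\<epsilon> * v l b <= log 2 C1 + 2 * log 2 R"
      if "l \<ge> k" "\<alpha> \<in> boxes k" "i \<in> nodes l" "\<tau> l * 2 ^ b <= \<bar>c l i \<alpha>\<bar>" for l b i \<alpha>
    proof -
      have "finite {i\<in>nodes l. \<tau> l * 2 ^ b <= \<bar>c l i \<alpha>\<bar>}" using finite_nodes by (rule finite_subset[rotated]) auto
      then have "card {i\<in>nodes l. \<tau> l * 2 ^ b <= \<bar>c l i \<alpha>\<bar>} \<ge> 1" using that by (auto simp: Suc_le_eq card_gt_0_iff)
      then have "1 <= real (card {i\<in>nodes l. \<tau> l * 2 ^ b <= \<bar>c l i \<alpha>\<bar>})" by linarith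
      also note big_card[OF that(1,2), of b]
      also have "C1 * R\<^sup>2 * 2 powr (- \<epsilon> * v l b) = 2 powr (log 2 C1 + 2 * log 2 R - \<epsilon> * v l b)"
        using C1 by (simp add: R2 powr_diff powr_add powr_minus divide_inverse)
      finally show ?thesis using powr_le_cancel_iff[of 2 0 "log 2 C1 + 2 * log 2 R - \<epsilon> * v l b"] by simp
    qed
    define V where "V = V0 * log 2 R"
    have vV: "v l b <= V" if "l \<ge> k" "\<alpha> \<in> boxes k" "i \<in> nodes l" "\<tau> l * 2 ^ b <= \<bar>c l i \<alpha>\<bar>" for l b i \<alpha>
    proof -
      have "log 2 C1 <= log 2 C1 * log 2 R" using C1 lR mult_left_mono[of 1 "log 2 R" "log 2 C1"] by simp
      then have "\<epsilon> * v l b <= (log 2 C1 + 2) * log 2 R" using nonempty[OF that] by (simp add: distrib_right)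
      then show ?thesis using \<epsilon>0 by (simp add: V_def V0_def pos_le_divide_eq mult.commute)
    qed
    \<comment> \<open>Coefficients are rounded toward 0 to multiples of the threshold; each binary
      digit of the multiple, together with the sign, gives one piece.\<close>
    define N where "N l i \<alpha> = nat \<lfloor>\<bar>c l i \<alpha>\<bar> / \<tau> l\<rfloor>" for l i \<alpha>
    have N: "real (N l i \<alpha>) * \<tau> l <= \<bar>c l i \<alpha>\<bar>" "\<bar>c l i \<alpha>\<bar> <= real (N l i \<alpha>) * \<tau> l + \<tau> l" for l i \<alpha>
    proof -
      have "\<bar>c l i \<alpha>\<bar> / \<tau> l \<ge> 0" using \<tau>[of l] by simp
      then have "real (N l i \<alpha>) = of_int \<lfloor>\<bar>c l i \<alpha>\<bar> / \<tau> l\<rfloor>" by (simp add: N_def)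
      then have "real (N l i \<alpha>) <= \<bar>c l i \<alpha>\<bar> / \<tau> l" "\<bar>c l i \<alpha>\<bar> / \<tau> l <= real (N l i \<alpha>) + 1" by linarith+
      then show "real (N l i \<alpha>) * \<tau> l <= \<bar>c l i \<alpha>\<bar>" "\<bar>c l i \<alpha>\<bar> <= real (N l i \<alpha>) * \<tau> l + \<tau> l"
        using \<tau>[of l] by (auto simp: pos_le_divide_eq pos_divide_le_eq distrib_right)
    qed
    have Nbig: "\<tau> l * 2 ^ b <= \<bar>c l i \<alpha>\<bar>" if "2 ^ b <= N l i \<alpha>" for l b i \<alpha>
    proof -
      have "real (2 ^ b) <= real (N l i \<alpha>)" using that by (simp only: of_nat_le_iff)
      then have "2 ^ b * \<tau> l <= real (N l i \<alpha>) * \<tau> l" using \<tau>[of l] by (intro mult_right_mono) auto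
      then show ?thesis using N(1)[of l i \<alpha>] by (simp add: mult.commute)
    qed
    define S where "S = (\<lambda>(l, b, \<alpha>, \<sigma>). {i\<in>nodes l. (0 <= c l i \<alpha>) = \<sigma> \<and> odd (N l i \<alpha> div 2 ^ b)})"
    have S: "S (l, b, \<alpha>, \<sigma>) = {i\<in>nodes l. (0 <= c l i \<alpha>) = \<sigma> \<and> odd (N l i \<alpha> div 2 ^ b)}" for l b \<alpha> \<sigma> by (simp add: S_def)
    define co where "co = (\<lambda>(l, b, \<alpha> :: 'n => nat, \<sigma>). (if \<sigma> then 1 else - 1) * (\<tau> l * 2 ^ b))"
    have co: "co (l, b, \<alpha>, \<sigma>) = (if \<sigma> then 1 else - 1) * (\<tau> l * 2 ^ b)" for l b \<alpha> \<sigma> by (simp add: co_def)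
    \<comment> \<open>A quarter of the rate \<open>\<epsilon>\<close>, so that \<open>u ^ 4\<close>
      is the decay of the cardinality.\<close>
    define u where "u = (\<lambda>(l, b, \<alpha> :: 'n => nat, \<sigma> :: bool). 2 powr (- (\<epsilon> / 4) * v l b))"
    have u: "u (l, b, \<alpha>, \<sigma>) = 2 powr (- (\<epsilon> / 4) * v l b)" for l b \<alpha> \<sigma> by (simp add: u_def)
    have Sbig: "\<tau> l * 2 ^ b <= \<bar>c l i \<alpha>\<bar>" "i \<in> nodes l" if "i \<in> S (l, b, \<alpha>, \<sigma>)" for l b \<alpha> \<sigma> i
    proof -
      show "i \<in> nodes l" using that by (simp add: S)
      have "odd (N l i \<alpha> div 2 ^ b)" using that by (simp add: S)
      then have "N l i \<alpha> div 2 ^ b \<noteq> 0" by (metis even_zero)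
      then have "2 ^ b <= N l i \<alpha>" by (simp add: div_eq_0_iff)
      then show "\<tau> l * 2 ^ b <= \<bar>c l i \<alpha>\<bar>" by (rule Nbig)
    qed
    define I where "I = {(l, b, \<alpha>, \<sigma>). k <= l \<and> \<alpha> \<in> boxes k \<and> S (l, b, \<alpha>, \<sigma>) \<noteq> {}}"
    have IV: "v l b <= V" if "(l, b, \<alpha>, \<sigma>) \<in> I" for l b \<alpha> \<sigma>
    proof -
      obtain i where "i \<in> S (l, b, \<alpha>, \<sigma>)" "k <= l" "\<alpha> \<in> boxes k" using \<open>(l, b, \<alpha>, \<sigma>) \<in> I\<close> unfolding I_def by blast
      then show ?thesis using vV Sbig by blast
    qed
    define Vn where "Vn = nat \<lfloor>V\<rfloor>"
    have V: "V \<ge> 0" using V0 lR by (simp add: V_def)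
    have Vn: "real Vn <= V" "V < real Vn + 1" using V by (auto simp: Vn_def)
    have le_Vn: "n <= Vn" if "real n <= V" for n
    proof -
      have "real n < real (Suc Vn)" using that Vn(2) by simp
      then show ?thesis by (simp only: of_nat_less_iff less_Suc_eq_le)
    qed
    let ?T = "{l0 - Vn..l0 + Vn}"
    let ?B = "?T \<times> {..Vn} \<times> (boxes k :: 'n idx set) \<times> (UNIV :: bool set)"
    have IB: "I \<subseteq> ?B"
    proof
      fix t assume t: "t \<in> I"
      obtain l b \<alpha> \<sigma> where e: "t = (l, b, \<alpha>, \<sigma>)" by (metis surj_pair)
      have "v l b <= V" using IV t e by blast
      then have "\<bar>real l - real l0\<bar> <= V" "real b <= V" unfolding v_def by linarith+
      then have "real (l - l0) <= V" "real (l0 - l) <= V" "b <= Vn" using V le_Vn by (auto simp: of_nat_diff_if abs_le_iff)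
      then have "l - l0 <= Vn" "l0 - l <= Vn" "b <= Vn" using le_Vn by blast+
      moreover have "\<alpha> \<in> boxes k" using t unfolding e I_def by simp
      ultimately show "t \<in> ?B" unfolding e by auto
    qed
    have finB: "finite ?B" by (intro finite_cartesian_product) auto
    have finI: "finite I" using IB finB by (rule finite_subset)
    have cardI: "real (card I) <= C * (log 2 R)\<^sup>2"
    proof -
      have "card I <= card ?B" using IB finB by (rule card_mono[rotated])
      also have "... = card ?T * ((Vn + 1) * (card (boxes k :: 'n idx set) * 2))"
        by (simp add: card_cartesian_product)
      also have "... <= (2 * Vn + 1) * ((Vn + 1) * (card (boxes k :: 'n idx set) * 2))"
        by (rule mult_right_mono) auto
      finally have "real (card I) <= real ((2 * Vn + 1) * ((Vn + 1) * (card (boxes k :: 'n idx set) * 2)))" by (simp only: of_nat_le_iff)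
      also have "... = (2 * real Vn + 1) * ((real Vn + 1) * (K * 2))" by (simp add: K_def algebra_simps)
      also have "... <= ((2 * V0 + 1) * log 2 R) * (((V0 + 1) * log 2 R) * (K * 2))"
        using Vn(1) V0 lR K unfolding V_def by (intro mult_mono) (auto simp: distrib_right)
      also have "... = Cn * (log 2 R)\<^sup>2" by (simp add: Cn_def power2_eq_square)
      also have "... <= C * (log 2 R)\<^sup>2" using C(7) by (intro mult_right_mono) auto
      finally show ?thesis .
    qed
    have sumu: "(\<Sum>t\<in>I. u t) <= C"
    proof -
      have "(\<Sum>t\<in>I. u t) <= (\<Sum>t\<in>?B. u t)" using finB IB by (intro sum_mono2) (auto simp: u_def)
      also have "... = (\<Sum>l\<in>?T. \<Sum>b\<le>Vn. \<Sum>\<alpha>\<in>(boxes k :: 'n idx set). \<Sum>\<sigma>\<in>(UNIV :: bool set). 2 powr (- (\<epsilon> / 4) * \<bar>real l - real l0\<bar>) * 2 powr (- (\<epsilon> / 4) * real b))"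
        unfolding sum.cartesian_product' by (intro sum.cong refl) (auto simp: u_def v_def algebra_simps simp flip: powr_add)
      also have "... = (\<Sum>l\<in>?T. 2 powr (- (\<epsilon> / 4) * \<bar>real l - real l0\<bar>)) * (\<Sum>b\<le>Vn. 2 powr (- (\<epsilon> / 4) * real b)) * K * 2"
        by (simp add: sum_distrib_left sum_distrib_right K_def mult_ac)
      also have "... <= 2 / (1 - 2 powr (- (\<epsilon> / 4))) * (1 / (1 - 2 powr (- (\<epsilon> / 4)))) * K * 2"
        using \<epsilon>0 K \<eta> unfolding \<eta>_def
        by (intro mult_right_mono mult_mono sum_geometric_two_sided_le sum_geometric_le) (auto intro!: sum_nonneg)
      also have "... = Cs" by (simp add: Cs_def \<eta>_def)
      finally show ?thesis using C(6) by linarith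
    qed
    have pieces: "\<alpha> \<in> boxes k \<and> S (l, b, \<alpha>, \<sigma>) \<subseteq> nodes l \<and> S (l, b, \<alpha>, \<sigma>) \<noteq> {} \<and> 0 < u (l, b, \<alpha>, \<sigma>) \<and> u (l, b, \<alpha>, \<sigma>) <= 1 \<and>
        real (card (S (l, b, \<alpha>, \<sigma>))) <= C * R\<^sup>2 * u (l, b, \<alpha>, \<sigma>) ^ 4 \<and> (2 ^ l) ^ CARD('n) <= C * R\<^sup>2 * u (l, b, \<alpha>, \<sigma>) powr (- C) \<and>
        \<bar>co (l, b, \<alpha>, \<sigma>)\<bar> <= C * A * (2 ^ l) ^ CARD('n)" if t: "(l, b, \<alpha>, \<sigma>) \<in> I" for l b \<alpha> \<sigma>
    proof (intro conjI)
      have l: "l \<ge> k" and \<alpha>: "\<alpha> \<in> boxes k" and ne: "S (l, b, \<alpha>, \<sigma>) \<noteq> {}" using t unfolding I_def by auto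
      then show "\<alpha> \<in> boxes k" "S (l, b, \<alpha>, \<sigma>) \<noteq> {}" by auto
      show "S (l, b, \<alpha>, \<sigma>) \<subseteq> nodes l" using Sbig(2) by blast
      show u0: "0 < u (l, b, \<alpha>, \<sigma>)" by (simp add: u)
      have v0: "v l b \<ge> 0" by (simp add: v_def)
      then show u1: "u (l, b, \<alpha>, \<sigma>) <= 1" using \<epsilon>0 powr_mono[of "- (\<epsilon> / 4) * v l b" 0 2] by (simp add: u)
      have "card (S (l, b, \<alpha>, \<sigma>)) <= card {i\<in>nodes l. \<tau> l * 2 ^ b <= \<bar>c l i \<alpha>\<bar>}"
        using Sbig[of _ l b \<alpha> \<sigma>] by (intro card_mono) (auto intro: finite_subset[OF _ finite_nodes])
      then have "real (card (S (l, b, \<alpha>, \<sigma>))) <= C1 * R\<^sup>2 * 2 powr (- \<epsilon> * v l b)"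
        using big_card[OF l \<alpha>, of b] by linarith
      also have "2 powr (- \<epsilon> * v l b) = u (l, b, \<alpha>, \<sigma>) ^ 4" by (simp add: u powr_realpow[symmetric] powr_powr)
      also have "C1 * R\<^sup>2 * u (l, b, \<alpha>, \<sigma>) ^ 4 <= C * R\<^sup>2 * u (l, b, \<alpha>, \<sigma>) ^ 4" using C(2) by (intro mult_right_mono) auto
      finally show "real (card (S (l, b, \<alpha>, \<sigma>))) <= C * R\<^sup>2 * u (l, b, \<alpha>, \<sigma>) ^ 4" .
      have "(2 ^ l) ^ ?d = (2 powr (real l * ?d) :: real)" by (simp add: powr_realpow[symmetric] powr_powr)
      also have "... <= 2 powr (real l0 * ?d + v l b * ?d)"
      proof -
        have "real l <= real l0 + v l b" by (simp add: v_def)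
        then have "real l * ?d <= (real l0 + v l b) * ?d" by (intro mult_right_mono) auto
        then show ?thesis by (simp add: distrib_right)
      qed
      also have "... = (2 ^ l0) ^ ?d * 2 powr (v l b * ?d)" by (simp add: powr_realpow[symmetric] powr_powr powr_add)
      also have "... <= R\<^sup>2 * 2 powr (v l b * ?d)" using l0R by (intro mult_right_mono) auto
      also have "2 powr (v l b * ?d) = u (l, b, \<alpha>, \<sigma>) powr (- (4 * ?d / \<epsilon>))" using \<epsilon>0 by (simp add: u powr_powr)
      also have "R\<^sup>2 * u (l, b, \<alpha>, \<sigma>) powr (- (4 * ?d / \<epsilon>)) <= R\<^sup>2 * u (l, b, \<alpha>, \<sigma>) powr (- C)"
        using C(3) u0 u1 by (intro mult_left_mono powr_mono') auto
      also have "... <= C * (R\<^sup>2 * u (l, b, \<alpha>, \<sigma>) powr (- C))" using C(1) mult_right_mono[of 1 C "R\<^sup>2 * u (l, b, \<alpha>, \<sigma>) powr (- C)"] by simp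
      finally show "(2 ^ l) ^ CARD('n) <= C * R\<^sup>2 * u (l, b, \<alpha>, \<sigma>) powr (- C)" by (simp add: mult.assoc)
      obtain i where i: "i \<in> S (l, b, \<alpha>, \<sigma>)" using ne by blast
      have "\<bar>co (l, b, \<alpha>, \<sigma>)\<bar> <= \<bar>c l i \<alpha>\<bar>" using Sbig(1)[OF i] \<tau>[of l] by (simp add: co abs_mult)
      also have "... <= C0 * A * (2 ^ l) ^ ?d"
      \<comment> \<open>A single coefficient is compared with the whole sum of its level. The
        generous factor \<open>(2 ^ l) ^ d\<close> is at most its own \<open>q\<close>-th power,
        which spares a root.\<close>
      proof (rule ccontr)
        assume "\<not> \<bar>c l i \<alpha>\<bar> <= C0 * A * (2 ^ l) ^ ?d"
        then have "(C0 * A * (2 ^ l) ^ ?d) powr q < \<bar>c l i \<alpha>\<bar> powr q" using C0 A q by (intro powr_less_mono2) auto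
        also have "... <= (\<Sum>i\<in>nodes l. \<bar>c l i \<alpha>\<bar> powr q)"
          using Sbig(2)[OF i] by (intro member_le_sum finite_nodes) auto
        also note c[OF l \<alpha>]
        also have "(C0 * A * 2 powr (- s * l)) powr q * (2 ^ l) ^ ?d <= (C0 * A * 1) powr q * ((2 ^ l) ^ ?d) powr q"
        proof (intro mult_mono powr_mono2 mult_left_mono)
          have "1 <= ((2 ^ l) ^ ?d :: real)" by (intro one_le_power) simp
          then show "(2 ^ l) ^ ?d <= ((2 ^ l) ^ ?d :: real) powr q" using powr_mono[of 1 q "(2 ^ l) ^ ?d"] q by simp
          show "2 powr (- s * l) <= 1" using s powr_mono[of "- s * l" 0 2] by simp
        qed (use C0 A q in auto)
        finally show False by (simp add: powr_mult)
      qed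
      also have "... <= C * A * (2 ^ l) ^ ?d" using C(4) A by (intro mult_right_mono) auto
      finally show "\<bar>co (l, b, \<alpha>, \<sigma>)\<bar> <= C * A * (2 ^ l) ^ CARD('n)" .
    qed
    show "\<exists>(I :: (nat \<times> nat \<times> 'n idx \<times> bool) set) L \<alpha> S co u. finite I \<and>
      lp_le p (\<lambda>x. f x - (\<Sum>t\<in>I. co t * bump (L t) (\<alpha> t) (S t) x)) (C * A * R powr (- 2 * s / real CARD('n))) \<and>
      (\<forall>t\<in>I. admissible k C A R L \<alpha> S co u t) \<and>
      (\<Sum>t\<in>I. u t) <= C \<and> real (card I) <= C * (log 2 R)\<^sup>2"
    proof (rule exI[of _ I], rule exI[of _ fst], rule exI[of _ "\<lambda>t. fst (snd (snd t))"], rule exI[of _ S], rule exI[of _ co], rule exI[of _ u],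
        intro conjI finI sumu cardI)
      show "\<forall>t\<in>I. fst (snd (snd t)) \<in> boxes k \<and> S t \<subseteq> nodes (fst t) \<and> S t \<noteq> {} \<and> 0 < u t \<and> u t <= 1 \<and>
        real (card (S t)) <= C * R\<^sup>2 * u t ^ 4 \<and> (2 ^ fst t) ^ CARD('n) <= C * R\<^sup>2 * u t powr (- C) \<and>
        \<bar>co t\<bar> <= C * A * (2 ^ fst t) ^ CARD('n)"
      proof
        fix t assume t: "t \<in> I"
        obtain l b \<alpha> \<sigma> where e: "t = (l, b, \<alpha>, \<sigma>)" by (metis surj_pair)
        show "fst (snd (snd t)) \<in> boxes k \<and> S t \<subseteq> nodes (fst t) \<and> S t \<noteq> {} \<and> 0 < u t \<and> u t <= 1 \<and>
          real (card (S t)) <= C * R\<^sup>2 * u t ^ 4 \<and> (2 ^ fst t) ^ CARD('n) <= C * R\<^sup>2 * u t powr (- C) \<and>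
          \<bar>co t\<bar> <= C * A * (2 ^ fst t) ^ CARD('n)"
          using pieces[of l b \<alpha> \<sigma>] t unfolding e fst_conv snd_conv by blast
      qed
      \<comment> \<open>What rounding leaves over. It is bounded by the threshold and by the
        coefficient itself, and these two bounds are the two ends of the interpolation.\<close>
      define \<rho> where "\<rho> l \<alpha> i = c l i \<alpha> - (if 0 <= c l i \<alpha> then 1 else - 1) * (real (N l i \<alpha>) * \<tau> l)" for l \<alpha> i
      have \<rho>: "\<bar>\<rho> l \<alpha> i\<bar> <= \<tau> l" "\<bar>\<rho> l \<alpha> i\<bar> <= \<bar>c l i \<alpha>\<bar>" for l \<alpha> i
      proof -
        have "0 <= real (N l i \<alpha>) * \<tau> l" using \<tau>[of l] by simp
        then show "\<bar>\<rho> l \<alpha> i\<bar> <= \<tau> l" "\<bar>\<rho> l \<alpha> i\<bar> <= \<bar>c l i \<alpha>\<bar>" using N[of l i \<alpha>] unfolding \<rho>_def by (auto split: if_splits)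
      qed
      define E where "E l \<alpha> x = (\<Sum>i\<in>nodes l. \<rho> l \<alpha> i * psi \<alpha> (loc l i x))" for l \<alpha> and x :: "real^'n"
      have Em [measurable]: "E l \<alpha> \<in> borel_measurable borel" for l \<alpha>
        unfolding E_def by (rule level_error(1)[OF q])
      \<comment> \<open>The sum over all levels is of order \<open>2 powr (- s * l0)\<close>, that
        is \<open>R powr (- 2 * s / d)\<close>; rounding \<open>l0\<close> down costs the factor
        \<open>2 powr s\<close> in \<open>Ce\<close>.\<close>
      define a where "a l = M * A * 2 powr (- s * l0) * 2 powr (- \<kappa> * \<bar>real l - real l0\<bar>)" for l
      have Ea: "lp_le p (E l \<alpha>) (a l)" if l: "l \<ge> k" and \<alpha>: "\<alpha> \<in> boxes k" for l \<alpha>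
      proof -
        have Eb: "\<bar>E l \<alpha> x\<bar> <= \<tau> l" if "x \<in> cube" for x
          unfolding E_def using \<rho>(1) that by (intro level_error(2)[OF q]) auto
        show ?thesis
        proof (cases "l0 <= l")
          case False
          have "lp_le p (E l \<alpha>) (\<tau> l)" using Eb by (rule lp_le_bounded)
          then show ?thesis
          proof (rule lp_le_mono)
            have "\<tau> l = 1 * A * 2 powr (- s * l0) * 2 powr (- 1 * \<bar>real l - real l0\<bar>)"
              using False by (simp add: \<tau>_def \<gamma>_def powr_add[symmetric] algebra_simps)
            also have "... <= a l" unfolding a_def using M A
              by (intro mult_mono mult_nonneg_nonneg powr_mono mult_right_mono) (auto simp: \<kappa>_def)
            finally show "\<tau> l <= a l" .
            show "0 <= \<tau> l" using \<tau>[of l] by simp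
          qed
        next
          case True
          define w where "w = real l - real l0"
          have w: "w \<ge> 0" using True by (simp add: w_def)
          let ?M = "C0 * A * 2 powr (- s * l)"
          have M0: "?M > 0" using C0 A by simp
          have "(\<Sum>i\<in>nodes l. \<bar>\<rho> l \<alpha> i\<bar> powr q) <= (\<Sum>i\<in>nodes l. \<bar>c l i \<alpha>\<bar> powr q)"
            using \<rho>(2) q by (intro sum_mono powr_mono2) auto
          also note c[OF l \<alpha>]
          finally have "(pint q cube (E l \<alpha>)) <= ennreal ((2 ^ ?d * ?M) powr q)"
            unfolding E_def using M0 by (intro level_error(3)[OF q])
          from lp_le_interpolate[OF Em p q \<tau> _ Eb this] have "lp_le p (E l \<alpha>) (\<tau> l powr (1 - \<theta>) * (2 ^ ?d * ?M) powr \<theta>)"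
            using M0 unfolding \<theta>_def by simp
          then show ?thesis
          proof (rule lp_le_mono)
            have "\<tau> l powr (1 - \<theta>) * (2 ^ ?d * ?M) powr \<theta> = (A powr (1 - \<theta>) * A powr \<theta>) * M powr \<theta> * (2 powr ((- s * l0 - \<gamma> l) * (1 - \<theta>)) * 2 powr (- s * l * \<theta>))"
              unfolding \<tau>_def M_def by (simp add: powr_mult powr_powr mult_ac)
            also have "A powr (1 - \<theta>) * A powr \<theta> = A" using A by (simp flip: powr_add)
            also have "2 powr ((- s * l0 - \<gamma> l) * (1 - \<theta>)) * 2 powr (- s * l * \<theta>) = 2 powr (- s * l0) * 2 powr (- (\<beta> * (1 - \<theta>) + s * \<theta>) * w)"
              using True by (simp add: powr_add[symmetric] \<gamma>_def w_def algebra_simps)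
            also have "A * M powr \<theta> * (2 powr (- s * l0) * 2 powr (- (\<beta> * (1 - \<theta>) + s * \<theta>) * w)) <= A * M * (2 powr (- s * l0) * 2 powr (- \<kappa> * w))"
            proof (rule mult_mono)
              have "M powr \<theta> <= M" using powr_mono[of \<theta> 1 M] M th by simp
              then show "A * M powr \<theta> <= A * M" using A by simp
              have "\<kappa> * w <= (\<beta> * (1 - \<theta>) + s * \<theta>) * w" using w by (intro mult_right_mono) (auto simp: \<kappa>_def)
              then have "2 powr (- (\<beta> * (1 - \<theta>) + s * \<theta>) * w) <= 2 powr (- \<kappa> * w)"
                by (intro powr_mono) (simp_all only: mult_minus_left neg_le_iff_le one_le_numeral)
              then show "2 powr (- s * l0) * 2 powr (- (\<beta> * (1 - \<theta>) + s * \<theta>) * w) <= 2 powr (- s * l0) * 2 powr (- \<kappa> * w)"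
                by (intro mult_left_mono) auto
            qed (use A M in auto)
            also have "... = a l" using w by (simp add: a_def w_def)
            finally show "\<tau> l powr (1 - \<theta>) * (2 ^ ?d * ?M) powr \<theta> <= a l" .
          qed simp
        qed
      qed
      \<comment> \<open>Beyond level \<open>l0 + Vn\<close> no coefficient reaches its threshold, so
        a larger \<open>J\<close> adds remainders only. The pieces are thus fixed, and
        \<open>f\<close> minus their sum is a limit of sums of remainders.\<close>
      have split: "psum k J c x
          = (\<Sum>t\<in>I. co t * bump (fst t) (fst (snd (snd t))) (S t) x) + (\<Sum>l=k..J. \<Sum>\<alpha>\<in>boxes k. E l \<alpha> x)"
        if J: "J \<ge> l0 + Vn" for J x
      proof -
        let ?D = "{k..J} \<times> {..Vn} \<times> (boxes k :: 'n idx set) \<times> (UNIV :: bool set)"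
        let ?g = "\<lambda>t. co t * bump (fst t) (fst (snd (snd t))) (S t) x"
        have cexp: "c l i \<alpha> = \<rho> l \<alpha> i + (\<Sum>b\<le>Vn. \<Sum>\<sigma>\<in>UNIV. if i \<in> S (l, b, \<alpha>, \<sigma>) then co (l, b, \<alpha>, \<sigma>) else 0)"
          if "l \<ge> k" "\<alpha> \<in> boxes k" "i \<in> nodes l" for l i \<alpha>
        proof -
          have "\<not> 2 ^ Suc Vn <= N l i \<alpha>"
          proof
            assume "2 ^ Suc Vn <= N l i \<alpha>"
            then have "v l (Suc Vn) <= V" using vV[OF that] Nbig by blast
            then show False using Vn(2) by (simp add: v_def)
          qed
          then have Nd: "(\<Sum>b<Suc Vn. (N l i \<alpha> div 2 ^ b mod 2) * 2 ^ b) = N l i \<alpha>" by (intro binary_digits) simp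
          let ?sg = "if 0 <= c l i \<alpha> then 1 else - 1 :: real"
          have "(\<Sum>b\<le>Vn. \<Sum>\<sigma>\<in>UNIV. if i \<in> S (l, b, \<alpha>, \<sigma>) then co (l, b, \<alpha>, \<sigma>) else 0) = (\<Sum>b\<le>Vn. ?sg * (real ((N l i \<alpha> div 2 ^ b mod 2) * 2 ^ b) * \<tau> l))"
          proof (intro sum.cong refl)
            fix b
            show "(\<Sum>\<sigma>\<in>UNIV. if i \<in> S (l, b, \<alpha>, \<sigma>) then co (l, b, \<alpha>, \<sigma>) else 0) = ?sg * (real ((N l i \<alpha> div 2 ^ b mod 2) * 2 ^ b) * \<tau> l)"
              using that(3) by (cases "odd (N l i \<alpha> div 2 ^ b)") (auto simp: UNIV_bool S co odd_iff_mod_2_eq_one even_iff_mod_2_eq_zero)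
          qed
          also have "... = ?sg * (real (\<Sum>b<Suc Vn. (N l i \<alpha> div 2 ^ b mod 2) * 2 ^ b) * \<tau> l)"
            unfolding lessThan_Suc_atMost of_nat_sum sum_distrib_right sum_distrib_left ..
          also have "... = ?sg * (real (N l i \<alpha>) * \<tau> l)" unfolding Nd ..
          finally show ?thesis unfolding \<rho>_def by simp
        qed
        have g: "(\<Sum>i\<in>nodes l. (if i \<in> S (l, b, \<alpha>, \<sigma>) then co (l, b, \<alpha>, \<sigma>) else 0) * psi \<alpha> (loc l i x)) = ?g (l, b, \<alpha>, \<sigma>)" for l b \<alpha> \<sigma>
        proof -
          have "(\<Sum>i\<in>nodes l. (if i \<in> S (l, b, \<alpha>, \<sigma>) then co (l, b, \<alpha>, \<sigma>) else 0) * psi \<alpha> (loc l i x))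
            = (\<Sum>i\<in>S (l, b, \<alpha>, \<sigma>). co (l, b, \<alpha>, \<sigma>) * psi \<alpha> (loc l i x))"
            using Sbig(2)[of _ l b \<alpha> \<sigma>] by (intro sum.mono_neutral_cong_right finite_nodes) auto
          then show ?thesis by (simp add: bump_def sum_distrib_left)
        qed
        have "psum k J c x
          = (\<Sum>l=k..J. \<Sum>\<alpha>\<in>boxes k. E l \<alpha> x + (\<Sum>b\<le>Vn. \<Sum>\<sigma>\<in>UNIV. ?g (l, b, \<alpha>, \<sigma>)))"
        proof (intro sum.cong refl)
          fix l and \<alpha> :: "'n => nat" assume l: "l \<in> {k..J}" and \<alpha>: "\<alpha> \<in> boxes k"
          have "(\<Sum>i\<in>nodes l. c l i \<alpha> * psi \<alpha> (loc l i x)) = (\<Sum>i\<in>nodes l. \<rho> l \<alpha> i * psi \<alpha> (loc l i x)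
             + (\<Sum>b\<le>Vn. \<Sum>\<sigma>\<in>UNIV. (if i \<in> S (l, b, \<alpha>, \<sigma>) then co (l, b, \<alpha>, \<sigma>) else 0) * psi \<alpha> (loc l i x)))"
          proof (intro sum.cong refl)
            fix i :: "'n => nat" assume i: "i \<in> nodes l"
            have "k <= l" using l by simp
            from cexp[OF this \<alpha> i] show "c l i \<alpha> * psi \<alpha> (loc l i x) = \<rho> l \<alpha> i * psi \<alpha> (loc l i x)
             + (\<Sum>b\<le>Vn. \<Sum>\<sigma>\<in>UNIV. (if i \<in> S (l, b, \<alpha>, \<sigma>) then co (l, b, \<alpha>, \<sigma>) else 0) * psi \<alpha> (loc l i x))"
              unfolding sum_distrib_right[symmetric] distrib_right[symmetric] by (rule arg_cong)
          qed
          also have "... = E l \<alpha> x + (\<Sum>b\<le>Vn. \<Sum>\<sigma>\<in>UNIV. ?g (l, b, \<alpha>, \<sigma>))"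
            unfolding sum.distrib E_def[symmetric] g[symmetric]
            by (rule arg_cong2[of _ _ _ _ "(+)", OF refl]) (subst sum.swap, intro sum.cong refl sum.swap)
          finally show "(\<Sum>i\<in>nodes l. c l i \<alpha> * psi \<alpha> (loc l i x)) = E l \<alpha> x + (\<Sum>b\<le>Vn. \<Sum>\<sigma>\<in>UNIV. ?g (l, b, \<alpha>, \<sigma>))" .
        qed
        also have "... = (\<Sum>l=k..J. \<Sum>\<alpha>\<in>boxes k. E l \<alpha> x) + (\<Sum>l=k..J. \<Sum>b\<le>Vn. \<Sum>\<alpha>\<in>boxes k. \<Sum>\<sigma>\<in>UNIV. ?g (l, b, \<alpha>, \<sigma>))"
          unfolding sum.distrib by (rule arg_cong2[of _ _ _ _ "(+)", OF refl]) (intro sum.cong refl sum.swap)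
        also have "(\<Sum>l=k..J. \<Sum>b\<le>Vn. \<Sum>\<alpha>\<in>boxes k. \<Sum>\<sigma>\<in>UNIV. ?g (l, b, \<alpha>, \<sigma>)) = (\<Sum>t\<in>?D. ?g t)"
          unfolding sum.cartesian_product' ..
        also have "... = (\<Sum>t\<in>I. ?g t)"
        proof (rule sum.mono_neutral_right)
          show "finite ?D" by (intro finite_cartesian_product) auto
          show "I \<subseteq> ?D" using IB J unfolding I_def by fastforce
          show "\<forall>t\<in>?D - I. ?g t = 0"
          proof
            fix t assume t: "t \<in> ?D - I"
            obtain l b \<alpha> \<sigma> where e: "t = (l, b, \<alpha>, \<sigma>)" by (metis surj_pair)
            have "S t = {}" using t unfolding e I_def by auto
            then show "?g t = 0" by (simp add: bump_def)
          qed
        qed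
        finally show ?thesis by (simp add: add.commute)
      qed
      show "lp_le p (\<lambda>x. f x - (\<Sum>t\<in>I. co t * bump (fst t) (fst (snd (snd t))) (S t) x)) (C * A * R powr (- 2 * s / real CARD('n)))"
      proof (rule lp_le_limit[where h = "\<lambda>J x. \<Sum>l=k..J. \<Sum>\<alpha>\<in>boxes k. E l \<alpha> x" and ?J0.0 = k])
        show "(\<lambda>x. \<Sum>l=k..J. \<Sum>\<alpha>\<in>boxes k. E l \<alpha> x) \<in> borel_measurable borel" for J by measurable
        show "(\<lambda>x. f x - (\<Sum>t\<in>I. co t * bump (fst t) (fst (snd (snd t))) (S t) x)) \<in> borel_measurable borel"
          unfolding bump_def by measurable
        show "lp_le p (\<lambda>x. \<Sum>l=k..J. \<Sum>\<alpha>\<in>boxes k. E l \<alpha> x) (C * A * R powr (- 2 * s / real CARD('n)))" if J: "J \<ge> k" for J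
        proof (rule lp_le_mono)
          have a0: "a l > 0" for l using M A by (simp add: a_def)
          show "lp_le p (\<lambda>x. \<Sum>l=k..J. \<Sum>\<alpha>\<in>boxes k. E l \<alpha> x) (\<Sum>l=k..J. \<Sum>\<alpha>\<in>(boxes k :: 'n idx set). a l)"
          proof (intro lp_le_sum p borel_measurable_sum Em sum_pos a0 Ea)
            show "boxes k \<noteq> ({} :: 'n idx set)" using k by (auto intro: exI[of _ "\<lambda>_. 0"])
            then show "boxes k \<noteq> ({} :: 'n idx set)" .
          qed (use J in auto)
          show "0 <= (\<Sum>l=k..J. \<Sum>\<alpha>\<in>(boxes k :: 'n idx set). a l)" using a0 by (intro sum_nonneg) (auto intro: less_imp_le)
          have "(\<Sum>l=k..J. \<Sum>\<alpha>\<in>(boxes k :: 'n idx set). a l) = K * (M * A * 2 powr (- s * l0)) * (\<Sum>l=k..J. 2 powr (- \<kappa> * \<bar>real l - real l0\<bar>))"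
            by (simp add: a_def K_def sum_distrib_left mult_ac)
          also have "... <= K * (M * A * 2 powr (- s * l0)) * (2 / (1 - 2 powr (- \<kappa>)))"
            using K M A by (intro mult_left_mono sum_geometric_two_sided_le \<kappa>) auto
          also have "... = K * M * (2 / (1 - \<mu>)) * A * 2 powr (- s * l0)" by (simp add: \<mu>_def)
          also have "... <= K * M * (2 / (1 - \<mu>)) * A * (2 powr s * R powr (- 2 * s / real ?d))"
          proof (intro mult_left_mono)
            have "- s * l0 <= s - s * (2 / real ?d * log 2 R)"
              using mult_left_mono[OF l0(2), of s] s by (simp add: distrib_left)
            also have "s * (2 / real ?d * log 2 R) = log 2 R * (2 * s / real ?d)" by simp
            finally have "2 powr (- s * l0) <= 2 powr (s - log 2 R * (2 * s / real ?d))" by simp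
            also have "... = 2 powr s * (2 powr (log 2 R)) powr (- 2 * s / real ?d)"
              unfolding powr_powr by (simp add: powr_add[symmetric])
            also have "2 powr (log 2 R) = R" using R by simp
            finally show "2 powr (- s * l0) <= 2 powr s * R powr (- 2 * s / real ?d)" .
          qed (use K M A \<mu> in auto)
          also have "... = Ce * A * R powr (- 2 * s / real ?d)" by (simp add: Ce_def mult_ac)
          also have "... <= C * A * R powr (- 2 * s / real ?d)" using C(5) A by (intro mult_right_mono) auto
          finally show "(\<Sum>l=k..J. \<Sum>\<alpha>\<in>(boxes k :: 'n idx set). a l) <= C * A * R powr (- 2 * s / real ?d)" .
        qed
        show "1 <= p" by (rule p)
        fix \<delta> :: real assume "\<delta> > 0"
        from clim[OF this] obtain J0 where J0: "\<forall>J\<ge>J0. (\<integral>\<^sup>+x\<in>cube. ennreal \<bar>f x - psum k J c x\<bar> \<partial>lborel) <= ennreal \<delta>" by blast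
        show "\<exists>J. \<forall>j\<ge>J. (\<integral>\<^sup>+x\<in>cube. ennreal \<bar>f x - (\<Sum>t\<in>I. co t * bump (fst t) (fst (snd (snd t))) (S t) x) - (\<Sum>l=k..j. \<Sum>\<alpha>\<in>boxes k. E l \<alpha> x)\<bar> \<partial>lborel) <= ennreal \<delta>"
        proof (intro exI[of _ "max J0 (l0 + Vn)"] allI impI)
          fix j assume j: "j \<ge> max J0 (l0 + Vn)"
          then have j': "j \<ge> l0 + Vn" "j \<ge> J0" by auto
          show "(\<integral>\<^sup>+x\<in>cube. ennreal \<bar>f x - (\<Sum>t\<in>I. co t * bump (fst t) (fst (snd (snd t))) (S t) x) - (\<Sum>l=k..j. \<Sum>\<alpha>\<in>boxes k. E l \<alpha> x)\<bar> \<partial>lborel) <= ennreal \<delta>"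
            using J0[rule_format, OF j'(2)] unfolding split[OF j'(1)] diff_diff_add[symmetric] .
        qed
      qed
    qed
  qed
qed

section \<open>The approximation rate\<close>

subsection \<open>Assembling the network\<close>

lemma log2_le: "x > 0 ==> log 2 x <= 2 * x"
proof -
  assume x: "x > 0"
  have l2: "ln (2::real) \<ge> 1 / 2" using ln2_ge_two_thirds by simp
  have "ln x <= x" using ln_less_self[OF x] by simp
  also have "x <= 2 * x * ln 2" using mult_left_mono[OF l2, of "2 * x"] x by simp
  finally show ?thesis using l2 by (simp add: log_def pos_divide_le_eq)
qed

lemma log2_le_root:
  assumes "x > 0" "n > 0" shows "log 2 x <= 2 * n * x powr (1 / n)"
proof -
  have "log 2 (x powr (1 / n)) <= 2 * x powr (1 / n)" using assms by (intro log2_le) simp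
  then have "n * log 2 (x powr (1 / n)) <= n * (2 * x powr (1 / n))" using assms(2) by (intro mult_left_mono) auto
  then show ?thesis using assms by (simp add: log_powr)
qed

text \<open>The dummy spacing \<open>2 ^ \<beta>\<close> is of order
  \<open>4 ^ d * u powr (- (C + 4))\<close>. Then the dummies are subject to the same bound
  \<open>C * R^2 * u ^ 4\<close> as the elements, while \<open>\<beta>\<close> grows only like
  \<open>log (1 / u)\<close>. No \<open>log R\<close> enters, and this is what keeps the rate free
  of logarithms.\<close>

lemma piece_budget:
  fixes C R u :: real and c l d :: nat
  assumes C: "C \<ge> 1" and u: "0 < u" "u <= 1" and c: "c \<ge> 1" "real c <= C * R\<^sup>2 * u ^ 4"
    and l: "(2 ^ l) ^ d <= C * R\<^sup>2 * u powr (- C)"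
  shows "\<exists>\<beta>. real ((c + (2 ^ (l + 2)) ^ d div 2 ^ \<beta> + 3) * (\<beta> + 3)) <= 5 * C * (2 * d + 4 + 2 * (C + 4)) * R\<^sup>2 * u\<^sup>2"
proof -
  define y where "y = log 2 (1 / u)"
  have y0: "y \<ge> 0" using u by (simp add: y_def)
  have yu: "2 powr y = 1 / u" using u by (simp add: y_def)
  have y2: "y <= 2 * (1 / u)" unfolding y_def using u by (intro log2_le) auto
  define \<beta> where "\<beta> = nat \<lceil>2 * d + (C + 4) * y\<rceil>"
  have \<beta>: "2 * d + (C + 4) * y <= \<beta>" "\<beta> <= 2 * d + (C + 4) * y + 1"
    using C y0 by (auto simp: \<beta>_def intro!: real_nat_ceiling_ge) 
  have p: "2 powr (2 * d + (C + 4) * y) = 4 ^ d * u powr (- (C + 4))"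
  proof -
    have "2 powr (2 * real d) = (2 powr 2) powr real d" by (simp only: powr_powr)
    also have "... = 4 ^ d" by (simp add: powr_realpow)
    finally have 1: "2 powr (2 * real d) = (4 ^ d :: real)" .
    have "2 powr ((C + 4) * y) = (1 / u) powr (C + 4)" unfolding yu[symmetric] powr_powr by (simp add: mult.commute)
    also have "... = u powr (- (C + 4))" using u by (simp only: powr_divide powr_one_eq_one powr_minus_divide)
    finally show ?thesis using 1 by (simp add: powr_add)
  qed
  have q: "real ((2 ^ (l + 2)) ^ d div 2 ^ \<beta>) <= C * R\<^sup>2 * u ^ 4"
  proof -
    have "real ((2 ^ (l + 2)) ^ d div 2 ^ \<beta>) <= real ((2 ^ (l + 2)) ^ d) / real (2 ^ \<beta>)" by (rule of_nat_div_le_of_nat)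
    also have "... = 4 ^ d * (2 ^ l) ^ d / 2 powr \<beta>"
      by (simp add: power_add power_mult_distrib powr_realpow mult.commute)
    also have "... <= 4 ^ d * (C * R\<^sup>2 * u powr (- C)) / 2 powr (2 * d + (C + 4) * y)"
      using l \<beta>(1) by (intro frac_le mult_left_mono mult_nonneg_nonneg powr_mono) (use C in auto)
    also have "... = C * R\<^sup>2 * (u powr (- C) / u powr (- (C + 4)))" unfolding p by simp
    also have "u powr (- C) / u powr (- (C + 4)) = u ^ 4"
      using u by (simp add: powr_diff[symmetric] powr_numeral)
    finally show ?thesis .
  qed
  have X: "C * R\<^sup>2 * u ^ 4 \<ge> 1" using c by linarith
  have f1: "real (c + (2 ^ (l + 2)) ^ d div 2 ^ \<beta> + 3) <= 5 * (C * R\<^sup>2 * u ^ 4)"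
  proof -
    have "real (c + (2 ^ (l + 2)) ^ d div 2 ^ \<beta> + 3) = real c + real ((2 ^ (l + 2)) ^ d div 2 ^ \<beta>) + 3" by (simp only: of_nat_add of_nat_numeral)
    then show ?thesis using q c(2) X by linarith
  qed
  \<comment> \<open>The logarithm is absorbed by one factor \<open>1 / u\<close>; of the fourth
    power of \<open>u\<close> the third remains.\<close>
  have f2: "real (\<beta> + 3) <= (2 * d + 4 + 2 * (C + 4)) * (1 / u)"
  proof -
    have 1: "(C + 4) * y <= (C + 4) * (2 * (1 / u))" using y2 C by (intro mult_left_mono) auto
    have 2: "(2 * real d + 4) * 1 <= (2 * real d + 4) * (1 / u)" using u by (intro mult_left_mono) auto
    have 3: "(2 * real d + 4 + 2 * (C + 4)) * z = (2 * real d + 4) * z + (C + 4) * (2 * z)" for z :: real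
      by (simp add: algebra_simps)
    have "real \<beta> + 3 <= (2 * real d + 4 + 2 * (C + 4)) * (1 / u)" using \<beta>(2) 1 2 unfolding 3 by simp
    then show ?thesis by simp
  qed
  have "real ((c + (2 ^ (l + 2)) ^ d div 2 ^ \<beta> + 3) * (\<beta> + 3)) <= 5 * (C * R\<^sup>2 * u ^ 4) * ((2 * d + 4 + 2 * (C + 4)) * (1 / u))"
    unfolding of_nat_mult by (rule mult_mono[OF f1 f2]) (use X in auto)
  also have "... = 5 * C * (2 * d + 4 + 2 * (C + 4)) * R\<^sup>2 * u ^ 3"
    using u by (simp add: field_simps power_numeral_reduce)
  also have "... <= 5 * C * (2 * d + 4 + 2 * (C + 4)) * R\<^sup>2 * u\<^sup>2"
    using u C by (intro mult_left_mono power_decreasing) auto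
  finally show ?thesis by blast
qed

text \<open>The budget is of order \<open>R^2 u^2\<close>, so resources with \<open>w * D\<close> of
  order \<open>R * u\<close> meet the quadratic capacity condition of
  \<open>bump_net\<close>.\<close>

lemma piece_net:
  fixes S :: "('n::finite) idx set" and C R u :: real
  defines "K \<equiv> 5 * C * (2 * CARD('n) + 4 + 2 * (C + 4))"
  assumes C: "C \<ge> 1" and u: "0 < u" "u <= 1" and S: "S \<subseteq> nodes l" "S \<noteq> {}" "real (card S) <= C * R\<^sup>2 * u ^ 4"
    and l: "(2 ^ l) ^ CARD('n) <= C * R\<^sup>2 * u powr (- C)" and \<alpha>: "\<alpha> \<in> boxes k" and R: "R \<ge> 0"
    and e: "e \<ge> 1" "l + 2 <= e * T" and wD: "w \<ge> 1" "D \<ge> 1" "K * R * u <= real w * real D"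
  shows "\<exists>g. cmp coords (8 ^ CARD('n) * (40 * CARD('n)) * (2 ^ e + w)) (4 * (k + 2) * CARD('n) * (T + D + 1)) {g} \<and>
    (\<forall>x\<in>cube. \<bar>g x - bump l \<alpha> S x\<bar> <= real (8 ^ CARD('n) * CARD('n) * (k + 1)) / ((2 ^ e) ^ T)\<^sup>2)"
proof -
  have "finite S" using finite_subset[OF S(1) finite_nodes] .
  then have "card S \<ge> 1" using S(2) by (simp add: Suc_le_eq card_gt_0_iff)
  from piece_budget[OF C u this S(3) l] obtain \<beta>
    where \<beta>: "real ((card S + (2 ^ (l + 2)) ^ CARD('n) div 2 ^ \<beta> + 3) * (\<beta> + 3)) <= K * R\<^sup>2 * u\<^sup>2"
    unfolding K_def by blast
  have K1: "K \<ge> 1"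
  proof -
    have "1 * 1 <= 5 * C * (2 * CARD('n) + 4 + 2 * (C + 4))" using C by (intro mult_mono) auto
    then show ?thesis by (simp add: K_def)
  qed
  note \<beta>
  also have "K * R\<^sup>2 * u\<^sup>2 <= K * K * (R\<^sup>2 * u\<^sup>2)"
    using mult_right_mono[of "K * 1" "K * K" "R\<^sup>2 * u\<^sup>2"] K1 by (simp add: mult.assoc)
  also have "... = (K * R * u)\<^sup>2" by (simp add: power2_eq_square mult_ac)
  also have "... <= (real w * real D)\<^sup>2" using wD K1 R u by (intro power_mono) auto
  also have "... = real (D * D * (w * w))" by (simp add: power2_eq_square mult_ac)
  finally have "(card S + (2 ^ (l + 2)) ^ CARD('n) div 2 ^ \<beta> + 3) * (\<beta> + 3) <= D * D * (w * w)" by (simp only: of_nat_le_iff)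
  then show ?thesis using \<alpha> S(1) e wD by (intro bump_net) auto
qed

text \<open>Shares proportional to \<open>u\<close> add up to a constant multiple of the available
  width or depth; the obstacle is the overhead for accuracy. With base 2 a piece needs about
  \<open>log R\<close> layers for it, together \<open>(log R)^3\<close> layers in series. If
  \<open>L\<close> is too small for that, \<open>log R\<close> is comparable to
  \<open>log W\<close>, and a base \<open>2 ^ e\<close> of at most \<open>sqrt W\<close> needs a
  bounded number of layers, at the price of \<open>sqrt W\<close> neurons for each of
  \<open>(log R)^2\<close> pieces in parallel.\<close>

lemma assembly:
  fixes C a :: real and k :: nat
  assumes C: "C \<ge> 1" and a: "a \<ge> 0"
  shows "\<exists>K\<ge>1. \<forall>W L. W \<ge> K --> L \<ge> K --> (\<forall>(I :: 'i set) l \<alpha> (S :: 'i => ('n::finite) idx set) co u A. finite I --> A > 0 -->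
    (\<forall>t\<in>I. admissible k C A (real (W * L)) l \<alpha> S co u t) -->
    (\<Sum>t\<in>I. u t) <= C --> real (card I) <= C * (log 2 (real (W * L)))\<^sup>2 -->
    (\<exists>g. cmp coords (K * W) (K * L) {g} \<and>
      (\<forall>x\<in>cube. \<bar>(\<Sum>t\<in>I. co t * bump (l t) (\<alpha> t) (S t) x) - g x\<bar> <= A * real (W * L) powr (- a))))"
proof -
  let ?d = "CARD('n)"
  define c1 where "c1 = 8 ^ ?d * (40 * ?d)"
  define c2 where "c2 = 4 * (k + 2) * ?d"
  define c3 where "c3 = real (8 ^ ?d * ?d * (k + 1))"
  have c3: "c3 \<ge> 1"
  proof -
    have "1 * 1 * 1 <= 8 ^ ?d * ?d * (k + 1)" by (intro mult_le_mono) (auto simp: Suc_leI)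
    then have "real 1 <= real (8 ^ ?d * ?d * (k + 1))" by (simp only: of_nat_le_iff mult_1)
    then show ?thesis by (simp add: c3_def)
  qed
  define K2 where "K2 = 5 * C * (2 * ?d + 4 + 2 * (C + 4))"
  have K2: "K2 > 0" using C by (simp add: K2_def add_pos_nonneg)
  define Z where "Z = C * C * c3 * C powr (1 + C / 4)"
  have Z: "Z \<ge> 1"
  proof -
    have "1 * 1 * 1 * 1 <= C * C * c3 * C powr (1 + C / 4)"
      using C c3 by (intro mult_mono ge_one_powr_ge_zero mult_nonneg_nonneg) auto
    then show ?thesis by (simp add: Z_def)
  qed
  \<comment> \<open>Networks are accurate to order \<open>R powr (- 2 * K3)\<close>. This has to
    beat the polynomial bounds for coefficients and number of pieces and still leave
    \<open>R powr (- a)\<close>; the second summand makes \<open>K3 * log 2 R\<close> bound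
    \<open>l t + 2\<close> as well.\<close>
  define K3 where "K3 = (a + 5 + C / 2 + log 2 Z) / 2 + (1 + C / 4) * (log 2 C + 2) + 2"
  have K3: "K3 \<ge> 0" "(1 + C / 4) * (log 2 C + 2) + 2 <= K3" "5 + C / 2 + log 2 Z - 2 * K3 <= - a"
  proof -
    have "(1 + C / 4) * (log 2 C + 2) \<ge> 0" "(a + 5 + C / 2 + log 2 Z) / 2 \<ge> 0" using C Z a by auto
    then show "K3 \<ge> 0" "(1 + C / 4) * (log 2 C + 2) + 2 <= K3" unfolding K3_def by linarith+
    have "2 * K3 = a + 5 + C / 2 + log 2 Z + 2 * ((1 + C / 4) * (log 2 C + 2)) + 4" unfolding K3_def by (simp add: field_simps)
    then show "5 + C / 2 + log 2 Z - 2 * K3 <= - a" using \<open>(1 + C / 4) * (log 2 C + 2) \<ge> 0\<close> by linarith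
  qed
  \<comment> \<open>Constants for width and depth: \<open>X1\<close> and \<open>X2\<close> in
    series, \<open>X3\<close> and \<open>X4\<close> in parallel.\<close>
  define X1 where "X1 = real (3 * c1 + 2 * ?d + 2)"
  define X2 where "X2 = c2 * (C * (K3 + 3) * 868 + K2 * C)"
  define X3 where "X3 = c1 * (6272 * C + K2 * C)"
  define X4 where "X4 = c2 * (28 * K3 + 3)"
  have X0: "X1 \<ge> 0" "X2 \<ge> 0" "X3 \<ge> 0" "X4 \<ge> 0" using C K3 K2 by (auto simp: X1_def X2_def X3_def X4_def)
  define K where "K = nat \<lceil>X1 + X2 + X3 + X4 + 4\<rceil>"
  have "X1 + X2 + X3 + X4 + 4 <= K" unfolding K_def by (rule real_nat_ceiling_ge)
  then have K: "X1 <= K" "X2 <= K" "X3 <= K" "X4 <= K" "4 <= real K" using X0 by linarith+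
  have K4: "K \<ge> 4" using K(5) by simp
  show ?thesis
  proof (intro exI[of _ K] conjI allI impI)
    show "K \<ge> 1" using K4 by simp
    fix W L :: nat and I :: "'i set" and l :: "'i => nat" and \<alpha> :: "'i => 'n => nat" and S :: "'i => 'n idx set" and co u :: "'i => real" and A :: real
    assume W: "W \<ge> K" and L: "L \<ge> K" and finI: "finite I" and A: "A > 0"
      and pieces: "\<forall>t\<in>I. admissible k C A (real (W * L)) l \<alpha> S co u t"
      and sumu: "(\<Sum>t\<in>I. u t) <= C" and cardI: "real (card I) <= C * (log 2 (real (W * L)))\<^sup>2"
    define R where "R = real (W * L)"
    have W4: "real W \<ge> 4" and L4: "real L \<ge> 4" using W L K4 by linarith+
    have RWL: "R = real W * real L" by (simp add: R_def)
    have R: "R \<ge> 4" using mult_mono[of 4 "real W" 1 "real L"] W4 L4 by (simp add: RWL)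
    have lR: "log 2 R \<ge> 1" using R by simp
    have CR: "C * R\<^sup>2 \<ge> 1" using mult_mono[of 1 C 1 "R\<^sup>2"] C R by (simp add: one_le_power)
    \<comment> \<open>A piece is nonempty, so \<open>C * R^2 * u ^ 4\<close> is at least 1. This
      bounds \<open>u\<close> from below and turns the bound on the level into a power of
      \<open>R\<close>.\<close>
    have size: "(2 ^ l t) ^ ?d <= (C * R\<^sup>2) powr (1 + C / 4)" if t: "t \<in> I" for t
    proof -
      have u: "0 < u t" using pieces t by blast
      have "finite (S t)" "S t \<noteq> {}" using pieces t finite_subset[OF _ finite_nodes] by blast+
      then have "1 <= card (S t)" by (simp add: Suc_le_eq card_gt_0_iff)
      then have "1 <= real (card (S t))" by simp
      also have "... <= C * R\<^sup>2 * u t ^ 4" using pieces t by (simp add: R_def)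
      finally have "(C * R\<^sup>2 * u t ^ 4) powr (C / 4) \<ge> 1" using C by (intro ge_one_powr_ge_zero) auto
      then have "1 <= (C * R\<^sup>2) powr (C / 4) * u t powr C" using u by (simp add: powr_mult powr_powr flip: powr_numeral)
      then have "1 * u t powr (- C) <= (C * R\<^sup>2) powr (C / 4) * u t powr C * u t powr (- C)" by (intro mult_right_mono) auto
      also have "... = (C * R\<^sup>2) powr (C / 4)" using u by (simp add: mult.assoc flip: powr_add)
      finally have "u t powr (- C) <= (C * R\<^sup>2) powr (C / 4)" by simp
      then have "C * R\<^sup>2 * u t powr (- C) <= C * R\<^sup>2 * (C * R\<^sup>2) powr (C / 4)" using C by (intro mult_left_mono) auto
      also have "... = (C * R\<^sup>2) powr (1 + C / 4)" using CR by (simp add: powr_add)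
      finally show ?thesis using pieces t by (force simp: R_def)
    qed
    have lsize: "real (l t + 2) <= K3 * log 2 R" if t: "t \<in> I" for t
    proof -
      have "(2::real) ^ l t <= (2 ^ l t) ^ ?d" using power_increasing[of 1 ?d "(2::real) ^ l t"] by (simp add: Suc_leI)
      also note size[OF t]
      finally have "log 2 (2 ^ l t) <= log 2 ((C * R\<^sup>2) powr (1 + C / 4))" by (subst log_le_cancel_iff) (use CR in auto)
      then have "real (l t) <= (1 + C / 4) * log 2 (C * R\<^sup>2)" using CR by (simp add: log_powr)
      also have "log 2 (C * R\<^sup>2) = log 2 C + 2 * log 2 R" using C R by (simp add: log_mult log_nat_power)
      also have "(1 + C / 4) * (log 2 C + 2 * log 2 R) <= (1 + C / 4) * ((log 2 C + 2) * log 2 R)"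
        using C lR mult_left_mono[of 1 "log 2 R" "log 2 C"] by (intro mult_left_mono) (auto simp: distrib_right)
      finally have "real (l t + 2) <= ((1 + C / 4) * (log 2 C + 2) + 2) * log 2 R" using lR by (simp add: distrib_right mult.assoc)
      also have "... <= K3 * log 2 R" using K3(2) lR by (intro mult_right_mono) auto
      finally show ?thesis .
    qed
    have net: "\<exists>g. cmp coords (c1 * (2 ^ e + w)) (c2 * (T + D + 1)) {g} \<and> (\<forall>x\<in>cube. \<bar>g x - bump (l t) (\<alpha> t) (S t) x\<bar> <= c3 * R powr (- 2 * K3))"
      if t: "t \<in> I" and e: "e \<ge> 1" "K3 * log 2 R <= real e * real T" and wD: "w \<ge> 1" "D \<ge> 1" "K2 * R * u t <= real w * real D" for t e T w D
    proof -
      have "real (l t + 2) <= real (e * T)" using lsize[OF t] e(2) by simp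
      then have eT: "l t + 2 <= e * T" by (simp only: of_nat_le_iff)
      have "\<exists>g. cmp coords (8 ^ CARD('n) * (40 * CARD('n)) * (2 ^ e + w)) (4 * (k + 2) * CARD('n) * (T + D + 1)) {g} \<and>
        (\<forall>x\<in>cube. \<bar>g x - bump (l t) (\<alpha> t) (S t) x\<bar> <= real (8 ^ CARD('n) * CARD('n) * (k + 1)) / ((2 ^ e) ^ T)\<^sup>2)"
        using pieces t R wD(3) by (intro piece_net[OF C, of "u t" _ _ R] e(1) eT wD(1,2)) (auto simp: R_def K2_def)
      then obtain g where g: "cmp coords (c1 * (2 ^ e + w)) (c2 * (T + D + 1)) {g}"
        "\<And>x. x \<in> cube ==> \<bar>g x - bump (l t) (\<alpha> t) (S t) x\<bar> <= c3 / ((2 ^ e) ^ T)\<^sup>2"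
        unfolding c1_def c2_def c3_def by blast
      have "R powr K3 = (2 powr (log 2 R)) powr K3" using R by simp
      also have "... <= 2 powr (real e * real T)" unfolding powr_powr using e(2) by (intro powr_mono) (auto simp: mult.commute)
      also have "... = (2 ^ e) ^ T" by (simp add: powr_powr[symmetric] powr_realpow)
      finally have "(R powr K3)\<^sup>2 <= (((2 ^ e) ^ T)\<^sup>2 :: real)" by (intro power_mono) auto
      then have "c3 / ((2 ^ e) ^ T)\<^sup>2 <= c3 / (R powr K3)\<^sup>2" using c3 R by (intro divide_left_mono) auto
      also have "(R powr K3)\<^sup>2 = R powr (2 * K3)" using R by (simp add: powr_powr mult.commute flip: powr_numeral)
      also have "c3 / R powr (2 * K3) = c3 * R powr (- 2 * K3)" by (simp add: powr_minus divide_inverse)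
      finally show ?thesis using g by (intro exI[of _ g]) fastforce
    qed
    have total: "\<bar>(\<Sum>t\<in>I. co t * bump (l t) (\<alpha> t) (S t) x) - (\<Sum>t\<in>I. co t * g t x)\<bar> <= A * real (W * L) powr (- a)"
      if g: "\<And>t. t \<in> I ==> \<bar>g t x - bump (l t) (\<alpha> t) (S t) x\<bar> <= c3 * R powr (- 2 * K3)" for g x
    proof -
      have "\<bar>(\<Sum>t\<in>I. co t * bump (l t) (\<alpha> t) (S t) x) - (\<Sum>t\<in>I. co t * g t x)\<bar> = \<bar>\<Sum>t\<in>I. co t * (bump (l t) (\<alpha> t) (S t) x - g t x)\<bar>"
        by (simp add: sum_subtractf right_diff_distrib)
      also have "... <= (\<Sum>t\<in>I. \<bar>co t * (bump (l t) (\<alpha> t) (S t) x - g t x)\<bar>)" by (rule sum_abs)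
      also have "... <= (\<Sum>t\<in>I. (C * A * (C * R\<^sup>2) powr (1 + C / 4)) * (c3 * R powr (- 2 * K3)))"
      proof (rule sum_mono)
        fix t assume t: "t \<in> I"
        have "\<bar>co t\<bar> <= C * A * (2 ^ l t) ^ ?d" using pieces t by blast
        also have "... <= C * A * (C * R\<^sup>2) powr (1 + C / 4)" using size[OF t] C A by (intro mult_left_mono) auto
        finally show "\<bar>co t * (bump (l t) (\<alpha> t) (S t) x - g t x)\<bar> <= (C * A * (C * R\<^sup>2) powr (1 + C / 4)) * (c3 * R powr (- 2 * K3))"
          unfolding abs_mult using g[OF t] C A by (intro mult_mono) (auto simp: abs_minus_commute)
      qed
      also have "... = real (card I) * (C * A * (C * R\<^sup>2) powr (1 + C / 4) * (c3 * R powr (- 2 * K3)))" by simp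
      also have "... <= (C * (4 * R\<^sup>2)) * (C * A * (C * R\<^sup>2) powr (1 + C / 4) * (c3 * R powr (- 2 * K3))) "
      proof (rule mult_right_mono)
        have "(log 2 R)\<^sup>2 <= (2 * R)\<^sup>2" using lR R by (intro power_mono log2_le) auto
        then have "C * (log 2 R)\<^sup>2 <= C * (2 * R)\<^sup>2" using C by (intro mult_left_mono) auto
        then show "real (card I) <= C * (4 * R\<^sup>2)" using cardI by (simp add: R_def power_mult_distrib)
        show "0 <= C * A * (C * R\<^sup>2) powr (1 + C / 4) * (c3 * R powr (- 2 * K3))" using C A c3 by auto
      qed
      also have "... = A * Z * (4 * (R\<^sup>2 * (R\<^sup>2) powr (1 + C / 4) * R powr (- 2 * K3)))"
        by (simp add: Z_def powr_mult mult_ac)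
      also have "R\<^sup>2 * (R\<^sup>2) powr (1 + C / 4) * R powr (- 2 * K3) = R powr (4 + C / 2 - 2 * K3)"
        using R by (simp add: powr_powr powr_add[symmetric] algebra_simps flip: powr_numeral)
      also have "A * Z * (4 * R powr (4 + C / 2 - 2 * K3)) <= A * R powr (log 2 Z) * (R powr 1 * R powr (4 + C / 2 - 2 * K3))"
      proof (intro mult_mono mult_nonneg_nonneg)
        have "Z = 2 powr (log 2 Z)" using Z by simp
        also have "... <= R powr (log 2 Z)" using Z R by (intro powr_mono2) auto
        finally show "Z <= R powr (log 2 Z)" .
      qed (use A R Z in auto)
      also have "... = A * R powr (log 2 Z + (1 + (4 + C / 2 - 2 * K3)))" by (simp only: powr_add mult.assoc)
      also have "... <= A * R powr (- a)" using A R K3(3) by (intro mult_left_mono powr_mono) auto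
      finally show ?thesis by (simp add: R_def)
    qed
    have ccard: "card (coords :: (real^'n => real) set) <= ?d" by (rule card_image_le) simp
    have finish: "\<exists>g. cmp coords (K * W) (K * L) {g} \<and> (\<forall>x\<in>cube. \<bar>(\<Sum>t\<in>I. co t * bump (l t) (\<alpha> t) (S t) x) - g x\<bar> <= A * real (W * L) powr (- a))"
      if c: "cmp coords w D {\<lambda>x. \<Sum>t\<in>I. co t * g t x}" and wD: "real w <= real K * W" "real D <= real K * L"
        and g: "\<And>t x. t \<in> I ==> x \<in> cube ==> \<bar>g t x - bump (l t) (\<alpha> t) (S t) x\<bar> <= c3 * R powr (- 2 * K3)" for w D g
    proof -
      have "real w <= real (K * W)" "real D <= real (K * L)" using wD by simp_all
      then have wD': "w <= K * W" "D <= K * L" by (simp_all only: of_nat_le_iff)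
      have "4 * 1 <= K * W" using K4 W by (intro mult_le_mono) auto
      then have "cmp coords (K * W) (K * L) {\<lambda>x. \<Sum>t\<in>I. co t * g t x}"
        using wD' by (intro cmp_mono[OF cmp_pad[OF c]]) auto
      then show ?thesis
      proof (intro exI[of _ "\<lambda>x. \<Sum>t\<in>I. co t * g t x"] conjI ballI)
        fix x :: "real^'n" assume x: "x \<in> cube"
        show "\<bar>(\<Sum>t\<in>I. co t * bump (l t) (\<alpha> t) (S t) x) - (\<Sum>t\<in>I. co t * g t x)\<bar> <= A * real (W * L) powr (- a)"
          by (rule total) (rule g[OF _ x])
      qed
    qed
    show "\<exists>g. cmp coords (K * W) (K * L) {g} \<and> (\<forall>x\<in>cube. \<bar>(\<Sum>t\<in>I. co t * bump (l t) (\<alpha> t) (S t) x) - g x\<bar> <= A * real (W * L) powr (- a))"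
    proof (cases "(log 2 W) ^ 3 <= L")
      case True
      define T where "T = nat \<lceil>K3 * log 2 R\<rceil>"
      have T: "K3 * log 2 R <= T" "T <= K3 * log 2 R + 1" using K3 lR by (auto simp: T_def intro!: real_nat_ceiling_ge)
      \<comment> \<open>In series each piece uses the full width and a share of the depth
        proportional to its cost.\<close>
      define D where "D t = nat \<lceil>K2 * L * u t\<rceil>" for t
      have D: "K2 * L * u t <= D t" "D t <= K2 * L * u t + 1" "D t \<ge> 1" if "t \<in> I" for t
      proof -
        have u: "0 < u t" using pieces that by blast
        then have p: "K2 * L * u t > 0" using K2 L4 by (intro mult_pos_pos) auto
        then show "K2 * L * u t <= D t" "D t <= K2 * L * u t + 1" by (auto simp: D_def intro!: real_nat_ceiling_ge)
        then show "D t \<ge> 1" using p by linarith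
      qed
      have "\<exists>g. cmp coords (c1 * (2 ^ 1 + W)) (c2 * (T + D t + 1)) {g} \<and> (\<forall>x\<in>cube. \<bar>g x - bump (l t) (\<alpha> t) (S t) x\<bar> <= c3 * R powr (- 2 * K3))" if t: "t \<in> I" for t
      proof (rule net[OF t])
        have "real W * (K2 * L * u t) <= real W * real (D t)" using D(1)[OF t] by (intro mult_left_mono) auto
        then show "K2 * R * u t <= real W * real (D t)" by (simp add: RWL mult_ac)
      qed (use T D[OF t] W K4 in auto)
      then obtain g where g: "\<And>t. t \<in> I ==> cmp coords (c1 * (2 ^ 1 + W)) (c2 * (T + D t + 1)) {g t}"
        "\<And>t x. t \<in> I ==> x \<in> cube ==> \<bar>g t x - bump (l t) (\<alpha> t) (S t) x\<bar> <= c3 * R powr (- 2 * K3)" by metis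
      obtain h where h: "bij_betw h {0..<card I} I" using ex_bij_betw_nat_finite[OF finI] by blast
      have hI: "h j \<in> I" if "j < card I" for j using h that by (auto simp: bij_betw_def)
      have "cmp coords (c1 * (2 ^ 1 + W)) (c2 * (T + D (h j) + 1)) {\<lambda>x. co (h j) * g (h j) x}" if "j < card I" for j
        by (rule cmp_affs[OF g(1)[OF hI[OF that]]]) (auto intro!: affs_cmul affs_gen)
      then have "cmp coords (c1 * (2 ^ 1 + W) + 2 * card (coords :: (real^'n => real) set) + 2) (\<Sum>j<card I. c2 * (T + D (h j) + 1))
        (insert (\<lambda>x. \<Sum>j<card I. co (h j) * g (h j) x) coords)"
        by (intro cmp_serial_sum[where w = "\<lambda>_. c1 * (2 ^ 1 + W)"]) auto
      then have c: "cmp coords (c1 * (2 ^ 1 + W) + 2 * card (coords :: (real^'n => real) set) + 2) (\<Sum>j<card I. c2 * (T + D (h j) + 1)) {\<lambda>x. \<Sum>j<card I. co (h j) * g (h j) x}"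
        by (rule cmp_mono) auto
      have re: "(\<Sum>j<card I. F (h j)) = (\<Sum>t\<in>I. F t)" for F :: "'i => real"
        using sum.reindex_bij_betw[OF h, of F] by (simp add: atLeast0LessThan)
      have "(\<lambda>x. \<Sum>j<card I. co (h j) * g (h j) x) = (\<lambda>x. \<Sum>t\<in>I. co t * g t x)" by (rule ext) (rule re)
      note c = c[unfolded this]
      show ?thesis
      proof (rule finish[OF c _ _ g(2)])
        have "real (c1 * (2 ^ 1 + W) + 2 * card (coords :: (real^'n => real) set) + 2) <= c1 * (2 + real W) + 2 * ?d + 2"
          using ccard by (simp add: distrib_left)
        also have "... <= real c1 * (3 * real W) + (2 * real ?d + 2) * real W"
        proof -
          have "real c1 * (2 + real W) <= real c1 * (3 * real W)" using W4 by (intro mult_left_mono) auto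
          moreover have "(2 * real ?d + 2) * 1 <= (2 * real ?d + 2) * real W" using W4 by (intro mult_left_mono) auto
          ultimately show ?thesis unfolding mult_1_right by linarith
        qed
        also have "... = X1 * W" by (simp add: X1_def algebra_simps)
        also have "... <= real K * W" using K(1) by (intro mult_right_mono) auto
        finally show "real (c1 * (2 ^ 1 + W) + 2 * card (coords :: (real^'n => real) set) + 2) <= real K * W" .
        \<comment> \<open>By convexity \<open>(log R)^3\<close> is at most 4 times
          \<open>(log W)^3 + (log L)^3\<close>; the first term is at most \<open>L\<close> in this
          case and the second at most \<open>216 * L\<close>, and 868 is 4 times 217.\<close>
        have lR3: "(log 2 R) ^ 3 <= 868 * L"
        proof -
          have lL: "log 2 L \<ge> 0" "log 2 W \<ge> 0" using L4 W4 by auto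
          have "log 2 L <= 2 * 3 * L powr (1 / 3)" using L4 by (intro log2_le_root) auto
          then have "(log 2 L) ^ 3 <= (6 * L powr (1 / 3)) ^ 3" using lL by (intro power_mono) auto
          also have "... = 216 * L" using L4 by (simp add: power_mult_distrib powr_powr flip: powr_realpow)
          finally have l3: "(log 2 L) ^ 3 <= 216 * L" .
          have cub: "(x + y) ^ 3 <= 4 * (x ^ 3 + y ^ 3)" if "x \<ge> 0" "y \<ge> 0" for x y :: real
          proof -
            have "4 * (x ^ 3 + y ^ 3) - (x + y) ^ 3 = 3 * (x + y) * (x - y)\<^sup>2" by (simp add: power2_eq_square power3_eq_cube algebra_simps)
            moreover have "... \<ge> 0" using that by simp
            ultimately show ?thesis by linarith
          qed
          have "log 2 R = log 2 W + log 2 L" using W4 L4 by (simp add: RWL log_mult)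
          then show ?thesis using cub[OF lL(2,1)] l3 True by simp
        qed
        have "real (\<Sum>j<card I. c2 * (T + D (h j) + 1)) = (\<Sum>t\<in>I. real (c2 * (T + D t + 1)))"
          unfolding of_nat_sum by (rule re)
        also have "... <= (\<Sum>t\<in>I. c2 * ((K3 + 3) * log 2 R + K2 * L * u t))"
        proof (rule sum_mono)
          fix t assume "t \<in> I"
          then have "real (T + D t + 1) <= (K3 + 3) * log 2 R + K2 * L * u t"
            using D(2)[of t] T(2) lR by (simp add: distrib_right)
          then show "real (c2 * (T + D t + 1)) <= c2 * ((K3 + 3) * log 2 R + K2 * L * u t)"
            unfolding of_nat_mult by (rule mult_left_mono) simp
        qed
        also have "... = c2 * (card I * ((K3 + 3) * log 2 R) + K2 * L * (\<Sum>t\<in>I. u t))"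
          by (simp add: sum.distrib sum_distrib_left algebra_simps)
        also have "... <= c2 * (C * (log 2 R)\<^sup>2 * ((K3 + 3) * log 2 R) + K2 * L * C)"
          using cardI sumu K3 K2 lR by (intro mult_left_mono add_mono mult_right_mono) (auto simp: R_def)
        also have "... = c2 * (C * (K3 + 3) * (log 2 R) ^ 3 + K2 * C * L)" by (simp add: power2_eq_square power3_eq_cube mult_ac)
        also have "... <= c2 * (C * (K3 + 3) * (868 * L) + K2 * C * L)"
          using lR3 C K3(1) K2 by (intro mult_left_mono add_mono) auto
        also have "... = X2 * L" by (simp add: X2_def algebra_simps)
        also have "... <= real K * L" using K(2) by (intro mult_right_mono) auto
        finally show "real (\<Sum>j<card I. c2 * (T + D (h j) + 1)) <= real K * L" .
      qed
    next
      case False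
      have lW: "log 2 W \<ge> 2" using W4 le_log_iff[of 2 W 2] by simp
      \<comment> \<open>Here \<open>L\<close> is below \<open>(log W)^3\<close>, so
        \<open>log L\<close> is at most \<open>3 * log (log W)\<close>, hence at most
        \<open>6 * log W\<close>.\<close>
      have lRW: "log 2 R <= 7 * log 2 W"
      proof -
        have "log 2 L <= log 2 ((log 2 W) ^ 3)" using False L4 lW by (subst log_le_cancel_iff) auto
        also have "... = 3 * log 2 (log 2 W)" using lW by (simp add: log_nat_power)
        also have "... <= 3 * (2 * log 2 W)" using lW by (intro mult_left_mono log2_le) auto
        finally show ?thesis using W4 L4 by (simp add: RWL log_mult)
      qed
      \<comment> \<open>The base \<open>2 ^ e\<close> stays below \<open>sqrt W\<close>, while
        \<open>e\<close> is at least a quarter of \<open>log W\<close>. With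
        \<open>log R <= 7 * log W\<close>, a number of \<open>28 * K3\<close> layers yields the
        exponent \<open>K3 * log R\<close>.\<close>
      define e where "e = nat \<lfloor>log 2 W / 2\<rfloor>"
      have e: "e \<ge> 1" "log 2 W / 4 <= e" "e <= log 2 W / 2"
      proof -
        have "real e = of_int \<lfloor>log 2 W / 2\<rfloor>" using lW by (simp add: e_def)
        moreover have "\<lfloor>log 2 W / 2\<rfloor> \<ge> 1" using lW by (simp add: le_floor_iff)
        ultimately show "log 2 W / 4 <= e" "e <= log 2 W / 2" "e \<ge> 1" by linarith+
      qed
      have e2: "2 ^ e <= sqrt W"
      proof -
        have "(2::real) ^ e = 2 powr e" by (simp add: powr_realpow)
        also have "... <= 2 powr (log 2 W / 2)" using e by (intro powr_mono) auto
        also have "... = (2 powr (log 2 W)) powr (1 / 2)" unfolding powr_powr by simp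
        also have "... = sqrt W" using W4 by (simp add: powr_half_sqrt)
        finally show ?thesis .
      qed
      define T where "T = nat \<lceil>28 * K3\<rceil>"
      have T: "28 * K3 <= T" "T <= 28 * K3 + 1" using K3 by (auto simp: T_def intro!: real_nat_ceiling_ge)
      have eT: "K3 * log 2 R <= real e * real T"
      proof -
        have "K3 * log 2 R <= K3 * (7 * log 2 W)" using lRW K3 by (intro mult_left_mono) auto
        also have "... = log 2 W / 4 * (28 * K3)" by simp
        also have "... <= real e * real T" using e T lW K3 by (intro mult_mono) auto
        finally show ?thesis .
      qed
      \<comment> \<open>In parallel each piece uses the full depth and a share of the width
        proportional to its cost.\<close>
      define w where "w t = nat \<lceil>K2 * W * u t\<rceil>" for t
      have w: "K2 * W * u t <= w t" "w t <= K2 * W * u t + 1" "w t \<ge> 1" if "t \<in> I" for t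
      proof -
        have u: "0 < u t" using pieces that by blast
        then have p: "K2 * W * u t > 0" using K2 W4 by (intro mult_pos_pos) auto
        then show "K2 * W * u t <= w t" "w t <= K2 * W * u t + 1" by (auto simp: w_def intro!: real_nat_ceiling_ge)
        then show "w t \<ge> 1" using p by linarith
      qed
      have "\<exists>g. cmp coords (c1 * (2 ^ e + w t)) (c2 * (T + L + 1)) {g} \<and> (\<forall>x\<in>cube. \<bar>g x - bump (l t) (\<alpha> t) (S t) x\<bar> <= c3 * R powr (- 2 * K3))" if t: "t \<in> I" for t
      proof (rule net[OF t e(1) eT w(3)[OF t]])
        have "(K2 * W * u t) * real L <= real (w t) * real L" using w(1)[OF t] by (intro mult_right_mono) auto
        then show "K2 * R * u t <= real (w t) * real L" by (simp add: RWL mult_ac)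
      qed (use L K4 in auto)
      then obtain g where g: "\<And>t. t \<in> I ==> cmp coords (c1 * (2 ^ e + w t)) (c2 * (T + L + 1)) {g t}"
        "\<And>t x. t \<in> I ==> x \<in> cube ==> \<bar>g t x - bump (l t) (\<alpha> t) (S t) x\<bar> <= c3 * R powr (- 2 * K3)" by metis
      have "cmp coords (\<Sum>t\<in>I. c1 * (2 ^ e + w t)) (c2 * (T + L + 1)) (\<Union>t\<in>I. {g t})"
        by (rule cmp_parallel_family[OF finI _ g(1)]) auto
      then have c: "cmp coords (\<Sum>t\<in>I. c1 * (2 ^ e + w t)) (c2 * (T + L + 1)) {\<lambda>x. \<Sum>t\<in>I. co t * g t x}"
        by (rule cmp_affs) (use finI in \<open>auto intro!: affs_sum affs_cmul affs_gen\<close>)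
      show ?thesis
      proof (rule finish[OF c _ _ g(2)])
        \<comment> \<open>\<open>(log W)^2\<close> is at most a multiple of \<open>sqrt W\<close>,
          so the pieces times their base width of order \<open>sqrt W\<close> stay of order
          \<open>W\<close>; 3136 is the square of 56.\<close>
        have cI: "real (card I) <= 3136 * C * sqrt W"
        proof -
          have "log 2 W <= 2 * 4 * W powr (1 / 4)" using W4 by (intro log2_le_root) auto
          then have "log 2 R <= 56 * W powr (1 / 4)" using lRW by simp
          then have "(log 2 R)\<^sup>2 <= (56 * W powr (1 / 4))\<^sup>2" using lR by (intro power_mono) auto
          also have "... = 3136 * sqrt W" using W4 by (simp add: power_mult_distrib powr_powr powr_half_sqrt[symmetric] flip: powr_realpow)
          finally have "C * (log 2 R)\<^sup>2 <= C * (3136 * sqrt W)" using C by (intro mult_left_mono) auto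
          then show ?thesis using cardI by (simp add: R_def)
        qed
        have sW: "sqrt W \<ge> 1" "sqrt W * sqrt W = W" using W4 by auto
        have "real (\<Sum>t\<in>I. c1 * (2 ^ e + w t)) <= (\<Sum>t\<in>I. c1 * (2 * sqrt W + K2 * W * u t))"
          unfolding of_nat_sum
        proof (rule sum_mono)
          fix t assume t: "t \<in> I"
          have "2 ^ e + real (w t) <= 2 * sqrt W + K2 * W * u t" using w(2)[OF t] e2 sW(1) by linarith
          then have "c1 * (2 ^ e + real (w t)) <= c1 * (2 * sqrt W + K2 * W * u t)" by (intro mult_left_mono) auto
          then show "real (c1 * (2 ^ e + w t)) <= c1 * (2 * sqrt W + K2 * W * u t)" by simp
        qed
        also have "... = c1 * (card I * (2 * sqrt W) + K2 * W * (\<Sum>t\<in>I. u t))"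
          by (simp add: sum.distrib sum_distrib_left algebra_simps)
        also have "... <= c1 * (3136 * C * sqrt W * (2 * sqrt W) + K2 * W * C)"
          using cI sumu K2 sW by (intro mult_left_mono add_mono mult_right_mono) auto
        also have "... = c1 * (6272 * C * (sqrt W * sqrt W) + K2 * C * W)" by (simp add: mult_ac)
        also have "... = X3 * W" unfolding sW by (simp add: X3_def algebra_simps)
        also have "... <= real K * W" using K(3) by (intro mult_right_mono) auto
        finally show "real (\<Sum>t\<in>I. c1 * (2 ^ e + w t)) <= real K * W" .
        have "real (c2 * (T + L + 1)) <= c2 * ((28 * K3 + 2) + L)" using T(2) by (simp only: of_nat_mult of_nat_add of_nat_1) (intro mult_left_mono, auto)
        also have "... <= c2 * ((28 * K3 + 3) * L)"
        proof (rule mult_left_mono)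
          have "(28 * K3 + 2) * 1 <= (28 * K3 + 2) * L" using L4 K3 by (intro mult_left_mono) auto
          then show "(28 * K3 + 2) + L <= (28 * K3 + 3) * L" by (simp add: algebra_simps)
        qed simp
        also have "... = X4 * L" by (simp add: X4_def)
        also have "... <= real K * L" using K(4) by (intro mult_right_mono) auto
        finally show "real (c2 * (T + L + 1)) <= real K * L" .
      qed
    qed
  qed
qed

subsection \<open>Consequences of a Besov bound\<close>

lemma epow_mono: "x <= y ==> a \<ge> 0 ==> epow x a <= epow y a"
  by (auto simp: epow_def top_unique less_top intro!: ennreal_leI powr_mono2 enn2real_mono)

lemma epow_le_cancel:
  assumes le: "epow x a <= ennreal (A powr a)" and a: "a > 0" and A: "A \<ge> 0"
  shows "x <= ennreal A"
proof -
  have fin: "x \<noteq> \<infinity>" using le by (auto simp: epow_def top_unique)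
  then have "enn2real x powr a <= A powr a" using le by (simp add: epow_def ennreal_le_iff)
  then have "enn2real x <= A" using powr_less_mono2[OF a A, of "enn2real x"] by (meson not_le)
  then have "ennreal (enn2real x) <= ennreal A" by (rule ennreal_leI)
  then show ?thesis using fin by (simp add: less_top)
qed

text \<open>For \<open>t > norm h\<close> the modulus dominates the difference with step
  \<open>h\<close>. Integrating only over \<open>norm h < t <= 2 * norm h\<close>, where
  \<open>1 / t\<close> has mass at least 1/2, recovers a bound for this one difference. The weight
  at \<open>2 * norm h\<close> contributes \<open>2 powr s\<close>, the mass the remaining factor
  2.\<close>

lemma difference_bound:
  fixes f :: "real^'n::finite => real"
  assumes s: "s > 0" and r: "1 <= r" and A: "A > 0" and b: "besov_semi s q r f <= ennreal A" and h: "h \<noteq> 0"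
  defines "k \<equiv> nat \<lfloor>s\<rfloor> + 1"
  shows "Lpnorm q (cube_shift k h) (fdiff k h f) <= ennreal (2 powr (s + 1) * A * norm h powr s)"
proof -
  let ?N = "Lpnorm q (cube_shift k h) (fdiff k h f)" and ?t = "norm h"
  have t0: "?t > 0" using h by simp
  have Nm: "?N <= modulus k f t q" if "t > ?t" for t
    unfolding modulus_def using that by (intro SUP_upper) simp
  let ?y = "ennreal ((2 * ?t) powr (- s)) * ?N"
  have y: "?y <= ennreal (2 * A)"
  proof (cases "r = \<infinity>")
    case True
    have "?y <= ennreal ((2 * ?t) powr (- s)) * modulus k f (2 * ?t) q" using t0 by (intro mult_left_mono Nm) auto
    also have "... <= besov_semi s q r f"
    proof -
      have e: "besov_semi s q r f = (SUP t\<in>{0<..}. ennreal (t powr (-s)) * modulus k f t q)"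
        using True by (simp only: besov_semi_def Let_def k_def if_True refl)
      show ?thesis unfolding e using t0 by (intro SUP_upper[of "2 * ?t" "{0<..}" "\<lambda>t. ennreal (t powr (-s)) * modulus k f t q"]) simp
    qed
    also note b
    also have "ennreal A <= ennreal (2 * A)" using A by (intro ennreal_leI) simp
    finally show ?thesis .
  next
    case False
    let ?\<rho> = "enn2real r"
    have \<rho>: "?\<rho> \<ge> 1" using enn2real_ge_1[OF False r] .
    let ?I = "\<integral>\<^sup>+ t\<in>{0<..}. epow (ennreal (t powr (-s)) * modulus k f t q) ?\<rho> * ennreal (1 / t) \<partial>lborel"
    have eI: "epow ?I (1 / ?\<rho>) <= ennreal A" using b False by (simp add: besov_semi_def k_def)
    have I: "?I <= ennreal (A powr ?\<rho>)"
    proof (rule epow_le_cancel)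
      have "(A powr ?\<rho>) powr (1 / ?\<rho>) = A" using \<rho> A by (simp add: powr_powr)
      with eI show "epow ?I (1 / ?\<rho>) <= ennreal ((A powr ?\<rho>) powr (1 / ?\<rho>))" by (simp only:)
    qed (use \<rho> A in auto)
    have "epow ?y ?\<rho> * ennreal (1 / (2 * ?t)) * ennreal ?t = (\<integral>\<^sup>+t. epow ?y ?\<rho> * ennreal (1 / (2 * ?t)) * indicator {?t<..2 * ?t} t \<partial>lborel)"
      using t0 by (simp add: nn_integral_cmult_indicator)
    also have "... <= ?I"
    proof (rule nn_integral_mono)
      fix t
      show "epow ?y ?\<rho> * ennreal (1 / (2 * ?t)) * indicator {?t<..2 * ?t} t
          <= epow (ennreal (t powr (-s)) * modulus k f t q) ?\<rho> * ennreal (1 / t) * indicator {0<..} t"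
      proof (cases "t \<in> {?t<..2 * ?t}")
        case True
        then have t: "t > ?t" "t <= 2 * ?t" "t > 0" using t0 by auto
        have yt: "?y <= ennreal (t powr (-s)) * modulus k f t q"
          using t s by (intro mult_mono Nm ennreal_leI powr_mono2') auto
        have "epow ?y ?\<rho> * ennreal (1 / (2 * ?t)) <= epow (ennreal (t powr (-s)) * modulus k f t q) ?\<rho> * ennreal (1 / t)"
        proof (rule mult_mono)
          show "epow ?y ?\<rho> <= epow (ennreal (t powr (-s)) * modulus k f t q) ?\<rho>"
            using yt by (rule epow_mono) simp
          show "ennreal (1 / (2 * ?t)) <= ennreal (1 / t)"
            using t t0 by (intro ennreal_leI divide_left_mono) (auto intro: mult_pos_pos)
        qed auto
        then show ?thesis using True t by simp
      qed simp
    qed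
    also note I
    finally have "epow ?y ?\<rho> * (ennreal (1 / (2 * ?t)) * ennreal ?t) <= ennreal (A powr ?\<rho>)" by (simp only: mult.assoc)
    also have "ennreal (1 / (2 * ?t)) * ennreal ?t = ennreal (1 / 2)" using t0 by (simp add: ennreal_mult[symmetric])
    finally have "epow ?y ?\<rho> * ennreal (1 / 2) * ennreal 2 <= ennreal (A powr ?\<rho>) * ennreal 2" by (rule mult_right_mono) simp
    also have "z * ennreal (1 / 2) * ennreal 2 = z" for z
    proof -
      have "ennreal (1 / 2) * ennreal 2 = ennreal (1 / 2 * 2)" by (rule ennreal_mult[symmetric]) auto
      then show ?thesis by (simp only: mult.assoc) simp
    qed
    also have "ennreal (A powr ?\<rho>) * ennreal 2 = ennreal (A powr ?\<rho> * 2)" by (rule ennreal_mult[symmetric]) auto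
    also have "A powr ?\<rho> * 2 = 2 powr 1 * A powr ?\<rho>" by simp
    also have "... <= ennreal ((2 * A) powr ?\<rho>)"
      unfolding powr_mult using \<rho> by (intro ennreal_leI mult_right_mono powr_mono) auto
    finally show ?thesis by (rule epow_le_cancel) (use \<rho> A in auto)
  qed
  have "?N = ennreal ((2 * ?t) powr s) * ?y"
    using t0 by (simp add: mult.assoc[symmetric] ennreal_mult[symmetric] powr_add[symmetric])
  also have "... <= ennreal ((2 * ?t) powr s) * ennreal (2 * A)" by (intro mult_left_mono y) simp
  also have "... = ennreal (2 powr (s + 1) * A * ?t powr s)"
    using A by (simp add: ennreal_mult[symmetric] powr_mult powr_add mult_ac)
  finally show ?thesis .
qed

section \<open>Lower exponents and Borel representatives\<close>

lemma Lpnorm_cong_AE: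
  assumes "AE x in lborel. x \<in> Q --> f x = g x"
  shows "Lpnorm p Q f = Lpnorm p Q g"
proof -
  have ae: "AE x in lebesgue. x \<in> Q --> f x = g x" using assms by (simp add: AE_completion_iff)
  have "(AE x in lebesgue. x \<in> Q --> ennreal \<bar>f x\<bar> <= C) \<longleftrightarrow> (AE x in lebesgue. x \<in> Q --> ennreal \<bar>g x\<bar> <= C)" for C
    using ae by (auto elim!: eventually_elim2)
  moreover have "(\<integral>\<^sup>+x\<in>Q. ennreal (\<bar>f x\<bar> powr a) \<partial>lebesgue) = (\<integral>\<^sup>+x\<in>Q. ennreal (\<bar>g x\<bar> powr a) \<partial>lebesgue)" for a
    using ae by (intro nn_integral_cong_AE) (auto elim!: eventually_mono simp: indicator_def)
  ultimately show ?thesis by (simp add: Lpnorm_def)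
qed

text \<open>Jensen on a set of measure at most 1. For \<open>q = \<infinity>\<close> the norm is an
  infimum, so the essential bound \<open>B\<close> is approached through
  \<open>B + 1 / (n + 1)\<close>.\<close>

lemma lower_exponent:
  fixes g :: "real^'n::finite => real"
  assumes gm [measurable]: "g \<in> borel_measurable borel" and Q [measurable]: "Q \<in> sets borel" and Q1: "emeasure lborel Q <= 1"
    and q: "1 <= q'" "ennreal q' <= q" and B: "B \<ge> 0" "Lpnorm q Q g <= ennreal B"
  shows "(pint q' Q g) <= ennreal (B powr q')"
proof (cases "q = \<infinity>")
  case True
  have "AE x in lborel. x \<in> Q --> \<bar>g x\<bar> <= B + 1 / real (Suc n)" for n
  proof -
    have "Inf {C. AE x in lebesgue. x \<in> Q --> ennreal \<bar>g x\<bar> <= C} <= ennreal B" using B(2) True by (simp add: Lpnorm_def)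
    also have "... < ennreal (B + 1 / real (Suc n))" by (intro ennreal_lessI) (use B(1) in \<open>auto simp: add_nonneg_pos\<close>)
    finally obtain C where C: "AE x in lebesgue. x \<in> Q --> ennreal \<bar>g x\<bar> <= C" "C < ennreal (B + 1 / real (Suc n))"
      by (auto simp: Inf_less_iff)
    have "AE x in lborel. x \<in> Q --> ennreal \<bar>g x\<bar> <= C" using C(1) by (simp add: AE_completion_iff)
    then show ?thesis
    proof eventually_elim
      case (elim x)
      show ?case
      proof
        assume "x \<in> Q"
        then have "ennreal \<bar>g x\<bar> <= ennreal (B + 1 / real (Suc n))" using elim C(2) by (meson le_less_trans less_imp_le)
        then show "\<bar>g x\<bar> <= B + 1 / real (Suc n)" by (rule ennreal_le_iff[THEN iffD1, rotated]) (use B(1) in auto)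
      qed
    qed
  qed
  then have "AE x in lborel. \<forall>n. x \<in> Q --> \<bar>g x\<bar> <= B + 1 / real (Suc n)" unfolding AE_all_countable by blast
  then have "AE x in lborel. ennreal (\<bar>g x\<bar> powr q') * indicator Q x <= ennreal (B powr q') * indicator Q x"
  proof eventually_elim
    case (elim x)
    show ?case
    proof (cases "x \<in> Q")
      case True
      have "\<bar>g x\<bar> <= B"
      proof (rule field_le_epsilon)
        fix e :: real assume "e > 0"
        then obtain n where "1 / real (Suc n) < e" using reals_Archimedean by (auto simp: inverse_eq_divide)
        moreover have "\<bar>g x\<bar> <= B + 1 / real (Suc n)" using elim True by blast
        ultimately show "\<bar>g x\<bar> <= B + e" by linarith
      qed
      then show ?thesis using True q by (auto intro!: ennreal_leI powr_mono2)
    qed simp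
  qed
  then have "(pint q' Q g) <= (\<integral>\<^sup>+x. ennreal (B powr q') * indicator Q x \<partial>lborel)"
    by (rule nn_integral_mono_AE)
  also have "... = ennreal (B powr q') * emeasure lborel Q" by (simp add: nn_integral_cmult_indicator)
  also have "... <= ennreal (B powr q') * 1" by (intro mult_left_mono Q1) simp
  finally show ?thesis by simp
next
  case False
  let ?q = "enn2real q" and ?J = "\<integral>\<^sup>+x\<in>Q. ennreal (\<bar>g x\<bar> powr q') \<partial>lborel"
  have qq: "q' <= ?q" using q False by (metis enn2real_ennreal enn2real_mono infinity_ennreal_def less_top order_trans zero_le_one)
  have le: "(pint ?q Q g) <= ennreal (B powr ?q)"
  proof (rule epow_le_cancel)
    have "(B powr ?q) powr (1 / ?q) = B" using B q qq by (simp add: powr_powr)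
    with B(2) False show "epow (pint ?q Q g) (1 / ?q) <= ennreal ((B powr ?q) powr (1 / ?q))"
      by (simp add: Lpnorm_def nn_integral_completion)
  qed (use q qq in auto)
  show ?thesis
  proof (rule ccontr)
    assume n: "\<not> ?thesis"
    \<comment> \<open>The integral may be infinite, so Jensen is applied to a real number strictly
      between the claimed bound and the integral, or equal to the latter if finite.\<close>
    obtain I where I: "I > B powr q'" "ennreal I <= ?J"
    proof (cases ?J)
      case (real I)
      then show ?thesis using n that[of I] by (auto simp: ennreal_less_iff not_le)
    next
      case top
      then show ?thesis using that[of "B powr q' + 1"] by simp
    qed
    have I0: "I \<ge> 0" using I(1) by (meson less_imp_le order_trans powr_ge_zero)
    have "ennreal (I powr (?q / q')) <= ennreal (1 powr (?q / q' - 1)) * (\<integral>\<^sup>+x\<in>Q. ennreal ((\<bar>g x\<bar> powr q') powr (?q / q')) \<partial>lborel)"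
      using q qq Q1 I I0 by (intro jensen_powr) auto
    also have "... = (pint ?q Q g)" using q by (simp add: powr_powr)
    also note le
    finally have "I powr (?q / q') <= B powr ?q" by (simp add: ennreal_le_iff)
    moreover have "(B powr q') powr (?q / q') < I powr (?q / q')" using I(1) q qq by (intro powr_less_mono2) auto
    ultimately show False using q by (simp add: powr_powr)
  qed
qed

text \<open>On the cube \<open>q\<close> may be lowered. For \<open>p < q\<close> the choice
  \<open>q' = p\<close> makes the difference 0; for \<open>q <= p\<close> a finite \<open>q\<close>
  is kept; for \<open>p = q = \<infinity>\<close> the choice \<open>1 + D / s\<close> gives
  \<open>1 / q' < s / D\<close>.\<close>

lemma finite_exponent_exists:
  fixes p q :: ennreal and s :: real
  assumes p: "1 <= p" and q: "1 <= q" and s: "s > 0" and D: "D > 0" and e: "enn2real (inverse q) - enn2real (inverse p) < s / D"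
  shows "\<exists>q'\<ge>1. ennreal q' <= p \<and> ennreal q' <= q \<and> 1 / q' - enn2real (inverse p) < s / D"
proof -
  have inv: "enn2real (inverse x) = 1 / y" if "x = ennreal y" "y \<ge> 1" for x y
    using that by (simp add: inverse_ennreal inverse_eq_divide)
  have ge1: "y \<ge> 1" if "1 <= ennreal y" "y \<ge> 0" for y using that by (simp flip: ennreal_1 add: ennreal_le_iff)
  show ?thesis
  proof (cases "q <= p")
    case True
    show ?thesis
    proof (cases q)
      case (real y)
      then show ?thesis using True e inv[of q y] ge1[of y] q by (intro exI[of _ y]) auto
    next
      case top
      then have p: "p = top" using True by (simp add: top_unique)
      show ?thesis
      proof (intro exI[of _ "1 + D / s"] conjI)
        have "1 / (1 + D / s) < 1 / (D / s)" by (intro divide_strict_left_mono mult_pos_pos add_pos_pos divide_pos_pos) (use D s in auto)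
        then show "1 / (1 + D / s) - enn2real (inverse p) < s / D" by (simp add: p)
      qed (use D s top p in auto)
    qed
  next
    case False
    then obtain y where y: "p = ennreal y" "y \<ge> 0" by (cases p) auto
    then show ?thesis using False inv[of p y] ge1[of y] p s D by (intro exI[of _ y]) auto
  qed
qed

lemma lp_le_dominated:
  assumes h: "lp_le p h a" and le: "\<And>x. x \<in> cube ==> \<bar>g x\<bar> <= \<bar>h x\<bar>"
  shows "lp_le p g a"
proof (cases "p = \<infinity>")
  case True
  then show ?thesis using h le by (auto simp: lp_le_def elim!: eventually_mono intro: order_trans)
next
  case False
  have "(pint (enn2real p) cube g) <= (pint (enn2real p) cube h)"
    using le by (intro nn_integral_mono) (auto simp: indicator_def intro!: ennreal_leI powr_mono2)
  then show ?thesis using h False by (auto simp: lp_le_def intro: order_trans)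
qed

lemma borel_representative:
  fixes f :: "real^'n::finite => real"
  assumes "(\<lambda>x. indicator cube x * f x) \<in> borel_measurable lebesgue"
  shows "\<exists>g. g \<in> borel_measurable borel \<and> (\<forall>x. x \<notin> cube --> g x = 0) \<and> (AE x in lborel. x \<in> cube --> f x = g x)"
proof -
  obtain g' where g': "g' \<in> borel_measurable lborel" "AE x in lborel. indicator cube x * f x = g' x"
    using completion_ex_borel_measurable_real[OF assms] by blast
  have [measurable]: "g' \<in> borel_measurable borel" using g'(1) by simp
  have "(\<lambda>x. indicator cube x * g' x) \<in> borel_measurable borel" by measurable
  moreover have "AE x in lborel. x \<in> cube --> f x = indicator cube x * g' x"
    using g'(2) by eventually_elim auto
  ultimately show ?thesis by (intro exI[of _ "\<lambda>x. indicator cube x * g' x"]) auto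
qed

text \<open>By convexity all points \<open>x + j h\<close> with \<open>j <= k\<close> lie in the
  cube, and it suffices to avoid countably many translates of one null set.\<close>

lemma fdiff_cong_AE:
  fixes f g :: "real^'n::finite => real"
  assumes "AE x in lborel. x \<in> cube --> f x = g x"
  shows "AE x in lborel. x \<in> cube_shift k h --> fdiff k h f x = fdiff k h g x"
proof -
  obtain N where N: "N \<in> null_sets lborel" "{x. \<not> (x \<in> cube --> f x = g x)} \<subseteq> N"
    using assms by (auto simp: eventually_ae_filter)
  have "AE x in lborel. x + real j *\<^sub>R h \<notin> N" for j
    using AE_not_in[OF null_sets_translation[OF N(1), of "- (real j *\<^sub>R h)"]] by simp
  then have "AE x in lborel. \<forall>j. x + real j *\<^sub>R h \<notin> N" unfolding AE_all_countable by blast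
  then show ?thesis
  proof eventually_elim
    case (elim x)
    show ?case
    proof
      assume x: "x \<in> cube_shift k h"
      have "x + real j *\<^sub>R h \<in> cube" if "j <= k" for j
      proof -
        have "0 <= x $ m + real j * h $ m \<and> x $ m + real j * h $ m <= 1" for m
        proof -
          have b: "0 <= x $ m" "x $ m <= 1" "0 <= x $ m + real k * h $ m" "x $ m + real k * h $ m <= 1"
            using x by (auto simp: cube_shift_def mem_box_cart)
          show ?thesis
          proof (cases "0 <= h $ m")
            case True
            then have "0 <= real j * h $ m" "real j * h $ m <= real k * h $ m" using that by (auto intro: mult_right_mono)
            then show ?thesis using b by linarith
          next
            case False
            then have "real j * h $ m <= 0" "real k * h $ m <= real j * h $ m"
              using that by (auto intro: mult_nonneg_nonpos mult_right_mono_neg)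
            then show ?thesis using b by linarith
          qed
        qed
        then show ?thesis by (simp add: mem_box_cart)
      qed
      then have "f (x + real j *\<^sub>R h) = g (x + real j *\<^sub>R h)" if "j <= k" for j using that elim N(2) by blast
      then show "fdiff k h f x = fdiff k h g x" by (simp add: fdiff_def)
    qed
  qed
qed

text \<open>Covers the step \<open>h = 0\<close>, which \<open>difference_bound\<close>
  excludes.\<close>

lemma fdiff_zero: "k \<ge> 1 ==> fdiff k 0 f x = 0"
  using choose_alternating_sum[of k, where 'a = real]
  by (simp add: fdiff_def atLeast0AtMost flip: sum_distrib_right)

text \<open>A Borel representative and the lowered exponent \<open>q'\<close> give access to
  \<open>nonlinear_approximation\<close>. It is applied with \<open>R\<close> formed from
  \<open>W div K\<close> and \<open>L div K\<close>, so that the enlarged network of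
  \<open>assembly\<close> still fits into \<open>W\<close> and \<open>L\<close>. A positive real
  \<open>A\<close> stands for the norm, which keeps all bounds real and positive.\<close>

lemma approximation_rate:
  fixes s :: real and p q r :: ennreal
  assumes s: "0 < s" and r: "1 <= r" and p: "1 <= p" and q: "1 <= q"
    and emb: "enn2real (inverse q) - enn2real (inverse p) < s / real CARD('n::finite)"
  shows "\<exists>C > 0. \<exists>W0 :: nat. \<forall>W L. W \<ge> W0 --> L \<ge> W0 -->
    (\<forall>(f :: real^'n => real) A. (\<lambda>x. indicator cube x * f x) \<in> borel_measurable lebesgue --> A > 0 --> besov_norm s q r f <= ennreal A -->
      (INF g \<in> NN W L. Lpnorm p cube (\<lambda>x. f x - g x)) <= ennreal (C * A * real (W * L) powr (- 2 * s / real CARD('n))))"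
proof -
  let ?d = "CARD('n)"
  define k where "k = nat \<lfloor>s\<rfloor> + 1"
  have k: "k \<ge> 1" by (simp add: k_def)
  obtain q' where q': "q' \<ge> 1" "ennreal q' <= p" "ennreal q' <= q" "1 / q' - enn2real (inverse p) < s / real ?d"
    using finite_exponent_exists[OF p q s _ emb] by auto
  define a where "a = 2 * s / real ?d"
  have a: "a \<ge> 0" "- 2 * s / real ?d = - a" using s by (auto simp: a_def)
  obtain C where C: "C \<ge> 1" "\<And>(f :: real^'n => real) A R. f \<in> borel_measurable borel ==> (\<forall>x. x \<notin> cube --> f x = 0) ==> A > 0 ==>
    (pint q' cube f) <= ennreal (A powr q') ==>
    smooth_bound k q' s A f ==>
    R \<ge> 2 ==>
    (\<exists>(I :: (nat \<times> nat \<times> 'n idx \<times> bool) set) L \<alpha> S co u. finite I \<and>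
      lp_le p (\<lambda>x. f x - (\<Sum>t\<in>I. co t * bump (L t) (\<alpha> t) (S t) x)) (C * A * R powr (- a)) \<and>
      (\<forall>t\<in>I. admissible k C A R L \<alpha> S co u t) \<and>
      (\<Sum>t\<in>I. u t) <= C \<and> real (card I) <= C * (log 2 R)\<^sup>2)"
    using nonlinear_approximation[OF k q'(1) s p q'(2,4)] unfolding a(2) by blast
  obtain K where K: "K \<ge> 1" "\<And>W L (I :: (nat \<times> nat \<times> 'n idx \<times> bool) set) l \<alpha> (S :: _ => 'n idx set) co u A. W \<ge> K ==> L \<ge> K ==> finite I ==> A > 0 ==>
    (\<forall>t\<in>I. admissible k C A (real (W * L)) l \<alpha> S co u t) ==>
    (\<Sum>t\<in>I. u t) <= C ==> real (card I) <= C * (log 2 (real (W * L)))\<^sup>2 ==>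
    (\<exists>g. cmp coords (K * W) (K * L) {g} \<and>
      (\<forall>x\<in>cube. \<bar>(\<Sum>t\<in>I. co t * bump (l t) (\<alpha> t) (S t) x) - g x\<bar> <= A * real (W * L) powr (- a)))"
    using assembly[OF C(1) a(1), where 'i = "nat \<times> nat \<times> 'n idx \<times> bool" and 'n = 'n and k = k]
  proof (elim exE conjE, goal_cases)
    case (1 K)
    show ?case by (rule that[OF 1(2)]) (rule 1(3)[THEN spec, THEN spec, THEN mp, THEN mp, THEN spec, THEN spec, THEN spec, THEN spec, THEN spec, THEN spec, THEN spec, THEN mp, THEN mp, THEN mp, THEN mp, THEN mp])
  qed
  define B where "B = 2 powr (s + 1)"
  have B: "B \<ge> 1" using s unfolding B_def by (intro ge_one_powr_ge_zero) auto
  \<comment> \<open>\<open>C + 1\<close> adds the error of the network to that of the pieces,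
    \<open>B\<close> comes from \<open>difference_bound\<close>, and the last factor repairs the
    division of width and depth by \<open>K\<close>.\<close>
  define E where "E = (C + 1) * B * (4 * real K * real K) powr a"
  show ?thesis
  \<comment> \<open>Above \<open>2 * K * K\<close> both quotients by \<open>K\<close> are at least
    \<open>2 * K\<close>, so \<open>assembly\<close> applies and rounding loses at most a factor 2
    in each.\<close>
  proof (intro exI[of _ E] conjI exI[of _ "2 * K * K"] allI impI)
    show "E > 0" using C B K by (simp add: E_def add_pos_pos)
    fix W L :: nat and f :: "real^'n => real" and A :: real
    assume W: "2 * K * K <= W" and L: "2 * K * K <= L" and fm: "(\<lambda>x. indicator cube x * f x) \<in> borel_measurable lebesgue"
      and A: "A > 0" and bn: "besov_norm s q r f <= ennreal A"
    define W1 where "W1 = W div K"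
    define L1 where "L1 = L div K"
    have K0: "K > 0" using K(1) by simp
    have quot: "K * (n div K) <= n" "2 * K <= n div K" "real n <= 2 * real K * real (n div K)" if "2 * K * K <= n" for n
    proof -
      show "K * (n div K) <= n" by simp
      show g: "2 * K <= n div K" using that K0 by (simp add: less_eq_div_iff_mult_less_eq)
      have "n mod K < K" using K0 by simp
      then have "n < K * (n div K) + K" using mult_div_mod_eq[of K n] by linarith
      also have "K * (n div K) + K <= K * (n div K) + K * (n div K)" using g K0 by simp
      finally have "n <= 2 * K * (n div K)" by simp
      then have "real n <= real (2 * K * (n div K))" by (simp only: of_nat_le_iff)
      then show "real n <= 2 * real K * real (n div K)" by simp
    qed
    note qW = quot[OF W, folded W1_def] and qL = quot[OF L, folded L1_def]
    obtain f1 where f1 [measurable]: "f1 \<in> borel_measurable borel" and f10: "\<forall>x. x \<notin> cube --> f1 x = 0"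
      and ff: "AE x in lborel. x \<in> cube --> f x = f1 x" using borel_representative[OF fm] by blast
    have n1: "Lpnorm q cube f <= ennreal A" and n2: "besov_semi s q r f <= ennreal A"
    proof -
      have "Lpnorm q cube f <= besov_norm s q r f" unfolding besov_norm_def by (rule add_increasing2) auto
      then show "Lpnorm q cube f <= ennreal A" using bn by (rule order_trans)
      have "besov_semi s q r f <= besov_norm s q r f" unfolding besov_norm_def by (rule add_increasing) auto
      then show "besov_semi s q r f <= ennreal A" using bn by (rule order_trans)
    qed
    let ?A = "B * A"
    have A': "?A > 0" "A <= ?A" using A B by auto
    have b1: "(pint q' cube f1) <= ennreal (?A powr q')"
    proof (rule lower_exponent[OF f1 _ _ q'(1,3)])
      have "Lpnorm q cube f1 = Lpnorm q cube f" using Lpnorm_cong_AE[OF ff] by simp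
      also have "... <= ennreal ?A" using n1 ennreal_leI[OF A'(2)] by (rule order_trans)
      finally show "Lpnorm q cube f1 <= ennreal ?A" .
    qed (use A' in \<open>auto simp: emeasure_cube\<close>)
    have b2: "(pint q' (cube_shift k h) (fdiff k h f1)) <= ennreal ((?A * norm h powr s) powr q')" for h
    proof (cases "h = 0")
      case True
      then show ?thesis by (simp add: fdiff_zero[OF k])
    next
      case False
      have [measurable]: "fdiff k h f1 \<in> borel_measurable borel" unfolding fdiff_def[abs_def] by measurable
      have "cube_shift k h = cube \<inter> (\<lambda>x. x + real k *\<^sub>R h) -` cube" by (auto simp: cube_shift_def)
      also have "... \<in> sets borel"
        by (intro sets.Int borel_closed closed_cbox closed_vimage) (auto intro!: continuous_intros)
      finally have Q: "cube_shift k h \<in> sets borel" .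
      show ?thesis
      proof (rule lower_exponent[OF _ Q _ q'(1,3)])
        have "emeasure lborel (cube_shift k h) <= emeasure lborel (cube :: (real^'n) set)"
          by (intro emeasure_mono) (auto simp: cube_shift_def)
        then show "emeasure lborel (cube_shift k h) <= 1" by (simp add: emeasure_cube)
        have "Lpnorm q (cube_shift k h) (fdiff k h f1) = Lpnorm q (cube_shift k h) (fdiff k h f)"
          by (rule Lpnorm_cong_AE[OF fdiff_cong_AE, symmetric]) (rule ff)
        also have "... <= ennreal (?A * norm h powr s)"
          unfolding B_def k_def by (rule difference_bound[OF s r A n2 False])
        finally show "Lpnorm q (cube_shift k h) (fdiff k h f1) <= ennreal (?A * norm h powr s)" .
      qed (use A' in auto)
    qed
    let ?R = "real (W1 * L1)"
    have WL1: "W1 \<ge> K" "L1 \<ge> K" using qW(2) qL(2) by linarith+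
    have "2 * 1 <= W1 * L1" using qW(2) qL(2) K0 by (intro mult_le_mono) linarith+
    then have "real 2 <= ?R" by (simp only: of_nat_le_iff mult_1_right)
    then have R: "?R \<ge> 2" by (simp only: of_nat_numeral)
    then have Ra: "?R powr (- a) > 0" by (simp only: powr_gt_zero)
    from C(2)[OF f1 f10 A'(1) b1 _ R] b2 obtain I :: "(nat \<times> nat \<times> 'n idx \<times> bool) set" and l \<alpha> S co u
      where I: "finite I" "lp_le p (\<lambda>x. f1 x - (\<Sum>t\<in>I. co t * bump (l t) (\<alpha> t) (S t) x)) (C * ?A * ?R powr (- a))"
        "\<forall>t\<in>I. admissible k C ?A ?R l \<alpha> S co u t"
        "(\<Sum>t\<in>I. u t) <= C" "real (card I) <= C * (log 2 ?R)\<^sup>2" by blast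
    from K(2)[OF WL1 I(1) A'(1) I(3-5)] obtain g where g: "cmp coords (K * W1) (K * L1) {g}"
      "\<And>x. x \<in> cube ==> \<bar>(\<Sum>t\<in>I. co t * bump (l t) (\<alpha> t) (S t) x) - g x\<bar> <= ?A * ?R powr (- a)" by blast
    have W2: "W \<ge> 2" "L \<ge> 2" using W L mult_le_mono[of 1 K 1 K] K(1) by linarith+
    have gN: "g \<in> NN W L"
      using qW(1) qL(1) W2 by (intro cmp_NN cmp_mono[OF cmp_pad[OF g(1)]]) auto
    let ?h = "\<lambda>x. f1 x - (\<Sum>t\<in>I. co t * bump (l t) (\<alpha> t) (S t) x)" and ?c = "?A * ?R powr (- a)"
    have hm: "?h \<in> borel_measurable borel" unfolding bump_def by measurable
    have c0: "?c > 0" by (rule mult_pos_pos[OF A'(1) Ra])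
    have "lp_le p (\<lambda>x. \<bar>?h x\<bar> + ?c) (C * ?A * ?R powr (- a) + ?c)"
    proof (rule lp_le_add[OF _ _ _ _ _ c0 p])
      show "(\<lambda>x. \<bar>?h x\<bar>) \<in> borel_measurable borel" using hm by measurable
      show "lp_le p (\<lambda>x. \<bar>?h x\<bar>) (C * ?A * ?R powr (- a))" using I(2) by (simp add: lp_le_def)
      show "lp_le p (\<lambda>x :: real^'n. ?c) ?c" using c0 by (intro lp_le_bounded) simp
      show "C * ?A * ?R powr (- a) > 0" using C(1) by (intro mult_pos_pos A' Ra) simp
    qed simp
    then have "lp_le p (\<lambda>x. f1 x - g x) (C * ?A * ?R powr (- a) + ?c)"
    proof (rule lp_le_dominated)
      fix x :: "real^'n" assume "x \<in> cube"
      then show "\<bar>f1 x - g x\<bar> <= \<bar>\<bar>?h x\<bar> + ?c\<bar>" using g(2)[of x] by linarith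
    qed
    then have "Lpnorm p cube (\<lambda>x. f1 x - g x) <= ennreal (C * ?A * ?R powr (- a) + ?c)"
      using C(1) A' by (intro lp_le_Lpnorm p) auto
    moreover have "Lpnorm p cube (\<lambda>x. f x - g x) = Lpnorm p cube (\<lambda>x. f1 x - g x)"
      by (rule Lpnorm_cong_AE) (use ff in \<open>auto elim!: eventually_mono\<close>)
    moreover have "(INF g \<in> NN W L. Lpnorm p cube (\<lambda>x. f x - g x)) <= Lpnorm p cube (\<lambda>x. f x - g x)"
      using gN by (rule INF_lower)
    ultimately have "(INF g \<in> NN W L. Lpnorm p cube (\<lambda>x. f x - g x)) <= ennreal (C * ?A * ?R powr (- a) + ?c)" by simp
    also have "C * ?A * ?R powr (- a) + ?c = (C + 1) * ?A * ?R powr (- a)" by (simp add: algebra_simps)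
    also have "... <= (C + 1) * ?A * ((4 * real K * real K) powr a * real (W * L) powr (- a))"
    proof (rule mult_left_mono)
      have "real (W * L) <= (2 * real K * real W1) * (2 * real K * real L1)"
        unfolding of_nat_mult using qW(3) qL(3) by (intro mult_mono) auto
      then have "real (W * L) <= 4 * real K * real K * ?R" by (simp add: mult_ac)
      then have "(4 * real K * real K * ?R) powr (- a) <= real (W * L) powr (- a)"
        using a(1) W2 by (intro powr_mono2') auto
      then have "(4 * real K * real K) powr a * ((4 * real K * real K * ?R) powr (- a)) <= (4 * real K * real K) powr a * real (W * L) powr (- a)"
        by (rule mult_left_mono) simp
      moreover have "(4 * real K * real K) powr a * ((4 * real K * real K * ?R) powr (- a)) = ?R powr (- a)"
      proof -
        have "(4 * real K * real K) powr a * (4 * real K * real K) powr (- a) = 1" using K0 by (simp flip: powr_add)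
        then show ?thesis unfolding powr_mult[of "4 * real K * real K"] by (simp only: mult.assoc[symmetric] mult_1)
      qed
      ultimately show "?R powr (- a) <= (4 * real K * real K) powr a * real (W * L) powr (- a)" by simp
    qed (use C(1) A' in auto)
    also have "... = E * A * real (W * L) powr (- 2 * s / real CARD('n))" unfolding a(2) by (simp add: E_def mult_ac)
    finally show "(INF g \<in> NN W L. Lpnorm p cube (\<lambda>x. f x - g x)) <= ennreal (E * A * real (W * L) powr (- 2 * s / real CARD('n)))"
      by (simp only: ennreal_leI)
  qed
qed

theorem mainTheorem2:
  fixes s :: real and p q r :: ennreal
  assumes "0 < s" and "1 \<le> r" and "1 \<le> p" and "1 \<le> q"
    and "enn2real (inverse q) - enn2real (inverse p) < s / real CARD('n::finite)"
  shows "\<exists>C > 0. \<exists>W0 L0 :: nat. \<forall>W L. W \<ge> W0 \<longrightarrow> L \<ge> L0 \<longrightarrow>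
           (\<forall>f \<in> (besov_space s q r :: (real^'n \<Rightarrow> real) set).
              (INF g \<in> (NN W L :: (real^'n \<Rightarrow> real) set). Lpnorm p cube (\<lambda>x. f x - g x))
                \<le> ennreal C * besov_norm s q r f * ennreal (real (W * L) powr (- 2 * s / real CARD('n))))"
proof -
  obtain C and W0 :: nat where C: "C > 0" "\<And>W L (f :: real^'n \<Rightarrow> real) A. W \<ge> W0 \<Longrightarrow> L \<ge> W0 \<Longrightarrow>
      (\<lambda>x. indicator cube x * f x) \<in> borel_measurable lebesgue \<Longrightarrow> A > 0 \<Longrightarrow> besov_norm s q r f \<le> ennreal A \<Longrightarrow>
      (INF g \<in> NN W L. Lpnorm p cube (\<lambda>x. f x - g x)) \<le> ennreal (C * A * real (W * L) powr (- 2 * s / real CARD('n)))"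
    using approximation_rate[OF assms] by blast
  show ?thesis
  proof (intro exI[of _ C] conjI exI[of _ W0] allI impI ballI C(1))
    fix W L and f :: "real^'n \<Rightarrow> real"
    assume WL: "W0 \<le> W" "W0 \<le> L" and f: "f \<in> besov_space s q r"
    let ?e = "real (W * L) powr (- 2 * s / real CARD('n))" and ?N = "INF g \<in> NN W L. Lpnorm p cube (\<lambda>x. f x - g x)"
    have fm: "(\<lambda>x. indicator cube x * f x) \<in> borel_measurable lebesgue" and fin: "besov_norm s q r f < \<infinity>"
      using f by (auto simp: besov_space_def)
    note bound = C(2)[OF WL fm]
    obtain B where B: "B \<ge> 0" "besov_norm s q r f = ennreal B" using fin by (cases "besov_norm s q r f") auto
    have "?N \<le> ennreal (C * B * ?e)"
    proof (cases "B = 0")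
      case False
      then show ?thesis using B by (intro bound) auto
    next
      \<comment> \<open>For norm 0 the bound is available with every \<open>A > 0\<close>; the
        choice of \<open>A\<close> puts the infimum below any positive
        \<open>\<epsilon>\<close>.\<close>
      case True
      have "?N \<le> 0 + ennreal \<epsilon>" if "\<epsilon> > 0" for \<epsilon>
      proof -
        define z where "z = C * (?e + 1)"
        define A where "A = \<epsilon> / z"
        have e1: "z > 0" unfolding z_def using C(1) by (intro mult_pos_pos) (auto simp: add_nonneg_pos)
        have A: "A > 0" using that e1 by (simp add: A_def)
        have "?N \<le> ennreal (C * A * ?e)" using A B True by (intro bound) auto
        also have "C * A * ?e \<le> A * z" unfolding z_def using A C(1) by (simp add: algebra_simps)
        also have "A * z = \<epsilon>" using e1 unfolding A_def by simp
        finally show ?thesis by (simp only: ennreal_leI add_0)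
      qed
      then have "?N \<le> 0" by (rule ennreal_le_epsilon)
      then show ?thesis by simp
    qed
    also have "ennreal (C * B * ?e) = ennreal C * besov_norm s q r f * ennreal ?e"
      using C(1) B by (simp add: ennreal_mult)
    finally show "?N \<le> ennreal C * besov_norm s q r f * ennreal ?e" .
  qed
qed

end
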